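(* Let $1<p<\infty$, let $\beta>0$ be a constant, and let $\Omega=B(0,R)$ be the open ball of radius $R>0$ centered at the origin in $\mathbb{R}^n$, with outward unit normal $\eta$ on $\partial\Omega$. For a smooth vector field $v$ on $\overline\Omega$, let $\Omega_t=\{y=x+tv(x)+o(t):x\in\Omega\}$, for $|t|$ small, be a corresponding family of perturbations of $\Omega$, and let $\dot\lambda_1(0)$ be the derivative at $t=0$ of the first Robin $p$-Laplace eigenvalue $\lambda_1(t)=\lambda_1(\Omega_t)$ with parameter $\beta$. (i) If $\beta\ge\left(\frac{n-1}{R(p-1)}\right)^{p-1}$, then $\dot\lambda_1(0)<0$ for every such smooth $v$ with $\int_{\partial\Omega}v\cdot\eta\,ds>0$, and $\dot\lambda_1(0)>0$ for every such smooth $v$ with $\int_{\partial\Omega}v\cdot\eta\,ds<0$. (ii) If $R\ge1$, $\beta\ge1$ and $p\ge n$, then $\dot\lambda_1(0)\le0$ for every such smooth $v$ with $\int_{\partial\Omega}v\cdot\eta\,ds>0$, and $\dot\lambda_1(0)\ge0$ for every such smooth $v$ with $\int_{\partial\Omega}v\cdot\eta\,ds<0$.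
   Context: For a bounded domain $D\subset\mathbb{R}^n$, the Robin $p$-Laplace eigenvalue problem with parameter $\beta>0$ is $$\Delta_p u+\lambda|u|^{p-2}u=0 \text{ in } D,\qquad |\nabla u|^{p-2}\frac{\partial u}{\partial\eta}+\beta|u|^{p-2}u=0\text{ on }\partial D,$$ where $\Delta_p u=\mathrm{div}(|\nabla u|^{p-2}\nabla u)$ and $\eta$ is the outward unit normal. Its first eigenvalue is $$\lambda_1(D)=\inf_{z\in W^{1,p}(D),\,z\ne0}\frac{\int_D|\nabla z|^p\,dx+\beta\int_{\partial D}|z|^p\,ds}{\int_D|z|^p\,dx}.$$ Family of perturbations: $\Omega_t=T_t(\Omega)$, where, for $|t|$ small, $T_t(x)=x+tv(x)+o(t)$ is a $C^1$ diffeomorphism of $\overline{\Omega}$ onto its image, and $o(t)$ denotes a remainder with $o(t)/t\to0$ as $t\to0$, in the sense of $C^1(\overline\Omega)$ (so that the Jacobian matrix is $I+tDv+o(t)$ uniformly). A dot denotes the derivative with respect to $t$. *)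

theory Defs
  imports "HOL-Analysis.Analysis"
begin

section \<open>Smoothness\<close>

text \<open>
  For open \<open>U\<close>: \<open>f\<close> has continuous partial derivatives of all orders up to \<open>k\<close> on \<open>U\<close>.  Every
  derivative of order below \<open>k\<close> is required to be Frechet differentiable, which for open \<open>U\<close> is
  implied by, hence equivalent to, continuity of the derivatives of the next order.
\<close>

primrec Ck_on :: "nat \<Rightarrow> 'a::euclidean_space set \<Rightarrow> ('a \<Rightarrow> 'b::real_normed_vector) \<Rightarrow> bool" where
  "Ck_on 0 U f \<longleftrightarrow> continuous_on U f"
| "Ck_on (Suc k) U f \<longleftrightarrow>
     f differentiable_on U \<and> (\<forall>b\<in>Basis. Ck_on k U (\<lambda>x. frechet_derivative f (at x) b))"

definition smooth_on :: "'a::euclidean_space set \<Rightarrow> ('a \<Rightarrow> 'b::real_normed_vector) \<Rightarrow> bool" where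
  "smooth_on U f \<longleftrightarrow> open U \<and> (\<forall>k. Ck_on k U f)"

definition smooth_on_closed :: "'a::euclidean_space set \<Rightarrow> ('a \<Rightarrow> 'b::real_normed_vector) \<Rightarrow> bool" where
  "smooth_on_closed K f \<longleftrightarrow> (\<exists>U g. K \<subseteq> U \<and> smooth_on U g \<and> (\<forall>x\<in>K. g x = f x))"

text \<open>
  \<open>f\<close> is of class \<open>C\<^sup>1\<close> up to the boundary of a set \<open>S\<close> that is the closure of an open set, with
  derivative \<open>f'\<close>; derivatives at boundary points are taken within \<open>S\<close>.
\<close>

definition C1_derivative_on ::
  "'a::real_normed_vector set \<Rightarrow> ('a \<Rightarrow> 'b::real_normed_vector) \<Rightarrow> ('a \<Rightarrow> 'a \<Rightarrow>\<^sub>L 'b) \<Rightarrow> bool" where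
  "C1_derivative_on S f f' \<longleftrightarrow>
     (\<forall>x\<in>S. (f has_derivative blinfun_apply (f' x)) (at x within S)) \<and> continuous_on S f'"

definition C1_diffeo_on :: "'a::real_normed_vector set \<Rightarrow> ('a \<Rightarrow> 'b::real_normed_vector) \<Rightarrow> bool" where
  "C1_diffeo_on S f \<longleftrightarrow>
     (\<exists>f' g g'. C1_derivative_on S f f' \<and> C1_derivative_on (f ` S) g g' \<and> (\<forall>x\<in>S. g (f x) = x))"


section \<open>Surface measure\<close>

text \<open>
  The \<open>s\<close>-dimensional Hausdorff measure for integer \<open>s\<close>, normalised so that it agrees with Lebesgue
  measure on \<open>s\<close>-dimensional planes.  The case distinction makes the empty set weightless also for
  \<open>s = 0\<close>, where \<open>0 ^ 0 = 1\<close>; for \<open>s = 0\<close> one obtains counting measure.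
\<close>

definition hausdorff_weight :: "nat \<Rightarrow> 'a::euclidean_space set \<Rightarrow> ennreal" where
  "hausdorff_weight s U =
     (if U = {} then 0 else ennreal (unit_ball_vol (real s) * (diameter U / 2) ^ s))"

definition hausdorff_content :: "nat \<Rightarrow> real \<Rightarrow> 'a::euclidean_space set \<Rightarrow> ennreal" where
  "hausdorff_content s \<delta> A =
     (INF U\<in>{U :: nat \<Rightarrow> 'a set. A \<subseteq> (\<Union>i. U i) \<and> (\<forall>i. bounded (U i) \<and> diameter (U i) \<le> \<delta>)}.
        \<Sum>i. hausdorff_weight s (U i))"

definition hausdorff_outer :: "nat \<Rightarrow> 'a::euclidean_space set \<Rightarrow> ennreal" where
  "hausdorff_outer s A = (SUP \<delta>\<in>{0<..}. hausdorff_content s \<delta> A)"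

definition hausdorff_measure :: "nat \<Rightarrow> 'a::euclidean_space measure" where
  "hausdorff_measure s = measure_of UNIV (sets borel) (hausdorff_outer s)"

text \<open>
  The constructor \<open>measure_of\<close> yields the zero measure if the given set function is not countably
  additive on the Borel sets; \<open>emeasure_hausdorff_measure\<close> excludes this.
\<close>

lemma hausdorff_content_le:
  assumes "A \<subseteq> (\<Union>i. U i)" "\<And>i. bounded (U i)" "\<And>i. diameter (U i) \<le> \<delta>"
  shows "hausdorff_content s \<delta> A \<le> (\<Sum>i. hausdorff_weight s (U i))"
  unfolding hausdorff_content_def using assms by (intro INF_lower) auto

lemma hausdorff_content_mono:
  "A \<subseteq> B \<Longrightarrow> hausdorff_content s \<delta> A \<le> hausdorff_content s \<delta> B"
  unfolding hausdorff_content_def by (intro INF_superset_mono) auto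

lemma hausdorff_content_antimono:
  "\<delta> \<le> \<delta>' \<Longrightarrow> hausdorff_content s \<delta>' A \<le> hausdorff_content s \<delta> A"
  unfolding hausdorff_content_def by (intro INF_superset_mono) (auto intro: order_trans)

lemma hausdorff_content_empty: "0 < \<delta> \<Longrightarrow> hausdorff_content s \<delta> {} = 0"
  using hausdorff_content_le[of "{}" "\<lambda>_. {}" \<delta> s] by (simp add: hausdorff_weight_def)

lemma hausdorff_content_UN:
  fixes A :: "nat \<Rightarrow> 'a::euclidean_space set"
  shows "hausdorff_content s \<delta> (\<Union>n. A n) \<le> (\<Sum>n. hausdorff_content s \<delta> (A n))"
proof (rule ennreal_le_epsilon)
  fix e :: real assume "0 < e" and fin: "(\<Sum>n. hausdorff_content s \<delta> (A n)) < top"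
  have "\<exists>U. A n \<subseteq> (\<Union>i. U i) \<and> (\<forall>i. bounded (U i) \<and> diameter (U i) \<le> \<delta>)
      \<and> (\<Sum>i. hausdorff_weight s (U i)) < hausdorff_content s \<delta> (A n) + e * (1/2)^Suc n" for n
  proof -
    have "hausdorff_content s \<delta> (A n) < top"
      using fin ennreal_suminf_lessD by blast
    then have "hausdorff_content s \<delta> (A n) < hausdorff_content s \<delta> (A n) + ennreal (e * (1/2)^Suc n)"
      using \<open>0 < e\<close> by (auto simp: less_top ennreal_add_left_cancel_less[of _ 0, simplified])
    then show ?thesis
      unfolding hausdorff_content_def[of s \<delta> "A n"] INF_less_iff by auto
  qed
  then obtain U where U: "\<And>n. A n \<subseteq> (\<Union>i. U n i)" "\<And>n i. bounded (U n i)" "\<And>n i. diameter (U n i) \<le> \<delta>"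
      "\<And>n. (\<Sum>i. hausdorff_weight s (U n i)) < hausdorff_content s \<delta> (A n) + e * (1/2)^Suc n"
    by metis
  let ?V = "\<lambda>k. case prod_decode k of (n, i) \<Rightarrow> U n i"
  have "hausdorff_content s \<delta> (\<Union>n. A n) \<le> (\<Sum>k. hausdorff_weight s (?V k))"
  proof (rule hausdorff_content_le)
    show "(\<Union>n. A n) \<subseteq> (\<Union>k. ?V k)"
    proof
      fix x assume "x \<in> (\<Union>n. A n)"
      then obtain n i where "x \<in> U n i" using U(1) by blast
      then have "x \<in> ?V (prod_encode (n, i))" by simp
      then show "x \<in> (\<Union>k. ?V k)" by (rule UN_I[OF UNIV_I])
    qed
  qed (auto simp: U split: prod.split)
  also have "\<dots> = (\<Sum>n. \<Sum>i. hausdorff_weight s (U n i))"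
    using suminf_ennreal_2dimen[of "\<lambda>n. \<Sum>i. hausdorff_weight s (U n i)" "\<lambda>(n, i). hausdorff_weight s (U n i)"]
    by (simp add: o_def case_prod_unfold)
  also have "\<dots> \<le> (\<Sum>n. hausdorff_content s \<delta> (A n) + ennreal (e * (1/2)^Suc n))"
    using U(4) by (intro suminf_le) (auto intro: less_imp_le)
  also have "\<dots> = (\<Sum>n. hausdorff_content s \<delta> (A n)) + (\<Sum>n. ennreal (e * (1/2)^Suc n))"
    by (intro suminf_add[symmetric]) auto
  also have "(\<Sum>n. ennreal (e * (1/2)^Suc n)) = ennreal e"
    using sums_mult[OF power_half_series, of e] \<open>0 < e\<close>
    by (subst suminf_ennreal_eq[of _ e]) auto
  finally show "hausdorff_content s \<delta> (\<Union>n. A n) \<le> (\<Sum>n. hausdorff_content s \<delta> (A n)) + ennreal e" .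
qed

lemma hausdorff_outer_empty: "hausdorff_outer s ({} :: 'a::euclidean_space set) = 0"
proof -
  have "hausdorff_outer s ({} :: 'a set) = (SUP \<delta>\<in>{0::real<..}. (0::ennreal))"
    unfolding hausdorff_outer_def by (intro SUP_cong) (auto simp: hausdorff_content_empty)
  then show ?thesis by simp
qed

lemma hausdorff_outer_mono: "A \<subseteq> B \<Longrightarrow> hausdorff_outer s A \<le> hausdorff_outer s B"
  unfolding hausdorff_outer_def by (intro SUP_mono) (auto intro: hausdorff_content_mono)

lemma hausdorff_outer_UN:
  fixes A :: "nat \<Rightarrow> 'a::euclidean_space set"
  shows "hausdorff_outer s (\<Union>n. A n) \<le> (\<Sum>n. hausdorff_outer s (A n))"
  unfolding hausdorff_outer_def[of s "\<Union>n. A n"]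
proof (rule SUP_least)
  fix \<delta> :: real assume "\<delta> \<in> {0<..}"
  then show "hausdorff_content s \<delta> (\<Union>n. A n) \<le> (\<Sum>n. hausdorff_outer s (A n))"
    by (intro order_trans[OF hausdorff_content_UN] suminf_le)
       (auto simp: hausdorff_outer_def intro!: SUP_upper)
qed

lemma outer_measure_space_hausdorff: "outer_measure_space (Pow UNIV) (hausdorff_outer s)"
  by (auto simp: outer_measure_space_def positive_def increasing_def countably_subadditive_def
      hausdorff_outer_empty hausdorff_outer_mono hausdorff_outer_UN)

lemma hausdorff_outer_Un:
  fixes A B :: "'a::euclidean_space set"
  shows "hausdorff_outer s (A \<union> B) \<le> hausdorff_outer s A + hausdorff_outer s B"
proof -
  have "subadditive (Pow UNIV) (hausdorff_outer s :: 'a set \<Rightarrow> ennreal)"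
    using outer_measure_space_hausdorff
    by (intro ring_of_sets.countably_subadditive_subadditive[OF ring_of_sets_Pow])
       (auto simp: outer_measure_space_def)
  then have disj: "hausdorff_outer s (A \<union> (B - A)) \<le> hausdorff_outer s A + hausdorff_outer s (B - A)"
    by (rule subadditiveD) auto
  have "hausdorff_outer s (B - A) \<le> hausdorff_outer s B"
    by (rule hausdorff_outer_mono) auto
  with disj show ?thesis by (metis Un_Diff_cancel add_left_mono order_trans)
qed

lemma hausdorff_outer_separated:
  fixes A B :: "'a::euclidean_space set"
  assumes "0 < d" and sep: "\<And>x y. x \<in> A \<Longrightarrow> y \<in> B \<Longrightarrow> d \<le> dist x y"
  shows "hausdorff_outer s A + hausdorff_outer s B \<le> hausdorff_outer s (A \<union> B)"
proof -
  have *: "hausdorff_content s \<delta> A + hausdorff_content s \<delta>' B \<le> hausdorff_outer s (A \<union> B)"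
    if "0 < \<delta>" "0 < \<delta>'" for \<delta> \<delta>'
  proof -
    define m where "m = min (min \<delta> \<delta>') (d / 2)"
    have m: "0 < m" "m \<le> \<delta>" "m \<le> \<delta>'" "m < d" using that assms(1) by (auto simp: m_def)
    have "hausdorff_content s m A + hausdorff_content s m B \<le> hausdorff_content s m (A \<union> B)"
      unfolding hausdorff_content_def[of s m "A \<union> B"]
    proof (rule INF_greatest)
      fix U :: "nat \<Rightarrow> 'a set"
      assume "U \<in> {U. A \<union> B \<subseteq> (\<Union>i. U i) \<and> (\<forall>i. bounded (U i) \<and> diameter (U i) \<le> m)}"
      then have U: "A \<union> B \<subseteq> (\<Union>i. U i)" "\<And>i. bounded (U i)" "\<And>i. diameter (U i) \<le> m" by auto
      define V where "V C i = (if U i \<inter> C = {} then {} else U i)" for C i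
      have V: "hausdorff_content s m C \<le> (\<Sum>i. hausdorff_weight s (V C i))" if "C \<subseteq> A \<union> B" for C
      proof (rule hausdorff_content_le)
        show "C \<subseteq> (\<Union>i. V C i)"
        proof
          fix x assume "x \<in> C"
          then obtain i where "x \<in> U i" using U(1) \<open>C \<subseteq> A \<union> B\<close> by blast
          then show "x \<in> (\<Union>i. V C i)" using \<open>x \<in> C\<close> by (auto simp: V_def)
        qed
      qed (use U m in \<open>auto simp: V_def\<close>)
      have W: "hausdorff_weight s (V A i) + hausdorff_weight s (V B i) \<le> hausdorff_weight s (U i)" for i
      proof -
        have "U i \<inter> A = {} \<or> U i \<inter> B = {}"
        proof (rule ccontr)
          assume "\<not> ?thesis"
          then obtain x y where "x \<in> U i" "x \<in> A" "y \<in> U i" "y \<in> B" by blast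
          then show False
            using sep[of x y] diameter_bounded_bound[OF U(2)[of i], of x y] U(3)[of i] m by auto
        qed
        then show ?thesis by (auto simp: V_def hausdorff_weight_def)
      qed
      have "hausdorff_content s m A + hausdorff_content s m B
          \<le> (\<Sum>i. hausdorff_weight s (V A i)) + (\<Sum>i. hausdorff_weight s (V B i))"
        by (intro add_mono V) auto
      also have "\<dots> = (\<Sum>i. hausdorff_weight s (V A i) + hausdorff_weight s (V B i))"
        by (intro suminf_add) auto
      also have "\<dots> \<le> (\<Sum>i. hausdorff_weight s (U i))"
        by (intro suminf_le W) auto
      finally show "hausdorff_content s m A + hausdorff_content s m B \<le> (\<Sum>i. hausdorff_weight s (U i))" .
    qed
    also have "\<dots> \<le> hausdorff_outer s (A \<union> B)"
      unfolding hausdorff_outer_def using m by (intro SUP_upper) auto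
    finally show ?thesis
      using m by (elim order_trans[rotated]) (intro add_mono hausdorff_content_antimono)
  qed
  have "hausdorff_content s \<delta> A + hausdorff_outer s B \<le> hausdorff_outer s (A \<union> B)" if "0 < \<delta>" for \<delta>
    unfolding hausdorff_outer_def[of s B]
    by (subst ennreal_SUP_add_right) (auto intro!: SUP_least *[OF that])
  then show ?thesis
    unfolding hausdorff_outer_def[of s A]
    by (subst ennreal_SUP_add_left[symmetric]) (auto intro!: SUP_least)
qed

lemma closed_in_hausdorff_lambda_system:
  fixes C :: "'a::euclidean_space set"
  assumes "closed C"
  shows "C \<in> lambda_system UNIV (Pow UNIV) (hausdorff_outer s)"
proof (cases "C = {}")
  case True
  then show ?thesis by (simp add: lambda_system_def hausdorff_outer_empty)
next
  case ne: False
  let ?H = "hausdorff_outer s"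
  have "?H (C \<inter> X) + ?H (X - C) \<le> ?H X" for X
  proof (cases "?H X = top")
    case True
    then show ?thesis by simp
  next
    case False
    define L where "L k = {x \<in> X. 1 / real (k + 2) < infdist x C \<and> infdist x C \<le> 1 / real (k + 1)}" for k
    define A where "A k = {x \<in> X. 1 / real (k + 1) < infdist x C}" for k
    have inf_le: "infdist x C \<le> infdist y C + dist x y" for x y
      by (simp add: infdist_triangle)
    have L_sep: "1 / real (i + 2) - 1 / real (j + 1) \<le> dist x y" if "x \<in> L i" "y \<in> L j" for i j x y
      using that inf_le[of x y] by (auto simp: L_def)
    have par: "(\<Sum>i<n. ?H (L (2 * i + r))) \<le> ?H (\<Union>i<n. L (2 * i + r))" for n r
    proof (induction n)
      case (Suc n)
      define d where "d = (if n = 0 then 1 else 1 / real (2 * n + r) - 1 / real (2 * n + r + 1))"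
      have "0 < d" by (auto simp: d_def intro!: divide_strict_left_mono)
      have "d \<le> dist x y" if x: "x \<in> (\<Union>i<n. L (2 * i + r))" and y: "y \<in> L (2 * n + r)" for x y
      proof -
        obtain i where i: "i < n" "x \<in> L (2 * i + r)" using x by auto
        have "d \<le> 1 / real (2 * i + r + 2) - 1 / real (2 * n + r + 1)"
          using i by (auto simp: d_def intro!: divide_left_mono mult_pos_pos)
        then show ?thesis using L_sep[OF i(2) y] by linarith
      qed
      from hausdorff_outer_separated[OF \<open>0 < d\<close> this, where s = s]
      have "?H (\<Union>i<n. L (2 * i + r)) + ?H (L (2 * n + r)) \<le> ?H ((\<Union>i<n. L (2 * i + r)) \<union> L (2 * n + r))"
        by blast
      moreover have "(\<Union>i<n. L (2 * i + r)) \<union> L (2 * n + r) = (\<Union>i<Suc n. L (2 * i + r))"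
        by (auto simp: lessThan_Suc)
      ultimately have "?H (\<Union>i<n. L (2 * i + r)) + ?H (L (2 * n + r)) \<le> ?H (\<Union>i<Suc n. L (2 * i + r))"
        by (simp only:)
      with add_right_mono[OF Suc.IH, of "?H (L (2 * n + r))"] show ?case
        unfolding sum.lessThan_Suc by (rule order_trans)
    qed simp
    have par': "(\<Sum>i<n. ?H (L (2 * i + r))) \<le> ?H X" for n r
      by (rule order_trans[OF par hausdorff_outer_mono]) (auto simp: L_def)
    have all: "(\<Sum>i<2 * n. ?H (L i)) \<le> 2 * ?H X" for n
    proof -
      have "(\<Sum>i<2 * n. ?H (L i)) = (\<Sum>i<n. ?H (L (2 * i + 0))) + (\<Sum>i<n. ?H (L (2 * i + 1)))"
        by (induction n) (auto simp: algebra_simps)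
      also have "\<dots> \<le> ?H X + ?H X" by (intro add_mono par')
      finally show ?thesis by (simp add: mult_2)
    qed
    have "(\<Sum>i. ?H (L i)) \<le> 2 * ?H X"
    proof (rule suminf_le_const)
      show "(\<Sum>i<n. ?H (L i)) \<le> 2 * ?H X" for n
        by (rule order_trans[OF _ all[of n]]) (intro sum_mono2, auto)
    qed simp
    then have fin: "(\<Sum>i. ?H (L i)) < top"
      using False by (elim le_less_trans) (simp add: less_top[symmetric] ennreal_mult_eq_top_iff)
    have tail: "(\<lambda>n. \<Sum>i. ?H (L (i + n))) \<longlonglongrightarrow> 0"
    proof -
      let ?S = "\<Sum>i. ?H (L i)"
      have part: "(\<Sum>i<n. ?H (L i)) \<noteq> top" for n
        using le_less_trans[OF sum_le_suminf[of "\<lambda>i. ?H (L i)" "{..<n}"] fin] by (simp add: less_top[symmetric])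
      have "?S = (\<Sum>i. ?H (L (i + n))) + (\<Sum>i<n. ?H (L i))" for n
        by (rule suminf_offset) auto
      then have "(\<Sum>i. ?H (L (i + n))) = ?S - (\<Sum>i<n. ?H (L i))" for n
        using part by (metis ennreal_add_diff_cancel_right)
      moreover have "(\<lambda>n. ?S - (\<Sum>i<n. ?H (L i))) \<longlonglongrightarrow> ?S - ?S"
        using fin by (intro tendsto_diff_ennreal tendsto_const summable_LIMSEQ) auto
      ultimately show ?thesis using fin by (simp add: ennreal_minus_cancel_iff diff_eq_0_ennreal)
    qed
    have bound: "?H (C \<inter> X) + ?H (X - C) \<le> ?H X + (\<Sum>i. ?H (L (i + n)))" for n
    proof -
      have "X - C \<subseteq> A n \<union> (\<Union>i. L (i + n))"
      proof
        fix x assume x: "x \<in> X - C"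
        then have pos: "0 < infdist x C"
          using assms ne infdist_pos_not_in_closed by blast
        show "x \<in> A n \<union> (\<Union>i. L (i + n))"
        proof (cases "1 / real (n + 1) < infdist x C")
          case True then show ?thesis using x by (auto simp: A_def)
        next
          case False
          let ?P = "\<lambda>k. 1 / real (k + n + 2) < infdist x C"
          obtain N where "1 / real (Suc N) < infdist x C"
            using pos nat_approx_posE by blast
          moreover have "1 / real (N + n + 2) \<le> 1 / real (Suc N)" by (intro divide_left_mono) auto
          ultimately have ex: "?P N" by linarith
          define k where "k = (LEAST k. ?P k)"
          have k: "?P k" unfolding k_def using ex by (rule LeastI)
          have "infdist x C \<le> 1 / real (k + n + 1)"
          proof (cases k)
            case 0 then show ?thesis using False by simp
          next
            case (Suc j)
            then have "\<not> ?P j" unfolding k_def using not_less_Least[of j ?P] by simp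
            then show ?thesis using Suc by simp
          qed
          then show ?thesis using k x by (auto simp: L_def)
        qed
      qed
      then have "?H (X - C) \<le> ?H (A n) + (\<Sum>i. ?H (L (i + n)))"
        by (rule order_trans[OF hausdorff_outer_mono
              order_trans[OF hausdorff_outer_Un add_left_mono[OF hausdorff_outer_UN]]])
      then have "?H (C \<inter> X) + ?H (X - C) \<le> (?H (C \<inter> X) + ?H (A n)) + (\<Sum>i. ?H (L (i + n)))"
        by (simp add: add.assoc add_left_mono)
      also have "?H (C \<inter> X) + ?H (A n) \<le> ?H (C \<inter> X \<union> A n)"
      proof (rule hausdorff_outer_separated)
        fix x y assume "x \<in> C \<inter> X" "y \<in> A n"
        then show "1 / real (n + 1) \<le> dist x y"
          using inf_le[of y x] by (auto simp: A_def dist_commute)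
      qed simp
      also have "\<dots> \<le> ?H X" by (rule hausdorff_outer_mono) (auto simp: A_def)
      finally show ?thesis by (simp add: add_right_mono)
    qed
    have "(\<lambda>n. ?H X + (\<Sum>i. ?H (L (i + n)))) \<longlonglongrightarrow> ?H X + 0"
      by (intro tendsto_add tail tendsto_const)
    then show ?thesis
      using bound by (intro LIMSEQ_le_const[of _ "?H X"]) auto
  qed
  moreover have "?H X \<le> ?H (C \<inter> X) + ?H (X - C)" for X
    using hausdorff_outer_Un[of s "C \<inter> X" "X - C"] by (simp only: Int_commute[of C X] Int_Diff_Un)
  ultimately show ?thesis
    by (auto simp: lambda_system_def Diff_eq Int_commute intro!: antisym)
qed

lemma measure_space_hausdorff: "measure_space UNIV (sets borel) (hausdorff_outer s)"
proof -
  interpret sigma_algebra UNIV "Pow (UNIV :: 'a set)" by (rule sigma_algebra_Pow)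
  let ?L = "lambda_system UNIV (Pow UNIV) (hausdorff_outer s :: 'a set \<Rightarrow> ennreal)"
  have L: "measure_space UNIV ?L (hausdorff_outer s)"
    by (rule caratheodory_lemma) (rule outer_measure_space_hausdorff)
  then interpret L: sigma_algebra UNIV ?L by (simp add: measure_space_def)
  have "sets (borel :: 'a measure) \<subseteq> ?L"
    unfolding borel_eq_closed
    using L.sigma_sets_subset[of "Collect closed"] closed_in_hausdorff_lambda_system by fastforce
  then show ?thesis
    using L by (rule measure_down[rotated -1]) (use sets.sigma_algebra_axioms[of "borel :: 'a measure"] in simp)
qed

lemma space_hausdorff_measure [simp]: "space (hausdorff_measure s) = UNIV"
  by (simp add: hausdorff_measure_def)

lemma sets_hausdorff_measure [simp, measurable_cong]:
  "sets (hausdorff_measure s :: 'a::euclidean_space measure) = sets borel"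
  using sets.sigma_sets_eq[of "borel :: 'a::euclidean_space measure"] by (simp add: hausdorff_measure_def)

lemma emeasure_hausdorff_measure:
  "A \<in> sets borel \<Longrightarrow> emeasure (hausdorff_measure s) A = hausdorff_outer s A"
  using measure_space_hausdorff[of s] unfolding hausdorff_measure_def
  by (intro emeasure_measure_of_sigma) (auto simp: measure_space_def)


definition surface_measure :: "'a::euclidean_space set \<Rightarrow> 'a measure" where
  "surface_measure D = restrict_space (hausdorff_measure (DIM('a) - 1)) (frontier D)"


section \<open>Sobolev functions and traces\<close>

definition Lp :: "real \<Rightarrow> 'a measure \<Rightarrow> ('a \<Rightarrow> 'b::euclidean_space) set" where
  "Lp p M = {f \<in> borel_measurable M. integrable M (\<lambda>x. norm (f x) powr p)}"

definition Lp_tendsto ::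
  "real \<Rightarrow> 'a measure \<Rightarrow> (nat \<Rightarrow> 'a \<Rightarrow> 'b::euclidean_space) \<Rightarrow> ('a \<Rightarrow> 'b) \<Rightarrow> bool" where
  "Lp_tendsto p M f g \<longleftrightarrow> (\<lambda>k. LINT x|M. norm (f k x - g x) powr p) \<longlonglongrightarrow> 0"

definition test_function :: "'a::euclidean_space set \<Rightarrow> ('a \<Rightarrow> real) \<Rightarrow> bool" where
  "test_function D \<phi> \<longleftrightarrow> smooth_on UNIV \<phi> \<and> (\<exists>K. compact K \<and> K \<subseteq> D \<and> (\<forall>x. x \<notin> K \<longrightarrow> \<phi> x = 0))"

definition weak_gradient ::
  "'a::euclidean_space set \<Rightarrow> ('a \<Rightarrow> real) \<Rightarrow> ('a \<Rightarrow> 'a) \<Rightarrow> bool" where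
  "weak_gradient D z G \<longleftrightarrow>
     (\<forall>\<phi>. test_function D \<phi> \<longrightarrow> (\<forall>b\<in>Basis.
        (LINT x|lebesgue_on D. z x * frechet_derivative \<phi> (at x) b)
          = - (LINT x|lebesgue_on D. (G x \<bullet> b) * \<phi> x)))"

text \<open>\<open>z\<close> belongs to \<open>W\<^sup>1\<^sup>,\<^sup>p(D)\<close> and \<open>G\<close> represents its weak gradient.\<close>

definition sobolev :: "real \<Rightarrow> 'a::euclidean_space set \<Rightarrow> ('a \<Rightarrow> real) \<Rightarrow> ('a \<Rightarrow> 'a) \<Rightarrow> bool" where
  "sobolev p D z G \<longleftrightarrow> z \<in> Lp p (lebesgue_on D) \<and> G \<in> Lp p (lebesgue_on D) \<and> weak_gradient D z G"

text \<open>
  On a bounded \<open>C\<^sup>1\<close> domain the trace operator is the unique bounded linear map from \<open>W\<^sup>1\<^sup>,\<^sup>p(D)\<close> to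
  \<open>L\<^sup>p(\<partial>D)\<close> that restricts functions in \<open>W\<^sup>1\<^sup>,\<^sup>p(D)\<close> continuous on the closure of \<open>D\<close> to the boundary.  As
  those functions are dense, its graph is the closure of the graph of that restriction.
\<close>

definition has_trace ::
  "real \<Rightarrow> 'a::euclidean_space set \<Rightarrow> ('a \<Rightarrow> real) \<Rightarrow> ('a \<Rightarrow> 'a) \<Rightarrow> ('a \<Rightarrow> real) \<Rightarrow> bool" where
  "has_trace p D z G g \<longleftrightarrow>
     g \<in> Lp p (surface_measure D) \<and>
     (\<exists>\<phi> \<Phi>. (\<forall>k. sobolev p D (\<phi> k) (\<Phi> k) \<and> continuous_on (closure D) (\<phi> k)
                  \<and> \<phi> k \<in> Lp p (surface_measure D)) \<and>
        Lp_tendsto p (lebesgue_on D) \<phi> z \<and>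
        Lp_tendsto p (lebesgue_on D) \<Phi> G \<and>
        Lp_tendsto p (surface_measure D) \<phi> g)"


section \<open>The first Robin eigenvalue and domain perturbations\<close>

text \<open>A nonzero element of \<open>W\<^sup>1\<^sup>,\<^sup>p(D)\<close> is a function that does not vanish almost everywhere.\<close>

definition robin_lambda1 :: "real \<Rightarrow> real \<Rightarrow> 'a::euclidean_space set \<Rightarrow> real" where
  "robin_lambda1 p \<beta> D = Inf
     {((LINT x|lebesgue_on D. norm (G x) powr p) + \<beta> * (LINT x|surface_measure D. \<bar>g x\<bar> powr p))
        / (LINT x|lebesgue_on D. \<bar>z x\<bar> powr p) | z G g.
      sobolev p D z G \<and> has_trace p D z G g \<and> \<not> (AE x in lebesgue_on D. z x = 0)}"

text \<open>
  The second clause says that \<open>T\<^sub>t(x) = x + t v(x) + o(t)\<close> in the norm of \<open>C\<^sup>1\<close> on the closure of \<open>\<Omega>\<close>.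
  It includes \<open>t = 0\<close>, where it says that \<open>T\<^sub>0\<close> is the identity.
\<close>

definition perturbation_family ::
  "'a::euclidean_space set \<Rightarrow> ('a \<Rightarrow> 'a) \<Rightarrow> (real \<Rightarrow> 'a \<Rightarrow> 'a) \<Rightarrow> bool" where
  "perturbation_family \<Omega> v T \<longleftrightarrow>
     (\<forall>\<^sub>F t in nhds 0. C1_diffeo_on (closure \<Omega>) (T t)) \<and>
     (\<forall>e>0. \<forall>\<^sub>F t in nhds 0. \<exists>r'.
        C1_derivative_on (closure \<Omega>) (\<lambda>x. T t x - (x + t *\<^sub>R v x)) r' \<and>
        (\<forall>x\<in>closure \<Omega>. norm (T t x - (x + t *\<^sub>R v x)) \<le> e * \<bar>t\<bar> \<and> norm (r' x) \<le> e * \<bar>t\<bar>))"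

text \<open>\<open>\<integral> v \<bullet> \<eta> ds\<close> over the boundary of the ball of radius \<open>R\<close> about \<open>0\<close>, where \<open>\<eta>(x) = x / R\<close>.\<close>

definition ball_flux :: "real \<Rightarrow> ('a::euclidean_space \<Rightarrow> 'a) \<Rightarrow> real" where
  "ball_flux R v = (LINT x|surface_measure (ball 0 R). v x \<bullet> (x /\<^sub>R R))"

end

theory Submission
  imports Defs
begin

text \<open>
  Let \<open>u\<close> be the positive radial solution of \<open>\<Delta>\<^sub>p u + \<mu> u\<^sup>p\<^sup>-\<^sup>1 = 0\<close>.  The function
  \<open>h\<^sub>\<mu> = - \<bar>u'\<bar>\<^sup>p\<^sup>-\<^sup>2 u' / u\<^sup>p\<^sup>-\<^sup>1\<close> solves a Riccati equation and is increasing in \<open>\<mu>\<close> and in \<open>r\<close>, and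
  \<open>\<lambda>\<^sub>1(\<Omega>)\<close> is the \<open>\<mu>\<close> with \<open>h\<^sub>\<mu>(R) = \<beta>\<close>.  For small \<open>t\<close> the domain \<open>\<Omega>\<^sub>t\<close> is a radial graph
  \<open>\<bar>x\<bar> < \<rho>\<^sub>t(x / \<bar>x\<bar>)\<close> with \<open>\<rho>\<^sub>t = R + t v \<cdot> \<eta> + o(t)\<close> and Lipschitz constant \<open>O(t)\<close>.  Choose \<open>\<mu>\<^sub>t\<close> affine in \<open>t\<close>
  such that \<open>h\<^sub>\<mu>\<^sub>t(\<rho>\<^sub>t) - \<beta>\<close> has mean \<open>o(t)\<close>.  The test function \<open>u\<close> gives \<open>\<lambda>\<^sub>1(\<Omega>\<^sub>t) \<le> \<mu>\<^sub>t + o(t)\<close>.  Conversely,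
  the part of \<open>h\<^sub>\<mu>\<^sub>t(\<rho>\<^sub>t) - \<beta>\<close> of mean zero is approximately the normal component of \<open>t W\<close> with \<open>W\<close> divergence
  free, and Picone's inequality with the field \<open>- h x / \<bar>x\<bar> + t u\<^sup>-\<^sup>p W\<close> gives \<open>\<lambda>\<^sub>1(\<Omega>\<^sub>t) \<ge> \<mu>\<^sub>t - o(t)\<close>.  So the
  derivative is the slope of \<open>\<mu>\<^sub>t\<close>, a negative multiple of the flux of \<open>v\<close>.

  The normalisation of the Hausdorff measure is irrelevant: on the sphere it is uniformly distributed, hence
  a constant multiple \<open>\<kappa>\<close> of the cone measure, and \<open>\<kappa>\<close> is absorbed into \<open>\<beta>\<close>.
\<close>

text \<open>The radial field alone gives a lower bound into which the largest boundary value of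
  \<open>h\<close> enters. That is wrong at first order in t as soon as the normal velocity is not
  constant: only the mean may enter. The divergence-free correction redistributes flux over the
  boundary without creating any in the interior, and its weight makes its first-order effect on the
  Riccati inequality cancel. The other obstacle is the low regularity of the moved domain. Its
  boundary is only C^1, so area formula, outward normal and divergence theorem are replaced by
  inequalities whose loss is governed by the Lipschitz constant L of the radial graph. Since L =
  O(t), the loss in the boundary measure, of order L^2, is O(t^2), and the loss of order L in the
  divergence theorem occurs only for a field that already carries a factor t. Neither an
  eigenfunction of the moved domain nor its dependence on t enters: the eigenvalue is compared from
  both sides with an explicit affine function.\<close>

section \<open>Hausdorff measure under Lipschitz maps and finite covers\<close>

lemma hausdorff_weight_mono:
  assumes "bounded U" "diameter U \<le> c" "0 \<le> c"
  shows "hausdorff_weight s U \<le> ennreal (unit_ball_vol (real s) * (c / 2) ^ s)"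
proof (cases "U = {}")
  case False
  have "diameter U \<ge> 0" using assms(1) by (rule diameter_ge_0)
  show ?thesis using False assms \<open>diameter U \<ge> 0\<close>
    by (auto simp: hausdorff_weight_def intro!: ennreal_leI mult_left_mono power_mono)
qed (simp add: hausdorff_weight_def)

text \<open>The images of the sets \<open>U i \<inter> A\<close> form an admissible cover with
  diameters scaled by \<open>L\<close>, and the weight is homogeneous of degree \<open>s\<close>.
  The mesh changes from \<delta> to \<open>L * \<delta>\<close>, which disappears in the supremum
  over \<delta>.\<close>

lemma hausdorff_content_Lipschitz:
  fixes f :: "'a::euclidean_space \<Rightarrow> 'b::euclidean_space"
  assumes L: "0 < L" and lip: "\<And>x y. x \<in> A \<Longrightarrow> y \<in> A \<Longrightarrow> dist (f x) (f y) \<le> L * dist x y"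
  shows "hausdorff_content s (L * \<delta>) (f ` A) \<le> ennreal (L ^ s) * hausdorff_content s \<delta> A"
proof -
  have key: "hausdorff_content s (L * \<delta>) (f ` A) \<le> ennreal (L ^ s) * (\<Sum>i. hausdorff_weight s (U i))"
    if U: "A \<subseteq> (\<Union>i. U i)" "\<And>i. bounded (U i)" "\<And>i. diameter (U i) \<le> \<delta>" for U :: "nat \<Rightarrow> 'a set"
  proof -
    define V where "V i = f ` (U i \<inter> A)" for i
    have d: "dist (f x) (f y) \<le> L * diameter (U i)" if "x \<in> U i \<inter> A" "y \<in> U i \<inter> A" for x y i
    proof -
      have "dist x y \<le> diameter (U i)" using diameter_bounded_bound[OF U(2)[of i]] that by auto
      then show ?thesis using lip[of x y] that L by (smt (verit) IntD2 mult_left_mono)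
    qed
    have dV: "diameter (V i) \<le> L * diameter (U i)" for i
    proof (rule diameter_le)
      show "V i \<noteq> {} \<or> 0 \<le> L * diameter (U i)" using diameter_ge_0[OF U(2)[of i]] L by auto
      show "norm (x - y) \<le> L * diameter (U i)" if "x \<in> V i" "y \<in> V i" for x y
        using d[of _ i] that by (force simp: V_def dist_norm)
    qed
    have bV: "bounded (V i)" for i
    proof (cases "U i \<inter> A = {}")
      case False
      then obtain a where a: "a \<in> U i \<inter> A" by auto
      then show ?thesis unfolding V_def bounded_def using d[OF a]
        by (intro exI[of _ "f a"] exI[of _ "L * diameter (U i)"]) auto
    qed (auto simp: V_def)
    have "hausdorff_content s (L * \<delta>) (f ` A) \<le> (\<Sum>i. hausdorff_weight s (V i))"
    proof (rule hausdorff_content_le)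
      show "f ` A \<subseteq> (\<Union>i. V i)" using U(1) unfolding V_def by blast
      show "bounded (V i)" for i by (rule bV)
      show "diameter (V i) \<le> L * \<delta>" for i using dV[of i] U(3)[of i] L by (smt (verit) mult_left_mono)
    qed
    also have "\<dots> \<le> (\<Sum>i. ennreal (L ^ s) * hausdorff_weight s (U i))"
    proof (intro suminf_le)
      fix i
      show "hausdorff_weight s (V i) \<le> ennreal (L ^ s) * hausdorff_weight s (U i)"
      proof (cases "V i = {}")
        case False
        then have ne: "U i \<noteq> {}" by (auto simp: V_def)
        have "hausdorff_weight s (V i) \<le> ennreal (unit_ball_vol (real s) * (L * diameter (U i) / 2) ^ s)"
          using dV[of i] bV L diameter_ge_0[OF U(2)[of i]] by (intro hausdorff_weight_mono) auto
        also have "\<dots> = ennreal (L ^ s) * hausdorff_weight s (U i)"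
          using ne L diameter_ge_0[OF U(2)[of i]]
          by (simp add: hausdorff_weight_def ennreal_mult[symmetric] power_divide power_mult_distrib mult_ac)
        finally show ?thesis .
      qed (simp add: hausdorff_weight_def)
    qed auto
    also have "\<dots> = ennreal (L ^ s) * (\<Sum>i. hausdorff_weight s (U i))" by simp
    finally show ?thesis .
  qed
  have pos: "ennreal (L ^ s) > 0" "ennreal (L ^ s) < top" using L by auto
  \<comment> \<open>The factor is moved to the left so that the infimum over covers of
    \<open>A\<close> can be bounded below cover by cover.\<close>
  have "ennreal (1 / L ^ s) * hausdorff_content s (L * \<delta>) (f ` A) \<le> hausdorff_content s \<delta> A"
    unfolding hausdorff_content_def[of s \<delta> A]
  proof (rule INF_greatest)
    fix U :: "nat \<Rightarrow> 'a set"
    assume "U \<in> {U. A \<subseteq> (\<Union>i. U i) \<and> (\<forall>i. bounded (U i) \<and> diameter (U i) \<le> \<delta>)}"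
    then have "hausdorff_content s (L * \<delta>) (f ` A) \<le> ennreal (L ^ s) * (\<Sum>i. hausdorff_weight s (U i))"
      by (intro key) auto
    then have "ennreal (1 / L ^ s) * hausdorff_content s (L * \<delta>) (f ` A)
        \<le> ennreal (1 / L ^ s) * (ennreal (L ^ s) * (\<Sum>i. hausdorff_weight s (U i)))"
      by (intro mult_left_mono) auto
    also have "\<dots> = (\<Sum>i. hausdorff_weight s (U i))"
      using L by (simp add: mult.assoc[symmetric] ennreal_mult'[symmetric])
    finally show "ennreal (1 / L ^ s) * hausdorff_content s (L * \<delta>) (f ` A) \<le> (\<Sum>i. hausdorff_weight s (U i))" .
  qed
  then have "ennreal (L ^ s) * (ennreal (1 / L ^ s) * hausdorff_content s (L * \<delta>) (f ` A))
      \<le> ennreal (L ^ s) * hausdorff_content s \<delta> A"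
    by (intro mult_left_mono) auto
  then show ?thesis using L by (simp add: mult.assoc[symmetric] ennreal_mult'[symmetric])
qed

lemma hausdorff_outer_Lipschitz:
  fixes f :: "'a::euclidean_space \<Rightarrow> 'b::euclidean_space"
  assumes L: "0 < L" and lip: "\<And>x y. x \<in> A \<Longrightarrow> y \<in> A \<Longrightarrow> dist (f x) (f y) \<le> L * dist x y"
  shows "hausdorff_outer s (f ` A) \<le> ennreal (L ^ s) * hausdorff_outer s A"
  unfolding hausdorff_outer_def[of s "f ` A"]
proof (rule SUP_least)
  fix d :: real assume d: "d \<in> {0<..}"
  have "hausdorff_content s (L * (d / L)) (f ` A) \<le> ennreal (L ^ s) * hausdorff_content s (d / L) A"
    by (rule hausdorff_content_Lipschitz[OF L lip])
  also have "\<dots> \<le> ennreal (L ^ s) * hausdorff_outer s A"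
    unfolding hausdorff_outer_def using d L by (intro mult_left_mono SUP_upper) auto
  finally show "hausdorff_content s d (f ` A) \<le> ennreal (L ^ s) * hausdorff_outer s A" using L by simp
qed

lemma hausdorff_content_finite_cover:
  assumes "finite I" "A \<subseteq> (\<Union>i\<in>I. U i)" "\<And>i. i \<in> I \<Longrightarrow> bounded (U i)"
    "\<And>i. i \<in> I \<Longrightarrow> diameter (U i) \<le> \<delta>" "0 \<le> \<delta>"
  shows "hausdorff_content s \<delta> A \<le> ennreal (real (card I) * (unit_ball_vol (real s) * (\<delta> / 2) ^ s))"
proof -
  obtain e :: "nat \<Rightarrow> _" where e: "bij_betw e {0..<card I} I" using ex_bij_betw_nat_finite[OF assms(1)] by auto
  \<comment> \<open>The finite cover is padded by empty sets, whose weight is 0 for every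
    \<open>s\<close>, including \<open>s = 0\<close>.\<close>
  define V where "V k = (if k < card I then U (e k) else {})" for k
  have eI: "e k \<in> I" if "k < card I" for k using e that by (auto simp: bij_betw_def)
  have "hausdorff_content s \<delta> A \<le> (\<Sum>k. hausdorff_weight s (V k))"
  proof (rule hausdorff_content_le)
    show "A \<subseteq> (\<Union>k. V k)"
    proof
      fix x assume "x \<in> A"
      then obtain i where i: "i \<in> I" "x \<in> U i" using assms(2) by auto
      then obtain k where "k < card I" "e k = i" using e by (force simp: bij_betw_def)
      then show "x \<in> (\<Union>k. V k)" using i by (auto simp: V_def intro!: exI[of _ k])
    qed
  qed (use assms eI in \<open>auto simp: V_def\<close>)
  also have "\<dots> = (\<Sum>k<card I. hausdorff_weight s (V k))"
    by (rule suminf_finite) (auto simp: V_def hausdorff_weight_def)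
  also have "\<dots> \<le> (\<Sum>k<card I. ennreal (unit_ball_vol (real s) * (\<delta> / 2) ^ s))"
    using assms eI by (intro sum_mono hausdorff_weight_mono) (auto simp: V_def)
  also have "\<dots> = ennreal (real (card I) * (unit_ball_vol (real s) * (\<delta> / 2) ^ s))"
    by (simp add: ennreal_mult' ennreal_of_nat_eq_real_of_nat)
  finally show ?thesis .
qed

section \<open>Uniformly distributed measures\<close>

text \<open>Christensen's argument: average \<open>\<nu> (U \<inter> ball x r) / h r\<close>, which tends to \<open>1\<close> on \<open>U\<close>, against \<open>\<mu>\<close>.\<close>

lemma uniformly_distributed_le:
  fixes \<mu> \<nu> :: "'a::{metric_space,second_countable_topology} measure" and c :: ennreal
  assumes sets: "sets \<mu> = sets borel" "sets \<nu> = sets borel"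
    and fin: "sigma_finite_measure \<mu>" "sigma_finite_measure \<nu>"
    and S: "S \<in> sets borel" "emeasure \<mu> (- S) = 0" "emeasure \<nu> (- S) = 0"
    and g: "\<And>x r. x \<in> S \<Longrightarrow> 0 < r \<Longrightarrow> emeasure \<mu> (ball x r) = g r"
    and h: "\<And>x r. x \<in> S \<Longrightarrow> 0 < r \<Longrightarrow> emeasure \<nu> (ball x r) = h r"
    and h_pos: "\<And>r. 0 < r \<Longrightarrow> 0 < h r" "\<And>r. 0 < r \<Longrightarrow> h r < top"
    and small: "\<And>\<delta>. 0 < \<delta> \<Longrightarrow> \<exists>r. 0 < r \<and> r < \<delta> \<and> g r \<le> c * h r"
    and U: "open U"
  shows "emeasure \<mu> U \<le> c * emeasure \<nu> U"
proof -
  have "\<exists>r. \<forall>k. 0 < r k \<and> r k < inverse (real (Suc k)) \<and> g (r k) \<le> c * h (r k)" by (intro choice allI small) simp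
  then obtain r where r': "\<And>k. 0 < r k" "\<And>k. r k < inverse (real (Suc k))" and c: "\<And>k. g (r k) \<le> c * h (r k)" by metis
  have r: "\<And>k. 0 < r k" "r \<longlonglongrightarrow> 0"
    using r' by (auto intro!: tendsto_sandwich[OF _ _ tendsto_const LIMSEQ_inverse_real_of_nat] always_eventually less_imp_le)
  interpret \<mu>: sigma_finite_measure \<mu> by (rule fin)
  interpret \<nu>: sigma_finite_measure \<nu> by (rule fin)
  interpret P: pair_sigma_finite \<mu> \<nu> ..
  note sets[measurable_cong]
  have [measurable]: "U \<in> sets borel" "S \<in> sets borel" using U S by auto
  \<comment> \<open>Sections with the first point fixed give the averages over \<nu>, sections with
    the second point fixed lie in balls whose \<mu>-mass is \<open>g (r k)\<close>. Both points are
    restricted to \<open>S\<close>, where the masses of balls are known.\<close>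
  define D where "D k = {p :: 'a \<times> 'a. dist (fst p) (snd p) < r k \<and> fst p \<in> U \<inter> S \<and> snd p \<in> U \<inter> S}" for k
  have D[measurable]: "D k \<in> sets (borel \<Otimes>\<^sub>M borel)" for k
  proof -
    have [measurable]: "(\<lambda>p :: 'a \<times> 'a. dist (fst p) (snd p)) \<in> borel_measurable (borel \<Otimes>\<^sub>M borel)"
      unfolding borel_prod by (intro borel_measurable_continuous_onI continuous_intros)
    have "Measurable.pred (borel \<Otimes>\<^sub>M borel) (\<lambda>p. dist (fst p) (snd p) < r k \<and> fst p \<in> U \<inter> S \<and> snd p \<in> U \<inter> S)"
      by measurable
    then show ?thesis unfolding D_def pred_def by (simp add: space_pair_measure)
  qed
  have D'[measurable]: "D k \<in> sets (\<mu> \<Otimes>\<^sub>M \<nu>)" for k using D sets by (metis sets_pair_measure_cong)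
  define F where "F k x = (\<integral>\<^sup>+y. indicator (D k) (x, y) / h (r k) \<partial>\<nu>)" for k x
  have Fm: "F k \<in> borel_measurable \<mu>" for k unfolding F_def by measurable
  have h0: "h (r k) \<noteq> 0" "h (r k) \<noteq> top" for k using h_pos[OF r(1)[of k]] by auto
  have "emeasure \<mu> U = (\<integral>\<^sup>+x. indicator U x \<partial>\<mu>)" by simp
  also have "\<dots> \<le> (\<integral>\<^sup>+x. liminf (\<lambda>k. F k x) \<partial>\<mu>)"
  proof (rule nn_integral_mono_AE)
    have AE_S: "AE x in \<nu>. x \<in> S" using S by (intro AE_I[of _ _ "- S"]) auto
    have "AE x in \<mu>. x \<in> S" using S by (intro AE_I[of _ _ "- S"]) auto
    then show "AE x in \<mu>. indicator U x \<le> liminf (\<lambda>k. F k x)"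
    proof eventually_elim
      case (elim x)
      show ?case
      proof (cases "x \<in> U")
        case True
        then obtain e where e: "0 < e" "ball x e \<subseteq> U" using U open_contains_ball by blast
        have "\<forall>\<^sub>F k in sequentially. r k < e" using r(2) e(1) by (rule order_tendstoD)
        then have "\<forall>\<^sub>F k in sequentially. 1 \<le> F k x"
        proof eventually_elim
          case (elim k)
          have "F k x = (\<integral>\<^sup>+y. indicator (ball x (r k)) y / h (r k) \<partial>\<nu>)" unfolding F_def
          proof (rule nn_integral_cong_AE)
            show "AE y in \<nu>. indicator (D k) (x, y) / h (r k) = indicator (ball x (r k)) y / h (r k)" using AE_S
            proof eventually_elim
              case (elim y)
              then show ?case using True \<open>x \<in> S\<close> e \<open>r k < e\<close> by (auto simp: D_def indicator_def subset_iff)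
            qed
          qed
          also have "\<dots> = emeasure \<nu> (ball x (r k)) / h (r k)"
          proof -
            have b: "ball x (r k) \<in> sets \<nu>" by (simp add: sets)
            show ?thesis
              by (simp only: nn_integral_divide[OF borel_measurable_indicator[OF b]] nn_integral_indicator[OF b])
          qed
          also have "\<dots> = 1" using h[OF \<open>x \<in> S\<close> r(1)] h0[of k] mult_divide_eq_ennreal[of "h (r k)" 1] by simp
          finally show ?case by simp
        qed
        then have "1 \<le> liminf (\<lambda>k. F k x)" by (rule Liminf_bounded)
        then show ?thesis using True by simp
      qed simp
    qed
  qed
  also have "\<dots> \<le> liminf (\<lambda>k. \<integral>\<^sup>+x. F k x \<partial>\<mu>)"
    by (rule nn_integral_liminf[OF Fm])
  also have "\<dots> \<le> c * emeasure \<nu> U"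
  proof (rule Liminf_le)
    have "(\<integral>\<^sup>+x. F k x \<partial>\<mu>) \<le> c * emeasure \<nu> U" for k
    proof -
      have "(\<integral>\<^sup>+x. F k x \<partial>\<mu>) = (\<integral>\<^sup>+y. \<integral>\<^sup>+x. indicator (D k) (x, y) / h (r k) \<partial>\<mu> \<partial>\<nu>)"
        unfolding F_def by (rule P.Fubini'[symmetric]) measurable
      also have "\<dots> \<le> (\<integral>\<^sup>+y. c * indicator U y \<partial>\<nu>)"
      proof (rule nn_integral_mono)
        fix y
        show "(\<integral>\<^sup>+x. indicator (D k) (x, y) / h (r k) \<partial>\<mu>) \<le> c * indicator U y"
        proof (cases "y \<in> U \<inter> S")
          case True
          have "(\<integral>\<^sup>+x. indicator (D k) (x, y) / h (r k) \<partial>\<mu>) \<le> (\<integral>\<^sup>+x. indicator (ball y (r k)) x / h (r k) \<partial>\<mu>)"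
            by (intro nn_integral_mono divide_right_mono_ennreal) (auto simp: D_def indicator_def dist_commute)
          also have "\<dots> = g (r k) / h (r k)"
            using True g[OF _ r(1)] sets by (subst nn_integral_divide) (auto intro!: borel_measurable_indicator)
          also have "\<dots> \<le> (c * h (r k)) / h (r k)"
            by (intro divide_right_mono_ennreal c)
          also have "\<dots> = c" using h0 by (simp add: mult_divide_eq_ennreal)
          finally show ?thesis using True by simp
        next
          case False
          then have "indicator (D k) (x, y) = (0 :: ennreal)" for x by (auto simp: D_def)
          then show ?thesis by simp
        qed
      qed
      also have "\<dots> = c * emeasure \<nu> U" by (simp add: nn_integral_cmult)
      finally show ?thesis .
    qed
    then show "\<forall>\<^sub>F k in sequentially. (\<integral>\<^sup>+x. F k x \<partial>\<mu>) \<le> c * emeasure \<nu> U" by simp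
  qed simp
  finally show ?thesis .
qed

text \<open>Avoids a limit of \<open>g r / h r\<close>: for each \<open>c > 0\<close> either
  \<open>g \<le> c * h\<close> along arbitrarily small radii, or the reverse inequality holds for
  all small radii. Either alternative extends to all open sets, and the total masses decide which
  one holds according to whether \<open>c\<close> lies above or below their quotient.\<close>

lemma uniformly_distributed_proportional:
  fixes \<mu> \<nu> :: "'a::{metric_space,second_countable_topology} measure"
  assumes sets: "sets \<mu> = sets borel" "sets \<nu> = sets borel" and fin: "finite_measure \<mu>" "finite_measure \<nu>"
    and S: "S \<in> sets borel" "emeasure \<mu> (- S) = 0" "emeasure \<nu> (- S) = 0"
    and g: "\<And>x r. x \<in> S \<Longrightarrow> 0 < r \<Longrightarrow> emeasure \<mu> (ball x r) = g r" "\<And>r. 0 < r \<Longrightarrow> 0 < g r" "\<And>r. 0 < r \<Longrightarrow> g r < top"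
    and h: "\<And>x r. x \<in> S \<Longrightarrow> 0 < r \<Longrightarrow> emeasure \<nu> (ball x r) = h r" "\<And>r. 0 < r \<Longrightarrow> 0 < h r" "\<And>r. 0 < r \<Longrightarrow> h r < top"
    and pos: "0 < measure \<mu> UNIV" "0 < measure \<nu> UNIV" and U: "open U"
  shows "measure \<mu> U = measure \<mu> UNIV / measure \<nu> UNIV * measure \<nu> U"
proof -
  interpret \<mu>: finite_measure \<mu> by (rule fin)
  interpret \<nu>: finite_measure \<nu> by (rule fin)
  define \<kappa> where "\<kappa> = measure \<mu> UNIV / measure \<nu> UNIV"
  define N where "N c \<longleftrightarrow> (\<forall>\<delta>>0. \<exists>r. 0 < r \<and> r < \<delta> \<and> g r \<le> ennreal c * h r)" for c
  have A: "measure \<mu> V \<le> c * measure \<nu> V" if "0 < c" "N c" "open V" for c V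
  proof -
    have "emeasure \<mu> V \<le> ennreal c * emeasure \<nu> V" by (rule uniformly_distributed_le[where S = S and g = g and h = h])
        (use that sets S g h \<mu>.sigma_finite_measure_axioms \<nu>.sigma_finite_measure_axioms in \<open>auto simp: N_def\<close>)
    then show ?thesis using that(1) by (simp add: \<mu>.emeasure_eq_measure \<nu>.emeasure_eq_measure ennreal_mult'[symmetric])
  qed
  have B: "c * measure \<nu> V \<le> measure \<mu> V" if c: "0 < c" and N: "\<not> N c" and V: "open V" for c V
  proof -
    obtain \<delta> where \<delta>: "0 < \<delta>" "\<And>r. 0 < r \<Longrightarrow> r < \<delta> \<Longrightarrow> ennreal c * h r \<le> g r" using N unfolding N_def by (meson not_le less_imp_le)
    have "h r \<le> ennreal (1 / c) * g r" if "0 < r" "r < \<delta>" for r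
      using mult_left_mono[OF \<delta>(2)[OF that], of "ennreal (1 / c)"] c
      by (simp add: mult.assoc[symmetric] ennreal_mult'[symmetric])
    moreover have "\<exists>r. 0 < r \<and> r < \<epsilon> \<and> r < \<delta>" if "0 < \<epsilon>" for \<epsilon> :: real
      using that \<delta>(1) by (intro exI[of _ "min \<epsilon> \<delta> / 2"]) auto
    ultimately have "emeasure \<nu> V \<le> ennreal (1 / c) * emeasure \<mu> V"
      by (intro uniformly_distributed_le[where S = S and g = h and h = g] sets S h(1) g V \<mu>.sigma_finite_measure_axioms \<nu>.sigma_finite_measure_axioms) meson+
    then show ?thesis using c by (simp add: \<mu>.emeasure_eq_measure \<nu>.emeasure_eq_measure ennreal_mult'[symmetric] field_simps)
  qed
  have \<kappa>: "0 < \<kappa>" using pos by (simp add: \<kappa>_def)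
  have le: "measure \<mu> U \<le> c * measure \<nu> U" if "\<kappa> < c" for c
  proof (rule A)
    show "N c" using B[of c UNIV] that \<kappa> pos by (cases "N c") (auto simp: \<kappa>_def field_simps)
  qed (use that \<kappa> U in auto)
  have ge: "c * measure \<nu> U \<le> measure \<mu> U" if "0 < c" "c < \<kappa>" for c
  proof (rule B)
    show "\<not> N c" using A[of c UNIV] that pos by (auto simp: \<kappa>_def field_simps)
  qed (use that U in auto)
  have "measure \<mu> U \<le> \<kappa> * measure \<nu> U"
    by (rule tendsto_lowerbound[where F = "at_right \<kappa>" and f = "\<lambda>c. c * measure \<nu> U"])
      (use le in \<open>auto intro!: tendsto_intros eventually_mono[OF eventually_at_right_less[of \<kappa>]]\<close>)
  moreover have "\<kappa> * measure \<nu> U \<le> measure \<mu> U"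
    by (rule tendsto_upperbound[where F = "at_left \<kappa>" and f = "\<lambda>c. c * measure \<nu> U"])
      (use ge \<kappa> in \<open>auto intro!: tendsto_intros eventually_mono[OF eventually_at_left_real[of 0 \<kappa>]]\<close>)
  ultimately show ?thesis unfolding \<kappa>_def by linarith
qed

section \<open>Isometry invariance of Lebesgue measure and reflections\<close>

lemma measure_eq_on_open:
  fixes M N :: "'a::euclidean_space measure"
  assumes "sets M = sets borel" "sets N = sets borel"
    and "\<And>U. open U \<Longrightarrow> emeasure M U = emeasure N U"
    and "\<And>k :: nat. emeasure M (ball 0 (real k)) < top"
  shows "M = N"
proof (rule measure_eqI_generator_eq[where E = "Collect open" and \<Omega> = UNIV and A = "\<lambda>k. ball 0 (real k)"])
  show "(\<Union>k. ball (0::'a) (real k)) = UNIV"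
  proof -
    have "\<exists>k. x \<in> ball (0::'a) (real k)" for x using reals_Archimedean2[of "norm x"] by auto
    then show ?thesis by auto
  qed
  show "sets M = sigma_sets UNIV (Collect open)" "sets N = sigma_sets UNIV (Collect open)"
    using assms by (simp_all add: borel_def)
qed (use assms in \<open>auto simp: Int_stable_def less_top\<close>)

text \<open>\<open>lborel\<close> and its image under \<open>f\<close> give every ball of radius
  \<open>r\<close> the same mass, so both are uniformly distributed, and the comparison with
  constant 1 applies in either direction.\<close>

lemma lborel_isometry_invariant:
  fixes f g :: "'a::euclidean_space \<Rightarrow> 'a"
  assumes f: "\<And>x y. dist (f x) (f y) = dist x y" and gf: "\<And>x. g (f x) = x" "\<And>x. f (g x) = x"
  shows "distr lborel borel f = lborel"
proof -
  have dg: "dist (g x) (g y) = dist x y" for x y using f[of "g x" "g y"] gf by simp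
  have "continuous_on UNIV f" unfolding continuous_on_iff using f by auto
  then have [measurable]: "f \<in> borel_measurable borel" by (rule borel_measurable_continuous_onI)
  have pre: "f -` ball x r = ball (g x) r" for x r using f[of "g x"] gf by auto
  let ?h = "\<lambda>r. ennreal (unit_ball_vol (real DIM('a)) * r ^ DIM('a))"
  have ball: "emeasure lborel (ball x r) = ?h r" if "0 \<le> r" for x :: 'a and r using that by (simp add: emeasure_ball)
  have ball': "emeasure (distr lborel borel f) (ball x r) = ?h r" if "0 \<le> r" for x r
    using that by (simp add: emeasure_distr pre ball)
  have pos: "0 < ?h r" "?h r < top" if "0 < r" for r using that unit_ball_vol_pos[of "real DIM('a)"] by simp_all
  have sf: "sigma_finite_measure (distr lborel borel f)"
  proof
    show "\<exists>A. countable A \<and> A \<subseteq> sets (distr lborel borel f) \<and> \<Union> A = space (distr lborel borel f)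
        \<and> (\<forall>a\<in>A. emeasure (distr lborel borel f) a \<noteq> \<infinity>)"
    proof (intro exI[of _ "range (\<lambda>k::nat. ball 0 (real k))"] conjI ballI)
      have "\<exists>k. x \<in> ball (0::'a) (real k)" for x using reals_Archimedean2[of "norm x"] by auto
      then show "\<Union> (range (\<lambda>k::nat. ball 0 (real k))) = space (distr lborel borel f)" by auto
      fix a assume "a \<in> range (\<lambda>k::nat. ball (0::'a) (real k))"
      then obtain k :: nat where a: "a = ball 0 (real k)" by auto
      show "emeasure (distr lborel borel f) a \<noteq> \<infinity>" unfolding a by (subst ball') auto
    qed auto
  qed
  show ?thesis
  proof (rule measure_eq_on_open)
    fix U :: "'a set" assume U: "open U"
    show "emeasure (distr lborel borel f) U = emeasure lborel U"
    proof (rule antisym)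
      show "emeasure (distr lborel borel f) U \<le> emeasure lborel U"
        using uniformly_distributed_le[of "distr lborel borel f" lborel UNIV ?h ?h 1 U]
          sf lborel.sigma_finite_measure_axioms ball ball' pos dense[of "0::real"] U by simp
      show "emeasure lborel U \<le> emeasure (distr lborel borel f) U"
        using uniformly_distributed_le[of lborel "distr lborel borel f" UNIV ?h ?h 1 U]
          sf lborel.sigma_finite_measure_axioms ball ball' pos dense[of "0::real"] U by simp
    qed
  next
    show "emeasure (distr lborel borel f) (ball 0 (real k)) < top" for k by (subst ball') auto
  qed auto
qed

text \<open>The reflection in the hyperplane orthogonal to \<open>a - b\<close>. Equality of the
  norms makes this hyperplane pass through the midpoint, so that the two points are
  exchanged.\<close>

lemma reflection_exists:
  fixes a b :: "'a::euclidean_space"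
  assumes "norm a = norm b"
  obtains f :: "'a \<Rightarrow> 'a" where "linear f" "\<And>x. norm (f x) = norm x" "\<And>x. f (f x) = x" "f a = b"
proof (cases "a = b")
  case True
  then show ?thesis using that[of "\<lambda>x. x"] by (auto simp: linear_id[unfolded id_def])
next
  case False
  define w where "w = a - b"
  define f where "f x = x - (2 * (x \<bullet> w) / (w \<bullet> w)) *\<^sub>R w" for x
  have ww: "w \<bullet> w \<noteq> 0" using False by (simp add: w_def)
  show ?thesis
  proof (rule that[of f])
    show "linear f" by (rule linearI) (simp_all add: f_def algebra_simps inner_add_left add_divide_distrib)
    have "f x \<bullet> f x = x \<bullet> x" for x
      using ww by (simp add: f_def inner_diff_left inner_diff_right inner_commute field_simps power2_eq_square)
    then show "norm (f x) = norm x" for x by (simp add: norm_eq_sqrt_inner)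
    show "f (f x) = x" for x using ww by (simp add: f_def inner_diff_left algebra_simps)
    have "2 * (a \<bullet> w) = w \<bullet> w" using assms by (simp add: w_def inner_diff_left inner_diff_right inner_commute norm_eq)
    then show "f a = b" using ww by (simp add: f_def w_def)
  qed
qed

section \<open>Polar coordinates\<close>

text \<open>The mass of a set of directions is \<open>DIM('a)\<close> times the volume of the cone
  over it in the unit ball. The factor compensates the integral of \<open>r ^ (DIM('a) - 1)\<close>
  over the unit interval, so that this is the angular factor of Lebesgue measure.\<close>

definition cone_measure :: "'a::euclidean_space measure" where
  "cone_measure = distr (density lborel (\<lambda>x. ennreal (real DIM('a)) * indicator (cball 0 1) x)) borel sgn"

definition radial_measure :: "nat \<Rightarrow> real measure" where
  "radial_measure n = density lborel (\<lambda>r. ennreal (r ^ (n - 1)) * indicator {0..} r)"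

lemma sets_cone_measure [simp, measurable_cong]: "sets cone_measure = sets borel"
  and space_cone_measure [simp]: "space cone_measure = UNIV"
  and sets_radial_measure [simp, measurable_cong]: "sets (radial_measure n) = sets borel"
  and space_radial_measure [simp]: "space (radial_measure n) = UNIV"
  by (simp_all add: cone_measure_def radial_measure_def)

lemma emeasure_cone_measure:
  fixes B :: "'a::euclidean_space set"
  assumes [measurable]: "B \<in> sets borel"
  shows "emeasure cone_measure B = ennreal (real DIM('a)) * emeasure lborel {x \<in> cball 0 1. sgn x \<in> B}"
proof -
  have [measurable]: "{x \<in> cball 0 1. sgn x \<in> B} \<in> sets borel" by measurable
  have sB[measurable]: "sgn -` B \<in> sets borel" using measurable_sets[OF borel_measurable_sgn assms] by simp
  have fm: "(\<lambda>x :: 'a. ennreal (real DIM('a)) * indicator (cball 0 1) x) \<in> borel_measurable lborel"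
    by (intro borel_measurable_times_ennreal borel_measurable_indicator) auto
  have "emeasure cone_measure B
      = (\<integral>\<^sup>+x. ennreal (real DIM('a)) * indicator (cball 0 1) x * indicator (sgn -` B) x \<partial>lborel)"
    unfolding cone_measure_def using sB fm by (simp add: emeasure_distr emeasure_density)
  also have "\<dots> = (\<integral>\<^sup>+x. ennreal (real DIM('a)) * indicator {x \<in> cball 0 1. sgn x \<in> B} x \<partial>lborel)"
    by (intro nn_integral_cong) (auto simp: indicator_def)
  also have "\<dots> = ennreal (real DIM('a)) * emeasure lborel {x \<in> cball 0 1. sgn x \<in> B}"
    by (subst nn_integral_cmult_indicator) auto
  finally show ?thesis .
qed

lemma emeasure_cone_measure_UNIV:
  "emeasure (cone_measure :: 'a::euclidean_space measure) UNIV
     = ennreal (real DIM('a) * unit_ball_vol (real DIM('a)))"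
  using emeasure_cone_measure[of "UNIV :: 'a set"] emeasure_cball[of 1 "0 :: 'a"]
  by (simp add: ennreal_mult cball_def)

lemma finite_measure_cone_measure: "finite_measure cone_measure"
  by (rule finite_measureI) (simp add: emeasure_cone_measure_UNIV)

lemma AE_cone_measure: "AE \<theta> in (cone_measure :: 'a::euclidean_space measure). \<theta> \<in> sphere 0 1"
proof (rule AE_I[of _ _ "- sphere 0 1"])
  have "{x \<in> cball 0 1. sgn x \<in> - sphere 0 1} \<subseteq> {0 :: 'a}" by (auto simp: norm_sgn)
  then have "emeasure lborel {x \<in> cball (0::'a) 1. sgn x \<in> - sphere 0 1} \<le> emeasure lborel {0 :: 'a}"
    by (intro emeasure_mono) auto
  then show "emeasure (cone_measure :: 'a measure) (- sphere 0 1) = 0"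
    by (subst emeasure_cone_measure) (auto simp: borel_closed)
qed (auto simp: borel_closed)

lemma emeasure_lborel_scale:
  fixes X :: "'a::euclidean_space set"
  assumes "c > 0" "X \<in> sets borel"
  shows "emeasure lborel X = ennreal (c ^ DIM('a)) * emeasure lborel {x. c *\<^sub>R x \<in> X}"
proof -
  have "emeasure lborel X = emeasure (density (distr lborel borel (\<lambda>x::'a. 0 + c *\<^sub>R x)) (\<lambda>_. \<bar>c\<bar>^DIM('a))) X"
    using lborel_affine[of c "0::'a"] assms by simp
  also have "\<dots> = ennreal (c ^ DIM('a)) * emeasure (distr lborel borel (\<lambda>x::'a. c *\<^sub>R x)) X"
    using assms by (subst emeasure_density_const) auto
  also have "emeasure (distr lborel borel (\<lambda>x::'a. c *\<^sub>R x)) X = emeasure lborel {x. c *\<^sub>R x \<in> X}"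
    using assms by (subst emeasure_distr) (auto simp: vimage_def)
  finally show ?thesis .
qed

lemma emeasure_radial_measure:
  assumes "0 < n" "0 \<le> a"
  shows "emeasure (radial_measure n) {..a} = ennreal (a ^ n / real n)"
proof -
  have "emeasure (radial_measure n) {..a} = (\<integral>\<^sup>+r. ennreal (r ^ (n - 1)) * indicator {0..a} r \<partial>lborel)"
    unfolding radial_measure_def by (subst emeasure_density) (auto intro!: nn_integral_cong simp: indicator_def)
  also have "\<dots> = ennreal (a ^ n / real n - 0 ^ n / real n)"
    using assms by (intro nn_integral_FTC_Icc) (auto intro!: derivative_eq_intros simp: field_simps)
  finally show ?thesis using assms by (simp add: zero_power)
qed

lemma sigma_finite_radial_measure: "0 < n \<Longrightarrow> sigma_finite_measure (radial_measure n)"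
proof
  assume n: "0 < n"
  show "\<exists>A. countable A \<and> A \<subseteq> sets (radial_measure n) \<and> \<Union> A = space (radial_measure n)
      \<and> (\<forall>a\<in>A. emeasure (radial_measure n) a \<noteq> \<infinity>)"
    using n by (intro exI[of _ "range (\<lambda>k::nat. {..real k})"])
      (auto simp: emeasure_radial_measure real_arch_simple)
qed

text \<open>For fixed \<open>B\<close> both sides are measures in \<open>A\<close>, so half-lines
  \<open>{..a}\<close> suffice. For \<open>a > 0\<close>, scaling by \<open>a\<close> reduces them
  to the cone over \<open>B\<close> in the unit ball and produces the factor
  \<open>a ^ DIM('a)\<close>.\<close>

lemma radial_cone_rectangle:
  fixes B :: "'a::euclidean_space set"
  assumes A: "A \<in> sets borel" and B[measurable]: "B \<in> sets borel"
  shows "emeasure (radial_measure DIM('a)) A * emeasure cone_measure B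
    = emeasure lborel {x. norm x \<in> A \<and> sgn x \<in> B}"
proof -
  define M where "M = scale_measure (emeasure cone_measure B) (radial_measure DIM('a))"
  define N where "N = distr (density lborel (indicator (sgn -` B))) borel (norm :: 'a \<Rightarrow> real)"
  have [measurable]: "sgn -` B \<in> sets borel" using measurable_sets[OF borel_measurable_sgn B] by simp
  have NE: "emeasure N X = emeasure lborel {x. norm x \<in> X \<and> sgn x \<in> B}" if [measurable]: "X \<in> sets borel" for X
  proof -
    have "emeasure N X = (\<integral>\<^sup>+x. indicator (sgn -` B) x * indicator (norm -` X) x \<partial>lborel)"
      unfolding N_def using measurable_sets[OF borel_measurable_norm that]
      by (simp add: emeasure_distr) (subst emeasure_density, auto)
    also have "\<dots> = (\<integral>\<^sup>+x. indicator {x. norm x \<in> X \<and> sgn x \<in> B} x \<partial>lborel)"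
      by (intro nn_integral_cong) (auto simp: indicator_def)
    also have "\<dots> = emeasure lborel {x. norm x \<in> X \<and> sgn x \<in> B}"
      by (subst nn_integral_indicator) measurable
    finally show ?thesis .
  qed
  have Mfin: "emeasure cone_measure B < top"
    using finite_measure.emeasure_finite[OF finite_measure_cone_measure, of B] by (simp add: less_top)
  have "M = N"
  proof (rule measure_eqI_generator_eq[where E = "range (\<lambda>a::real. {..a})" and \<Omega> = UNIV and A = "\<lambda>k. {..real k}"])
    show "Int_stable (range (\<lambda>a::real. {..a}))" by (auto simp: Int_stable_def)
    show "sets M = sigma_sets UNIV (range (\<lambda>a. {..a}))" "sets N = sigma_sets UNIV (range (\<lambda>a. {..a}))"
      unfolding M_def N_def by (simp_all add: borel_eq_atMost)
    show "(\<Union>k. {..real k}) = UNIV" by (auto simp: real_arch_simple)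
    show "emeasure M {..real k} \<noteq> \<infinity>" for k
      using Mfin by (auto simp: M_def emeasure_radial_measure ennreal_mult_eq_top_iff)
    fix X assume "X \<in> range (\<lambda>a::real. {..a})"
    then obtain a where X: "X = {..a}" by auto
    show "emeasure M X = emeasure N X"
    proof (cases "a > 0")
      case True
      have "emeasure N X = emeasure lborel {x :: 'a. norm x \<le> a \<and> sgn x \<in> B}" unfolding X by (subst NE) auto
      also have "\<dots> = ennreal (a ^ DIM('a)) * emeasure lborel {x :: 'a. norm (a *\<^sub>R x) \<le> a \<and> sgn (a *\<^sub>R x) \<in> B}"
        using True by (subst emeasure_lborel_scale[of a]) auto
      also have "{x :: 'a. norm (a *\<^sub>R x) \<le> a \<and> sgn (a *\<^sub>R x) \<in> B} = {x \<in> cball 0 1. sgn x \<in> B}"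
        using True by (auto simp: sgn_scaleR)
      also have "ennreal (a ^ DIM('a)) * emeasure lborel {x \<in> cball 0 1. sgn x \<in> B} = emeasure M X"
        using True unfolding M_def X
        by (simp add: emeasure_radial_measure emeasure_cone_measure ennreal_mult'[symmetric] mult_ac)
           (simp add: mult.assoc[symmetric] ennreal_mult'[symmetric])
      finally show ?thesis by simp
    next
      case False
      have "{x :: 'a. norm x \<in> X \<and> sgn x \<in> B} \<subseteq> {0}"
        using False unfolding X by (auto, meson dual_order.trans norm_le_zero_iff not_le_imp_less less_imp_le)
      then have "emeasure lborel {x :: 'a. norm x \<in> X \<and> sgn x \<in> B} \<le> emeasure lborel {0 :: 'a}"
        by (intro emeasure_mono) auto
      then have N0: "emeasure N X = 0" using NE[of X] X by simp
      have "emeasure (radial_measure DIM('a)) X \<le> emeasure (radial_measure DIM('a)) {..0}"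
        using False X by (intro emeasure_mono) auto
      also have "\<dots> = 0" by (subst emeasure_radial_measure) auto
      finally show ?thesis using N0 by (simp add: M_def)
    qed
  qed auto
  then have "emeasure M A = emeasure N A" by simp
  then show ?thesis using NE[OF A] by (simp add: M_def mult.commute)
qed

lemma distr_polar:
  "distr lborel (borel \<Otimes>\<^sub>M borel) (\<lambda>x::'a::euclidean_space. (norm x, sgn x))
     = radial_measure DIM('a) \<Otimes>\<^sub>M cone_measure"
proof (rule pair_measure_eqI[symmetric])
  show "sigma_finite_measure (radial_measure DIM('a))" by (rule sigma_finite_radial_measure) simp
  interpret finite_measure "cone_measure :: 'a measure" by (rule finite_measure_cone_measure)
  show "sigma_finite_measure (cone_measure :: 'a measure)" ..
  show "sets (radial_measure DIM('a) \<Otimes>\<^sub>M (cone_measure :: 'a measure))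
     = sets (distr lborel (borel \<Otimes>\<^sub>M borel) (\<lambda>x::'a. (norm x, sgn x)))"
    by (simp cong: sets_pair_measure_cong)
  fix A and B :: "'a set" assume "A \<in> sets (radial_measure DIM('a))" "B \<in> sets cone_measure"
  then have [measurable]: "A \<in> sets borel" "B \<in> sets borel" by auto
  show "emeasure (radial_measure DIM('a)) A * emeasure cone_measure B
      = emeasure (distr lborel (borel \<Otimes>\<^sub>M borel) (\<lambda>x::'a. (norm x, sgn x))) (A \<times> B)"
    by (subst emeasure_distr) (auto simp: radial_cone_rectangle vimage_def)
qed

lemma norm_scaleR_sgn: "norm x *\<^sub>R sgn x = (x :: 'a::real_normed_vector)"
  by (cases "x = 0") (auto simp: sgn_div_norm)

lemma integral_polar:
  fixes f :: "'a::euclidean_space \<Rightarrow> real"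
  assumes f: "integrable lborel f"
  shows "integrable (radial_measure DIM('a) \<Otimes>\<^sub>M cone_measure) (\<lambda>(r, \<theta>). f (r *\<^sub>R \<theta>))"
    and "(LINT x|lborel. f x) = (LINT \<theta>|cone_measure. LINT r|radial_measure DIM('a). f (r *\<^sub>R \<theta>))"
    and "integrable cone_measure (\<lambda>\<theta>. LINT r|radial_measure DIM('a). f (r *\<^sub>R \<theta>))"
proof -
  let ?f = "\<lambda>(r, \<theta>). f (r *\<^sub>R \<theta>)"
  interpret R: sigma_finite_measure "radial_measure DIM('a)" by (rule sigma_finite_radial_measure) simp
  interpret C: finite_measure "cone_measure :: 'a measure" by (rule finite_measure_cone_measure)
  interpret P: pair_sigma_finite "radial_measure DIM('a)" "cone_measure :: 'a measure" ..
  have [measurable]: "f \<in> borel_measurable borel" using borel_measurable_integrable[OF f] by simp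
  have eq: "(\<lambda>x. ?f (norm x, sgn x)) = f" by (simp add: norm_scaleR_sgn)
  note norm_scaleR_sgn[simp]
  show int: "integrable (radial_measure DIM('a) \<Otimes>\<^sub>M cone_measure) ?f"
    unfolding distr_polar[symmetric] by (subst integrable_distr_eq) (simp_all add: eq f)
  have "(LINT x|lborel. f x) = (LINT x|lborel. ?f (norm x, sgn x))" by (simp add: eq)
  also have "\<dots> = (LINT p|(radial_measure DIM('a) \<Otimes>\<^sub>M cone_measure). ?f p)"
    unfolding distr_polar[symmetric] by (subst integral_distr) auto
  also have "\<dots> = (LINT \<theta>|cone_measure. LINT r|radial_measure DIM('a). f (r *\<^sub>R \<theta>))"
    using P.integral_snd[OF int] by (simp add: case_prod_unfold)
  finally show "(LINT x|lborel. f x) = (LINT \<theta>|cone_measure. LINT r|radial_measure DIM('a). f (r *\<^sub>R \<theta>))" .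
  show "integrable cone_measure (\<lambda>\<theta>. LINT r|radial_measure DIM('a). f (r *\<^sub>R \<theta>))"
    using P.integrable_snd[OF int] by (simp add: case_prod_unfold)
qed

text \<open>A linear isometry commutes with \<open>sgn\<close> and preserves the unit ball, so it
  maps cones to cones of the same volume.\<close>

lemma cone_measure_invariant:
  fixes f :: "'a::euclidean_space \<Rightarrow> 'a"
  assumes f: "linear f" "\<And>x. norm (f x) = norm x" "\<And>x. f (f x) = x" and B: "B \<in> sets borel"
  shows "emeasure cone_measure (f -` B) = emeasure cone_measure B"
proof -
  have d: "dist (f x) (f y) = dist x y" for x y using f by (metis dist_norm linear_diff)
  have [measurable]: "f \<in> borel_measurable borel"
    using f(1) by (intro borel_measurable_continuous_onI linear_continuous_on linear_conv_bounded_linear[THEN iffD1])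
  have fB: "f -` B \<in> sets borel" using measurable_sets[OF _ B, of f borel] by simp
  have [measurable]: "B \<in> sets borel" by (rule B)
  have sg: "sgn (f x) = f (sgn x)" for x using f by (simp add: sgn_div_norm linear_scale)
  have "emeasure lborel {x \<in> cball 0 1. sgn x \<in> B} = emeasure (distr lborel borel f) {x \<in> cball 0 1. sgn x \<in> B}"
    using lborel_isometry_invariant[of f f, OF d f(3) f(3)] by simp
  also have "\<dots> = emeasure lborel {x. f x \<in> cball 0 1 \<and> sgn (f x) \<in> B}"
    by (subst emeasure_distr) (auto simp: vimage_def)
  also have "{x. f x \<in> cball 0 1 \<and> sgn (f x) \<in> B} = {x \<in> cball 0 1. sgn x \<in> f -` B}"
    by (auto simp: f sg)
  finally show ?thesis by (simp add: emeasure_cone_measure fB)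
qed

text \<open>The cone over the cap contains a ball about \<open>x /\<^sub>R 2\<close>, a point where
  \<open>sgn\<close> is continuous.\<close>

lemma cone_measure_ball_pos:
  fixes x :: "'a::euclidean_space"
  assumes "norm x = 1" "0 < r"
  shows "0 < emeasure cone_measure (ball x r)"
proof -
  let ?C = "{z \<in> cball 0 1. sgn z \<in> ball x r}"
  have "continuous (at (x /\<^sub>R 2)) sgn" using assms by (intro continuous_sgn continuous_ident) auto
  then have "\<exists>d>0. \<forall>z. dist z (x /\<^sub>R 2) < d \<longrightarrow> dist (sgn z) (sgn (x /\<^sub>R 2)) < r"
    using assms(2) unfolding continuous_at_eps_delta by blast
  then obtain d where d: "d > 0" "\<And>z. dist z (x /\<^sub>R 2) < d \<Longrightarrow> dist (sgn z) (sgn (x /\<^sub>R 2)) < r" by auto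
  have s: "sgn (x /\<^sub>R 2) = x" using assms by (simp add: sgn_div_norm)
  have "ball (x /\<^sub>R 2) (min d (1/2)) \<subseteq> ?C"
  proof
    fix z assume z: "z \<in> ball (x /\<^sub>R 2) (min d (1/2))"
    have "norm z \<le> norm (x /\<^sub>R 2) + dist (x /\<^sub>R 2) z" by (metis dist_0_norm dist_triangle)
    then show "z \<in> ?C" using z d(2)[of z] s assms by (auto simp: dist_commute)
  qed
  then have "emeasure lborel (ball (x /\<^sub>R 2) (min d (1/2))) \<le> emeasure lborel ?C" by (intro emeasure_mono) auto
  moreover have "0 < emeasure lborel (ball (x /\<^sub>R 2) (min d (1/2)))"
    using d(1) unit_ball_vol_pos[of "real DIM('a)"] by (subst emeasure_ball) auto
  ultimately have "emeasure lborel ?C > 0" by (rule order_less_le_trans[rotated])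
  then show ?thesis by (simp add: emeasure_cone_measure ennreal_zero_less_mult_iff)
qed

section \<open>Hausdorff measure of the unit sphere\<close>

text \<open>The balls of radius \<open>r / 2\<close> about the points of \<open>P\<close> are disjoint and lie in a shell of width \<open>r\<close>.\<close>

lemma separated_card_le:
  assumes P: "finite P" "P \<subseteq> sphere (0::'a::euclidean_space) 1" and r: "0 < r" "r \<le> 1"
    and sep: "\<And>x y. x \<in> P \<Longrightarrow> y \<in> P \<Longrightarrow> x \<noteq> y \<Longrightarrow> r \<le> dist x y"
  shows "real (card P) * r ^ (DIM('a) - 1) \<le> 4 ^ DIM('a) * real DIM('a)"
proof -
  let ?n = "DIM('a)" and ?\<mu> = "measure (lborel :: 'a measure)"
  let ?u = "unit_ball_vol (real ?n)"
  have u: "0 < ?u" by (rule unit_ball_vol_pos) simp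
  have vol: "?\<mu> (ball x s) = ?u * s ^ ?n" if "0 \<le> s" for x s using that by (simp add: content_ball)
  have "disjoint_family_on (\<lambda>p. ball p (r / 2)) P" unfolding disjoint_family_on_def
  proof (intro ballI impI)
    fix x y assume xy: "x \<in> P" "y \<in> P" "x \<noteq> y"
    have False if "z \<in> ball x (r / 2)" "z \<in> ball y (r / 2)" for z
      using sep[OF xy] that dist_triangle[of x y z] by (simp add: dist_commute)
    then show "ball x (r / 2) \<inter> ball y (r / 2) = {}" by blast
  qed
  then have "?\<mu> (\<Union>p\<in>P. ball p (r / 2)) = (\<Sum>p\<in>P. ?\<mu> (ball p (r / 2)))"
    using P(1) emeasure_lborel_ball_finite by (intro measure_finite_Union) (auto simp: less_le)
  also have "\<dots> = real (card P) * (?u * (r / 2) ^ ?n)" using r by (simp add: vol)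
  finally have "real (card P) * (?u * (r / 2) ^ ?n) = ?\<mu> (\<Union>p\<in>P. ball p (r / 2))" ..
  also have "\<dots> \<le> ?\<mu> (ball 0 (1 + r / 2) - ball 0 (1 - r / 2))"
  proof (rule measure_mono_fmeasurable)
    show "(\<Union>p\<in>P. ball p (r / 2)) \<subseteq> ball 0 (1 + r / 2) - ball 0 (1 - r / 2)"
    proof
      fix z assume "z \<in> (\<Union>p\<in>P. ball p (r / 2))"
      then obtain p where p: "p \<in> P" "dist p z < r / 2" by auto
      then have "norm p = 1" using P(2) by auto
      then show "z \<in> ball 0 (1 + r / 2) - ball 0 (1 - r / 2)"
        using p(2) norm_triangle_ineq3[of p z] by (auto simp: dist_norm abs_le_iff)
    qed
    show "(\<Union>p\<in>P. ball p (r / 2)) \<in> sets lborel" by (simp add: open_UN)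
  qed (intro fmeasurable_Diff, auto intro: fmeasurableI emeasure_lborel_ball_finite)
  also have "\<dots> = ?u * ((1 + r / 2) ^ ?n - (1 - r / 2) ^ ?n)"
    using r by (subst measure_Diff) (auto simp: vol emeasure_ball right_diff_distrib)
  also have "(1 + r / 2) ^ ?n - (1 - r / 2) ^ ?n \<le> 2 ^ ?n * (real ?n * (r / 2))"
  proof -
    \<comment> \<open>Division by 2 brings both bases into the unit interval, where taking the power
      has Lipschitz constant \<open>DIM('a)\<close>.\<close>
    have "norm (((1 + r / 2) / 2) ^ ?n - ((1 - r / 2) / 2) ^ ?n) \<le> real ?n * norm ((1 + r / 2) / 2 - (1 - r / 2) / 2)"
      by (rule norm_power_diff) (use r in auto)
    also have "(1 + r / 2) / 2 - (1 - r / 2) / 2 = r / 2" by (simp add: field_simps)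
    finally have "((1 + r / 2) / 2) ^ ?n - ((1 - r / 2) / 2) ^ ?n \<le> real ?n * (r / 2)" using r by simp
    then show ?thesis unfolding power_divide diff_divide_distrib[symmetric] by (simp add: divide_le_eq mult.commute)
  qed
  finally have "?u * (real (card P) * (r / 2) ^ ?n) \<le> ?u * (2 ^ ?n * (real ?n * (r / 2)))" using u by (simp add: mult_ac)
  then have "real (card P) * (r / 2) ^ ?n \<le> 2 ^ ?n * (real ?n * (r / 2))" using u by simp
  moreover have "(r / 2) ^ ?n = r * r ^ (?n - 1) / 2 ^ ?n" by (simp add: power_divide flip: power_Suc)
  ultimately have "r * (real (card P) * r ^ (?n - 1)) \<le> r * (2 ^ ?n * 2 ^ ?n * real ?n / 2)" by (simp add: field_simps)
  then have "real (card P) * r ^ (?n - 1) \<le> 4 ^ ?n * real ?n / 2" using r by (simp flip: power_mult_distrib)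
  moreover have "0 \<le> real (card P) * r ^ (?n - 1)" using r by simp
  ultimately show ?thesis by linarith
qed

text \<open>A maximal \<open>r\<close>-separated subset of the sphere is an \<open>r\<close>-net,
  and the packing estimate bounds its cardinality times \<open>r ^ ?m\<close>. Hence the contents
  are bounded independently of the mesh.\<close>

lemma hausdorff_outer_sphere_finite:
  "hausdorff_outer (DIM('a) - 1) (sphere (0::'a::euclidean_space) 1) < top"
proof -
  let ?m = "DIM('a) - 1" and ?S = "sphere (0::'a) 1"
  define C where "C = 4 ^ DIM('a) * real DIM('a)"
  have "hausdorff_content ?m d ?S \<le> ennreal (C * unit_ball_vol (real ?m))" if d: "0 < d" for d
  proof -
    define r where "r = min 1 (d / 2)"
    have r: "0 < r" "r \<le> 1" "2 * r \<le> d" using d by (auto simp: r_def)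
    define Q where "Q P \<longleftrightarrow> finite P \<and> P \<subseteq> ?S \<and> (\<forall>x\<in>P. \<forall>y\<in>P. x \<noteq> y \<longrightarrow> r \<le> dist x y)" for P
    have C: "real (card P) * r ^ ?m \<le> C" if "Q P" for P
      unfolding C_def by (rule separated_card_le) (use that r in \<open>auto simp: Q_def\<close>)
    have "card P < Suc (nat \<lfloor>C / r ^ ?m\<rfloor>)" if "Q P" for P
    proof -
      have "real (card P) \<le> C / r ^ ?m" using C[OF that] r by (simp add: pos_le_divide_eq)
      then show ?thesis by (simp add: less_Suc_eq_le le_nat_floor)
    qed
    moreover have "Q {}" by (simp add: Q_def)
    ultimately obtain P where P: "Q P" "\<And>P'. Q P' \<Longrightarrow> card P' \<le> card P"
      using ex_has_greatest_nat[of Q "{}" card] by blast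
    have "?S \<subseteq> (\<Union>p\<in>P. cball p r)"
    proof
      fix x assume x: "x \<in> ?S"
      show "x \<in> (\<Union>p\<in>P. cball p r)"
      proof (rule ccontr)
        assume "\<not> ?thesis"
        then have far: "r < dist p x" if "p \<in> P" for p using that by (auto simp: not_le)
        then have "x \<notin> P" using r by fastforce
        moreover have "Q (insert x P)" using P(1) x far by (auto simp: Q_def dist_commute less_imp_le)
        ultimately show False using P(2)[of "insert x P"] P(1) by (simp add: Q_def)
      qed
    qed
    then have "hausdorff_content ?m (2 * r) ?S \<le> ennreal (real (card P) * (unit_ball_vol (real ?m) * (2 * r / 2) ^ ?m))"
      using P(1) r by (intro hausdorff_content_finite_cover[where U = "\<lambda>p. cball p r"]) (auto simp: Q_def)
    also have "real (card P) * (unit_ball_vol (real ?m) * (2 * r / 2) ^ ?m) = real (card P) * r ^ ?m * unit_ball_vol (real ?m)" by simp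
    also have "ennreal \<dots> \<le> ennreal (C * unit_ball_vol (real ?m))"
      using C[OF P(1)] by (intro ennreal_leI mult_right_mono unit_ball_vol_nonneg) auto
    finally show ?thesis using hausdorff_content_antimono[OF r(3)] by (rule order_trans[rotated])
  qed
  then have "hausdorff_outer ?m ?S \<le> ennreal (C * unit_ball_vol (real ?m))"
    unfolding hausdorff_outer_def by (intro SUP_least) auto
  then show ?thesis by (rule order_le_less_trans) simp
qed

text \<open>The cone over a cap of radius \<open>d\<close> lies in a tube of width comparable to
  \<open>d\<close> around the segment from the origin to \<open>a\<close>, so about
  \<open>1 / d\<close> balls of radius \<open>2 * d\<close> cover it.\<close>

lemma cone_measure_cball_le:
  fixes a :: "'a::euclidean_space"
  assumes a: "norm a = 1" and d: "0 < d" "d \<le> 2"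
  shows "emeasure cone_measure (cball a d) \<le> ennreal (real DIM('a) * (5 * 2 ^ DIM('a) * unit_ball_vol (real DIM('a))) * d ^ (DIM('a) - 1))"
proof -
  let ?n = "DIM('a)"
  define N where "N = nat \<lceil>1 / d\<rceil>"
  have N: "1 / d \<le> real N" "real N \<le> 1 / d + 1" "0 < real N" using d by (auto simp: N_def of_nat_ceiling intro: order_trans)
  have sub: "{x \<in> cball 0 1. sgn x \<in> cball a d} \<subseteq> (\<Union>j\<in>{..N}. cball ((real j / real N) *\<^sub>R a) (2 * d))"
  proof
    fix x assume x: "x \<in> {x \<in> cball 0 1. sgn x \<in> cball a d}"
    define j where "j = nat \<lfloor>real N * norm x\<rfloor>"
    have "real N * norm x \<le> real N * 1" using x by (intro mult_left_mono) auto
    then have j: "real j \<le> real N * norm x" "real N * norm x \<le> real j + 1" "j \<le> N" unfolding j_def by (auto simp: nat_le_iff floor_le_iff)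
    have jx: "\<bar>norm x - real j / real N\<bar> \<le> d"
    proof -
      have "real j / real N \<le> norm x" "norm x \<le> (real j + 1) / real N"
        using j N(3) by (simp_all add: pos_divide_le_eq pos_le_divide_eq mult.commute)
      then have "\<bar>norm x - real j / real N\<bar> \<le> 1 / real N" unfolding add_divide_distrib by linarith
      also have "\<dots> \<le> d" using N(1,3) d by (simp add: field_simps)
      finally show ?thesis .
    qed
    have "x - (real j / real N) *\<^sub>R a = norm x *\<^sub>R (sgn x - a) + (norm x - real j / real N) *\<^sub>R a"
      by (simp add: algebra_simps norm_scaleR_sgn)
    then have "norm (x - (real j / real N) *\<^sub>R a) \<le> norm x * norm (sgn x - a) + \<bar>norm x - real j / real N\<bar>"
      using norm_triangle_ineq[of "norm x *\<^sub>R (sgn x - a)" "(norm x - real j / real N) *\<^sub>R a"] a by simp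
    also have "\<dots> \<le> 1 * d + d" using x jx by (intro add_mono mult_mono) (auto simp: dist_norm norm_minus_commute)
    finally have "x \<in> cball ((real j / real N) *\<^sub>R a) (2 * d)" by (simp add: dist_norm norm_minus_commute)
    then show "x \<in> (\<Union>j\<in>{..N}. cball ((real j / real N) *\<^sub>R a) (2 * d))" using j(3) by blast
  qed
  have "emeasure lborel {x \<in> cball 0 1. sgn x \<in> cball a d} \<le> (\<Sum>j\<in>{..N}. emeasure lborel (cball ((real j / real N) *\<^sub>R a) (2 * d)))"
    by (rule order_trans[OF emeasure_mono[OF sub] emeasure_subadditive_finite]) auto
  also have "\<dots> = ennreal (real (N + 1) * (unit_ball_vol (real ?n) * (2 * d) ^ ?n))"
    using d by (simp add: emeasure_cball ennreal_of_nat_eq_real_of_nat ennreal_mult' del: of_nat_Suc)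
  \<comment> \<open>Here \<open>N + 1 \<le> 1 / d + 2 \<le> 5 / d\<close>, the last step by
    \<open>d \<le> 2\<close>.\<close>
  also have "\<dots> \<le> ennreal (5 / d * (unit_ball_vol (real ?n) * (2 * d) ^ ?n))"
    using N d by (intro ennreal_leI mult_right_mono) (auto simp: field_simps)
  also have "5 / d * (unit_ball_vol (real ?n) * (2 * d) ^ ?n) = 5 * 2 ^ ?n * unit_ball_vol (real ?n) * d ^ (?n - 1)"
    using d DIM_positive[where 'a='a] by (cases ?n) (auto simp: power_mult_distrib)
  finally show ?thesis by (subst emeasure_cone_measure) (auto simp: ennreal_mult' mult.assoc intro!: mult_left_mono)
qed

text \<open>The case \<open>diameter U = 0\<close> is included, which is why the ball estimate is needed for all larger radii.\<close>

lemma cone_measure_le_weight: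
  obtains C where "0 < C" "\<And>(a::'a::euclidean_space) U. norm a = 1 \<Longrightarrow> a \<in> U \<Longrightarrow> bounded U \<Longrightarrow> diameter U \<le> 1 \<Longrightarrow>
    emeasure cone_measure (cball a (diameter U)) \<le> ennreal C * hausdorff_weight (DIM('a) - 1) U"
proof -
  let ?m = "DIM('a) - 1"
  define K where "K = real DIM('a) * (5 * 2 ^ DIM('a) * unit_ball_vol (real DIM('a)))"
  define C where "C = K * 2 ^ ?m / unit_ball_vol (real ?m)"
  have u: "0 < unit_ball_vol (real ?m)" by (rule unit_ball_vol_pos) simp
  have "0 < K" unfolding K_def by (intro mult_pos_pos unit_ball_vol_pos) auto
  then have C: "0 < C" using u by (simp add: C_def)
  show thesis
  proof (rule that[OF C])
    fix a :: 'a and U assume a: "norm a = 1" "a \<in> U" and U: "bounded U" "diameter U \<le> 1"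
    have d: "0 \<le> diameter U" by (rule diameter_ge_0[OF U(1)])
    have "emeasure cone_measure (cball a (diameter U)) \<le> ennreal (K * diameter U ^ ?m)"
    proof (rule tendsto_lowerbound[where F = "at_right (diameter U)" and f = "\<lambda>r. ennreal (K * r ^ ?m)"])
      show "((\<lambda>r. ennreal (K * r ^ ?m)) \<longlongrightarrow> ennreal (K * diameter U ^ ?m)) (at_right (diameter U))" by (intro tendsto_intros)
      have "\<forall>\<^sub>F r in at_right (diameter U). r \<in> {diameter U<..<2}" by (rule eventually_at_right_real) (use U in simp)
      then show "\<forall>\<^sub>F r in at_right (diameter U). emeasure cone_measure (cball a (diameter U)) \<le> ennreal (K * r ^ ?m)"
      proof eventually_elim
        case (elim r)
        have "emeasure cone_measure (cball a (diameter U)) \<le> emeasure cone_measure (cball a r)"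
          using elim by (intro emeasure_mono) auto
        also have "\<dots> \<le> ennreal (K * r ^ ?m)" unfolding K_def using elim d by (intro cone_measure_cball_le a) auto
        finally show ?case .
      qed
    qed simp
    also have "K * diameter U ^ ?m = C * (unit_ball_vol (real ?m) * (diameter U / 2) ^ ?m)"
    proof -
      have "K * D = K * P / X * (X * (D / P))" if "X \<noteq> 0" "P \<noteq> 0" for X P D :: real using that by simp
      then show ?thesis unfolding C_def power_divide using u by (metis less_irrefl power_not_zero zero_neq_numeral)
    qed
    also have "ennreal \<dots> = ennreal C * hausdorff_weight ?m U"
      using a(2) C by (auto simp: hausdorff_weight_def ennreal_mult')
    finally show "emeasure cone_measure (cball a (diameter U)) \<le> ennreal C * hausdorff_weight ?m U" .
  qed
qed

text \<open>Mass distribution principle: the cone measure of a small set is at most a constant times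
  its Hausdorff weight, so a cover of too small total weight could not carry the mass of the
  sphere.\<close>

lemma hausdorff_outer_sphere_pos: "0 < hausdorff_outer (DIM('a) - 1) (sphere (0::'a::euclidean_space) 1)"
proof (rule ccontr)
  let ?m = "DIM('a) - 1" and ?S = "sphere (0::'a) 1"
  let ?T = "emeasure (cone_measure :: 'a measure) UNIV"
  obtain C where C: "0 < C" "\<And>(a::'a) U. norm a = 1 \<Longrightarrow> a \<in> U \<Longrightarrow> bounded U \<Longrightarrow> diameter U \<le> 1 \<Longrightarrow>
    emeasure cone_measure (cball a (diameter U)) \<le> ennreal C * hausdorff_weight ?m U"
    by (rule cone_measure_le_weight[where 'a='a]) (rule that)
  have "0 < real DIM('a) * unit_ball_vol (real DIM('a))" by (intro mult_pos_pos unit_ball_vol_pos) auto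
  then have T: "0 < ennreal (real DIM('a) * unit_ball_vol (real DIM('a)) / C)" using C by simp
  assume "\<not> ?thesis"
  then have "hausdorff_outer ?m ?S = 0" by simp
  moreover have "hausdorff_content ?m 1 ?S \<le> hausdorff_outer ?m ?S" unfolding hausdorff_outer_def by (rule SUP_upper) simp
  ultimately have "hausdorff_content ?m 1 ?S < ennreal (real DIM('a) * unit_ball_vol (real DIM('a)) / C)" using T by simp
  then obtain U :: "nat \<Rightarrow> 'a set" where U: "?S \<subseteq> (\<Union>i. U i)" "\<And>i. bounded (U i)" "\<And>i. diameter (U i) \<le> 1"
    and less: "(\<Sum>i. hausdorff_weight ?m (U i)) < ennreal (real DIM('a) * unit_ball_vol (real DIM('a)) / C)"
    unfolding hausdorff_content_def INF_less_iff by auto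
  \<comment> \<open>The covering sets may fail to be measurable. Each one that meets the sphere is
    replaced by a closed ball about one of its points on the sphere; the others are
    discarded.\<close>
  define B where "B i = (if U i \<inter> ?S = {} then {} else cball (SOME a. a \<in> U i \<inter> ?S) (diameter (U i)))" for i
  have B: "U i \<inter> ?S \<subseteq> B i" "emeasure cone_measure (B i) \<le> ennreal C * hausdorff_weight ?m (U i)" "B i \<in> sets borel" for i
  proof -
    have "U i \<inter> ?S \<subseteq> B i \<and> emeasure cone_measure (B i) \<le> ennreal C * hausdorff_weight ?m (U i)"
    proof (cases "U i \<inter> ?S = {}")
      case False
      define a where "a = (SOME a. a \<in> U i \<inter> ?S)"
      have a: "a \<in> U i \<inter> ?S" unfolding a_def using False by (simp only: some_in_eq) simp
      have "U i \<subseteq> cball a (diameter (U i))" using diameter_bounded_bound[OF U(2)[of i]] a by auto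
      then show ?thesis using C(2)[of a "U i"] a U(2,3)[of i] False by (auto simp: B_def a_def)
    qed (auto simp: B_def)
    then show "U i \<inter> ?S \<subseteq> B i" "emeasure cone_measure (B i) \<le> ennreal C * hausdorff_weight ?m (U i)" by auto
    show "B i \<in> sets borel" by (simp add: B_def)
  qed
  have "AE x in cone_measure. x \<in> (\<Union>i. B i)" using AE_cone_measure by eventually_elim (use U(1) B(1) in blast)
  then have "?T \<le> emeasure cone_measure (\<Union>i. B i)" using B(3) by (intro emeasure_mono_AE) (auto elim: eventually_mono)
  also have "\<dots> \<le> (\<Sum>i. emeasure cone_measure (B i))" using B(3) by (intro emeasure_subadditive_countably) auto
  also have "\<dots> \<le> (\<Sum>i. ennreal C * hausdorff_weight ?m (U i))" by (intro suminf_le B) auto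
  also have "\<dots> = ennreal C * (\<Sum>i. hausdorff_weight ?m (U i))" by simp
  also have "\<dots> < ennreal C * ennreal (real DIM('a) * unit_ball_vol (real DIM('a)) / C)"
    using less C(1) by (intro ennreal_mult_strict_left_mono) auto
  also have "\<dots> = ?T" using C(1) by (simp add: emeasure_cone_measure_UNIV ennreal_mult'[symmetric])
  finally show False by simp
qed

lemma hausdorff_outer_isometry:
  fixes f :: "'a::euclidean_space \<Rightarrow> 'b::euclidean_space"
  assumes "\<And>x y. x \<in> A \<Longrightarrow> y \<in> A \<Longrightarrow> dist (f x) (f y) = dist x y"
  shows "hausdorff_outer s (f ` A) = hausdorff_outer s A"
proof (rule antisym)
  show "hausdorff_outer s (f ` A) \<le> hausdorff_outer s A" using hausdorff_outer_Lipschitz[of 1 A f s] assms by simp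
  have inj: "inj_on f A" using assms by (intro inj_onI) (metis dist_eq_0_iff)
  have "hausdorff_outer s (inv_into A f ` f ` A) \<le> hausdorff_outer s (f ` A)"
  proof -
    have "dist (inv_into A f x) (inv_into A f y) \<le> 1 * dist x y" if "x \<in> f ` A" "y \<in> f ` A" for x y
      using that assms inj by auto
    from hausdorff_outer_Lipschitz[of 1, OF _ this, of _ s] show ?thesis by simp
  qed
  then show "hausdorff_outer s A \<le> hausdorff_outer s (f ` A)" using inj by simp
qed

text \<open>Reflections carry any point of the sphere to any other and preserve both measures, so
  caps of equal radius have equal mass. With both total masses finite and positive, the comparison
  of uniformly distributed measures applies.\<close>

lemma hausdorff_sphere_proportional:
  obtains \<kappa> :: real where "0 < \<kappa>"
    "\<And>B :: 'a::euclidean_space set. B \<in> sets borel \<Longrightarrow>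
       hausdorff_outer (DIM('a) - 1) (B \<inter> sphere 0 1) = ennreal \<kappa> * emeasure cone_measure B"
proof -
  let ?m = "DIM('a) - 1" and ?S = "sphere (0::'a) 1"
  let ?H = "hausdorff_outer ?m :: 'a set \<Rightarrow> ennreal"
  let ?C = "cone_measure :: 'a measure"
  define \<sigma> where "\<sigma> = density (hausdorff_measure ?m) (indicator ?S)"
  have S[measurable]: "?S \<in> sets borel" by (simp add: borel_closed)
  have sets_\<sigma>: "sets \<sigma> = sets borel" by (simp add: \<sigma>_def)
  have \<sigma>: "emeasure \<sigma> B = ?H (B \<inter> ?S)" if [measurable]: "B \<in> sets borel" for B
  proof -
    have "emeasure \<sigma> B = (\<integral>\<^sup>+x. indicator (B \<inter> ?S) x \<partial>hausdorff_measure ?m)"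
    proof -
      have "emeasure \<sigma> B = (\<integral>\<^sup>+x. indicator ?S x * indicator B x \<partial>hausdorff_measure ?m)"
        unfolding \<sigma>_def by (rule emeasure_density) auto
      then show ?thesis by (simp only: indicator_inter_arith[symmetric] Int_commute[of ?S])
    qed
    also have "\<dots> = ?H (B \<inter> ?S)"
      by (subst nn_integral_indicator) (auto simp: emeasure_hausdorff_measure)
    finally show ?thesis .
  qed
  have fin: "?H ?S < top" by (rule hausdorff_outer_sphere_finite)
  have fin\<sigma>: "finite_measure \<sigma>" by (rule finite_measureI) (use \<sigma>[of UNIV] fin sets_eq_imp_space_eq[OF sets_\<sigma>] in auto)
  interpret s: finite_measure \<sigma> by (rule fin\<sigma>)
  interpret c: finite_measure ?C by (rule finite_measure_cone_measure)
  have T0: "0 < measure ?C UNIV"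
    unfolding measure_def emeasure_cone_measure_UNIV using unit_ball_vol_pos[of "real DIM('a)"] by simp
  have "0 < ennreal (measure \<sigma> UNIV)"
    using hausdorff_outer_sphere_pos[where 'a='a] \<sigma>[of UNIV] unfolding s.emeasure_eq_measure by simp
  then have H0: "0 < measure \<sigma> UNIV" by simp
  obtain b :: 'a where b: "b \<in> Basis" using nonempty_Basis by blast
  then have nb: "norm b = 1" by simp
  define g where "g r = emeasure \<sigma> (ball b r)" for r
  define h where "h r = emeasure ?C (ball b r)" for r
  have inv: "emeasure \<sigma> (ball x r) = g r" "emeasure ?C (ball x r) = h r" if x: "x \<in> ?S" for x r
  proof -
    obtain f where f: "linear f" "\<And>x. norm (f x) = norm x" "\<And>x. f (f x) = x" "f x = b"
      using reflection_exists[of x b] x nb by auto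
    have d: "dist (f u) (f v) = dist u v" for u v using f by (metis dist_norm linear_diff)
    have fb: "f b = x" using f by metis
    have pre: "f -` ball b r = ball x r" using d[of x] f by auto
    show "emeasure ?C (ball x r) = h r"
      using cone_measure_invariant[OF f(1-3), of "ball b r"] pre by (simp add: h_def)
    have "f ` (ball x r \<inter> ?S) = ball b r \<inter> ?S"
    proof
      show "f ` (ball x r \<inter> ?S) \<subseteq> ball b r \<inter> ?S" using f d[of x] by auto
      show "ball b r \<inter> ?S \<subseteq> f ` (ball x r \<inter> ?S)"
      proof
        fix y assume "y \<in> ball b r \<inter> ?S"
        then have "f y \<in> ball x r \<inter> ?S" using d[of b y] f fb by auto
        then show "y \<in> f ` (ball x r \<inter> ?S)" using f(3)[of y] by (metis imageI)
      qed
    qed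
    then have "?H (ball b r \<inter> ?S) = ?H (ball x r \<inter> ?S)"
      using hausdorff_outer_isometry[of "ball x r \<inter> ?S" f ?m] d by metis
    then show "emeasure \<sigma> (ball x r) = g r" by (simp add: g_def \<sigma>)
  qed
  have null: "emeasure \<sigma> (- ?S) = 0" "emeasure ?C (- ?S) = 0"
  proof -
    show "emeasure \<sigma> (- ?S) = 0" by (subst \<sigma>) (auto simp: hausdorff_outer_empty)
    show "emeasure ?C (- ?S) = 0"
      using AE_cone_measure[where 'a='a] by (subst (asm) AE_iff_measurable[of "- ?S"]) (auto simp: S)
  qed
  have h_fin: "h r < top" for r unfolding h_def by (simp add: less_top[symmetric])
  have g_fin: "g r < top" for r unfolding g_def by (simp add: less_top[symmetric])
  have h_pos: "0 < h r" if "0 < r" for r unfolding h_def using cone_measure_ball_pos[OF nb that] .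
  \<comment> \<open>A null cap would make all caps of this radius null and thus, by compactness, the
    whole sphere.\<close>
  have g_pos: "0 < g r" if r: "0 < r" for r
  proof (rule ccontr)
    assume "\<not> 0 < g r"
    then have z: "g r = 0" by simp
    have "compact ?S" by simp
    then obtain K where K: "finite K" "K \<subseteq> ?S" "?S \<subseteq> (\<Union>x\<in>K. ball x r)"
      using compactE_image[of ?S ?S "\<lambda>x. ball x r"] r by (metis (no_types, lifting) UN_iff centre_in_ball open_ball subsetI)
    have "emeasure \<sigma> ?S \<le> emeasure \<sigma> (\<Union>x\<in>K. ball x r)" using K by (intro emeasure_mono) (auto simp: sets_\<sigma>)
    also have "\<dots> \<le> (\<Sum>x\<in>K. emeasure \<sigma> (ball x r))"
      using K by (intro emeasure_subadditive_finite) (auto simp: sets_\<sigma>)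
    also have "\<dots> = 0" using K(2) inv(1) z by (intro sum.neutral) auto
    finally have "emeasure \<sigma> UNIV = 0" using \<sigma>[of ?S] \<sigma>[of UNIV] S by simp
    then show False using H0 by (simp add: s.emeasure_eq_measure)
  qed
  define \<kappa> where "\<kappa> = measure \<sigma> UNIV / measure ?C UNIV"
  have \<kappa>: "0 < \<kappa>" using T0 H0 by (simp add: \<kappa>_def)
  have "\<sigma> = scale_measure (ennreal \<kappa>) ?C"
  proof (rule measure_eq_on_open)
    fix U :: "'a set" assume "open U"
    then have "measure \<sigma> U = \<kappa> * measure ?C U"
      unfolding \<kappa>_def using sets_\<sigma> fin\<sigma> finite_measure_cone_measure null inv g_pos g_fin h_pos h_fin H0 T0
      by (intro uniformly_distributed_proportional[where S = ?S and g = g and h = h]) auto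
    then show "emeasure \<sigma> U = emeasure (scale_measure (ennreal \<kappa>) ?C) U"
      using \<kappa> by (simp add: s.emeasure_eq_measure c.emeasure_eq_measure ennreal_mult'[symmetric])
  next
    show "emeasure \<sigma> (ball 0 (real k)) < top" for k by (simp add: less_top[symmetric])
  qed (simp_all add: sets_\<sigma>)
  then have "emeasure \<sigma> B = ennreal \<kappa> * emeasure ?C B" for B by simp
  then show thesis using that[OF \<kappa>] \<sigma> by metis
qed

section \<open>Radial graphs\<close>

text \<open>Attached to the type by choice, so that all domains of the space share one
  constant.\<close>

definition hausdorff_ratio :: "'a::euclidean_space itself \<Rightarrow> real" where
  "hausdorff_ratio _ = (SOME \<kappa>. 0 < \<kappa> \<and> (\<forall>B :: 'a set. B \<in> sets borel \<longrightarrow>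
       hausdorff_outer (DIM('a) - 1) (B \<inter> sphere 0 1) = ennreal \<kappa> * emeasure cone_measure B))"

lemma hausdorff_ratio:
  shows "0 < hausdorff_ratio TYPE('a::euclidean_space)"
    and "B \<in> sets borel \<Longrightarrow> hausdorff_outer (DIM('a) - 1) ((B :: 'a set) \<inter> sphere 0 1)
      = ennreal (hausdorff_ratio TYPE('a)) * emeasure cone_measure B"
proof -
  have "\<exists>\<kappa>. 0 < \<kappa> \<and> (\<forall>B :: 'a set. B \<in> sets borel \<longrightarrow>
       hausdorff_outer (DIM('a) - 1) (B \<inter> sphere 0 1) = ennreal \<kappa> * emeasure cone_measure B)"
    using hausdorff_sphere_proportional[where 'a='a] by metis
  from someI_ex[OF this]
  show "0 < hausdorff_ratio TYPE('a)"
    "B \<in> sets borel \<Longrightarrow> hausdorff_outer (DIM('a) - 1) ((B :: 'a set) \<inter> sphere 0 1)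
      = ennreal (hausdorff_ratio TYPE('a)) * emeasure cone_measure B"
    unfolding hausdorff_ratio_def by blast+
qed

text \<open>
  The star-shaped domain \<open>{x. norm x < \<rho> (sgn x)}\<close>, with \<open>\<rho>\<close> a Lipschitz function on the unit sphere.
  Outside the sphere \<open>\<rho>\<close> only has to be measurable; \<open>sgn 0 = 0\<close> makes \<open>\<rho> 0 > 0\<close> the condition that the
  origin belongs to the domain.
\<close>

locale radial_graph =
  fixes D :: "'a::euclidean_space set" and \<rho> :: "'a \<Rightarrow> real" and r0 r1 L :: real and m :: nat and \<kappa> :: real
  assumes m_def: "m = DIM('a) - 1" and \<kappa>_def: "\<kappa> = hausdorff_ratio TYPE('a)"
    and D_eq: "D = {x. norm x < \<rho> (sgn x)}"
    and open_D: "open D"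
    and frontier_D: "frontier D = (\<lambda>n. \<rho> n *\<^sub>R n) ` sphere 0 1"
    and \<rho>_meas [measurable]: "\<rho> \<in> borel_measurable borel"
    and r0_pos: "0 < r0"
    and \<rho>_bounds: "\<And>x. r0 \<le> \<rho> x" "\<And>x. \<rho> x \<le> r1"
    and lip_nonneg: "0 \<le> L"
    and \<rho>_lip: "\<And>n n'. norm n = 1 \<Longrightarrow> norm n' = 1 \<Longrightarrow> \<bar>\<rho> n - \<rho> n'\<bar> \<le> L * dist n n'"
begin

definition graph_map :: "'a \<Rightarrow> 'a" where "graph_map n = \<rho> n *\<^sub>R n"

lemma \<rho>_pos: "0 < \<rho> x" using r0_pos \<rho>_bounds(1)[of x] by simp

text \<open>Law of cosines, split into an angular and a radial part. The Lipschitz bounds for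
  \<open>graph_map\<close> and its inverse are read off from it.\<close>

lemma dist_graph_map:
  assumes "norm n = 1" "norm n' = 1"
  shows "(dist (graph_map n) (graph_map n'))\<^sup>2 = \<rho> n * \<rho> n' * (dist n n')\<^sup>2 + (\<rho> n - \<rho> n')\<^sup>2"
proof -
  have "n \<bullet> n = 1" "n' \<bullet> n' = 1" using assms by (simp_all add: dot_square_norm)
  then show ?thesis
    by (simp add: dist_norm power2_norm_eq_inner graph_map_def inner_diff_left inner_diff_right inner_commute)
       (simp add: power2_eq_square algebra_simps)
qed

lemma sgn_graph_map: "norm n = 1 \<Longrightarrow> sgn (graph_map n) = n"
  using \<rho>_pos[of n] by (simp add: graph_map_def sgn_scaleR sgn_div_norm)

lemma norm_graph_map: "norm n = 1 \<Longrightarrow> norm (graph_map n) = \<rho> n"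
  using \<rho>_pos[of n] by (simp add: graph_map_def)

lemma graph_map_sgn: "x \<in> frontier D \<Longrightarrow> graph_map (sgn x) = x"
  unfolding frontier_D using sgn_graph_map by (auto simp: graph_map_def)

lemma graph_map_meas [measurable]: "graph_map \<in> borel_measurable borel"
  unfolding graph_map_def by measurable

text \<open>Without its radial part the law of cosines makes \<open>sgn\<close> Lipschitz with
  constant \<open>1 / c\<close> on the image; with the radial part bounded by \<open>L\<close>,
  \<open>graph_map\<close> has constant \<open>sqrt (C\<^sup>2 + L\<^sup>2)\<close>. The bounds are
  sharp only if \<open>c\<close> and \<open>C\<close> are close, hence the decomposition into pieces
  below.\<close>

lemma hausdorff_graph_map:
  assumes A: "A \<subseteq> sphere 0 1" and c: "0 < c" "\<And>n. n \<in> A \<Longrightarrow> c \<le> \<rho> n" "\<And>n. n \<in> A \<Longrightarrow> \<rho> n \<le> C"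
  shows "ennreal (c ^ s) * hausdorff_outer s A \<le> hausdorff_outer s (graph_map ` A)"
    and "hausdorff_outer s (graph_map ` A) \<le> ennreal (sqrt (C\<^sup>2 + L\<^sup>2) ^ s) * hausdorff_outer s A"
proof -
  have n1: "norm n = 1" if "n \<in> A" for n using that A by auto
  have "dist (sgn x) (sgn y) \<le> (1 / c) * dist x y" if xy: "x \<in> graph_map ` A" "y \<in> graph_map ` A" for x y
  proof -
    obtain n n' where t: "n \<in> A" "n' \<in> A" "x = graph_map n" "y = graph_map n'" using xy by blast
    have "c * c \<le> \<rho> n * \<rho> n'" using c t by (intro mult_mono) (auto intro: order_trans[OF less_imp_le])
    then have "c * c * (dist n n')\<^sup>2 \<le> \<rho> n * \<rho> n' * (dist n n')\<^sup>2" by (intro mult_right_mono) auto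
    also have "\<dots> \<le> (dist x y)\<^sup>2"
      unfolding t dist_graph_map[OF n1[OF t(1)] n1[OF t(2)]] by simp
    finally have "(c * dist n n')\<^sup>2 \<le> (dist x y)\<^sup>2" by (simp add: power_mult_distrib power2_eq_square[of c])
    then have "c * dist n n' \<le> dist x y" by (rule power2_le_imp_le) simp
    then show ?thesis using t c(1) by (simp add: sgn_graph_map n1 field_simps)
  qed
  then have "hausdorff_outer s (sgn ` graph_map ` A) \<le> ennreal ((1 / c) ^ s) * hausdorff_outer s (graph_map ` A)"
    using c(1) by (intro hausdorff_outer_Lipschitz) auto
  moreover have "sgn ` graph_map ` A = A" using n1 by (force simp: image_image sgn_graph_map)
  ultimately have "ennreal (c ^ s) * hausdorff_outer s A
      \<le> ennreal (c ^ s) * (ennreal ((1 / c) ^ s) * hausdorff_outer s (graph_map ` A))"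
    by (intro mult_left_mono) auto
  then show "ennreal (c ^ s) * hausdorff_outer s A \<le> hausdorff_outer s (graph_map ` A)"
    using c(1) by (simp add: mult.assoc[symmetric] ennreal_mult'[symmetric] power_one_over)
  show "hausdorff_outer s (graph_map ` A) \<le> ennreal (sqrt (C\<^sup>2 + L\<^sup>2) ^ s) * hausdorff_outer s A"
  proof (cases "A = {}")
    case False
    then have "0 < C" using c by (meson all_not_in_conv less_le_trans)
    show ?thesis
    proof (rule hausdorff_outer_Lipschitz)
      show "0 < sqrt (C\<^sup>2 + L\<^sup>2)" using \<open>0 < C\<close> by (simp add: sum_power2_gt_zero_iff)
      fix n n' assume t: "n \<in> A" "n' \<in> A"
      have "\<rho> n * \<rho> n' \<le> C\<^sup>2" unfolding power2_eq_square
        using c t \<rho>_pos \<open>0 < C\<close> by (intro mult_mono) (auto intro: less_imp_le)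
      moreover have "(\<rho> n - \<rho> n')\<^sup>2 \<le> (L * dist n n')\<^sup>2"
        using \<rho>_lip[OF n1[OF t(1)] n1[OF t(2)]] lip_nonneg by (intro power2_le_iff_abs_le[THEN iffD2]) auto
      ultimately have "(dist (graph_map n) (graph_map n'))\<^sup>2 \<le> C\<^sup>2 * (dist n n')\<^sup>2 + (L * dist n n')\<^sup>2"
        using dist_graph_map[OF n1[OF t(1)] n1[OF t(2)]] by (simp add: add_mono mult_right_mono)
      also have "\<dots> = (sqrt (C\<^sup>2 + L\<^sup>2) * dist n n')\<^sup>2"
        by (simp add: power_mult_distrib algebra_simps)
      finally show "dist (graph_map n) (graph_map n') \<le> sqrt (C\<^sup>2 + L\<^sup>2) * dist n n'" by (rule power2_le_imp_le) simp
    qed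
  qed (simp add: hausdorff_outer_empty)
qed

end

text \<open>Countable additivity over the level sets of \<open>k\<close>. It reduces a comparison of
  measures to pieces on which a density is nearly constant.\<close>

lemma emeasure_le_pieces:
  fixes M N :: "'a::topological_space measure" and k :: "'a \<Rightarrow> nat"
  assumes sets: "sets M = sets borel" "sets N = sets borel"
    and k[measurable]: "k \<in> measurable borel (count_space UNIV)"
    and pieces: "\<And>j B. B \<in> sets borel \<Longrightarrow> B \<subseteq> k -` {j} \<Longrightarrow> emeasure M B \<le> c * emeasure N B"
    and B: "B \<in> sets borel"
  shows "emeasure M B \<le> c * emeasure N B"
proof -
  define P where "P j = B \<inter> k -` {j}" for j
  have kj: "k -` {j} \<in> sets borel" for j using measurable_sets[OF k, of "{j}"] by simp
  have P: "P j \<in> sets borel" for j using B kj by (auto simp: P_def)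
  have U: "(\<Union>j. P j) = B" by (auto simp: P_def)
  have dj: "disjoint_family P" by (auto simp: disjoint_family_on_def P_def)
  have "emeasure M B = (\<Sum>j. emeasure M (P j))"
    using suminf_emeasure[of P M] P dj U sets by (simp add: image_subset_iff)
  also have "\<dots> \<le> (\<Sum>j. c * emeasure N (P j))"
    using P by (intro suminf_le pieces) (auto simp: P_def)
  also have "\<dots> = c * (\<Sum>j. emeasure N (P j))" by simp
  also have "(\<Sum>j. emeasure N (P j)) = emeasure N B"
    using suminf_emeasure[of P N] P dj U sets by (simp add: image_subset_iff)
  finally show ?thesis .
qed

context radial_graph
begin

lemma \<kappa>_pos: "0 < \<kappa>" unfolding \<kappa>_def by (rule hausdorff_ratio)

lemma space_surface_measure: "space (surface_measure D) = frontier D"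
  unfolding surface_measure_def by (simp add: space_restrict_space)

text \<open>Surface measure transported to the unit sphere by radial projection, where it can be
  compared with \<open>cone_measure\<close>.\<close>

definition spherical :: "'a measure" where
  "spherical = distr (surface_measure D) borel sgn"

lemma sgn_measurable_surface [measurable]: "sgn \<in> measurable (surface_measure D) borel"
  unfolding surface_measure_def by (intro measurable_restrict_space1) simp

lemma sets_spherical [simp, measurable_cong]: "sets spherical = sets borel"
  by (simp add: spherical_def)

lemma emeasure_spherical:
  assumes B: "B \<in> sets borel"
  shows "emeasure spherical B = hausdorff_outer m (graph_map ` (B \<inter> sphere 0 1))"
proof -
  have [measurable]: "frontier D \<in> sets borel" by (simp add: borel_closed)
  have sB: "sgn -` B \<in> sets borel" using measurable_sets[OF borel_measurable_sgn B] by simp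
  have eq: "sgn -` B \<inter> frontier D = graph_map ` (B \<inter> sphere 0 1)"
  proof
    show "graph_map ` (B \<inter> sphere 0 1) \<subseteq> sgn -` B \<inter> frontier D"
      using sgn_graph_map by (auto simp: frontier_D graph_map_def)
    show "sgn -` B \<inter> frontier D \<subseteq> graph_map ` (B \<inter> sphere 0 1)"
    proof
      fix x assume x: "x \<in> sgn -` B \<inter> frontier D"
      then obtain n where n: "norm n = 1" "x = graph_map n" by (auto simp: frontier_D graph_map_def)
      then have "n \<in> B" using x sgn_graph_map by auto
      then show "x \<in> graph_map ` (B \<inter> sphere 0 1)" using n by auto
    qed
  qed
  have "emeasure spherical B = emeasure (surface_measure D) (sgn -` B \<inter> frontier D)"
    unfolding spherical_def using B by (simp add: emeasure_distr space_surface_measure)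
  also have "\<dots> = emeasure (hausdorff_measure m) (sgn -` B \<inter> frontier D)"
    unfolding surface_measure_def m_def by (subst emeasure_restrict_space) auto
  also have "\<dots> = hausdorff_outer m (sgn -` B \<inter> frontier D)"
    using sB by (subst emeasure_hausdorff_measure) auto
  finally show ?thesis by (simp add: eq)
qed

lemma nn_integral_surface:
  assumes [measurable]: "f \<in> borel_measurable borel"
  shows "(\<integral>\<^sup>+x. f x \<partial>surface_measure D) = (\<integral>\<^sup>+n. f (graph_map n) \<partial>spherical)"
proof -
  have "(\<integral>\<^sup>+n. f (graph_map n) \<partial>spherical) = (\<integral>\<^sup>+x. f (graph_map (sgn x)) \<partial>surface_measure D)"
    unfolding spherical_def by (subst nn_integral_distr) auto
  also have "\<dots> = (\<integral>\<^sup>+x. f x \<partial>surface_measure D)"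
    by (intro nn_integral_cong) (simp add: graph_map_sgn space_surface_measure)
  finally show ?thesis by simp
qed

lemma emeasure_density_cone:
  assumes [measurable]: "g \<in> borel_measurable borel" "B \<in> sets borel"
  shows "\<And>c. (\<And>n. n \<in> B \<Longrightarrow> norm n = 1 \<Longrightarrow> c \<le> g n) \<Longrightarrow> ennreal c * emeasure cone_measure B
      \<le> emeasure (density cone_measure (\<lambda>n. ennreal (g n))) (B :: 'a set)"
    and "\<And>c. (\<And>n. n \<in> B \<Longrightarrow> norm n = 1 \<Longrightarrow> g n \<le> c) \<Longrightarrow>
      emeasure (density cone_measure (\<lambda>n. ennreal (g n))) (B :: 'a set) \<le> ennreal c * emeasure cone_measure B"
proof -
  let ?D = "density cone_measure (\<lambda>n. ennreal (g n))"
  have e: "emeasure ?D B = (\<integral>\<^sup>+n. ennreal (g n) * indicator B n \<partial>cone_measure)" by (rule emeasure_density) auto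
  have c: "ennreal c * emeasure cone_measure B = (\<integral>\<^sup>+n. ennreal c * indicator B n \<partial>cone_measure)" for c
    by (rule nn_integral_cmult_indicator[symmetric]) simp
  show "ennreal c * emeasure cone_measure B \<le> emeasure ?D B" if "\<And>n. n \<in> B \<Longrightarrow> norm n = 1 \<Longrightarrow> c \<le> g n" for c unfolding e c
    by (rule nn_integral_mono_AE) (use AE_cone_measure in eventually_elim, auto simp: that indicator_def intro: ennreal_leI)
  show "emeasure ?D B \<le> ennreal c * emeasure cone_measure B" if "\<And>n. n \<in> B \<Longrightarrow> norm n = 1 \<Longrightarrow> g n \<le> c" for c unfolding e c
    by (rule nn_integral_mono_AE) (use AE_cone_measure in eventually_elim, auto simp: that indicator_def intro: ennreal_leI)
qed

text \<open>Both bounds hold up to a factor \<open>(1 + d / r0) ^ m\<close> on the sets where \<open>\<rho>\<close> varies by less than \<open>d\<close>.\<close>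

lemma spherical_bounds:
  assumes B[measurable]: "B \<in> sets borel"
  shows "emeasure (density cone_measure (\<lambda>n. ennreal (\<kappa> * \<rho> n ^ m))) B \<le> emeasure spherical B"
    and "emeasure spherical B \<le> emeasure (density cone_measure (\<lambda>n. ennreal (\<kappa> * sqrt ((\<rho> n)\<^sup>2 + L\<^sup>2) ^ m))) B"
proof -
  let ?q = "\<lambda>d. (1 + d / r0) ^ m"
  let ?L = "density cone_measure (\<lambda>n. ennreal (\<kappa> * \<rho> n ^ m))"
    and ?U = "density cone_measure (\<lambda>n. ennreal (\<kappa> * sqrt ((\<rho> n)\<^sup>2 + L\<^sup>2) ^ m))"
  note \<kappa> = \<kappa>_pos
  have S: "sphere 0 1 \<in> sets (borel :: 'a measure)" by (simp add: borel_closed)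
  have both: "emeasure ?L B \<le> ennreal (?q d) * emeasure spherical B
      \<and> emeasure spherical B \<le> ennreal (?q d) * emeasure ?U B" if d: "0 < d" for d
  proof -
    \<comment> \<open>Numbers the level strips of \<open>\<rho>\<close> of width \<open>d\<close>,
      counted from the lower bound \<open>r0\<close>, so that the argument of \<open>nat\<close> is
      nonnegative.\<close>
    define k where "k n = nat \<lfloor>(\<rho> n - r0) / d\<rfloor>" for n
    have k: "k \<in> measurable borel (count_space UNIV)" unfolding k_def by measurable
    have piece: "emeasure ?L A \<le> ennreal (?q d) * emeasure spherical A
        \<and> emeasure spherical A \<le> ennreal (?q d) * emeasure ?U A"
      if A[measurable]: "A \<in> sets borel" and Aj: "A \<subseteq> k -` {j}" for A j
    proof -
      define c where "c = r0 + real j * d"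
      have c: "r0 \<le> c" "0 < c" using r0_pos d by (auto simp: c_def add_pos_nonneg)
      have cb: "c \<le> \<rho> n \<and> \<rho> n \<le> c + d" if "n \<in> A" for n
      proof -
        have nn: "0 \<le> (\<rho> n - r0) / d" using \<rho>_bounds(1)[of n] d by simp
        have "int j = \<lfloor>(\<rho> n - r0) / d\<rfloor>" using that Aj nn by (auto simp: k_def)
        then have "real j \<le> (\<rho> n - r0) / d" "(\<rho> n - r0) / d \<le> real j + 1" by linarith+
        then show ?thesis using d by (auto simp: c_def field_simps)
      qed
      \<comment> \<open>Turns the absolute variation \<open>d\<close> on a strip into a relative
        one, as \<open>r0 \<le> c\<close>.\<close>
      have q: "c + d \<le> (1 + d / r0) * c"
        using c r0_pos d mult_left_mono[OF c(1), of "d / r0"] by (simp add: algebra_simps)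
      have q1: "1 \<le> 1 + d / r0" using d r0_pos by simp
      let ?A = "A \<inter> sphere 0 1"
      have cb': "c \<le> \<rho> n" "\<rho> n \<le> c + d" if "n \<in> ?A" for n using cb[of n] that by auto
      have A1: "?A \<subseteq> sphere 0 1" by auto
      have HA: "hausdorff_outer m ?A = ennreal \<kappa> * emeasure cone_measure A"
        unfolding m_def \<kappa>_def by (rule hausdorff_ratio(2)[OF A])
      have "emeasure ?L A \<le> ennreal (\<kappa> * (c + d) ^ m) * emeasure cone_measure A"
      proof (rule emeasure_density_cone(2))
        fix n assume "n \<in> A"
        then have "\<rho> n ^ m \<le> (c + d) ^ m" using cb \<rho>_pos[of n] by (intro power_mono) auto
        then show "\<kappa> * \<rho> n ^ m \<le> \<kappa> * (c + d) ^ m" using \<kappa> by (intro mult_left_mono) auto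
      qed auto
      also have "\<dots> \<le> ennreal (?q d * c ^ m * \<kappa>) * emeasure cone_measure A"
      proof (intro mult_right_mono ennreal_leI)
        have "(c + d) ^ m \<le> ((1 + d / r0) * c) ^ m" using q c d by (intro power_mono) auto
        then show "\<kappa> * (c + d) ^ m \<le> ?q d * c ^ m * \<kappa>"
          using \<kappa> mult_left_mono[of "(c + d) ^ m" _ \<kappa>] by (simp add: power_mult_distrib mult_ac)
      qed simp
      also have "\<dots> = ennreal (?q d) * (ennreal (c ^ m) * hausdorff_outer m ?A)"
        using c q1 \<kappa> by (simp add: HA ennreal_mult'[symmetric] mult.assoc[symmetric])
      also have "\<dots> \<le> ennreal (?q d) * hausdorff_outer m (graph_map ` ?A)"
        by (intro mult_left_mono hausdorff_graph_map[OF A1 c(2) cb']) auto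
      finally have lo: "emeasure ?L A \<le> ennreal (?q d) * emeasure spherical A" by (simp add: emeasure_spherical)
      have "emeasure spherical A \<le> ennreal (sqrt ((c + d)\<^sup>2 + L\<^sup>2) ^ m) * hausdorff_outer m ?A"
        unfolding emeasure_spherical[OF A] by (rule hausdorff_graph_map[OF A1 c(2) cb'])
      also have "\<dots> = ennreal (sqrt ((c + d)\<^sup>2 + L\<^sup>2) ^ m * \<kappa>) * emeasure cone_measure A"
        using \<kappa> by (simp add: HA ennreal_mult'[symmetric] mult.assoc[symmetric])
      also have "\<dots> \<le> ennreal (?q d * (\<kappa> * sqrt (c\<^sup>2 + L\<^sup>2) ^ m)) * emeasure cone_measure A"
      proof (intro mult_right_mono ennreal_leI)
        have "(c + d)\<^sup>2 \<le> ((1 + d / r0) * c)\<^sup>2" using q c d by (intro power_mono) auto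
        moreover have "L\<^sup>2 \<le> ((1 + d / r0) * L)\<^sup>2"
          using q1 lip_nonneg mult_right_mono[OF q1 lip_nonneg] by (intro power_mono) auto
        ultimately have "sqrt ((c + d)\<^sup>2 + L\<^sup>2) \<le> sqrt ((1 + d / r0)\<^sup>2 * (c\<^sup>2 + L\<^sup>2))"
          unfolding distrib_left power_mult_distrib by (intro real_sqrt_le_mono add_mono)
        also have "\<dots> = (1 + d / r0) * sqrt (c\<^sup>2 + L\<^sup>2)"
          using q1 by (simp add: real_sqrt_mult)
        finally have "sqrt ((c + d)\<^sup>2 + L\<^sup>2) ^ m \<le> ((1 + d / r0) * sqrt (c\<^sup>2 + L\<^sup>2)) ^ m" by (intro power_mono) auto
        then show "sqrt ((c + d)\<^sup>2 + L\<^sup>2) ^ m * \<kappa> \<le> ?q d * (\<kappa> * sqrt (c\<^sup>2 + L\<^sup>2) ^ m)"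
          using \<kappa> mult_right_mono[of "sqrt ((c + d)\<^sup>2 + L\<^sup>2) ^ m" _ \<kappa>] by (simp add: power_mult_distrib mult_ac)
      qed simp
      also have "\<dots> = ennreal (?q d) * (ennreal (\<kappa> * sqrt (c\<^sup>2 + L\<^sup>2) ^ m) * emeasure cone_measure A)"
        using q1 by (simp add: ennreal_mult' mult.assoc)
      also have "\<dots> \<le> ennreal (?q d) * emeasure ?U A"
      proof (rule mult_left_mono[OF emeasure_density_cone(1)])
        fix n assume "n \<in> A"
        then have "c\<^sup>2 \<le> (\<rho> n)\<^sup>2" using cb c by (intro power_mono) auto
        then show "\<kappa> * sqrt (c\<^sup>2 + L\<^sup>2) ^ m \<le> \<kappa> * sqrt ((\<rho> n)\<^sup>2 + L\<^sup>2) ^ m"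
          using \<kappa> by (intro mult_left_mono power_mono real_sqrt_le_mono) auto
      qed auto
      finally show ?thesis using lo by simp
    qed
    show ?thesis
    proof
      show "emeasure ?L B \<le> ennreal (?q d) * emeasure spherical B"
        by (rule emeasure_le_pieces[OF _ _ k _ B]) (use piece in auto)
      show "emeasure spherical B \<le> ennreal (?q d) * emeasure ?U B"
        by (rule emeasure_le_pieces[OF _ _ k _ B]) (use piece in auto)
    qed
  qed
  have lim: "((\<lambda>d. ennreal (?q d) * X) \<longlongrightarrow> ennreal ((1 + 0 / r0) ^ m) * X) (at_right 0)" for X :: ennreal
    by (intro tendsto_mult_ennreal tendsto_ennrealI tendsto_intros) (use r0_pos in auto)
  have ev: "\<forall>\<^sub>F d in at_right (0::real). 0 < d" by (rule eventually_at_right_less)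
  have "emeasure ?L B \<le> ennreal ((1 + 0 / r0) ^ m) * emeasure spherical B"
    using both by (intro tendsto_lowerbound[OF lim] eventually_mono[OF ev]) auto
  then show "emeasure ?L B \<le> emeasure spherical B" by simp
  have "emeasure spherical B \<le> ennreal ((1 + 0 / r0) ^ m) * emeasure ?U B"
    using both by (intro tendsto_lowerbound[OF lim] eventually_mono[OF ev]) auto
  then show "emeasure spherical B \<le> emeasure ?U B" by simp
qed

text \<open>Up to the factor \<kappa>, and for \<open>m > 0\<close>, the exact density is
  \<open>\<rho> ^ (m - 1)\<close> times the root of \<open>\<rho>\<^sup>2\<close> plus the squared
  tangential gradient. This lower bound drops the gradient, the upper bound that follows puts
  \<open>L\<close> in its place. They differ by O(L^2), so nothing of first order in t is lost when
  L = O(t).\<close>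

lemma nn_integral_surface_ge:
  assumes [measurable]: "f \<in> borel_measurable borel"
  shows "(\<integral>\<^sup>+n. ennreal (\<kappa> * \<rho> n ^ m) * f (graph_map n) \<partial>cone_measure) \<le> (\<integral>\<^sup>+x. f x \<partial>surface_measure D)"
proof -
  have "(\<integral>\<^sup>+n. ennreal (\<kappa> * \<rho> n ^ m) * f (graph_map n) \<partial>cone_measure)
      = (\<integral>\<^sup>+n. f (graph_map n) \<partial>density cone_measure (\<lambda>n. ennreal (\<kappa> * \<rho> n ^ m)))"
    by (subst nn_integral_density) auto
  also have "\<dots> \<le> (\<integral>\<^sup>+n. f (graph_map n) \<partial>spherical)"
    by (rule nn_integral_mono_measure) (auto simp: le_measure spherical_bounds)
  finally show ?thesis by (simp add: nn_integral_surface)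
qed

lemma nn_integral_surface_le:
  assumes [measurable]: "f \<in> borel_measurable borel"
  shows "(\<integral>\<^sup>+x. f x \<partial>surface_measure D)
    \<le> (\<integral>\<^sup>+n. ennreal (\<kappa> * sqrt ((\<rho> n)\<^sup>2 + L\<^sup>2) ^ m) * f (graph_map n) \<partial>cone_measure)"
proof -
  have "(\<integral>\<^sup>+n. ennreal (\<kappa> * sqrt ((\<rho> n)\<^sup>2 + L\<^sup>2) ^ m) * f (graph_map n) \<partial>cone_measure)
      = (\<integral>\<^sup>+n. f (graph_map n) \<partial>density cone_measure (\<lambda>n. ennreal (\<kappa> * sqrt ((\<rho> n)\<^sup>2 + L\<^sup>2) ^ m)))"
    by (subst nn_integral_density) auto
  also have "\<dots> \<ge> (\<integral>\<^sup>+n. f (graph_map n) \<partial>spherical)"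
    by (rule nn_integral_mono_measure) (auto simp: le_measure spherical_bounds)
  finally show ?thesis by (simp add: nn_integral_surface)
qed

end

section \<open>The radial profile\<close>

text \<open>
  For a radial positive solution \<open>u\<close> of the \<open>p\<close>-Laplace eigenvalue equation with eigenvalue \<open>1\<close>, the
  function \<open>h = - \<bar>u'\<bar> ^ (p - 2) u' / u ^ (p - 1)\<close> solves the Riccati equation
  \<open>h' = 1 - (n - 1) h / r + (p - 1) h powr (p / (p - 1))\<close> with \<open>h 0 = 0\<close>.  The monotone iteration below
  converges to the minimal solution of the equivalent integral equation, on the interval where it is bounded.
\<close>

locale riccati =
  fixes p :: real and n :: nat
  assumes p: "1 < p" and n: "0 < n"
begin

definition rhs :: "real \<Rightarrow> real" where "rhs y = 1 + (p - 1) * y powr (p / (p - 1))"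

lemma rhs_mono: "0 \<le> x \<Longrightarrow> x \<le> y \<Longrightarrow> rhs x \<le> rhs y"
  using p by (auto simp: rhs_def intro!: mult_left_mono powr_mono2)

lemma rhs_ge_1: "1 \<le> rhs y"
  using p by (simp add: rhs_def)

lemma continuous_on_rhs:
  assumes "continuous_on S f" "\<And>x. x \<in> S \<Longrightarrow> 0 \<le> f x"
  shows "continuous_on S (\<lambda>x. rhs (f x))"
  unfolding rhs_def using assms p by (intro continuous_intros continuous_on_powr') auto

text \<open>Picard iteration for the integrated equation, in which \<open>r ^ (n - 1) * H r\<close>
  is the integral of \<open>s ^ (n - 1) * rhs (H s)\<close> over \<open>{0..r}\<close>. The
  substitution \<open>s = r * t\<close> removes the singular term \<open>H / r\<close> at the origin
  and makes monotonicity in \<open>r\<close> visible.\<close>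

primrec it :: "nat \<Rightarrow> real \<Rightarrow> real" where
  "it 0 r = 0"
| "it (Suc k) r = r * integral {0..1} (\<lambda>t. t ^ (n - 1) * rhs (it k (r * t)))"

lemma it_props:
  shows it_cont: "continuous_on {0..} (it k)"
    and it_nonneg: "0 \<le> r \<Longrightarrow> 0 \<le> it k r"
proof -
  have "continuous_on {0..} (it k) \<and> (\<forall>r\<ge>0. 0 \<le> it k r)"
  proof (induction k)
    case (Suc k)
    then have IH: "continuous_on {0..} (it k)" "\<And>r. r \<ge> 0 \<Longrightarrow> 0 \<le> it k r" by auto
    have c: "continuous_on ({0..} \<times> {0..1}) (\<lambda>(r, t). t ^ (n - 1) * rhs (it k (r * t)))" unfolding case_prod_unfold
      by (intro continuous_intros continuous_on_rhs continuous_on_compose2[OF IH(1)]) (auto intro: IH)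
    then have "continuous_on {0..} (\<lambda>r. integral (cbox 0 1) (\<lambda>t. t ^ (n - 1) * rhs (it k (r * t))))"
      by (intro integral_continuous_on_param) simp
    then have "continuous_on {0..} (it (Suc k))" unfolding it.simps by (intro continuous_intros) simp
    moreover have "0 \<le> it (Suc k) r" if r: "0 \<le> r" for r
    proof -
      have "continuous_on {0..1} (\<lambda>t. t ^ (n - 1) * rhs (it k (r * t)))"
        by (intro continuous_intros continuous_on_rhs continuous_on_compose2[OF IH(1)]) (use r in \<open>auto intro: IH\<close>)
      then have "0 \<le> integral {0..1} (\<lambda>t. t ^ (n - 1) * rhs (it k (r * t)))"
        using order_trans[OF zero_le_one rhs_ge_1] by (intro integral_nonneg integrable_continuous_interval) auto
      then show ?thesis using r by simp
    qed
    ultimately show ?case by blast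
  qed simp
  then show "continuous_on {0..} (it k)" "0 \<le> r \<Longrightarrow> 0 \<le> it k r" by auto
qed

lemma it_integrand_cont:
  "0 \<le> r \<Longrightarrow> continuous_on {0..1} (\<lambda>t. t ^ (n - 1) * rhs (it k (r * t)))"
  by (intro continuous_intros continuous_on_rhs continuous_on_compose2[OF it_cont]) (auto intro: it_nonneg)

lemma it_integrand_cont': "continuous_on {0..r} (\<lambda>s. s ^ (n - 1) * rhs (it k s))"
  by (intro continuous_intros continuous_on_rhs continuous_on_subset[OF it_cont]) (auto intro: it_nonneg)

lemma it_mono: "0 \<le> r \<Longrightarrow> r \<le> s \<Longrightarrow> it k r \<le> it k s"
proof (induction k arbitrary: r s)
  case (Suc k)
  have "integral {0..1} (\<lambda>t. t ^ (n - 1) * rhs (it k (r * t))) \<le> integral {0..1} (\<lambda>t. t ^ (n - 1) * rhs (it k (s * t)))"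
    using Suc.prems by (intro integral_le integrable_continuous_interval it_integrand_cont)
       (auto intro!: mult_left_mono rhs_mono it_nonneg Suc.IH mult_right_mono)
  moreover have "0 \<le> integral {0..1} (\<lambda>t. t ^ (n - 1) * rhs (it k (r * t)))"
    using Suc.prems order_trans[OF zero_le_one rhs_ge_1]
    by (intro integral_nonneg integrable_continuous_interval it_integrand_cont) auto
  ultimately show ?case using Suc.prems by (auto intro!: mult_mono)
qed simp

lemma it_incseq: "0 \<le> r \<Longrightarrow> it k r \<le> it (Suc k) r"
proof (induction k arbitrary: r)
  case 0
  then show ?case using it_nonneg[of r "Suc 0"] by simp
next
  case (Suc k)
  show ?case unfolding it.simps(2)[of "Suc k" r] it.simps(2)[of k r] using Suc.prems
    by (intro mult_left_mono integral_le integrable_continuous_interval it_integrand_cont)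
       (auto intro!: mult_left_mono rhs_mono it_nonneg Suc.IH simp del: it.simps)
qed

lemma it_integral_eq:
  assumes r: "0 \<le> r"
  shows "r ^ (n - 1) * it (Suc k) r = integral {0..r} (\<lambda>s. s ^ (n - 1) * rhs (it k s))"
proof (cases "r = 0")
  case False
  then have r: "0 < r" using assms by simp
  let ?F = "\<lambda>s. s ^ (n - 1) * rhs (it k s)"
  have "(?F has_integral integral {0..r} ?F) {0..r}"
    by (intro integrable_integral integrable_continuous_interval it_integrand_cont')
  then have "((\<lambda>t. ?F (r * t)) has_integral (1 / \<bar>r\<bar>) * integral {0..r} ?F) ((\<lambda>x. x / r) ` {0..r})"
    using r has_integral_stretch_real[of ?F "integral {0..r} ?F" 0 r r] by simp
  moreover have "(\<lambda>x. x / r) ` {0..r} = {0..1}" using r by (subst image_divide_atLeastAtMost) auto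
  ultimately have "integral {0..1} (\<lambda>t. ?F (r * t)) = (1 / r) * integral {0..r} ?F"
    using r by (simp add: integral_unique)
  moreover have "integral {0..1} (\<lambda>t. ?F (r * t)) = r ^ (n - 1) * integral {0..1} (\<lambda>t. t ^ (n - 1) * rhs (it k (r * t)))"
    by (simp add: power_mult_distrib mult.assoc)
  ultimately show ?thesis using r by (simp add: field_simps)
qed simp

text \<open>The interval on which the iteration stays finite; outside it the supremum in
  \<open>H\<close> carries no meaning.\<close>

definition bdd :: "real \<Rightarrow> bool" where "bdd r \<longleftrightarrow> 0 \<le> r \<and> bdd_above (range (\<lambda>k. it k r))"

definition H :: "real \<Rightarrow> real" where "H r = (SUP k. it k r)"

lemma it_le_H: "bdd r \<Longrightarrow> it k r \<le> H r"
  unfolding H_def bdd_def by (intro cSUP_upper) auto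

lemma bddI: "0 \<le> r \<Longrightarrow> (\<And>k. it k r \<le> M) \<Longrightarrow> bdd r"
  unfolding bdd_def by (auto intro: bdd_aboveI[of _ M])

lemma H_leI: "(\<And>k. it k r \<le> M) \<Longrightarrow> H r \<le> M"
  unfolding H_def by (rule cSUP_least) auto

lemma bdd_mono: "bdd r \<Longrightarrow> 0 \<le> s \<Longrightarrow> s \<le> r \<Longrightarrow> bdd s"
  using it_mono[of s r] it_le_H[of r] by (intro bddI[of s "H r"]) (auto intro: order_trans)

lemma H_mono: "bdd r \<Longrightarrow> 0 \<le> s \<Longrightarrow> s \<le> r \<Longrightarrow> H s \<le> H r"
  using it_mono[of s r] it_le_H[of r] by (intro H_leI) (auto intro: order_trans)

lemma H_nonneg: "bdd r \<Longrightarrow> 0 \<le> H r"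
  using it_le_H[of r 0] by simp

lemma it_LIMSEQ: assumes "bdd r" shows "(\<lambda>k. it k r) \<longlonglongrightarrow> H r"
  unfolding H_def using assms
  by (intro LIMSEQ_incseq_SUP) (auto simp: bdd_def intro!: incseq_SucI it_incseq simp del: it.simps)

text \<open>The quotient of \<open>it k r\<close> by \<open>r\<close> is an integral whose integrand
  increases with \<open>r\<close>. In the limit this yields that the slope of \<open>H\<close> is at
  least \<open>H r / r\<close>, the source of its strict monotonicity.\<close>

lemma it_ratio: "0 \<le> r \<Longrightarrow> r \<le> s \<Longrightarrow> s * it k r \<le> r * it k s"
proof (cases k)
  case (Suc j)
  assume rs: "0 \<le> r" "r \<le> s"
  have "integral {0..1} (\<lambda>t. t ^ (n - 1) * rhs (it j (r * t))) \<le> integral {0..1} (\<lambda>t. t ^ (n - 1) * rhs (it j (s * t)))"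
    using rs by (intro integral_le integrable_continuous_interval it_integrand_cont)
       (auto intro!: mult_left_mono rhs_mono it_nonneg it_mono mult_right_mono)
  from mult_left_mono[OF this, of "r * s"] show ?thesis using rs by (simp add: Suc mult_ac)
qed simp

lemma H_ratio: "bdd s \<Longrightarrow> 0 \<le> r \<Longrightarrow> r \<le> s \<Longrightarrow> s * H r \<le> r * H s"
  using it_ratio[of r s]
  by (intro LIMSEQ_le[OF tendsto_mult_left[OF it_LIMSEQ] tendsto_mult_left[OF it_LIMSEQ]]) (auto intro: bdd_mono)

text \<open>The first iterate is already \<open>r / real n\<close>. The bound makes \<open>H\<close>
  positive and keeps the parameter in the shooting argument bounded.\<close>

lemma H_ge: assumes "bdd r" shows "r / real n \<le> H r"
proof -
  have r: "0 \<le> r" using assms by (simp add: bdd_def)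
  have "((\<lambda>t. t ^ (n - 1)) has_integral (1 ^ n / real n - 0 ^ n / real n)) {0..1::real}"
    using n by (intro fundamental_theorem_of_calculus)
      (auto intro!: derivative_eq_intros simp: has_real_derivative_iff_has_vector_derivative[symmetric])
  then have "integral {0..1} (\<lambda>t::real. t ^ (n - 1)) = 1 / real n" using n by (simp add: integral_unique zero_power)
  then have "r / real n = r * integral {0..1} (\<lambda>t. t ^ (n - 1))" by simp
  also have "\<dots> = it (Suc 0) r"
    using p by (simp add: rhs_def)
  finally show ?thesis using it_le_H[OF assms, of "Suc 0"] by simp
qed

lemma H_integral_eq:
  assumes "bdd r"
  shows "(\<lambda>s. s ^ (n - 1) * rhs (H s)) integrable_on {0..r}"
    and "r ^ (n - 1) * H r = integral {0..r} (\<lambda>s. s ^ (n - 1) * rhs (H s))"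
proof -
  let ?h = "\<lambda>s. s ^ (n - 1) * rhs (H s)"
  have r: "0 \<le> r" using assms by (simp add: bdd_def)
  let ?f = "\<lambda>k s. s ^ (n - 1) * rhs (it k s)"
  have "?h integrable_on {0..r} \<and>
      (\<lambda>k. integral {0..r} (?f k)) \<longlonglongrightarrow> integral {0..r} ?h"
  proof (rule monotone_convergence_increasing)
    show "?f k integrable_on {0..r}" for k by (intro integrable_continuous_interval it_integrand_cont')
    show "?f k s \<le> ?f (Suc k) s" if "s \<in> {0..r}" for k s
      using that by (intro mult_left_mono rhs_mono it_nonneg it_incseq) auto
    show "(\<lambda>k. ?f k s) \<longlonglongrightarrow> s ^ (n - 1) * rhs (H s)" if s: "s \<in> {0..r}" for s
    proof -
      have "bdd s" using s bdd_mono[OF assms] by auto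
      then have "(\<lambda>k. it k s) \<longlonglongrightarrow> H s" by (rule it_LIMSEQ)
      then show ?thesis unfolding rhs_def
        using s p by (intro tendsto_intros tendsto_powr2) (auto intro!: always_eventually it_nonneg)
    qed
    show "bounded (range (\<lambda>k. integral {0..r} (?f k)))"
    proof (rule boundedI)
      fix x assume "x \<in> range (\<lambda>k. integral {0..r} (?f k))"
      then obtain k where x: "x = r ^ (n - 1) * it (Suc k) r" using it_integral_eq[OF r] by auto
      have "0 \<le> it (Suc k) r" "it (Suc k) r \<le> H r" using it_nonneg[OF r] it_le_H[OF assms] by blast+
      then show "norm x \<le> r ^ (n - 1) * H r"
        unfolding x using r by (auto simp: abs_mult intro!: mult_left_mono simp del: it.simps)
    qed
  qed
  then have A: "?h integrable_on {0..r}"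
    and B: "(\<lambda>k. integral {0..r} (?f k)) \<longlonglongrightarrow> integral {0..r} ?h" by auto
  have "(\<lambda>k. r ^ (n - 1) * it (Suc k) r) \<longlonglongrightarrow> r ^ (n - 1) * H r"
    using it_LIMSEQ[OF assms] by (intro tendsto_intros LIMSEQ_Suc)
  then have "(\<lambda>k. integral {0..r} (?f k)) \<longlonglongrightarrow> r ^ (n - 1) * H r" by (simp only: it_integral_eq[OF r])
  with A B show "?h integrable_on {0..r}"
    "r ^ (n - 1) * H r = integral {0..r} ?h" using LIMSEQ_unique by blast+
qed

lemma H_le_linear: assumes "bdd r" "0 \<le> s" "s \<le> r" shows "H s \<le> s * rhs (H r)"
proof (rule H_leI)
  fix k
  show "it k s \<le> s * rhs (H r)"
  proof (cases k)
    case 0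
    then show ?thesis using assms order_trans[OF zero_le_one rhs_ge_1] by simp
  next
    case (Suc j)
    have "integral {0..1} (\<lambda>t. t ^ (n - 1) * rhs (it j (s * t))) \<le> integral {0..1} (\<lambda>t::real. rhs (H r))"
    proof (intro integral_le integrable_continuous_interval it_integrand_cont assms)
      fix t :: real assume t: "t \<in> {0..1}"
      have "s * t \<le> r * 1" using t assms by (intro mult_mono) auto
      then have "it j (s * t) \<le> H r" using t assms it_mono[of "s * t" r j] it_le_H[OF assms(1), of j] by auto
      then have "rhs (it j (s * t)) \<le> rhs (H r)" using t assms by (intro rhs_mono it_nonneg) auto
      moreover have "t ^ (n - 1) \<le> 1" using t by (auto intro: power_le_one)
      ultimately have "t ^ (n - 1) * rhs (it j (s * t)) \<le> 1 * rhs (H r)"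
        using t order_trans[OF zero_le_one rhs_ge_1] by (intro mult_mono) auto
      then show "t ^ (n - 1) * rhs (it j (s * t)) \<le> rhs (H r)" by simp
    qed auto
    then show ?thesis using Suc assms by (auto intro: mult_left_mono)
  qed
qed

lemma H_0: "bdd 0" "H 0 = 0"
proof -
  have z: "it k 0 = 0" for k by (cases k) auto
  then show "bdd 0" by (intro bddI[of 0 0]) auto
  show "H 0 = 0" by (simp add: H_def z)
qed

text \<open>Away from the origin the integral equation writes \<open>H\<close> as a continuous
  integral divided by a power. At the origin, where this division fails, the linear bound takes
  over.\<close>

lemma H_cont: assumes "bdd r" shows "continuous_on {0..r} H"
  unfolding continuous_on_eq_continuous_within
proof
  fix s assume s: "s \<in> {0..r}"
  show "continuous (at s within {0..r}) H"
  proof (cases "s = 0")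
    case True
    have "(H \<longlongrightarrow> 0) (at 0 within {0..r})"
    proof (rule tendsto_sandwich[of "\<lambda>_. 0" H _ "\<lambda>s. s * rhs (H r)"])
      show "\<forall>\<^sub>F x in at 0 within {0..r}. 0 \<le> H x"
        unfolding eventually_at_filter by (rule always_eventually) (auto intro: H_nonneg bdd_mono[OF assms])
      show "\<forall>\<^sub>F x in at 0 within {0..r}. H x \<le> x * rhs (H r)"
        unfolding eventually_at_filter by (rule always_eventually) (auto intro: H_le_linear[OF assms])
      have "((\<lambda>s. s * rhs (H r)) \<longlongrightarrow> 0 * rhs (H r)) (at 0 within {0..r})" by (intro tendsto_intros)
      then show "((\<lambda>s. s * rhs (H r)) \<longlongrightarrow> 0) (at 0 within {0..r})" by simp
    qed simp
    then show ?thesis using True H_0 by (simp add: continuous_within)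
  next
    case False
    then have s0: "0 < s" using s by simp
    have "continuous_on {0..r} (\<lambda>x. integral {0..x} (\<lambda>s. s ^ (n - 1) * rhs (H s)))"
      by (rule indefinite_integral_continuous_1[OF H_integral_eq(1)[OF assms]])
    then have "continuous_on {0<..r} (\<lambda>x. integral {0..x} (\<lambda>s. s ^ (n - 1) * rhs (H s)))"
      by (rule continuous_on_subset) auto
    then have "continuous_on {0<..r} (\<lambda>x. integral {0..x} (\<lambda>s. s ^ (n - 1) * rhs (H s)) / x ^ (n - 1))"
      by (intro continuous_intros) auto
    moreover have "integral {0..x} (\<lambda>s. s ^ (n - 1) * rhs (H s)) / x ^ (n - 1) = H x" if "x \<in> {0<..r}" for x
      using H_integral_eq(2)[OF bdd_mono[OF assms], of x] that by (auto simp: field_simps)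
    ultimately have "continuous_on {0<..r} H" by (rule continuous_on_eq)
    then have "continuous (at s within {0<..r}) H" using s s0 by (simp add: continuous_on_eq_continuous_within)
    moreover have "at s within {0..r} = at s within {0<..r}" using s0 by (intro at_within_nhd[of s "{0<..}"]) auto
    ultimately show ?thesis by simp
  qed
qed

lemma H_deriv:
  assumes "bdd r" "0 < s" "s < r"
  shows "(H has_real_derivative rhs (H s) - (real n - 1) * H s / s) (at s)"
proof -
  define k where "k = n - 1"
  have nk: "real n - 1 = real k" using n by (simp add: k_def)
  let ?F = "\<lambda>s. s ^ k * rhs (H s)" and ?Y = "\<lambda>x. integral {0..x} (\<lambda>s. s ^ k * rhs (H s))"
  have "continuous_on {0..r} ?F"
    by (intro continuous_intros continuous_on_rhs H_cont assms) (auto intro: H_nonneg bdd_mono[OF assms(1)])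
  then have "(?Y has_real_derivative ?F s) (at s within {0..r})"
    using assms by (intro integral_has_real_derivative) auto
  then have Y: "(?Y has_real_derivative ?F s) (at s)" using assms by (simp add: at_within_Icc_at)
  have eq: "x ^ k * H x = ?Y x" if "0 < x" "x < r" for x
    using H_integral_eq(2)[OF bdd_mono[OF assms(1)], of x] that by (simp add: k_def)
  have "((\<lambda>x. ?Y x / x ^ k) has_real_derivative
      (?F s * s ^ k - ?Y s * (real k * s ^ (k - 1))) / (s ^ k * s ^ k)) (at s)"
    using assms by (auto intro!: derivative_eq_intros Y)
  also have "(?F s * s ^ k - ?Y s * (real k * s ^ (k - 1))) / (s ^ k * s ^ k) = rhs (H s) - (real n - 1) * H s / s"
    using assms eq[OF assms(2,3), symmetric] unfolding nk by (cases k) (auto simp: field_simps)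
  finally show ?thesis
  proof (rule has_field_derivative_transform_within_open[of _ _ _ "{0<..<r}"])
    show "?Y x / x ^ k = H x" if "x \<in> {0<..<r}" for x using eq[of x] that by (simp add: field_simps)
  qed (use assms in auto)
qed

text \<open>The positive slope makes the eigenvalue of a ball strictly decreasing in the radius, for every \<open>b\<close>.\<close>

lemma H_deriv_pos:
  assumes "bdd r" "0 < s" "s < r"
  shows "0 < rhs (H s) - (real n - 1) * H s / s"
proof -
  have d: "((\<lambda>x. (H x - H s) / (x - s)) \<longlongrightarrow> rhs (H s) - (real n - 1) * H s / s) (at_right s)"
    using H_deriv[OF assms] unfolding has_field_derivative_iff by (rule filterlim_mono) (auto simp: at_le)
  have "H s / s \<le> rhs (H s) - (real n - 1) * H s / s"
  proof (rule tendsto_lowerbound[OF d])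
    have "\<forall>\<^sub>F x in at_right s. x \<in> {s<..<r}" using assms(3) by (rule eventually_at_right_real)
    then show "\<forall>\<^sub>F x in at_right s. H s / s \<le> (H x - H s) / (x - s)"
    proof eventually_elim
      case (elim x)
      have "x * H s \<le> s * H x" using assms elim by (intro H_ratio bdd_mono[OF assms(1)]) auto
      then show ?case using elim assms by (simp add: field_simps)
    qed
  qed simp
  moreover have "0 < H s"
    by (rule less_le_trans[OF divide_pos_pos H_ge[OF bdd_mono[OF assms(1)]]]) (use assms n in auto)
  ultimately show ?thesis using assms by (meson divide_pos_pos less_le_trans)
qed

text \<open>A priori bound: as long as an iterate stays below \<open>M = H r + 1\<close>, the next
  one can exceed \<open>H r\<close> by at most 1 on an interval of length \<open>1 / rhs M\<close>.
  The bound is the same for all iterates, so it passes to the limit.\<close>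

lemma bdd_open: assumes "bdd r" shows "\<exists>\<delta>>0. bdd (r + \<delta>)"
proof -
  have r: "0 \<le> r" using assms by (simp add: bdd_def)
  define M where "M = H r + 1"
  define \<delta> where "\<delta> = 1 / rhs M"
  have A: "1 \<le> rhs M" by (rule rhs_ge_1)
  have \<delta>: "0 < \<delta>" using A by (simp add: \<delta>_def)
  have M0: "0 \<le> M" using H_nonneg[OF assms] by (simp add: M_def)
  have "it k x \<le> M" if "0 \<le> x" "x \<le> r + \<delta>" for k x using that
  proof (induction k arbitrary: x)
    case (Suc k)
    show ?case
    proof (cases "x \<le> r")
      case True
      have "it (Suc k) x \<le> it (Suc k) r" by (rule it_mono[OF Suc.prems(1) True])
      also have "\<dots> \<le> H r" by (rule it_le_H[OF assms])
      finally show ?thesis by (simp add: M_def)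
    next
      case False
      let ?F = "\<lambda>s. s ^ (n - 1) * rhs (it k s)"
      have x: "0 < x" "r \<le> x" using False r by auto
      have "x ^ (n - 1) * it (Suc k) x = integral {0..x} ?F" by (rule it_integral_eq[OF Suc.prems(1)])
      also have "\<dots> = integral {0..r} ?F + integral {r..x} ?F"
        using r x by (intro Henstock_Kurzweil_Integration.integral_combine[symmetric] integrable_continuous_interval it_integrand_cont')
      also have "integral {0..r} ?F = r ^ (n - 1) * it (Suc k) r" by (rule it_integral_eq[OF r, symmetric])
      also have "\<dots> \<le> x ^ (n - 1) * H r"
        using r x it_le_H[OF assms, of "Suc k"] it_nonneg[OF r, of "Suc k"] by (intro mult_mono power_mono) auto
      also have "integral {r..x} ?F \<le> integral {r..x} (\<lambda>s. x ^ (n - 1) * rhs M)"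
      proof (intro integral_le integrable_continuous_interval continuous_on_subset[OF it_integrand_cont'[of x]])
        fix s assume s: "s \<in> {r..x}"
        then have "rhs (it k s) \<le> rhs M" using r Suc.prems by (intro rhs_mono it_nonneg Suc.IH) auto
        then show "?F s \<le> x ^ (n - 1) * rhs M"
          using s r order_trans[OF zero_le_one rhs_ge_1] by (intro mult_mono power_mono) auto
      qed (use r in auto)
      also have "\<dots> = x ^ (n - 1) * (rhs M * (x - r))" using x by simp
      also have "\<dots> \<le> x ^ (n - 1) * 1"
        using x Suc.prems A by (intro mult_left_mono) (auto simp: \<delta>_def field_simps)
      finally have "x ^ (n - 1) * it (Suc k) x \<le> x ^ (n - 1) * M" by (simp add: M_def algebra_simps)
      then show ?thesis using x by simp
    qed
  qed (use M0 in simp)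
  then have "bdd (r + \<delta>)" using r \<delta> by (intro bddI[of _ M]) auto
  then show ?thesis using \<delta> by blast
qed

text \<open>By scaling, \<open>r \<mapsto> s powr (p - 1) * H (s * r)\<close> solves the equation for the eigenvalue \<open>s powr p\<close>.\<close>

lemma shooting:
  assumes b: "0 < b" and R: "0 < R"
  obtains s where "0 < s" "bdd (s * R)" "s powr (p - 1) * H (s * R) = b"
proof -
  \<comment> \<open>The parameters that do not overshoot the target; their supremum turns out to hit
    \<open>b\<close> exactly.\<close>
  define J where "J = {s. 0 < s \<and> bdd (s * R) \<and> s powr (p - 1) * H (s * R) \<le> b}"
  obtain \<delta> where \<delta>: "0 < \<delta>" "bdd \<delta>" using bdd_open[OF H_0(1)] by auto
  have "J \<noteq> {}"
  proof -
    \<comment> \<open>Small enough that \<open>s * R\<close> stays where \<open>H\<close> is at most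
      \<open>H \<delta>\<close> and that the power factor is at most
      \<open>b / (H \<delta> + 1)\<close>; the summand 1 keeps the denominator positive.\<close>
    define s where "s = min (\<delta> / R) ((b / (H \<delta> + 1)) powr (1 / (p - 1)))"
    have H\<delta>: "0 \<le> H \<delta>" by (rule H_nonneg[OF \<delta>(2)])
    have s: "0 < s" "s * R \<le> \<delta>" using \<delta> R b H\<delta> by (auto simp: s_def min_def field_simps)
    have "s powr (p - 1) \<le> ((b / (H \<delta> + 1)) powr (1 / (p - 1))) powr (p - 1)"
      using s p by (intro powr_mono2) (auto simp: s_def)
    also have "\<dots> = b / (H \<delta> + 1)" using p b H\<delta> by (simp add: powr_powr)
    finally have "s powr (p - 1) * H (s * R) \<le> b / (H \<delta> + 1) * (H \<delta> + 1)"
      using H_mono[OF \<delta>(2), of "s * R"] s R H\<delta> b H_nonneg[OF bdd_mono[OF \<delta>(2), of "s * R"]] by (intro mult_mono) auto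
    then have "s powr (p - 1) * H (s * R) \<le> b" using H\<delta> by simp
    moreover have "bdd (s * R)" using s R by (intro bdd_mono[OF \<delta>(2)]) auto
    ultimately show ?thesis using s by (auto simp: J_def)
  qed
  have J_le: "s \<le> max 1 (b * real n / R)" if "s \<in> J" for s
  proof (cases "s \<le> 1")
    case False
    have "s powr (p - 1) * (s * R / real n) \<le> s powr (p - 1) * H (s * R)"
      using that H_ge[of "s * R"] by (intro mult_left_mono) (auto simp: J_def)
    also have "\<dots> \<le> b" using that by (simp add: J_def)
    finally have 1: "s powr (p - 1) * (s * R / real n) \<le> b" .
    have "1 \<le> s powr (p - 1)" using False p by (intro ge_one_powr_ge_zero) auto
    then have "1 * (s * R / real n) \<le> s powr (p - 1) * (s * R / real n)" using False R by (intro mult_right_mono) auto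
    with 1 have "s * R / real n \<le> b" by simp
    then show ?thesis using R n by (simp add: le_max_iff_disj field_simps)
  qed simp
  then have bJ: "bdd_above J" by (rule bdd_aboveI)
  define s0 where "s0 = Sup J"
  have s0: "0 < s0"
  proof -
    obtain s where s: "s \<in> J" using \<open>J \<noteq> {}\<close> by auto
    then have "s \<le> s0" unfolding s0_def using bJ by (rule cSup_upper)
    then show ?thesis using s by (auto simp: J_def)
  qed
  \<comment> \<open>The limit from the left is taken in each iterate, because \<open>s0 * R\<close>
    is not yet known to satisfy \<open>bdd\<close>.\<close>
  have low: "s0 powr (p - 1) * it k (s0 * R) \<le> b" for k
  proof (rule tendsto_upperbound[where F = "at_left s0" and f = "\<lambda>s. s powr (p - 1) * it k (s * R)"])
    have "\<forall>\<^sub>F s in at_left s0. s \<in> {0<..<s0}" using s0 by (intro eventually_at_left_real) auto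
    then show "\<forall>\<^sub>F s in at_left s0. s powr (p - 1) * it k (s * R) \<le> b"
    proof (rule eventually_mono)
      fix s assume s: "s \<in> {0<..<s0}"
      then obtain s' where s': "s' \<in> J" "s < s'" unfolding s0_def using less_cSup_iff[OF \<open>J \<noteq> {}\<close> bJ] by auto
      have "it k (s * R) \<le> it k (s' * R)" using s s' R by (intro it_mono) auto
      also have "\<dots> \<le> H (s' * R)" using s' by (intro it_le_H) (auto simp: J_def)
      finally have "s powr (p - 1) * it k (s * R) \<le> s' powr (p - 1) * H (s' * R)"
        using s s' p R by (intro mult_mono powr_mono2 it_nonneg) auto
      also have "\<dots> \<le> b" using s' by (simp add: J_def)
      finally show "s powr (p - 1) * it k (s * R) \<le> b" .
    qed
    have "isCont (it k) (s0 * R)" using continuous_on_interior[OF it_cont, of "s0 * R" k] s0 R by simp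
    then have "isCont (\<lambda>s. s powr (p - 1) * it k (s * R)) s0"
      using s0 by (intro continuous_intros isCont_o2[of _ "\<lambda>s. s * R" "it k"]) auto
    then show "((\<lambda>s. s powr (p - 1) * it k (s * R)) \<longlongrightarrow> s0 powr (p - 1) * it k (s0 * R)) (at_left s0)"
      unfolding isCont_def by (rule filterlim_mono) (auto simp: at_le)
  qed simp
  have bnd: "it k (s0 * R) \<le> b / s0 powr (p - 1)" for k using low[of k] s0 by (simp add: field_simps)
  have B: "bdd (s0 * R)" using s0 R bnd by (intro bddI) auto
  have le: "s0 powr (p - 1) * H (s0 * R) \<le> b" using H_leI[of "s0 * R", OF bnd] s0 by (simp add: field_simps)
  have "s0 powr (p - 1) * H (s0 * R) = b"
  proof (rule ccontr)
    assume "\<not> ?thesis"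
    with le have lt: "s0 powr (p - 1) * H (s0 * R) < b" by simp
    \<comment> \<open>A strict inequality would persist slightly beyond \<open>s0\<close>, where
      \<open>H\<close> is still finite and continuous, against the choice of the supremum.\<close>
    obtain \<epsilon> where \<epsilon>: "0 < \<epsilon>" "bdd (s0 * R + \<epsilon>)" using bdd_open[OF B] by auto
    have "isCont H (s0 * R)" using continuous_on_interior[OF H_cont[OF \<epsilon>(2)], of "s0 * R"] s0 R \<epsilon>(1) by simp
    then have "isCont (\<lambda>s. s powr (p - 1) * H (s * R)) s0"
      using s0 by (intro continuous_intros isCont_o2[of _ "\<lambda>s. s * R" H]) auto
    then have "((\<lambda>s. s powr (p - 1) * H (s * R)) \<longlongrightarrow> s0 powr (p - 1) * H (s0 * R)) (at_right s0)"
      unfolding isCont_def by (rule filterlim_mono) (auto simp: at_le)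
    from order_tendstoD(2)[OF this lt]
    have "\<forall>\<^sub>F s in at_right s0. s powr (p - 1) * H (s * R) < b" .
    moreover have "\<forall>\<^sub>F s in at_right s0. s \<in> {s0<..<s0 + \<epsilon> / R}" using \<epsilon>(1) R by (intro eventually_at_right_real) auto
    ultimately have "\<forall>\<^sub>F s in at_right s0. s \<in> J \<and> s0 < s"
    proof eventually_elim
      case (elim s)
      have "s * R \<le> s0 * R + \<epsilon>" using elim R by (auto simp: field_simps)
      then have "bdd (s * R)" using elim s0 R by (intro bdd_mono[OF \<epsilon>(2)]) auto
      then show ?case using elim s0 by (auto simp: J_def)
    qed
    then obtain s where "s \<in> J" "s0 < s" using eventually_happens'[OF trivial_limit_at_right_real] by blast
    then show False using cSup_upper[OF _ bJ, of s] by (simp add: s0_def)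
  qed
  with s0 B show thesis by (rule that)
qed

end

section \<open>Divergence-free fields with prescribed flux density on a sphere\<close>

definition C1_field :: "('a::euclidean_space \<Rightarrow> 'a) \<Rightarrow> ('a \<Rightarrow> 'a \<Rightarrow> 'a) \<Rightarrow> bool" where
  "C1_field W W' \<longleftrightarrow> (\<forall>x. (W has_derivative W' x) (at x)) \<and> (\<forall>v. continuous_on UNIV (\<lambda>x. W' x v))"

definition has_divergence :: "('a::euclidean_space \<Rightarrow> 'a) \<Rightarrow> ('a \<Rightarrow> real) \<Rightarrow> bool" where
  "has_divergence W \<delta> \<longleftrightarrow> (\<exists>W'. C1_field W W' \<and> (\<forall>x. \<delta> x = (\<Sum>b\<in>Basis. W' x b \<bullet> b)))"

lemma has_divergenceI:
  assumes "\<And>x. (W has_derivative W' x) (at x)" "\<And>v. continuous_on UNIV (\<lambda>x. W' x v)"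
    "\<And>x. (\<Sum>b\<in>Basis. W' x b \<bullet> b) = \<delta> x"
  shows "has_divergence W \<delta>"
  unfolding has_divergence_def C1_field_def using assms by metis

lemma has_divergence_add:
  assumes "has_divergence V \<delta>" "has_divergence W \<gamma>"
  shows "has_divergence (\<lambda>x. V x + W x) (\<lambda>x. \<delta> x + \<gamma> x)"
proof -
  obtain V' W' where V: "C1_field V V'" "\<And>x. \<delta> x = (\<Sum>b\<in>Basis. V' x b \<bullet> b)"
    and W: "C1_field W W'" "\<And>x. \<gamma> x = (\<Sum>b\<in>Basis. W' x b \<bullet> b)" using assms unfolding has_divergence_def by blast
  show ?thesis by (rule has_divergenceI[where W' = "\<lambda>x v. V' x v + W' x v"])
       (use V W in \<open>auto simp: C1_field_def inner_add_left sum.distrib intro!: has_derivative_add continuous_on_add\<close>)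
qed

lemma has_divergence_scale:
  assumes "has_divergence V \<delta>"
  shows "has_divergence (\<lambda>x. c *\<^sub>R V x) (\<lambda>x. c * \<delta> x)"
proof -
  obtain V' where V: "C1_field V V'" "\<And>x. \<delta> x = (\<Sum>b\<in>Basis. V' x b \<bullet> b)"
    using assms unfolding has_divergence_def by blast
  show ?thesis by (rule has_divergenceI[where W' = "\<lambda>x v. c *\<^sub>R V' x v"])
       (use V in \<open>auto simp: C1_field_def sum_distrib_left intro!: has_derivative_scaleR_right continuous_on_scaleR continuous_on_const\<close>)
qed

lemma sum_inner_Basis: "(\<Sum>b\<in>Basis. (a \<bullet> b) * (y \<bullet> b)) = a \<bullet> (y::'a::euclidean_space)"
  by (simp add: euclidean_inner[of a y])

text \<open>On the sphere \<open>W x \<bullet> x\<close> is \<open>R\<close> times the normal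
  component of \<open>W\<close>. The additive constant cannot be dropped, since a divergence-free
  field has total flux zero; it is recovered later from the mean. The field is required on the whole
  space, so that it can be used on every moved domain.\<close>

definition flux_density :: "real \<Rightarrow> ('a::euclidean_space \<Rightarrow> real) \<Rightarrow> bool" where
  "flux_density R g \<longleftrightarrow> (\<forall>r>0. \<exists>W c. has_divergence W (\<lambda>x. 0) \<and> (\<forall>x\<in>sphere 0 R. \<bar>W x \<bullet> x - g x - c\<bar> \<le> r))"

lemma flux_density_add:
  assumes "flux_density R f" "flux_density R g"
  shows "flux_density R (\<lambda>x. f x + g x)"
  unfolding flux_density_def
proof (intro allI impI)
  fix r :: real assume r: "0 < r"
  obtain V c where V: "has_divergence V (\<lambda>x. 0)" "\<And>x. x \<in> sphere 0 R \<Longrightarrow> \<bar>V x \<bullet> x - f x - c\<bar> \<le> r / 2"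
    using assms(1) r unfolding flux_density_def by (meson half_gt_zero)
  obtain W d where W: "has_divergence W (\<lambda>x. 0)" "\<And>x. x \<in> sphere 0 R \<Longrightarrow> \<bar>W x \<bullet> x - g x - d\<bar> \<le> r / 2"
    using assms(2) r unfolding flux_density_def by (meson half_gt_zero)
  have "has_divergence (\<lambda>x. V x + W x) (\<lambda>x. 0)" using has_divergence_add[OF V(1) W(1)] by simp
  moreover have "\<bar>(V x + W x) \<bullet> x - (f x + g x) - (c + d)\<bar> \<le> r" if "x \<in> sphere 0 R" for x
    using V(2)[OF that] W(2)[OF that] unfolding inner_add_left by linarith
  ultimately show "\<exists>W c. has_divergence W (\<lambda>x. 0) \<and> (\<forall>x\<in>sphere 0 R. \<bar>W x \<bullet> x - (f x + g x) - c\<bar> \<le> r)"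
    by blast
qed

lemma flux_density_scale:
  assumes "flux_density R f"
  shows "flux_density R (\<lambda>x. a * f x)"
  unfolding flux_density_def
proof (intro allI impI)
  fix r :: real assume r: "0 < r"
  define e where "e = r / (\<bar>a\<bar> + 1)"
  have e: "0 < e" using r by (simp add: e_def)
  obtain V c where V: "has_divergence V (\<lambda>x. 0)" "\<And>x. x \<in> sphere 0 R \<Longrightarrow> \<bar>V x \<bullet> x - f x - c\<bar> \<le> e"
    using assms(1) e unfolding flux_density_def by meson
  have "has_divergence (\<lambda>x. a *\<^sub>R V x) (\<lambda>x. 0)" using has_divergence_scale[OF V(1), of a] by simp
  moreover have "\<bar>(a *\<^sub>R V x) \<bullet> x - a * f x - a * c\<bar> \<le> r" if x: "x \<in> sphere 0 R" for x
  proof -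
    have "\<bar>(a *\<^sub>R V x) \<bullet> x - a * f x - a * c\<bar> = \<bar>a\<bar> * \<bar>V x \<bullet> x - f x - c\<bar>"
      by (simp add: abs_mult[symmetric] algebra_simps)
    also have "\<dots> \<le> (\<bar>a\<bar> + 1) * e" using V(2)[OF x] e by (intro mult_mono) auto
    also have "\<dots> = r" by (simp add: e_def)
    finally show ?thesis .
  qed
  ultimately show "\<exists>W c. has_divergence W (\<lambda>x. 0) \<and> (\<forall>x\<in>sphere 0 R. \<bar>W x \<bullet> x - a * f x - c\<bar> \<le> r)"
    by blast
qed

text \<open>With \<open>s = a \<bullet> x\<close> and \<open>n\<close> the dimension, the field \<open>s\<^sup>k a - c s\<^sup>k\<^sup>-\<^sup>1 x\<close> is divergence free for
  \<open>c = k \<bar>a\<bar>\<^sup>2 / (n + k - 1)\<close> and has flux density \<open>s\<^sup>k\<^sup>+\<^sup>1 - c R\<^sup>2 s\<^sup>k\<^sup>-\<^sup>1\<close>, which allows induction.\<close>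

lemma flux_density_ridge:
  fixes a :: "'a::euclidean_space"
  assumes R: "0 < R"
  shows "flux_density R (\<lambda>x. (a \<bullet> x) ^ j)"
proof (induction j rule: less_induct)
  case (less j)
  show ?case
  proof (cases j)
    case 0
    have "has_divergence (\<lambda>x::'a. 0) (\<lambda>x. 0)" by (rule has_divergenceI[where W' = "\<lambda>x v. 0"]) auto
    then show ?thesis unfolding flux_density_def 0 by (intro allI impI exI[of _ "\<lambda>x. 0"] exI[of _ "-1"]) auto
  next
    case (Suc k)
    \<comment> \<open>This value makes the two contributions to the divergence cancel. For
      \<open>k = 0\<close> it is 0 in every dimension, also in dimension 1, where the denominator
      vanishes as well; the field is then the constant \<open>a\<close>.\<close>
    define c where "c = real k * (a \<bullet> a) / (real k + real DIM('a) - 1)"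
    let ?s = "\<lambda>x. a \<bullet> x"
    let ?V = "\<lambda>x. ?s x ^ k *\<^sub>R a - c *\<^sub>R ?s x ^ (k - 1) *\<^sub>R x"
    let ?V' = "\<lambda>x v. (real k * ?s x ^ (k - 1) * ?s v) *\<^sub>R a
      - c *\<^sub>R ((real (k - 1) * ?s x ^ (k - 2) * ?s v) *\<^sub>R x + ?s x ^ (k - 1) *\<^sub>R v)"
    have "has_divergence ?V (\<lambda>x. 0)"
    proof (rule has_divergenceI[where W' = ?V'])
      show "(?V has_derivative ?V' x) (at x)" for x
        by (auto intro!: derivative_eq_intros simp: numeral_2_eq_2 algebra_simps)
      have D: "1 \<le> real DIM('a)" using DIM_positive[where 'a='a] by linarith
      have "(\<Sum>b\<in>Basis. ?V' x b \<bullet> b) = real k * ?s x ^ (k - 1) * (a \<bullet> a)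
          - c * (real (k - 1) * ?s x ^ (k - 2) * ?s x + ?s x ^ (k - 1) * real DIM('a))" for x
      proof -
        have "?V' x b \<bullet> b = real k * ?s x ^ (k - 1) * ((a \<bullet> b) * (a \<bullet> b))
            - c * (real (k - 1) * ?s x ^ (k - 2) * ((a \<bullet> b) * (x \<bullet> b)) + ?s x ^ (k - 1) * (b \<bullet> b))" for b
          by (simp add: inner_diff_left inner_add_left)
        then show ?thesis by (simp only: sum_subtractf sum.distrib sum_distrib_left[symmetric] sum_inner_Basis) simp
      qed
      also have "\<dots> x = 0" for x
      proof (cases k)
        case (Suc i)
        have "Suc i - 1 = i" "Suc i - 2 = i - 1" by auto
        moreover have "real i * ?s x ^ (i - 1) * ?s x = ?s x ^ i * real i" by (cases i) auto
        moreover have "c * (real i + real DIM('a)) = real k * (a \<bullet> a)"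
        proof -
          have "real i + real DIM('a) \<noteq> 0" using D by linarith
          then show ?thesis unfolding c_def Suc by simp
        qed
        moreover have "real k * ?s x ^ i * (a \<bullet> a) - c * (?s x ^ i * real i + ?s x ^ i * real DIM('a))
            = ?s x ^ i * (real k * (a \<bullet> a) - c * (real i + real DIM('a)))" by (simp add: algebra_simps)
        ultimately show ?thesis by (simp only: Suc) simp
      qed (simp add: c_def)
      finally show "(\<Sum>b\<in>Basis. ?V' x b \<bullet> b) = 0" for x .
    qed (intro continuous_intros)
    moreover have "?V x \<bullet> x - (?s x ^ j - c * R\<^sup>2 * ?s x ^ (k - 1)) - 0 = 0" if "x \<in> sphere 0 R" for x
    proof -
      have "x \<bullet> x = R\<^sup>2" using that by (simp add: dot_square_norm)
      then show ?thesis using R by (simp add: Suc inner_diff_left)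
    qed
    ultimately have "flux_density R (\<lambda>x. ?s x ^ j - c * R\<^sup>2 * ?s x ^ (k - 1))"
      unfolding flux_density_def by (intro allI impI exI[of _ ?V] exI[of _ 0]) (simp del: scaleR_scaleR)
    moreover have "flux_density R (\<lambda>x. c * R\<^sup>2 * ?s x ^ (k - 1))" using Suc by (intro flux_density_scale less) simp
    ultimately show ?thesis using flux_density_add by fastforce
  qed
qed

lemma flux_density_approx:
  assumes "\<And>r. 0 < r \<Longrightarrow> \<exists>f. flux_density R f \<and> (\<forall>x\<in>sphere 0 R. \<bar>f x - g x\<bar> \<le> r)"
  shows "flux_density R g"
  unfolding flux_density_def
proof (intro allI impI)
  fix r :: real assume r: "0 < r"
  obtain f where f: "flux_density R f" "\<And>x. x \<in> sphere 0 R \<Longrightarrow> \<bar>f x - g x\<bar> \<le> r / 2" using assms[of "r / 2"] r by auto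
  obtain V c where V: "has_divergence V (\<lambda>x. 0)" "\<And>x. x \<in> sphere 0 R \<Longrightarrow> \<bar>V x \<bullet> x - f x - c\<bar> \<le> r / 2"
    using f(1) r unfolding flux_density_def by (meson half_gt_zero)
  have "\<bar>V x \<bullet> x - g x - c\<bar> \<le> r" if "x \<in> sphere 0 R" for x using V(2)[OF that] f(2)[OF that] by linarith
  with V(1) show "\<exists>W c. has_divergence W (\<lambda>x. 0) \<and> (\<forall>x\<in>sphere 0 R. \<bar>W x \<bullet> x - g x - c\<bar> \<le> r)" by blast
qed

lemma flux_density_sum:
  assumes "0 < R" "\<And>i. i \<in> I \<Longrightarrow> flux_density R (f i)"
  shows "flux_density R (\<lambda>x :: 'a::euclidean_space. \<Sum>i\<in>I. f i x)"
  using assms(2)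
proof (induction I rule: infinite_finite_induct)
  case (insert i I)
  then show ?case using flux_density_add[of R "f i" "\<lambda>x. \<Sum>i\<in>I. f i x"] by simp
qed (use flux_density_scale[OF flux_density_ridge[OF assms(1), of "0::'a" 0], of 0] in simp_all)

text \<open>Taylor polynomials of the exponential are sums of ridge powers, and the remainder is
  uniform on the sphere because \<open>a \<bullet> x\<close> is bounded there by
  \<open>norm a * R\<close>.\<close>

lemma flux_density_exp:
  fixes a :: "'a::euclidean_space"
  assumes R: "0 < R"
  shows "flux_density R (\<lambda>x. exp (a \<bullet> x))"
proof (rule flux_density_approx)
  fix r :: real assume r: "0 < r"
  define M where "M = norm a * R"
  have "(\<lambda>k. inverse (fact k) * M ^ k) \<longlonglongrightarrow> 0" by (rule summable_LIMSEQ_zero[OF summable_exp])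
  then have "(\<lambda>k. exp M * (inverse (fact k) * M ^ k)) \<longlonglongrightarrow> exp M * 0" by (intro tendsto_intros)
  then have "(\<lambda>k. exp M * (inverse (fact k) * M ^ k)) \<longlonglongrightarrow> 0" by simp
  from order_tendstoD(2)[OF this r] obtain N where N: "exp M * (inverse (fact N) * M ^ N) < r"
    unfolding eventually_sequentially by blast
  let ?f = "\<lambda>x. \<Sum>k<N. (1 / fact k) * (a \<bullet> x) ^ k"
  have "flux_density R ?f" using R by (intro flux_density_sum flux_density_scale flux_density_ridge)
  moreover have "\<bar>?f x - exp (a \<bullet> x)\<bar> \<le> r" if x: "x \<in> sphere 0 R" for x
  proof -
    obtain t where t: "\<bar>t\<bar> \<le> \<bar>a \<bullet> x\<bar>" "exp (a \<bullet> x) = (\<Sum>k<N. (a \<bullet> x) ^ k / fact k) + exp t / fact N * (a \<bullet> x) ^ N"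
      using Maclaurin_exp_le[of "a \<bullet> x" N] by blast
    have ax: "\<bar>a \<bullet> x\<bar> \<le> M" using Cauchy_Schwarz_ineq2[of a x] x by (simp add: M_def)
    have "\<bar>?f x - exp (a \<bullet> x)\<bar> = exp t / fact N * \<bar>a \<bullet> x\<bar> ^ N" unfolding t(2) by (simp add: abs_mult power_abs)
    also have "\<dots> \<le> exp M / fact N * M ^ N"
      using t(1) ax by (intro mult_mono power_mono divide_right_mono) auto
    also have "\<dots> \<le> r" using N by (simp add: field_simps)
    finally show ?thesis .
  qed
  ultimately show "\<exists>f. flux_density R f \<and> (\<forall>x\<in>sphere 0 R. \<bar>f x - exp (a \<bullet> x)\<bar> \<le> r)" by blast
qed

text \<open>Products of powers of different linear forms are not powers of linear forms, but
  products of exponentials are exponentials. This span is therefore an algebra, as Stone-Weierstrass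
  requires.\<close>

inductive_set exp_span :: "('a::euclidean_space \<Rightarrow> real) set" where
  exp: "(\<lambda>x. exp (a \<bullet> x)) \<in> exp_span"
| scale: "f \<in> exp_span \<Longrightarrow> (\<lambda>x. c * f x) \<in> exp_span"
| add: "f \<in> exp_span \<Longrightarrow> g \<in> exp_span \<Longrightarrow> (\<lambda>x. f x + g x) \<in> exp_span"

lemma exp_span_mult:
  assumes "f \<in> exp_span" "g \<in> exp_span"
  shows "(\<lambda>x. f x * g x) \<in> exp_span"
  using assms(1)
proof induction
  case (exp a)
  show ?case using assms(2)
  proof induction
    case (exp b)
    show ?case using exp_span.exp[of "a + b"] by (simp add: inner_add_left exp_add)
  next
    case (scale g c)
    show ?case using exp_span.scale[OF scale.IH, of c] by (simp add: mult_ac)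
  next
    case (add f g)
    show ?case using exp_span.add[OF add.IH] by (simp add: algebra_simps)
  qed
next
  case (scale f c)
  show ?case using exp_span.scale[OF scale.IH, of c] by (simp add: mult_ac)
next
  case (add f h)
  show ?case using exp_span.add[OF add.IH] by (simp add: algebra_simps)
qed

lemma exp_span_continuous: "f \<in> exp_span \<Longrightarrow> continuous_on S f"
  by (induction rule: exp_span.induct) (auto intro!: continuous_intros)

lemma flux_density_exp_span: "f \<in> exp_span \<Longrightarrow> 0 < R \<Longrightarrow> flux_density R f"
  by (induction rule: exp_span.induct) (auto intro: flux_density_exp flux_density_scale flux_density_add)

lemma flux_density_continuous:
  fixes g :: "'a::euclidean_space \<Rightarrow> real"
  assumes R: "0 < R" and g: "continuous_on (sphere 0 R) g"
  shows "flux_density R g"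
proof (rule flux_density_approx)
  fix r :: real assume r: "0 < r"
  interpret function_ring_on "exp_span :: ('a \<Rightarrow> real) set" "sphere 0 R"
  proof
    show "(\<lambda>_. c) \<in> (exp_span :: ('a \<Rightarrow> real) set)" for c using exp_span.scale[OF exp_span.exp[of 0], of c] by simp
    \<comment> \<open>The direction \<open>x - y\<close> separates the two points: the exponents
      differ by the square of their distance.\<close>
    show "\<exists>f\<in>exp_span. f x \<noteq> f y" if "x \<noteq> y" for x y :: 'a
    proof (rule bexI[of _ "\<lambda>z. exp ((x - y) \<bullet> z)"])
      have "(x - y) \<bullet> x \<noteq> (x - y) \<bullet> y" using that by (metis inner_diff_right inner_eq_zero_iff right_minus_eq)
      then show "exp ((x - y) \<bullet> x) \<noteq> exp ((x - y) \<bullet> y)" by simp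
    qed (rule exp_span.exp)
  qed (auto intro: exp_span_continuous exp_span_mult exp_span.add)
  obtain f where "f \<in> exp_span" "\<forall>x\<in>sphere 0 R. \<bar>g x - f x\<bar> < r" using Stone_Weierstrass_basic[OF g r] by blast
  then show "\<exists>f. flux_density R f \<and> (\<forall>x\<in>sphere 0 R. \<bar>f x - g x\<bar> \<le> r)"
    using flux_density_exp_span[OF _ R] by (metis abs_minus_commute less_imp_le)
qed

section \<open>The divergence theorem on radial graphs\<close>

context radial_graph
begin

lemma zero_in_D: "0 \<in> D" using \<rho>_pos[of 0] by (simp add: D_eq)

lemma ray_in_D: "norm n = 1 \<Longrightarrow> 0 \<le> r \<Longrightarrow> r *\<^sub>R n \<in> D \<longleftrightarrow> r < \<rho> n"
  using \<rho>_pos[of 0] \<rho>_pos[of n] by (cases "r = 0") (auto simp: D_eq sgn_scaleR sgn_div_norm)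

lemma D_borel [measurable]: "D \<in> sets borel" using open_D by simp

lemma norm_D: "x \<in> D \<Longrightarrow> norm x < r1" using \<rho>_bounds(2)[of "sgn x"] by (simp add: D_eq)

lemma r1_pos: "0 < r1" using \<rho>_pos[of 0] \<rho>_bounds(2)[of 0] by simp

lemma D_finite: "emeasure lborel D < \<infinity>"
proof -
  have "emeasure lborel D \<le> emeasure lborel (ball (0::'a) r1)" using norm_D by (intro emeasure_mono) auto
  also have "\<dots> < \<infinity>" using r1_pos by (simp add: emeasure_ball)
  finally show ?thesis .
qed

lemma set_integrable_D_bounded:
  fixes f :: "'a \<Rightarrow> real"
  assumes "f \<in> borel_measurable borel" "\<And>x. x \<in> D \<Longrightarrow> \<bar>f x\<bar> \<le> M"
  shows "set_integrable lborel D f"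
  unfolding set_integrable_def
proof (rule integrableI_bounded_set[where A = D and B = M])
  show "(\<lambda>x. indicator D x *\<^sub>R f x) \<in> borel_measurable lborel" using assms(1) by simp
qed (use assms D_finite in \<open>auto simp: indicator_def\<close>)

definition ray :: "('a \<Rightarrow> real) \<Rightarrow> 'a \<Rightarrow> real" where
  "ray f n = (LINT r|radial_measure DIM('a). indicator D (r *\<^sub>R n) * f (r *\<^sub>R n))"

lemma integral_ray:
  assumes "set_integrable lborel D f"
  shows "integrable cone_measure (ray f)" "(LINT x:D|lborel. f x) = (LINT n|cone_measure. ray f n)"
  using integral_polar(2,3)[of "\<lambda>x. indicator D x * f x"] assms
  unfolding set_integrable_def set_lebesgue_integral_def ray_def by simp_all

lemma ray_eq:
  assumes [measurable]: "f \<in> borel_measurable borel" and n: "norm n = 1"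
  shows "ray f n = (LINT r:{0..<\<rho> n}|lborel. r ^ m * f (r *\<^sub>R n))"
proof -
  have rm: "radial_measure DIM('a) = density lborel (\<lambda>r. ennreal (r ^ m * indicator {0..} r))"
    unfolding radial_measure_def m_def by (intro arg_cong[where f = "density lborel"] ext) (auto simp: indicator_def)
  have "ray f n = (LINT r|lborel. (r ^ m * indicator {0..} r) *\<^sub>R (indicator D (r *\<^sub>R n) * f (r *\<^sub>R n)))"
    unfolding ray_def rm by (intro integral_density) (auto simp: indicator_def)
  also have "\<dots> = (LINT r:{0..<\<rho> n}|lborel. r ^ m * f (r *\<^sub>R n))"
    unfolding set_lebesgue_integral_def
    by (intro Bochner_Integration.integral_cong) (auto simp: indicator_def ray_in_D[OF n])
  finally show ?thesis .
qed

lemma integral_cone_cong: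
  fixes f g :: "'a \<Rightarrow> real"
  assumes "f \<in> borel_measurable borel" "g \<in> borel_measurable borel" "\<And>n. norm n = 1 \<Longrightarrow> f n = g n"
  shows "(LINT n|cone_measure. f n) = (LINT n|cone_measure. g n)"
  using assms AE_cone_measure by (intro integral_cong_AE) (auto elim: eventually_mono)

lemma integral_cone_mono:
  fixes f g :: "'a \<Rightarrow> real"
  assumes "integrable cone_measure f" "integrable cone_measure g" "\<And>n. norm n = 1 \<Longrightarrow> f n \<le> g n"
  shows "(LINT n|cone_measure. f n) \<le> (LINT n|cone_measure. g n)"
  using assms AE_cone_measure by (intro integral_mono_AE) (auto elim: eventually_mono)

lemma integrable_cone_bounded:
  fixes f :: "'a \<Rightarrow> real"
  assumes "f \<in> borel_measurable borel" "\<And>n. norm n = 1 \<Longrightarrow> \<bar>f n\<bar> \<le> M"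
  shows "integrable cone_measure f"
proof -
  interpret finite_measure "cone_measure :: 'a measure" by (rule finite_measure_cone_measure)
  show ?thesis using assms AE_cone_measure by (intro integrable_const_bound[where B = M]) (auto elim: eventually_mono)
qed

text \<open>The fundamental theorem of calculus along each ray, followed by polar coordinates. For a
  radial field the boundary enters only through the end point \<open>\<rho> n\<close> of the ray, so
  the formula is exact.\<close>

lemma radial_divergence:
  fixes f g :: "'a \<Rightarrow> real"
  assumes f: "f \<in> borel_measurable borel" "\<And>x. x \<in> D \<Longrightarrow> \<bar>f x\<bar> \<le> M"
    and g: "g \<in> borel_measurable borel"
    and G: "\<And>n. norm n = 1 \<Longrightarrow> continuous_on {0..\<rho> n} (G n)" "\<And>n. norm n = 1 \<Longrightarrow> G n 0 = 0"
      "\<And>n. norm n = 1 \<Longrightarrow> G n (\<rho> n) = g n"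
      "\<And>n r. norm n = 1 \<Longrightarrow> 0 < r \<Longrightarrow> r < \<rho> n \<Longrightarrow> (G n has_real_derivative r ^ m * f (r *\<^sub>R n)) (at r)"
  shows "(LINT x:D|lborel. f x) = (LINT n|cone_measure. g n)"
proof -
  have int: "set_integrable lborel D f" by (rule set_integrable_D_bounded[OF f])
  have "ray f n = g n" if n: "norm n = 1" for n
  proof -
    let ?F = "\<lambda>r. r ^ m * f (r *\<^sub>R n)"
    note f(1)[measurable]
    have M0: "0 \<le> M" using f(2)[OF zero_in_D] by simp
    have "set_integrable lborel {0..<\<rho> n} ?F" unfolding set_integrable_def
    proof (rule integrableI_bounded_set[where A = "{0..<\<rho> n}" and B = "r1 ^ m * M"])
      show "AE r in lborel. r \<in> {0..<\<rho> n} \<longrightarrow> norm (indicator {0..<\<rho> n} r *\<^sub>R ?F r) \<le> r1 ^ m * M"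
      proof (intro always_eventually allI impI)
        fix r assume r: "r \<in> {0..<\<rho> n}"
        then have "r *\<^sub>R n \<in> D" using ray_in_D[OF n] by auto
        then have "r ^ m * \<bar>f (r *\<^sub>R n)\<bar> \<le> r1 ^ m * M"
          using r \<rho>_bounds(2)[of n] r1_pos f(2) by (intro mult_mono power_mono) auto
        then show "norm (indicator {0..<\<rho> n} r *\<^sub>R ?F r) \<le> r1 ^ m * M" using r by (simp add: abs_mult)
      qed
      show "emeasure lborel {0..<\<rho> n} < \<infinity>" using \<rho>_pos[of n] by simp
    qed auto
    then have "ray f n = integral {0..<\<rho> n} ?F" unfolding ray_eq[OF f(1) n] by (rule set_borel_integral_eq_integral)
    also have "\<dots> = integral {0..\<rho> n} ?F"
      by (rule integral_spike_set) (auto intro: negligible_subset[of "{\<rho> n}"])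
    also have "(?F has_integral G n (\<rho> n) - G n 0) {0..\<rho> n}"
      using \<rho>_pos[of n] G(1,4)[OF n] by (intro fundamental_theorem_of_calculus_interior)
         (auto simp: has_real_derivative_iff_has_vector_derivative[symmetric])
    then have "integral {0..\<rho> n} ?F = g n" using G(2,3)[OF n] by (simp add: integral_unique)
    finally show ?thesis .
  qed
  then show ?thesis unfolding integral_ray(2)[OF int] using g borel_measurable_integrable[OF integral_ray(1)[OF int]]
    by (intro integral_cone_cong) auto
qed

end

section \<open>The divergence theorem by translation, with an error proportional to the Lipschitz
  constant\<close>

lemma compact_abs_bounded:
  fixes f :: "'a::topological_space \<Rightarrow> real"
  assumes "compact K" "continuous_on K f"
  shows "\<exists>M. \<forall>x\<in>K. \<bar>f x\<bar> \<le> M"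
  using compact_imp_bounded[OF compact_continuous_image[OF assms(2,1)]] by (simp add: bounded_iff)

text \<open>On the half-line, \<open>A\<close> is the interval up to \<open>s\<close> except in a
  window of half-width \<open>E\<close>, and near the jump \<open>q\<close> is constant up to
  \<open>w\<close>. The signed difference of the intervals up to \<open>s\<close> and up to \<rho>
  has integral \<open>s - \<rho>\<close>.\<close>

lemma integral_near_jump:
  fixes q :: "real \<Rightarrow> real"
  assumes q: "q \<in> borel_measurable borel" "\<And>r. r \<in> {0..B} \<Longrightarrow> \<bar>q r\<bar> \<le> M"
    and A[measurable]: "A \<in> sets borel"
    and A_in: "\<And>r. 0 \<le> r \<Longrightarrow> r < s - E \<Longrightarrow> r \<in> A" and A_out: "\<And>r. 0 \<le> r \<Longrightarrow> s + E \<le> r \<Longrightarrow> r \<notin> A"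
    and h: "\<bar>s - \<rho>\<bar> \<le> h" "0 \<le> E" "0 \<le> \<rho> - h - E" "\<rho> + h + E \<le> B"
    and w: "\<And>r. \<bar>r - \<rho>\<bar> \<le> h + E \<Longrightarrow> \<bar>q r - q \<rho>\<bar> \<le> w"
  shows "\<bar>(LINT r|lborel. indicator {0..} r * (indicator A r - indicator {..<\<rho>} r) * q r) - q \<rho> * (s - \<rho>)\<bar>
    \<le> 2 * E * \<bar>q \<rho>\<bar> + 2 * (h + E) * w"
proof -
  note q(1)[measurable]
  let ?f = "\<lambda>r. indicator {0..} r * (indicator A r - indicator {..<\<rho>} r) * q r :: real"
  let ?g = "\<lambda>r. q \<rho> * (indicator {0..<s} r - indicator {0..<\<rho>} r) :: real"
  let ?b = "\<lambda>r. \<bar>q \<rho>\<bar> * indicator {s - E..s + E} r + w * indicator {\<rho> - h - E..\<rho> + h + E} r :: real"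
  have s: "0 \<le> s - E" "s + E \<le> B" using h by auto
  have w0: "0 \<le> w" using w[of \<rho>] h by auto
  have B0: "0 \<le> B" using h by linarith
  have fB: "?f r = 0" if "r \<notin> {0..B}" for r using that A_out[of r] s h by (auto simp: indicator_def)
  have intf: "integrable lborel ?f"
  proof (rule integrableI_bounded_set[where A = "{0..B}" and B = M])
    show "AE r in lborel. r \<in> {0..B} \<longrightarrow> norm (?f r) \<le> M"
      using q(2) B0 by (intro always_eventually allI impI) (fastforce simp: indicator_def)
    show "AE r in lborel. r \<notin> {0..B} \<longrightarrow> ?f r = 0" using fB by (intro always_eventually allI impI) auto
  qed (use B0 in auto)
  have intg: "integrable lborel ?g" and intb: "integrable lborel ?b"
    using h s by (auto intro!: integrable_mult_right Bochner_Integration.integrable_diff Bochner_Integration.integrable_add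
        integrable_real_indicator simp: emeasure_lborel_Icc_eq)
  have "(LINT r|lborel. indicator {0..<s} r - indicator {0..<\<rho>} r :: real) = s - \<rho>"
    using h s by (subst Bochner_Integration.integral_diff) (auto intro!: integrable_real_indicator)
  then have "(LINT r|lborel. ?g r) = q \<rho> * (s - \<rho>)" by simp
  then have "\<bar>(LINT r|lborel. ?f r) - q \<rho> * (s - \<rho>)\<bar> = \<bar>LINT r|lborel. ?f r - ?g r\<bar>"
    by (simp only: Bochner_Integration.integral_diff[OF intf intg])
  also have "\<dots> \<le> (LINT r|lborel. \<bar>?f r - ?g r\<bar>)"
    by (rule integral_abs_bound)
  also have "\<dots> \<le> (LINT r|lborel. ?b r)"
  proof (rule integral_mono[OF integrable_abs[OF Bochner_Integration.integrable_diff[OF intf intg]] intb])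
    fix r
    show "\<bar>?f r - ?g r\<bar> \<le> ?b r"
    proof (cases "0 \<le> r")
      case False
      then show ?thesis using w0 by (auto simp: indicator_def)
    next
      case True
      define a b c where "a = (indicator A r :: real)" and "b = (indicator {..<\<rho>} r :: real)"
        and "c = (indicator {0..<s} r :: real)"
      have i: "indicator {0..} r = (1 :: real)" "indicator {0..<\<rho>} r = b"
        using True by (simp_all add: b_def indicator_def)
      have split: "?f r - ?g r = q \<rho> * (a - c) + (a - b) * (q r - q \<rho>)"
        unfolding i a_def[symmetric] b_def[symmetric] c_def[symmetric] by (simp add: algebra_simps)
      have 1: "\<bar>a - c\<bar> \<le> indicator {s - E..s + E} r"
      proof -
        consider "r < s - E" | "s + E \<le> r" | "r \<in> {s - E..s + E}" by fastforce
        then show ?thesis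
        proof cases
          case 1
          then have "r \<in> A" using A_in True by blast
          moreover have "r \<in> {0..<s}" using 1 True h by auto
          ultimately show ?thesis by (simp add: a_def c_def)
        next
          case 2
          then have "r \<notin> A" using A_out True by blast
          moreover have "r \<notin> {0..<s}" using 2 h by auto
          ultimately show ?thesis by (simp add: a_def c_def)
        qed (auto simp: a_def c_def indicator_def)
      qed
      have 2: "\<bar>(a - b) * (q r - q \<rho>)\<bar> \<le> w * indicator {\<rho> - h - E..\<rho> + h + E} r"
      proof (cases "r \<in> {\<rho> - h - E..\<rho> + h + E}")
        case True
        then have "\<bar>q r - q \<rho>\<bar> \<le> w" by (intro w) (auto simp: abs_le_iff)
        moreover have "\<bar>a - b\<bar> \<le> 1" by (auto simp: a_def b_def indicator_def)
        ultimately have "\<bar>a - b\<bar> * \<bar>q r - q \<rho>\<bar> \<le> 1 * w" by (intro mult_mono) auto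
        then show ?thesis using True by (simp add: abs_mult)
      next
        case False
        then have "(r < \<rho> \<and> r < s - E) \<or> (\<not> r < \<rho> \<and> s + E \<le> r)" using h by auto
        then have "(r < \<rho> \<and> r \<in> A) \<or> (\<not> r < \<rho> \<and> r \<notin> A)" using \<open>0 \<le> r\<close> A_in[of r] A_out[of r] by blast
        then have "a = b" by (auto simp: a_def b_def)
        then show ?thesis using w0 by (simp add: indicator_def)
      qed
      have "\<bar>?f r - ?g r\<bar> \<le> \<bar>q \<rho>\<bar> * \<bar>a - c\<bar> + \<bar>(a - b) * (q r - q \<rho>)\<bar>"
        unfolding split abs_mult[symmetric] by (rule abs_triangle_ineq)
      also have "\<dots> \<le> ?b r" using 1 2 by (intro add_mono mult_left_mono) auto
      finally show ?thesis .
    qed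
  qed
  also have "(LINT r|lborel. ?b r) = 2 * E * \<bar>q \<rho>\<bar> + 2 * (h + E) * w"
    using h by (subst Bochner_Integration.integral_add) (auto simp: algebra_simps)
  finally show ?thesis .
qed

context radial_graph
begin

text \<open>The ray in direction \<open>n\<close> leaves the translate of \<open>D\<close> near
  radius \<open>\<rho> n + h * (e \<bullet> n)\<close>. In \<open>E\<close>, the term with
  \<open>L\<close> comes from the change of direction under the translation, at most
  \<open>4 * h / r0\<close>; the quadratic term is the excess of the norm over the radial
  component.\<close>

lemma translated_ray:
  assumes n: "norm n = 1" and e: "norm e = 1" and h: "0 < h" "h \<le> r0 / 4" and r: "0 \<le> r"
  defines "E \<equiv> 4 * L * h / r0 + 4 * h\<^sup>2 / r0"
  shows "r < \<rho> n + h * (e \<bullet> n) - E \<Longrightarrow> r *\<^sub>R n - h *\<^sub>R e \<in> D"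
    and "\<rho> n + h * (e \<bullet> n) + E \<le> r \<Longrightarrow> r *\<^sub>R n - h *\<^sub>R e \<notin> D"
proof -
  define y where "y = r *\<^sub>R n - h *\<^sub>R e"
  have et: "\<bar>e \<bullet> n\<bar> \<le> 1" using Cauchy_Schwarz_ineq2[of e n] e n by simp
  have het: "\<bar>h * (e \<bullet> n)\<bar> \<le> h" using et h by (simp add: abs_mult mult_left_le)
  have E0: "0 \<le> E" using h r0_pos lip_nonneg by (simp add: E_def)
  have ineq: "r - h * (e \<bullet> n) \<le> norm y" "norm y \<le> r - h * (e \<bullet> n) + 4 * h\<^sup>2 / r0"
    "\<bar>\<rho> (sgn y) - \<rho> n\<bar> \<le> 4 * L * h / r0" if r2: "r0 / 2 < r"
  proof -
    define d where "d = r - h * (e \<bullet> n)"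
    have d: "r0 / 4 < d" using r2 het h unfolding d_def by linarith
    have "n \<bullet> n = 1" "e \<bullet> e = 1" using n e by (simp_all add: dot_square_norm)
    then have ny: "(norm y)\<^sup>2 = d\<^sup>2 + h\<^sup>2 * (1 - (e \<bullet> n)\<^sup>2)" unfolding y_def d_def power2_norm_eq_inner
      by (simp add: inner_diff_left inner_diff_right inner_commute power2_eq_square algebra_simps)
    have e2: "(e \<bullet> n)\<^sup>2 \<le> 1" using et by (simp add: abs_square_le_1)
    have "d\<^sup>2 \<le> (norm y)\<^sup>2" unfolding ny using e2 by simp
    then have dn: "d \<le> norm y" by (rule power2_le_imp_le) simp
    then show "r - h * (e \<bullet> n) \<le> norm y" by (simp add: d_def)
    have "(norm y)\<^sup>2 \<le> d\<^sup>2 + h\<^sup>2" unfolding ny using e2 by (simp add: mult_left_le)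
    \<comment> \<open>Completes the square, using that \<open>d\<close> exceeds
      \<open>r0 / 4\<close>.\<close>
    also have "\<dots> \<le> (d + 4 * h\<^sup>2 / r0)\<^sup>2"
    proof -
      have "h\<^sup>2 = 2 * (r0 / 8) * (4 * h\<^sup>2 / r0)" using r0_pos by simp
      also have "\<dots> \<le> 2 * d * (4 * h\<^sup>2 / r0)" using d r0_pos by (intro mult_right_mono) auto
      finally have "h\<^sup>2 \<le> 2 * d * (4 * h\<^sup>2 / r0)" .
      moreover have "(d + 4 * h\<^sup>2 / r0)\<^sup>2 = d\<^sup>2 + (4 * h\<^sup>2 / r0)\<^sup>2 + 2 * d * (4 * h\<^sup>2 / r0)" by (rule power2_sum)
      ultimately show ?thesis using zero_le_power2[of "4 * h\<^sup>2 / r0"] by linarith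
    qed
    finally have sq: "(norm y)\<^sup>2 \<le> (d + 4 * h\<^sup>2 / r0)\<^sup>2" .
    have "0 \<le> d" "0 \<le> 4 * h\<^sup>2 / r0" using d r0_pos by simp_all
    then have "norm y \<le> d + 4 * h\<^sup>2 / r0" by (intro power2_le_imp_le[OF sq] add_nonneg_nonneg)
    then show "norm y \<le> r - h * (e \<bullet> n) + 4 * h\<^sup>2 / r0" by (simp add: d_def)
    have y0: "y \<noteq> 0" using dn d r0_pos by auto
    have "dist (sgn y) n \<le> 4 * h / r0"
    proof -
      have "norm y *\<^sub>R sgn y = y" by (rule norm_scaleR_sgn)
      have "r *\<^sub>R (sgn y - n) = (r - norm y) *\<^sub>R sgn y - h *\<^sub>R e"
        using norm_scaleR_sgn[of y] by (simp add: y_def algebra_simps)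
      then have "r * norm (sgn y - n) \<le> norm ((r - norm y) *\<^sub>R sgn y) + norm (h *\<^sub>R e)"
        using r by (metis abs_of_nonneg norm_scaleR norm_triangle_ineq4)
      also have "norm ((r - norm y) *\<^sub>R sgn y) \<le> h"
      proof -
        have "\<bar>norm (r *\<^sub>R n) - norm y\<bar> \<le> norm (r *\<^sub>R n - y)" by (rule norm_triangle_ineq3)
        then show ?thesis using y0 r n e h by (simp add: y_def norm_sgn)
      qed
      finally have "r * norm (sgn y - n) \<le> 2 * h" using e h by simp
      moreover have "r0 / 2 * norm (sgn y - n) \<le> r * norm (sgn y - n)" using r2 by (intro mult_right_mono) auto
      ultimately show ?thesis using r0_pos by (simp add: dist_norm field_simps)
    qed
    then have "L * dist (sgn y) n \<le> 4 * L * h / r0"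
      using mult_left_mono[OF _ lip_nonneg, of "dist (sgn y) n" "4 * h / r0"] by (simp add: mult_ac)
    then show "\<bar>\<rho> (sgn y) - \<rho> n\<bar> \<le> 4 * L * h / r0" using \<rho>_lip[of "sgn y" n] y0 n by (simp add: norm_sgn)
  qed
  show "r *\<^sub>R n - h *\<^sub>R e \<in> D" if "r < \<rho> n + h * (e \<bullet> n) - E"
  proof (cases "r0 / 2 < r")
    case True
    have "norm y < \<rho> (sgn y)" using ineq[OF True] that by (auto simp: E_def)
    then show ?thesis by (simp add: D_eq y_def)
  next
    case False
    have "norm y \<le> r + h" using norm_triangle_ineq4[of "r *\<^sub>R n" "h *\<^sub>R e"] n e r h by (simp add: y_def)
    also have "\<dots> < r0" using False h r0_pos by simp
    also have "\<dots> \<le> \<rho> (sgn y)" by (rule \<rho>_bounds)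
    finally show ?thesis by (simp add: D_eq y_def)
  qed
  show "r *\<^sub>R n - h *\<^sub>R e \<notin> D" if "\<rho> n + h * (e \<bullet> n) + E \<le> r"
  proof -
    have "r0 / 2 < r" using that het E0 h \<rho>_bounds(1)[of n] r0_pos by linarith
    from ineq[OF this] that have "\<rho> (sgn y) \<le> norm y" using h r0_pos by (auto simp: E_def)
    then show ?thesis by (simp add: D_eq y_def)
  qed
qed

text \<open>The difference quotient of \<phi> in direction \<open>e\<close>, integrated over
  \<open>D\<close>, is an integral of \<phi> over the layer between \<open>D\<close> and its
  translate, divided by the step \<open>h\<close>. Along each ray the layer has width close to
  \<open>h * (e \<bullet> n)\<close>. The radial direction in place of the true normal costs
  \<open>4 * L / r0\<close> on either side of the crossing point.\<close>

lemma translation_divergence: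
  fixes \<phi> :: "'a \<Rightarrow> real"
  assumes \<phi>: "\<And>x. (\<phi> has_derivative \<phi>' x) (at x)" and \<phi>': "continuous_on UNIV (\<lambda>x. \<phi>' x e)"
    and e: "norm e = 1"
  shows "\<bar>(LINT x:D|lborel. \<phi>' x e) - (LINT n|cone_measure. \<phi> (graph_map n) * (e \<bullet> n) * \<rho> n ^ m)\<bar>
    \<le> 8 * L / r0 * (LINT n|cone_measure. \<bar>\<phi> (graph_map n)\<bar> * \<rho> n ^ m)"
proof -
  have \<phi>c: "continuous_on UNIV \<phi>" by (rule has_derivative_continuous_on) (use \<phi> in simp)
  have [measurable]: "\<phi> \<in> borel_measurable borel" "(\<lambda>x. \<phi>' x e) \<in> borel_measurable borel"
    using \<phi>c \<phi>' by (auto intro: borel_measurable_continuous_onI)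
  define B where "B = r1 + 1"
  have B: "0 < B" using r1_pos by (simp add: B_def)
  let ?K = "cball (0::'a) B"
  obtain M' where M': "\<And>x. x \<in> ?K \<Longrightarrow> \<bar>\<phi>' x e\<bar> \<le> M'"
    using compact_abs_bounded[OF compact_cball continuous_on_subset[OF \<phi>' subset_UNIV]] by metis
  obtain M where M: "\<And>x. x \<in> ?K \<Longrightarrow> \<bar>\<phi> x\<bar> \<le> M"
    using compact_abs_bounded[OF compact_cball continuous_on_subset[OF \<phi>c subset_UNIV]] by metis
  \<comment> \<open>Includes the Jacobian of polar coordinates, so that the one-dimensional layer
    estimate applies directly.\<close>
  define g where "g x = norm x ^ m * \<phi> x" for x
  have gc: "continuous_on ?K g" unfolding g_def by (intro continuous_intros continuous_on_subset[OF \<phi>c]) auto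
  have gu: "uniformly_continuous_on ?K g" by (rule compact_uniformly_continuous[OF gc]) simp
  have [measurable]: "g \<in> borel_measurable borel" unfolding g_def by measurable
  have gM: "\<bar>g x\<bar> \<le> B ^ m * M" if "x \<in> ?K" for x
    using M[OF that] that B by (auto simp: g_def abs_mult intro!: mult_mono power_mono)
  have gK: "graph_map n \<in> ?K" if "norm n = 1" for n
    using norm_graph_map[OF that] \<rho>_bounds(2)[of n] by (simp add: B_def)
  have gg: "g (graph_map n) = \<phi> (graph_map n) * \<rho> n ^ m" if "norm n = 1" for n
    using norm_graph_map[OF that] by (simp add: g_def)
  interpret c: finite_measure "cone_measure :: 'a measure" by (rule finite_measure_cone_measure)
  define T where "T = measure (cone_measure :: 'a measure) UNIV"
  have et: "\<bar>e \<bullet> n\<bar> \<le> 1" if "norm n = 1" for n using Cauchy_Schwarz_ineq2[of e n] e that by simp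
  define S1 where "S1 = (LINT n|cone_measure. g (graph_map n) * (e \<bullet> n))"
  define S2 where "S2 = (LINT n|cone_measure. \<bar>g (graph_map n)\<bar>)"
  have i1: "integrable cone_measure (\<lambda>n. g (graph_map n) * (e \<bullet> n))"
  proof (rule integrable_cone_bounded[where M = "B ^ m * M"])
    show "\<bar>g (graph_map n) * (e \<bullet> n)\<bar> \<le> B ^ m * M" if "norm n = 1" for n
      using gM[OF gK[OF that]] et[OF that] mult_mono[of "\<bar>g (graph_map n)\<bar>" "B ^ m * M" "\<bar>e \<bullet> n\<bar>" 1]
      by (auto simp: abs_mult)
  qed (measurable)
  have i2: "integrable cone_measure (\<lambda>n. \<bar>g (graph_map n)\<bar>)"
    by (rule integrable_cone_bounded[where M = "B ^ m * M"]) (use gM gK in auto)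
  have S1: "(LINT n|cone_measure. \<phi> (graph_map n) * (e \<bullet> n) * \<rho> n ^ m) = S1"
    unfolding S1_def by (rule integral_cone_cong) (auto simp: gg)
  have S2: "(LINT n|cone_measure. \<bar>\<phi> (graph_map n)\<bar> * \<rho> n ^ m) = S2"
    unfolding S2_def using less_imp_le[OF \<rho>_pos] by (intro integral_cone_cong) (auto simp: gg abs_mult)
  define I where "I h = (LINT x:D|lborel. (\<phi> (x + h *\<^sub>R e) - \<phi> x) / h)" for h
  define E where "E h = 4 * L * h / r0 + 4 * h\<^sup>2 / r0" for h
  have E0: "0 \<le> E h" if "0 < h" for h using that r0_pos lip_nonneg by (simp add: E_def)
  have quot: "\<bar>(\<phi> (x + h *\<^sub>R e) - \<phi> x) / h\<bar> \<le> M'" if x: "x \<in> D" and h: "0 < h" "h \<le> 1" for x h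
  proof -
    have seg: "x + s *\<^sub>R e \<in> ?K" if "0 \<le> s" "s \<le> h" for s
      using norm_triangle_ineq[of x "s *\<^sub>R e"] norm_D[OF x] that h e by (simp add: B_def)
    have d: "((\<lambda>s. \<phi> (x + s *\<^sub>R e)) has_real_derivative \<phi>' (x + s *\<^sub>R e) e) (at s)" for s
    proof -
      have "((\<lambda>s. x + s *\<^sub>R e) has_derivative (\<lambda>s. s *\<^sub>R e)) (at s)" by (auto intro!: derivative_eq_intros)
      from has_derivative_compose[OF this \<phi>] have "((\<lambda>s. \<phi> (x + s *\<^sub>R e)) has_derivative (\<lambda>t. \<phi>' (x + s *\<^sub>R e) (t *\<^sub>R e))) (at s)" .
      moreover have "\<phi>' (x + s *\<^sub>R e) (t *\<^sub>R e) = \<phi>' (x + s *\<^sub>R e) e * t" for t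
        using linear_scale[OF has_derivative_linear[OF \<phi>]] by simp
      ultimately show ?thesis by (simp add: has_field_derivative_def)
    qed
    obtain s where s: "0 < s" "s < h" "\<phi> (x + h *\<^sub>R e) - \<phi> (x + 0 *\<^sub>R e) = (h - 0) * \<phi>' (x + s *\<^sub>R e) e"
      using MVT2[OF h(1), of "\<lambda>s. \<phi> (x + s *\<^sub>R e)" "\<lambda>s. \<phi>' (x + s *\<^sub>R e) e"] d by blast
    then have "(\<phi> (x + h *\<^sub>R e) - \<phi> x) / h = \<phi>' (x + s *\<^sub>R e) e" using h by simp
    then show ?thesis using M'[OF seg[of s]] s by simp
  qed
  have I_lim: "(\<lambda>k. I (h k)) \<longlonglongrightarrow> (LINT x:D|lborel. \<phi>' x e)" if h: "\<And>k. 0 < h k" "\<And>k. h k \<le> 1" "h \<longlonglongrightarrow> 0" for h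
    unfolding I_def set_lebesgue_integral_def
  proof (rule integral_dominated_convergence[where w = "\<lambda>x. indicator D x * M'"])
    show "integrable lborel (\<lambda>x. indicator D x * M')"
      using set_integrable_D_bounded[of "\<lambda>_. M'" "\<bar>M'\<bar>"] by (simp add: set_integrable_def)
    show "AE x in lborel. norm (indicator D x *\<^sub>R ((\<phi> (x + h k *\<^sub>R e) - \<phi> x) / h k)) \<le> indicator D x * M'" for k
    proof (intro always_eventually allI)
      fix x
      show "norm (indicator D x *\<^sub>R ((\<phi> (x + h k *\<^sub>R e) - \<phi> x) / h k)) \<le> indicator D x * M'"
        using quot[of x "h k"] h(1,2)[of k] by (cases "x \<in> D") simp_all
    qed
    show "AE x in lborel. (\<lambda>k. indicator D x *\<^sub>R ((\<phi> (x + h k *\<^sub>R e) - \<phi> x) / h k)) \<longlonglongrightarrow> indicator D x *\<^sub>R \<phi>' x e"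
    proof (intro always_eventually allI tendsto_scaleR tendsto_const)
      fix x
      have "((\<lambda>s. x + s *\<^sub>R e) has_derivative (\<lambda>s. s *\<^sub>R e)) (at 0)" by (auto intro!: derivative_eq_intros)
      from has_derivative_compose[OF this, of \<phi> "\<phi>' x"] \<phi>[of x]
      have "((\<lambda>s. \<phi> (x + s *\<^sub>R e)) has_derivative (\<lambda>t. \<phi>' x (t *\<^sub>R e))) (at 0)" by simp
      moreover have "\<phi>' x (t *\<^sub>R e) = \<phi>' x e * t" for t using linear_scale[OF has_derivative_linear[OF \<phi>]] by simp
      ultimately have "((\<lambda>s. \<phi> (x + s *\<^sub>R e)) has_real_derivative \<phi>' x e) (at 0)"
        by (simp add: has_field_derivative_def)
      then have "((\<lambda>s. (\<phi> (x + s *\<^sub>R e) - \<phi> x) / s) \<longlongrightarrow> \<phi>' x e) (at 0)" by (simp add: has_field_derivative_iff)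
      moreover have "filterlim h (at 0) sequentially"
        using h(1,3) unfolding filterlim_at by (auto intro!: always_eventually simp: less_imp_neq[symmetric])
      ultimately show "(\<lambda>k. (\<phi> (x + h k *\<^sub>R e) - \<phi> x) / h k) \<longlonglongrightarrow> \<phi>' x e"
        by (rule filterlim_compose)
    qed
  qed (measurable)
  \<comment> \<open>Estimate for a fixed step \<open>h\<close>; \<open>w\<close> is the oscillation
    of \<open>g\<close> at the scale of the layer and tends to 0 at the end.\<close>
  have main: "\<bar>I h - S1\<bar> \<le> 2 * (E h / h) * S2 + 2 * (1 + E h / h) * w * T"
    if h: "0 < h" "h \<le> r0 / 4" "h + E h \<le> r0" "h + E h \<le> 1" "h \<le> 1"
      and w: "\<And>x y. x \<in> ?K \<Longrightarrow> y \<in> ?K \<Longrightarrow> dist x y \<le> h + E h \<Longrightarrow> \<bar>g x - g y\<bar> \<le> w" for h w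
  proof -
    define f where "f y = (indicator D (y - h *\<^sub>R e) - indicator D y) * \<phi> y" for y
    have [measurable]: "(\<lambda>y. y - h *\<^sub>R e) \<in> borel_measurable borel" by measurable
    have shK: "y \<in> ?K" if "y - h *\<^sub>R e \<in> D" for y
      using norm_triangle_ineq[of "y - h *\<^sub>R e" "h *\<^sub>R e"] norm_D[OF that] h e by (simp add: B_def)
    have DK: "y \<in> ?K" if "y \<in> D" for y using norm_D[OF that] by (simp add: B_def)
    have inta: "integrable lborel (\<lambda>y. indicator D (y - h *\<^sub>R e) * \<phi> y)"
    proof (rule integrableI_bounded_set[where A = ?K and B = M])
      show "emeasure lborel ?K < \<infinity>" using B by (simp add: emeasure_cball)
      show "AE x in lborel. x \<in> ?K \<longrightarrow> norm (indicator D (x - h *\<^sub>R e) * \<phi> x) \<le> M"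
      proof (intro always_eventually allI impI)
        fix x assume x: "x \<in> ?K"
        show "norm (indicator D (x - h *\<^sub>R e) * \<phi> x) \<le> M"
          using M[OF x] abs_ge_zero[of "\<phi> x"] by (cases "x - h *\<^sub>R e \<in> D") simp_all
      qed
      show "AE x in lborel. x \<notin> ?K \<longrightarrow> indicator D (x - h *\<^sub>R e) * \<phi> x = 0"
      proof (intro always_eventually allI impI)
        fix x assume "x \<notin> ?K"
        then show "indicator D (x - h *\<^sub>R e) * \<phi> x = 0" using shK[of x] by (cases "x - h *\<^sub>R e \<in> D") simp_all
      qed
    qed auto
    have intb: "integrable lborel (\<lambda>y. indicator D y * \<phi> y)"
      using set_integrable_D_bounded[of \<phi> M] M DK by (simp add: set_integrable_def)
    have "(LINT x|lborel. indicator D x * \<phi> (x + h *\<^sub>R e)) = (LINT x|distr lborel borel ((+) (h *\<^sub>R e)). indicator D (x - h *\<^sub>R e) * \<phi> x)"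
      by (subst integral_distr) (auto simp: add.commute)
    also have "\<dots> = (LINT y|lborel. indicator D (y - h *\<^sub>R e) * \<phi> y)" by (simp add: lborel_distr_plus)
    finally have tr: "(LINT x|lborel. indicator D x * \<phi> (x + h *\<^sub>R e)) = (LINT y|lborel. indicator D (y - h *\<^sub>R e) * \<phi> y)" .
    have inta': "integrable lborel (\<lambda>x. indicator D x * \<phi> (x + h *\<^sub>R e))"
    proof (rule integrableI_bounded_set[where A = D and B = M])
      show "AE x in lborel. x \<in> D \<longrightarrow> norm (indicator D x * \<phi> (x + h *\<^sub>R e)) \<le> M"
      proof (intro always_eventually allI impI)
        fix x assume "x \<in> D"
        then show "norm (indicator D x * \<phi> (x + h *\<^sub>R e)) \<le> M" using M[OF shK[of "x + h *\<^sub>R e"]] by simp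
      qed
    qed (use D_finite in auto)
    have "h * I h = (LINT x|lborel. indicator D x * \<phi> (x + h *\<^sub>R e) - indicator D x * \<phi> x)"
    proof -
      have "(\<lambda>x. indicator D x *\<^sub>R ((\<phi> (x + h *\<^sub>R e) - \<phi> x) / h))
          = (\<lambda>x. (indicator D x * \<phi> (x + h *\<^sub>R e) - indicator D x * \<phi> x) / h)"
        by (simp add: fun_eq_iff right_diff_distrib diff_divide_distrib)
      then show ?thesis unfolding I_def set_lebesgue_integral_def using h by simp
    qed
    also have "\<dots> = (LINT y|lborel. f y)"
      using inta inta' intb by (simp add: tr f_def left_diff_distrib)
    finally have hI: "h * I h = (LINT y|lborel. f y)" .
    have intf: "integrable lborel f" unfolding f_def left_diff_distrib using inta intb by auto
    define J where "J n = (LINT r|radial_measure DIM('a). f (r *\<^sub>R n))" for n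
    have [measurable]: "f \<in> borel_measurable borel" unfolding f_def by measurable
    have J: "integrable cone_measure J" "h * I h = (LINT n|cone_measure. J n)"
      unfolding hI J_def using integral_polar[OF intf] by auto
    have est: "\<bar>J n - h * (g (graph_map n) * (e \<bullet> n))\<bar> \<le> 2 * E h * \<bar>g (graph_map n)\<bar> + 2 * (h + E h) * w"
      if n: "norm n = 1" for n
    proof -
      let ?q = "\<lambda>r. g (r *\<^sub>R n)" and ?A = "{r. r *\<^sub>R n - h *\<^sub>R e \<in> D}"
      have rm: "radial_measure DIM('a) = density lborel (\<lambda>r. ennreal (r ^ m * indicator {0..} r))"
        unfolding radial_measure_def m_def
        by (intro arg_cong[where f = "density lborel"] ext) (auto simp: indicator_def)
      have "J n = (LINT r|lborel. (r ^ m * indicator {0..} r) *\<^sub>R f (r *\<^sub>R n))"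
        unfolding J_def rm by (intro integral_density) (auto simp: indicator_def)
      also have "\<dots> = (LINT r|lborel. indicator {0..} r * (indicator ?A r - indicator {..<\<rho> n} r) * ?q r)"
        using n by (intro Bochner_Integration.integral_cong) (auto simp: indicator_def f_def g_def ray_in_D[OF n])
      finally have JJ: "J n = (LINT r|lborel. indicator {0..} r * (indicator ?A r - indicator {..<\<rho> n} r) * ?q r)" .
      have "\<bar>J n - ?q (\<rho> n) * (\<rho> n + h * (e \<bullet> n) - \<rho> n)\<bar> \<le> 2 * E h * \<bar>?q (\<rho> n)\<bar> + 2 * (h + E h) * w" unfolding JJ
      proof (rule integral_near_jump[where B = B and M = "B ^ m * M"])
        show "\<bar>g (r *\<^sub>R n)\<bar> \<le> B ^ m * M" if "r \<in> {0..B}" for r using that n by (intro gM) auto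
        show "?A \<in> sets borel" by measurable
        show "r \<in> ?A" if "0 \<le> r" "r < \<rho> n + h * (e \<bullet> n) - E h" for r
          using translated_ray(1)[OF n e h(1,2) that(1)] that(2) by (simp add: E_def)
        show "r \<notin> ?A" if "0 \<le> r" "\<rho> n + h * (e \<bullet> n) + E h \<le> r" for r
          using translated_ray(2)[OF n e h(1,2) that(1)] that(2) by (simp add: E_def)
        show "\<bar>\<rho> n + h * (e \<bullet> n) - \<rho> n\<bar> \<le> h" using et[OF n] h by (simp add: abs_mult mult_left_le)
        show "0 \<le> E h" by (rule E0[OF h(1)])
        show "0 \<le> \<rho> n - h - E h" using \<rho>_bounds(1)[of n] h by simp
        show "\<rho> n + h + E h \<le> B" using \<rho>_bounds(2)[of n] h by (simp add: B_def)
        fix r assume r: "\<bar>r - \<rho> n\<bar> \<le> h + E h"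
        have d1: "dist (r *\<^sub>R n) (\<rho> n *\<^sub>R n) = \<bar>r - \<rho> n\<bar>" using n by (simp add: dist_norm scaleR_diff_left[symmetric])
        have k1: "r *\<^sub>R n \<in> ?K" using r n h \<rho>_bounds[of n] r0_pos by (auto simp: B_def abs_le_iff)
        have k2: "\<rho> n *\<^sub>R n \<in> ?K" using gK[OF n] by (simp add: graph_map_def)
        show "\<bar>g (r *\<^sub>R n) - g (\<rho> n *\<^sub>R n)\<bar> \<le> w" by (rule w[OF k1 k2]) (use d1 r in linarith)
      qed (measurable)
      then show ?thesis by (simp add: graph_map_def mult_ac)
    qed
    have "\<bar>h * I h - h * S1\<bar> = \<bar>LINT n|cone_measure. J n - h * (g (graph_map n) * (e \<bullet> n))\<bar>"
      unfolding J(2) S1_def using J(1) i1 by simp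
    also have "\<dots> \<le> (LINT n|cone_measure. \<bar>J n - h * (g (graph_map n) * (e \<bullet> n))\<bar>)"
      by (rule integral_abs_bound)
    also have "\<dots> \<le> (LINT n|cone_measure. 2 * E h * \<bar>g (graph_map n)\<bar> + 2 * (h + E h) * w)"
      using J(1) i1 i2 est by (intro integral_cone_mono) auto
    also have "\<dots> = 2 * E h * S2 + 2 * (h + E h) * w * T"
      unfolding S2_def T_def using i2 by (simp add: mult_ac)
    finally have le: "\<bar>h * I h - h * S1\<bar> \<le> 2 * E h * S2 + 2 * (h + E h) * w * T" .
    have "\<bar>h * I h - h * S1\<bar> = h * \<bar>I h - S1\<bar>" using h by (simp add: right_diff_distrib[symmetric] abs_mult)
    moreover have "2 * E h * S2 + 2 * (h + E h) * w * T = h * (2 * (E h / h) * S2 + 2 * (1 + E h / h) * w * T)"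
      using h by (simp add: field_simps)
    ultimately have "h * \<bar>I h - S1\<bar> \<le> h * (2 * (E h / h) * S2 + 2 * (1 + E h / h) * w * T)" using le by simp
    then show ?thesis using h by simp
  qed
  define h where "h k = 1 / real (Suc k)" for k
  have hs: "0 < h k" "h k \<le> 1" for k by (simp_all add: h_def)
  have h0: "h \<longlonglongrightarrow> 0" unfolding h_def using LIMSEQ_inverse_real_of_nat by (simp add: inverse_eq_divide)
  have Eh: "E (h k) / h k = 4 * L / r0 + 4 * h k / r0" for k
    using hs[of k] by (simp add: E_def field_simps power2_eq_square)
  have E_lim: "(\<lambda>k. E (h k) / h k) \<longlonglongrightarrow> 4 * L / r0"
  proof -
    have "(\<lambda>k. 4 * L / r0 + 4 * h k / r0) \<longlonglongrightarrow> 4 * L / r0 + 4 * 0 / r0" using h0 r0_pos by (intro tendsto_intros) auto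
    then show ?thesis by (simp add: Eh)
  qed
  have hE_lim: "(\<lambda>k. h k + E (h k)) \<longlonglongrightarrow> 0"
  proof -
    have "(\<lambda>k. h k + (E (h k) / h k) * h k) \<longlonglongrightarrow> 0 + 4 * L / r0 * 0"
      by (rule tendsto_add[OF h0 tendsto_mult[OF E_lim h0]])
    moreover have "(E (h k) / h k) * h k = E (h k)" for k using hs[of k] by simp
    ultimately show ?thesis by simp
  qed
  have ineq: "\<bar>(LINT x:D|lborel. \<phi>' x e) - S1\<bar> \<le> 2 * (4 * L / r0) * S2 + 2 * (1 + 4 * L / r0) * w * T"
    if w: "0 < w" for w
  proof (rule tendsto_le[OF _ _ _ ])
    show "(\<lambda>k. \<bar>I (h k) - S1\<bar>) \<longlonglongrightarrow> \<bar>(LINT x:D|lborel. \<phi>' x e) - S1\<bar>" using I_lim[OF hs h0] by (intro tendsto_intros)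
    show "(\<lambda>k. 2 * (E (h k) / h k) * S2 + 2 * (1 + E (h k) / h k) * w * T) \<longlonglongrightarrow> 2 * (4 * L / r0) * S2 + 2 * (1 + 4 * L / r0) * w * T"
      by (intro tendsto_add tendsto_mult tendsto_const E_lim)
    obtain d where d: "0 < d" "\<And>x y. x \<in> ?K \<Longrightarrow> y \<in> ?K \<Longrightarrow> dist x y < d \<Longrightarrow> dist (g x) (g y) < w"
      using gu w unfolding uniformly_continuous_on_def by (metis dist_commute)
    have "\<forall>\<^sub>F k in sequentially. h k + E (h k) < min d (min r0 1)" "\<forall>\<^sub>F k in sequentially. h k < r0 / 4"
      using order_tendstoD(2)[OF hE_lim, of "min d (min r0 1)"] order_tendstoD(2)[OF h0, of "r0 / 4"] d(1) r0_pos by auto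
    then show "\<forall>\<^sub>F k in sequentially. \<bar>I (h k) - S1\<bar> \<le> 2 * (E (h k) / h k) * S2 + 2 * (1 + E (h k) / h k) * w * T"
    proof eventually_elim
      case (elim k)
      show ?case
      proof (rule main)
        fix x y assume "x \<in> ?K" "y \<in> ?K" "dist x y \<le> h k + E (h k)"
        then have "dist (g x) (g y) < w" using elim by (intro d(2)) auto
        then show "\<bar>g x - g y\<bar> \<le> w" by (simp add: dist_real_def)
      qed (use elim hs[of k] in auto)
    qed
  qed simp
  have "\<bar>(LINT x:D|lborel. \<phi>' x e) - S1\<bar> \<le> 2 * (4 * L / r0) * S2 + 2 * (1 + 4 * L / r0) * 0 * T"
  proof (rule tendsto_lowerbound[where F = "at_right 0"])
    show "((\<lambda>w. 2 * (4 * L / r0) * S2 + 2 * (1 + 4 * L / r0) * w * T) \<longlongrightarrow> 2 * (4 * L / r0) * S2 + 2 * (1 + 4 * L / r0) * 0 * T) (at_right 0)"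
      by (intro tendsto_intros)
    show "\<forall>\<^sub>F w in at_right 0. \<bar>(LINT x:D|lborel. \<phi>' x e) - S1\<bar> \<le> 2 * (4 * L / r0) * S2 + 2 * (1 + 4 * L / r0) * w * T"
      using eventually_at_right_less[of 0] by (rule eventually_mono) (rule ineq)
  qed simp
  then show ?thesis unfolding S1 S2 by (simp add: field_simps)
qed

end

section \<open>Pointwise inequalities\<close>

lemma norm_powr_Young:
  fixes G V :: "'a::real_inner"
  assumes p: "1 < p"
  shows "p * (G \<bullet> V) - (p - 1) * norm V powr (p / (p - 1)) \<le> norm G powr p"
proof -
  have "G \<bullet> V \<le> norm G * norm V" by (rule norm_cauchy_schwarz)
  also have "\<dots> \<le> norm G powr p / p + norm V powr (p / (p - 1)) / (p / (p - 1))"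
    using p by (intro Youngs_inequality) (auto simp: field_simps)
  finally have "p * (G \<bullet> V) \<le> p * (norm G powr p / p + norm V powr (p / (p - 1)) / (p / (p - 1)))"
    using p by (intro mult_left_mono) auto
  also have "\<dots> = norm G powr p + (p - 1) * norm V powr (p / (p - 1))"
    using p by (simp add: field_simps)
  finally show ?thesis by simp
qed

text \<open>At the origin the difference quotient has absolute value
  \<open>\<bar>h\<bar> powr (p - 1)\<close>, which tends to 0 because \<open>p > 1\<close>.\<close>

lemma abs_powr_has_derivative:
  assumes p: "1 < p"
  shows "((\<lambda>y::real. \<bar>y\<bar> powr p) has_real_derivative p * (\<bar>y\<bar> powr (p - 1) * sgn y)) (at y)"
proof (cases "y = 0")
  case True
  have "(\<lambda>h. \<bar>h\<bar> powr (p - 1)) \<midarrow>0\<rightarrow> \<bar>0\<bar> powr (p - 1)"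
    using p by (intro tendsto_powr2 tendsto_rabs tendsto_ident_at tendsto_const) auto
  then have "(\<lambda>h. \<bar>\<bar>h\<bar> powr (p - 1)\<bar>) \<midarrow>0\<rightarrow> 0" using p by simp
  then have "(\<lambda>h. \<bar>\<bar>h\<bar> powr p / h\<bar>) \<midarrow>0\<rightarrow> 0"
  proof (rule Lim_transform_eventually)
    show "\<forall>\<^sub>F h in at 0. \<bar>\<bar>h\<bar> powr (p - 1)\<bar> = \<bar>\<bar>h\<bar> powr p / h\<bar>"
      unfolding eventually_at_filter by (rule always_eventually) (auto simp: powr_diff)
  qed
  then have "(\<lambda>h. \<bar>h\<bar> powr p / h) \<midarrow>0\<rightarrow> 0" by (rule tendsto_rabs_zero_cancel)
  then show ?thesis using True by (simp add: has_field_derivative_iff)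
next
  case False
  then consider "0 < y" | "y < 0" by linarith
  then show ?thesis
  proof cases
    case 1
    have "((\<lambda>x. x powr p) has_real_derivative p * y powr (p - 1)) (at y)" by (rule has_real_derivative_powr[OF 1])
    then have "((\<lambda>x. \<bar>x\<bar> powr p) has_real_derivative p * y powr (p - 1)) (at y)"
      by (rule has_field_derivative_transform_within_open[of _ _ _ "{0<..}"]) (use 1 in auto)
    then show ?thesis using 1 by simp
  next
    case 2
    have "((\<lambda>x. (- x) powr p) has_real_derivative p * (- y) powr (p - 1) * - 1) (at y)"
      by (rule DERIV_chain2[OF has_real_derivative_powr]) (use 2 in \<open>auto intro!: derivative_eq_intros\<close>)
    then have "((\<lambda>x. \<bar>x\<bar> powr p) has_real_derivative p * (- y) powr (p - 1) * - 1) (at y)"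
      by (rule has_field_derivative_transform_within_open[of _ _ _ "{..<0}"]) (use 2 in auto)
    then show ?thesis using 2 by simp
  qed
qed

text \<open>At the origin \<open>sgn\<close> jumps, but it is bounded and multiplied by a positive
  power of the norm.\<close>

lemma continuous_abs_powr_sgn:
  assumes p: "1 < p"
  shows "continuous_on UNIV (\<lambda>x. norm x powr (p - 1) *\<^sub>R sgn (x :: 'a::real_normed_vector))"
  unfolding continuous_on_eq_continuous_within
proof
  fix x :: 'a
  show "continuous (at x within UNIV) (\<lambda>x. norm x powr (p - 1) *\<^sub>R sgn x)"
  proof (cases "x = 0")
    case True
    have "((\<lambda>x :: 'a. norm x powr (p - 1)) \<longlongrightarrow> norm (0 :: 'a) powr (p - 1)) (at 0)"
      using p by (intro tendsto_powr2 tendsto_norm tendsto_ident_at tendsto_const) auto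
    then have "((\<lambda>x :: 'a. norm x powr (p - 1)) \<longlongrightarrow> 0) (at 0)" by simp
    then have "((\<lambda>x :: 'a. norm x powr (p - 1) *\<^sub>R sgn x) \<longlongrightarrow> 0) (at 0)"
    proof (rule Lim_null_comparison[rotated])
      show "\<forall>\<^sub>F x in at 0. norm (norm x powr (p - 1) *\<^sub>R sgn (x::'a)) \<le> norm x powr (p - 1)"
        by (rule always_eventually) (simp add: norm_sgn)
    qed
    then show ?thesis using True by (simp add: continuous_within)
  next
    case False
    then show ?thesis using p by (intro continuous_intros continuous_sgn) auto
  qed
qed

text \<open>Young's inequality with \<open>X\<close> scaled by
  \<open>\<bar>y\<bar> powr (p - 1) * sgn y\<close>. If \<open>Z\<close> is the gradient of a
  function with value \<open>y\<close>, the first term is the derivative of its \<open>p\<close>-th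
  power along \<open>X\<close>. The field \<open>X\<close> takes the place of
  \<open>|grad u|^(p-2) grad u / u^(p-1)\<close> in Picone's inequality.\<close>

lemma picone_pointwise:
  fixes Z X :: "'a::real_inner" and y :: real
  assumes p: "1 < p"
  shows "p * (\<bar>y\<bar> powr (p - 1) * sgn y) * (Z \<bullet> X) - (p - 1) * (\<bar>y\<bar> powr p * norm X powr (p / (p - 1))) \<le> norm Z powr p"
proof -
  let ?V = "(\<bar>y\<bar> powr (p - 1) * sgn y) *\<^sub>R X"
  have "norm ?V powr (p / (p - 1)) = \<bar>y\<bar> powr p * norm X powr (p / (p - 1))"
    using p by (cases "y = 0") (simp_all add: abs_mult sgn_if powr_mult powr_powr)
  then show ?thesis using norm_powr_Young[OF p, of Z ?V] by (simp add: mult_ac)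
qed

text \<open>The equality case of Young's inequality at \<open>b\<close> supplies the tangent to the
  convex power.\<close>

lemma norm_powr_gradient:
  fixes a b :: "'a::real_inner"
  assumes q: "1 < q"
  shows "norm b powr q + q * ((norm b powr (q - 1) *\<^sub>R sgn b) \<bullet> (a - b)) \<le> norm a powr q"
proof (cases "b = 0")
  case False
  let ?V = "norm b powr (q - 1) *\<^sub>R sgn b"
  have "norm ?V powr (q / (q - 1)) = norm b powr q" using False q by (simp add: norm_sgn powr_powr)
  moreover have "?V \<bullet> b = norm b powr q"
  proof -
    have "sgn b \<bullet> b = norm b" using False by (simp add: sgn_div_norm dot_square_norm power2_eq_square)
    then show ?thesis using False by (simp add: powr_diff)
  qed
  ultimately show ?thesis
    using norm_powr_Young[OF q, of a ?V] by (simp add: inner_diff_right inner_commute algebra_simps)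
qed (use q in simp)

text \<open>The tangent inequality at \<open>a + w\<close> has the gradient at the wrong point.
  Uniform continuity of the gradient on bounded sets, the origin included, moves it to
  \<open>a\<close> at the cost of \<open>\<epsilon> * norm w\<close>.\<close>

lemma norm_powr_expansion:
  fixes C \<epsilon> :: real
  assumes q: "1 < q" and \<epsilon>: "0 < \<epsilon>"
  obtains \<delta> where "0 < \<delta>"
    "\<And>a w :: 'a::euclidean_space. norm a \<le> C \<Longrightarrow> norm w \<le> \<delta> \<Longrightarrow>
      norm (a + w) powr q \<le> norm a powr q + q * ((norm a powr (q - 1) *\<^sub>R sgn a) \<bullet> w) + \<epsilon> * norm w"
proof -
  let ?P = "\<lambda>x::'a. norm x powr (q - 1) *\<^sub>R sgn x"
  have "uniformly_continuous_on (cball 0 (C + 1)) ?P"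
    by (intro compact_uniformly_continuous continuous_on_subset[OF continuous_abs_powr_sgn[OF q]]) auto
  moreover have "0 < \<epsilon> / q" using q \<epsilon> by simp
  ultimately obtain d where d: "0 < d"
    "\<And>x y. x \<in> cball 0 (C + 1) \<Longrightarrow> y \<in> cball 0 (C + 1) \<Longrightarrow> dist y x < d \<Longrightarrow> dist (?P y) (?P x) < \<epsilon> / q"
    unfolding uniformly_continuous_on_def by metis
  show thesis
  proof (rule that[of "min (d / 2) 1"])
    fix a w :: 'a assume a: "norm a \<le> C" and w: "norm w \<le> min (d / 2) 1"
    have "norm (a + w) \<le> C + 1" using norm_triangle_ineq[of a w] a w by simp
    then have k: "a + w \<in> cball 0 (C + 1)" "a \<in> cball 0 (C + 1)" using a by auto
    have "dist (a + w) a < d" using w d(1) by (simp add: dist_norm)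
    then have "dist (?P (a + w)) (?P a) < \<epsilon> / q" by (rule d(2)[OF k(2,1)])
    then have "(?P (a + w) - ?P a) \<bullet> w \<le> \<epsilon> / q * norm w"
      using norm_cauchy_schwarz[of "?P (a + w) - ?P a" w] mult_right_mono[of "norm (?P (a + w) - ?P a)" "\<epsilon> / q" "norm w"]
      by (simp add: dist_norm)
    then have "q * ((?P (a + w) - ?P a) \<bullet> w) \<le> q * (\<epsilon> / q * norm w)" using q by (intro mult_left_mono) auto
    then have "q * (?P (a + w) \<bullet> w) \<le> q * (?P a \<bullet> w) + \<epsilon> * norm w"
      using q by (simp add: inner_diff_left algebra_simps)
    moreover have "norm (a + w) powr q + q * (?P (a + w) \<bullet> (a - (a + w))) \<le> norm a powr q"
      by (rule norm_powr_gradient[OF q])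
    ultimately show "norm (a + w) powr q \<le> norm a powr q + q * (?P a \<bullet> w) + \<epsilon> * norm w"
      by simp
  qed (use d in simp)
qed

section \<open>The Picone inequality on a radial graph\<close>

lemmas continuous_on_if_derivative = has_derivative_continuous_on[OF has_derivative_at_withinI]

text \<open>
  With \<open>v = \<bar>z\<bar> powr p\<close>, the test field \<open>X = - h sgn x + t u powr (- p) W\<close> splits the boundary term into
  a radial part, treated exactly, and a part of order \<open>t\<close>, for which the translation estimate suffices.
\<close>

locale profile = radial_graph +
  fixes p q \<mu> :: real and h :: "real \<Rightarrow> real" and u :: "'a \<Rightarrow> real" and u' :: "'a \<Rightarrow> 'a"
  assumes p: "1 < p" and q_def: "q = p / (p - 1)"
    and h_cont: "continuous_on UNIV h" and h_0: "h 0 = 0" and h_nonneg: "\<And>r. 0 \<le> h r"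
    and h_deriv: "\<And>r. 0 < r \<Longrightarrow> r < r1 \<Longrightarrow>
      (h has_real_derivative \<mu> - real m * h r / r + (p - 1) * h r powr q) (at r)"
    and u_pos: "\<And>x. 0 < u x"
    and u_deriv: "\<And>x. (u has_derivative (\<lambda>v. u' x \<bullet> v)) (at x)" and u'_cont: "continuous_on UNIV u'"
    and u'_eq: "\<And>x. norm x < r1 \<Longrightarrow> u' x = - (h (norm x) powr (q - 1) * u x) *\<^sub>R sgn x"
begin

lemma q: "1 < q" and q_p: "(p - 1) * q = p"
  using p by (auto simp: q_def field_simps)

lemma u_cont: "continuous_on S u"
  by (rule continuous_on_if_derivative[OF u_deriv])

text \<open>The derivative of \<open>r ^ m * (h r * v (r *\<^sub>R n))\<close> along a ray: the term
  \<open>m * h r / r\<close> of the Riccati equation cancels against the derivative of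
  \<open>r ^ m\<close>. As the field is radial, the boundary term is exact.\<close>

lemma radial_part:
  fixes v :: "'a \<Rightarrow> real" and V :: "'a \<Rightarrow> 'a"
  assumes v: "\<And>x. (v has_derivative (\<lambda>y. V x \<bullet> y)) (at x)" and V: "continuous_on UNIV V"
  shows "(LINT x:D|lborel. h (norm x) * (V x \<bullet> sgn x) + v x * (\<mu> + (p - 1) * h (norm x) powr q))
    = (LINT n|cone_measure. h (\<rho> n) * v (graph_map n) * \<rho> n ^ m)"
proof -
  have vc: "continuous_on UNIV v" by (rule continuous_on_if_derivative[OF v])
  have [measurable]: "v \<in> borel_measurable borel" "V \<in> borel_measurable borel" "h \<in> borel_measurable borel"
    using vc V h_cont by (auto intro: borel_measurable_continuous_onI)
  let ?K = "cball (0::'a) r1"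
  have hn: "continuous_on ?K (\<lambda>x. h (norm x))" by (intro continuous_on_compose2[OF h_cont] continuous_intros) auto
  have "continuous_on ?K (\<lambda>x. h (norm x) * norm (V x))"
    using hn by (intro continuous_intros continuous_on_subset[OF V]) auto
  from compact_abs_bounded[OF compact_cball this]
  obtain M1 where M1: "\<forall>x\<in>?K. \<bar>h (norm x) * norm (V x)\<bar> \<le> M1" by blast
  have "continuous_on ?K (\<lambda>x. v x * (\<mu> + (p - 1) * h (norm x) powr q))" using q h_nonneg hn
    by (intro continuous_intros continuous_on_subset[OF vc] continuous_on_powr') auto
  from compact_abs_bounded[OF compact_cball this]
  obtain M2 where M2: "\<forall>x\<in>?K. \<bar>v x * (\<mu> + (p - 1) * h (norm x) powr q)\<bar> \<le> M2" by blast
  show ?thesis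
  proof (rule radial_divergence[where M = "M1 + M2" and G = "\<lambda>n r. r ^ m * (h r * v (r *\<^sub>R n))"])
    fix x assume "x \<in> D"
    then have xK: "x \<in> ?K" using norm_D[of x] by simp
    have "\<bar>V x \<bullet> sgn x\<bar> \<le> norm (V x) * norm (sgn x)" by (rule Cauchy_Schwarz_ineq2)
    also have "\<dots> \<le> norm (V x)" by (simp add: norm_sgn)
    finally have "\<bar>h (norm x) * (V x \<bullet> sgn x)\<bar> \<le> \<bar>h (norm x) * norm (V x)\<bar>" by (simp add: abs_mult mult_left_mono)
    also have "\<dots> \<le> M1" using M1 xK by blast
    finally show "\<bar>h (norm x) * (V x \<bullet> sgn x) + v x * (\<mu> + (p - 1) * h (norm x) powr q)\<bar> \<le> M1 + M2"
      using M2 xK abs_triangle_ineq by (smt (verit))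
  next
    fix n :: 'a assume n: "norm n = 1"
    show "continuous_on {0..\<rho> n} (\<lambda>r. r ^ m * (h r * v (r *\<^sub>R n)))"
      by (intro continuous_intros continuous_on_compose2[OF vc] continuous_on_subset[OF h_cont]) auto
    show "0 ^ m * (h 0 * v (0 *\<^sub>R n)) = 0" by (simp add: h_0)
    show "\<rho> n ^ m * (h (\<rho> n) * v (\<rho> n *\<^sub>R n)) = h (\<rho> n) * v (graph_map n) * \<rho> n ^ m" by (simp add: graph_map_def)
    fix r assume r: "0 < r" "r < \<rho> n"
    have r1: "r < r1" using r \<rho>_bounds(2)[of n] by simp
    have "((\<lambda>s. s *\<^sub>R n) has_derivative (\<lambda>s. s *\<^sub>R n)) (at r)" by (auto intro!: derivative_eq_intros)
    from has_derivative_compose[OF this v]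
    have vr: "((\<lambda>s. v (s *\<^sub>R n)) has_real_derivative V (r *\<^sub>R n) \<bullet> n) (at r)"
      by (simp add: has_field_derivative_def mult_commute_abs)
    have sg: "sgn (r *\<^sub>R n) = n" using r n by (simp add: sgn_scaleR sgn_div_norm)
    have "((\<lambda>s. s ^ m * (h s * v (s *\<^sub>R n))) has_real_derivative
        real m * r ^ (m - 1) * (h r * v (r *\<^sub>R n)) + r ^ m * ((\<mu> - real m * h r / r + (p - 1) * h r powr q) * v (r *\<^sub>R n)
         + h r * (V (r *\<^sub>R n) \<bullet> n))) (at r)"
      using r by (auto intro!: derivative_eq_intros h_deriv[OF r(1) r1] vr simp: algebra_simps)
    also have "real m * r ^ (m - 1) * (h r * v (r *\<^sub>R n)) + r ^ m * ((\<mu> - real m * h r / r + (p - 1) * h r powr q) * v (r *\<^sub>R n)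
         + h r * (V (r *\<^sub>R n) \<bullet> n))
      = r ^ m * (h r * (V (r *\<^sub>R n) \<bullet> n) + v (r *\<^sub>R n) * (\<mu> + (p - 1) * h r powr q))"
      using r by (cases m) (auto simp: field_simps)
    finally show "((\<lambda>s. s ^ m * (h s * v (s *\<^sub>R n))) has_real_derivative r ^ m * (h (norm (r *\<^sub>R n)) * (V (r *\<^sub>R n) \<bullet> sgn (r *\<^sub>R n))
        + v (r *\<^sub>R n) * (\<mu> + (p - 1) * h (norm (r *\<^sub>R n)) powr q))) (at r)"
      using r n by (simp add: sg)
  qed (measurable)
qed

end

context radial_graph
begin

lemma set_integrable_continuous:
  fixes f :: "'a \<Rightarrow> real"
  assumes "continuous_on UNIV f"
  shows "set_integrable lborel D f"
proof -
  obtain M where "\<forall>x\<in>cball 0 r1. \<bar>f x\<bar> \<le> M"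
    using compact_abs_bounded[OF compact_cball continuous_on_subset[OF assms subset_UNIV]] by blast
  moreover have "x \<in> cball 0 r1" if "x \<in> D" for x using norm_D[OF that] by simp
  ultimately show ?thesis
    using assms by (intro set_integrable_D_bounded[where M = M] borel_measurable_continuous_onI) blast+
qed

lemma integrable_cone_continuous:
  fixes f :: "'a \<Rightarrow> real"
  assumes "continuous_on UNIV f"
  shows "integrable cone_measure (\<lambda>n. f (graph_map n) * \<rho> n ^ m)"
proof -
  obtain M where M: "\<forall>x\<in>cball 0 r1. \<bar>f x\<bar> \<le> M"
    using compact_abs_bounded[OF compact_cball continuous_on_subset[OF assms subset_UNIV]] by blast
  have [measurable]: "f \<in> borel_measurable borel" by (rule borel_measurable_continuous_onI[OF assms])
  show ?thesis
  proof (rule integrable_cone_bounded[where M = "M * r1 ^ m"])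
    fix n :: 'a assume n: "norm n = 1"
    have "graph_map n \<in> cball 0 r1" using norm_graph_map[OF n] \<rho>_bounds(2)[of n] by simp
    then have f: "\<bar>f (graph_map n)\<bar> \<le> M" using M by blast
    then have "0 \<le> M" using abs_ge_zero order_trans by blast
    then have "\<bar>f (graph_map n)\<bar> * \<rho> n ^ m \<le> M * r1 ^ m"
      using f \<rho>_pos[of n] \<rho>_bounds(2)[of n] by (intro mult_mono power_mono) auto
    then show "\<bar>f (graph_map n) * \<rho> n ^ m\<bar> \<le> M * r1 ^ m" using \<rho>_pos[of n] by (simp add: abs_mult)
  qed measurable
qed

lemma integrable_cone_flux:
  assumes F: "continuous_on UNIV F"
  shows "integrable cone_measure (\<lambda>n. (F (graph_map n) \<bullet> n) * \<rho> n ^ m)"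
proof (rule Bochner_Integration.integrable_bound[OF integrable_cone_continuous[OF continuous_on_norm[OF F]]])
  have [measurable]: "F \<in> borel_measurable borel" by (rule borel_measurable_continuous_onI[OF F])
  show "(\<lambda>n. (F (graph_map n) \<bullet> n) * \<rho> n ^ m) \<in> borel_measurable cone_measure" by measurable
  show "AE n in cone_measure. norm ((F (graph_map n) \<bullet> n) * \<rho> n ^ m) \<le> norm (norm (F (graph_map n)) * \<rho> n ^ m)"
    using AE_cone_measure
  proof eventually_elim
    case (elim n)
    then show ?case
      unfolding norm_mult using Cauchy_Schwarz_ineq2[of "F (graph_map n)" n] by (intro mult_right_mono) auto
  qed
qed

text \<open>The translation estimate, applied in each coordinate direction to the corresponding
  component of \<open>v x *\<^sub>R Y x\<close>. The errors add up to the sum of the absolute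
  components of \<open>Y\<close> on the boundary.\<close>

lemma tangential_divergence:
  fixes v :: "'a \<Rightarrow> real" and V Y :: "'a \<Rightarrow> 'a"
  assumes v: "\<And>x. (v has_derivative (\<lambda>y. V x \<bullet> y)) (at x)" and V: "continuous_on UNIV V"
    and Y: "has_divergence Y \<delta>"
  shows "\<bar>(LINT x:D|lborel. V x \<bullet> Y x + v x * \<delta> x) - (LINT n|cone_measure. v (graph_map n) * (Y (graph_map n) \<bullet> n) * \<rho> n ^ m)\<bar>
    \<le> 8 * L / r0 * (LINT n|cone_measure. \<bar>v (graph_map n)\<bar> * (\<Sum>b\<in>Basis. \<bar>Y (graph_map n) \<bullet> b\<bar>) * \<rho> n ^ m)"
proof -
  obtain Y' where Y': "\<And>x. (Y has_derivative Y' x) (at x)" "\<And>y. continuous_on UNIV (\<lambda>x. Y' x y)"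
    "\<And>x. \<delta> x = (\<Sum>b\<in>Basis. Y' x b \<bullet> b)" using Y unfolding has_divergence_def C1_field_def by metis
  have vc: "continuous_on UNIV v" by (rule continuous_on_if_derivative[OF v])
  have Yc: "continuous_on UNIV Y" by (rule continuous_on_if_derivative[OF Y'(1)])
  define \<phi> where "\<phi> b x = v x * (Y x \<bullet> b)" for b x
  define \<phi>' where "\<phi>' b x y = v x * (Y' x y \<bullet> b) + (V x \<bullet> y) * (Y x \<bullet> b)" for b x y
  have d: "(\<phi> b has_derivative \<phi>' b x) (at x)" for b x
    unfolding \<phi>_def \<phi>'_def by (intro has_derivative_mult v has_derivative_inner_left Y')
  have dc: "continuous_on UNIV (\<lambda>x. \<phi>' b x y)" for b y unfolding \<phi>'_def by (intro continuous_intros vc V Yc Y'(2))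
  have \<phi>c: "continuous_on UNIV (\<phi> b)" for b unfolding \<phi>_def by (intro continuous_intros vc Yc)
  let ?I = "\<lambda>b. LINT x:D|lborel. \<phi>' b x b" and ?g = "\<lambda>b n. \<phi> b (graph_map n) * (b \<bullet> n) * \<rho> n ^ m"
    and ?a = "\<lambda>b n. \<bar>\<phi> b (graph_map n)\<bar> * \<rho> n ^ m"
  have "(\<Sum>b\<in>Basis. \<phi>' b x b) = V x \<bullet> Y x + v x * \<delta> x" for x
    unfolding \<phi>'_def sum.distrib sum_distrib_left[symmetric] sum_inner_Basis Y'(3) by simp
  then have "(LINT x:D|lborel. V x \<bullet> Y x + v x * \<delta> x) = (LINT x:D|lborel. \<Sum>b\<in>Basis. \<phi>' b x b)" by simp
  also have "\<dots> = (\<Sum>b\<in>Basis. ?I b)"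
    using set_integrable_continuous[OF dc] unfolding set_lebesgue_integral_def set_integrable_def scaleR_sum_right
    by (intro Bochner_Integration.integral_sum) simp
  finally have L1: "(LINT x:D|lborel. V x \<bullet> Y x + v x * \<delta> x) = (\<Sum>b\<in>Basis. ?I b)" .
  have i1: "integrable cone_measure (?g b)" for b
    using integrable_cone_flux[of "\<lambda>x. \<phi> b x *\<^sub>R b"] by (simp add: continuous_on_scaleR \<phi>c)
  have i2: "integrable cone_measure (?a b)" for b by (rule integrable_cone_continuous) (intro continuous_intros \<phi>c)
  have "v (graph_map n) * (Y (graph_map n) \<bullet> n) * \<rho> n ^ m = (\<Sum>b\<in>Basis. ?g b n)" for n
    by (subst euclidean_inner) (simp add: \<phi>_def sum_distrib_left sum_distrib_right mult_ac inner_commute[of n])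
  then have L2: "(LINT n|cone_measure. v (graph_map n) * (Y (graph_map n) \<bullet> n) * \<rho> n ^ m) = (\<Sum>b\<in>Basis. LINT n|cone_measure. ?g b n)"
    using i1 by (simp add: Bochner_Integration.integral_sum)
  have "\<bar>v (graph_map n)\<bar> * (\<Sum>b\<in>Basis. \<bar>Y (graph_map n) \<bullet> b\<bar>) * \<rho> n ^ m = (\<Sum>b\<in>Basis. ?a b n)" for n
    by (simp add: \<phi>_def abs_mult sum_distrib_left sum_distrib_right)
  then have L3: "(LINT n|cone_measure. \<bar>v (graph_map n)\<bar> * (\<Sum>b\<in>Basis. \<bar>Y (graph_map n) \<bullet> b\<bar>) * \<rho> n ^ m)
      = (\<Sum>b\<in>Basis. LINT n|cone_measure. ?a b n)"
    using i2 by (simp add: Bochner_Integration.integral_sum)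
  have "\<bar>(\<Sum>b\<in>Basis. ?I b) - (\<Sum>b\<in>Basis. LINT n|cone_measure. ?g b n)\<bar> \<le> (\<Sum>b\<in>Basis. \<bar>?I b - (LINT n|cone_measure. ?g b n)\<bar>)"
    unfolding sum_subtractf[symmetric] by (rule sum_abs)
  also have "\<dots> \<le> (\<Sum>b\<in>Basis. 8 * L / r0 * (LINT n|cone_measure. ?a b n))"
    by (intro sum_mono translation_divergence d dc) auto
  finally show ?thesis unfolding L1 L2 L3 by (simp add: sum_distrib_left)
qed

end

context profile
begin

text \<open>Product rule for a divergence-free \<open>W\<close>. The exponent \<open>- p\<close> is
  the one for which this divergence is the negative of the first-order change of
  \<open>(p - 1) * norm X powr q\<close> when the radial field is perturbed by the weighted
  field.\<close>

lemma has_divergence_weighted: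
  assumes "has_divergence W (\<lambda>x. 0)"
  shows "has_divergence (\<lambda>x. u x powr - p *\<^sub>R W x) (\<lambda>x. - p * u x powr (- p - 1) * (u' x \<bullet> W x))"
proof -
  obtain W' where W': "\<And>x. (W has_derivative W' x) (at x)" "\<And>v. continuous_on UNIV (\<lambda>x. W' x v)"
    "\<And>x. (\<Sum>b\<in>Basis. W' x b \<bullet> b) = 0" using assms unfolding has_divergence_def C1_field_def by metis
  have Wc: "continuous_on UNIV W" by (rule continuous_on_if_derivative[OF W'(1)])
  have uc: "continuous_on UNIV (\<lambda>x. u x powr c)" for c
    using u_pos by (intro continuous_on_powr u_cont continuous_on_const) (metis less_irrefl)
  have up: "((\<lambda>x. u x powr - p) has_derivative (\<lambda>y. - p * u x powr (- p - 1) * (u' x \<bullet> y))) (at x)" for x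
  proof -
    have "((\<lambda>t. t powr - p) has_derivative (\<lambda>t. - p * u x powr (- p - 1) * t)) (at (u x))"
      by (rule has_derivative_eq_rhs[OF has_real_derivative_powr[OF u_pos[of x], of "- p", unfolded has_field_derivative_def]])
         (simp add: fun_eq_iff)
    from has_derivative_compose[OF u_deriv this] show ?thesis .
  qed
  let ?d = "\<lambda>x y. u x powr - p *\<^sub>R W' x y + (- p * u x powr (- p - 1) * (u' x \<bullet> y)) *\<^sub>R W x"
  show ?thesis
  proof (rule has_divergenceI[where W' = ?d])
    show "((\<lambda>x. u x powr - p *\<^sub>R W x) has_derivative ?d x) (at x)" for x by (intro has_derivative_scaleR up W')
    show "continuous_on UNIV (\<lambda>x. ?d x y)" for y by (intro continuous_intros uc u'_cont Wc W'(2))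
    have "?d x b \<bullet> b = u x powr - p * (W' x b \<bullet> b) + (- p * u x powr (- p - 1)) * ((u' x \<bullet> b) * (W x \<bullet> b))" for x b
      by (simp add: inner_add_left inner_diff_left)
    then show "(\<Sum>b\<in>Basis. ?d x b \<bullet> b) = - p * u x powr (- p - 1) * (u' x \<bullet> W x)" for x
      by (simp only: sum.distrib sum_distrib_left[symmetric] sum_inner_Basis W'(3))
  qed
qed

text \<open>Picone pointwise for \<open>v = \<bar>z\<bar> powr p\<close>, integrated over
  \<open>D\<close>. By the Riccati equation, \<open>interior\<close> says that the divergence of the
  field plus \<open>(p - 1)\<close> times the \<open>q\<close>-th power of its norm is at most
  \<open>\<eta> - \<mu>\<close>; \<open>boundary\<close> bounds the inward flux density together
  with the error of the approximate divergence theorem.\<close>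

lemma C1_lower_bound:
  fixes z :: "'a \<Rightarrow> real" and Z Y :: "'a \<Rightarrow> 'a" and t \<eta> b :: real
  assumes z: "\<And>x. (z has_derivative (\<lambda>y. Z x \<bullet> y)) (at x)" and Z: "continuous_on UNIV Z"
    and Y: "has_divergence Y \<delta>"
    and interior: "\<And>x. x \<in> D \<Longrightarrow>
      (p - 1) * norm (- h (norm x) *\<^sub>R sgn x + t *\<^sub>R Y x) powr q \<le> (p - 1) * h (norm x) powr q - t * \<delta> x + \<eta>"
    and boundary: "\<And>n. norm n = 1 \<Longrightarrow>
      h (\<rho> n) - t * (Y (graph_map n) \<bullet> n) + \<bar>t\<bar> * (8 * L / r0) * (\<Sum>b\<in>Basis. \<bar>Y (graph_map n) \<bullet> b\<bar>) \<le> b"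
  shows "(\<mu> - \<eta>) * (LINT x:D|lborel. \<bar>z x\<bar> powr p)
    \<le> (LINT x:D|lborel. norm (Z x) powr p) + b * (LINT n|cone_measure. \<bar>z (graph_map n)\<bar> powr p * \<rho> n ^ m)"
proof -
  define v where "v x = \<bar>z x\<bar> powr p" for x
  define V where "V x = (p * (\<bar>z x\<bar> powr (p - 1) * sgn (z x))) *\<^sub>R Z x" for x
  have zc: "continuous_on UNIV z" by (rule continuous_on_if_derivative[OF z])
  have v: "(v has_derivative (\<lambda>y. V x \<bullet> y)) (at x)" for x
  proof -
    have "((\<lambda>y. \<bar>y\<bar> powr p) has_derivative (\<lambda>y. p * (\<bar>z x\<bar> powr (p - 1) * sgn (z x)) * y)) (at (z x))"
      using abs_powr_has_derivative[OF p, of "z x"] by (simp add: has_field_derivative_def)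
    from has_derivative_compose[OF z this] show ?thesis by (simp add: v_def[abs_def] V_def)
  qed
  have vc: "continuous_on UNIV v" by (rule continuous_on_if_derivative[OF v])
  have V: "continuous_on UNIV V"
  proof -
    have "continuous_on UNIV (\<lambda>y::real. \<bar>y\<bar> powr (p - 1) * sgn y)"
      using continuous_abs_powr_sgn[OF p, where 'a = real] by simp
    from continuous_on_compose2[OF this zc] have "continuous_on UNIV (\<lambda>x. \<bar>z x\<bar> powr (p - 1) * sgn (z x))" by simp
    note s = continuous_on_mult[OF continuous_on_const this, of p]
    show ?thesis unfolding V_def by (rule continuous_on_scaleR[OF s Z])
  qed
  obtain Y' where Y': "\<And>x. (Y has_derivative Y' x) (at x)" "\<And>y. continuous_on UNIV (\<lambda>x. Y' x y)"
    "\<And>x. \<delta> x = (\<Sum>b\<in>Basis. Y' x b \<bullet> b)" using Y unfolding has_divergence_def C1_field_def by metis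
  have Yc: "continuous_on UNIV Y" by (rule continuous_on_if_derivative[OF Y'(1)])
  have \<delta>c: "continuous_on UNIV \<delta>" unfolding Y'(3)[abs_def] by (intro continuous_intros Y'(2))
  have hn: "continuous_on UNIV (\<lambda>x::'a. h (norm x))"
    by (intro continuous_on_compose2[OF h_cont] continuous_intros) auto
  have [measurable]: "z \<in> borel_measurable borel" "Z \<in> borel_measurable borel" "v \<in> borel_measurable borel"
     "V \<in> borel_measurable borel" "(\<lambda>x::'a. h (norm x)) \<in> borel_measurable borel"
    using zc Z vc V hn by (auto intro: borel_measurable_continuous_onI)
  let ?f = "\<lambda>x. h (norm x) * (V x \<bullet> sgn x) + v x * (\<mu> + (p - 1) * h (norm x) powr q)"
  let ?g = "\<lambda>x. V x \<bullet> Y x + v x * \<delta> x"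
  let ?Bv = "\<lambda>n. v (graph_map n)" and ?BY = "\<lambda>n. Y (graph_map n)"
  have v0: "0 \<le> v x" for x by (simp add: v_def)
  have point: "(\<mu> - \<eta>) * v x - ?f x + t * ?g x \<le> norm (Z x) powr p" if x: "x \<in> D" for x
  proof -
    let ?X = "- h (norm x) *\<^sub>R sgn x + t *\<^sub>R Y x"
    have "V x \<bullet> ?X - v x * ((p - 1) * norm ?X powr q) \<le> norm (Z x) powr p"
      using picone_pointwise[OF p, of "z x" "Z x" ?X] unfolding v_def V_def q_def by (simp add: mult_ac)
    moreover have "v x * ((p - 1) * norm ?X powr q)
        \<le> v x * ((p - 1) * h (norm x) powr q - t * \<delta> x + \<eta>)"
      using interior[OF x] v0 by (intro mult_left_mono)
    moreover have "V x \<bullet> ?X = - h (norm x) * (V x \<bullet> sgn x) + t * (V x \<bullet> Y x)"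
      by (simp add: inner_add_right inner_diff_right)
    ultimately show ?thesis by (simp add: algebra_simps)
  qed
  have int_v: "set_integrable lborel D v" by (rule set_integrable_continuous[OF vc])
  have int_Z: "set_integrable lborel D (\<lambda>x. norm (Z x) powr p)"
    by (rule set_integrable_continuous) (intro continuous_on_powr' continuous_intros Z, use p in auto)
  have bounded_sgn: "set_integrable lborel D (\<lambda>x. f x * (F x \<bullet> sgn x))"
    if f: "continuous_on UNIV f" and F: "continuous_on UNIV F" for f :: "'a \<Rightarrow> real" and F :: "'a \<Rightarrow> 'a"
  proof -
    have "continuous_on UNIV (\<lambda>x. f x * norm (F x))" by (intro continuous_intros f F)
    from compact_abs_bounded[OF compact_cball continuous_on_subset[OF this subset_UNIV]]
    obtain M where M: "\<forall>x\<in>cball 0 r1. \<bar>f x * norm (F x)\<bar> \<le> M" by blast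
    show ?thesis
    proof (rule set_integrable_D_bounded[where M = M])
      have [measurable]: "f \<in> borel_measurable borel" "F \<in> borel_measurable borel"
        using f F by (auto intro: borel_measurable_continuous_onI)
      show "(\<lambda>x. f x * (F x \<bullet> sgn x)) \<in> borel_measurable borel" by measurable
      fix x assume "x \<in> D"
      then have "x \<in> cball 0 r1" using norm_D[of x] by simp
      then have "\<bar>f x * norm (F x)\<bar> \<le> M" using M by blast
      moreover have "\<bar>F x \<bullet> sgn x\<bar> \<le> norm (F x)"
        using Cauchy_Schwarz_ineq2[of "F x" "sgn x"] by (cases "x = 0") (auto simp: norm_sgn)
      then have "\<bar>f x\<bar> * \<bar>F x \<bullet> sgn x\<bar> \<le> \<bar>f x\<bar> * norm (F x)" by (intro mult_left_mono) auto
      ultimately show "\<bar>f x * (F x \<bullet> sgn x)\<bar> \<le> M" by (simp add: abs_mult)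
    qed
  qed
  have hp: "continuous_on UNIV (\<lambda>x::'a. h (norm x) powr c)" if "0 < c" for c
    using that by (intro continuous_on_powr' hn continuous_intros) (auto simp: h_nonneg)
  have int_f: "set_integrable lborel D ?f"
    using q by (intro set_integral_add bounded_sgn set_integrable_continuous continuous_intros hn V vc hp) auto
  have int_g: "set_integrable lborel D ?g" by (intro set_integrable_continuous continuous_intros V Yc vc \<delta>c)
  have int_L: "set_integrable lborel D (\<lambda>x. (\<mu> - \<eta>) * v x - ?f x + t * ?g x)"
    by (intro set_integral_add set_integral_diff set_integrable_mult_right int_v int_f int_g)
  have "(LINT x:D|lborel. (\<mu> - \<eta>) * v x - ?f x + t * ?g x) \<le> (LINT x:D|lborel. norm (Z x) powr p)"
    using int_L int_Z point by (intro set_integral_mono) auto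
  moreover have "(LINT x:D|lborel. (\<mu> - \<eta>) * v x - ?f x + t * ?g x)
      = (\<mu> - \<eta>) * (LINT x:D|lborel. v x) - (LINT x:D|lborel. ?f x) + t * (LINT x:D|lborel. ?g x)"
    using int_v int_f int_g
    by (simp only: set_integral_add set_integral_diff set_integrable_mult_right set_integral_mult_right)
  ultimately have main: "(\<mu> - \<eta>) * (LINT x:D|lborel. v x) - (LINT x:D|lborel. ?f x) + t * (LINT x:D|lborel. ?g x)
      \<le> (LINT x:D|lborel. norm (Z x) powr p)" by linarith
  define A1 where "A1 = (LINT n|cone_measure. h (\<rho> n) * ?Bv n * \<rho> n ^ m)"
  define A2 where "A2 = (LINT n|cone_measure. ?Bv n * (?BY n \<bullet> n) * \<rho> n ^ m)"
  define A3 where "A3 = (LINT n|cone_measure. \<bar>?Bv n\<bar> * (\<Sum>b\<in>Basis. \<bar>?BY n \<bullet> b\<bar>) * \<rho> n ^ m)"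
  have R: "(LINT x:D|lborel. ?f x) = A1" unfolding A1_def by (rule radial_part[OF v V])
  have "\<bar>(LINT x:D|lborel. ?g x) - A2\<bar> \<le> 8 * L / r0 * A3"
    unfolding A2_def A3_def by (rule tangential_divergence[OF v V Y])
  then have "\<bar>t\<bar> * \<bar>(LINT x:D|lborel. ?g x) - A2\<bar> \<le> \<bar>t\<bar> * (8 * L / r0 * A3)" by (intro mult_left_mono) auto
  then have T: "t * A2 - \<bar>t\<bar> * (8 * L / r0) * A3 \<le> t * (LINT x:D|lborel. ?g x)"
    unfolding abs_mult[symmetric] by (simp add: algebra_simps abs_le_iff)
  have iA1: "integrable cone_measure (\<lambda>n. h (\<rho> n) * ?Bv n * \<rho> n ^ m)"
  proof -
    have "integrable cone_measure (\<lambda>n. (h (norm (graph_map n)) * ?Bv n) * \<rho> n ^ m)"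
      by (rule integrable_cone_continuous) (intro continuous_intros hn vc)
    moreover have "AE n in cone_measure. (h (norm (graph_map n)) * ?Bv n) * \<rho> n ^ m = h (\<rho> n) * ?Bv n * \<rho> n ^ m"
      using AE_cone_measure by eventually_elim (simp add: norm_graph_map)
    moreover have "h \<in> borel_measurable borel" by (rule borel_measurable_continuous_onI[OF h_cont])
    ultimately show ?thesis by (subst integrable_cong_AE[symmetric]) auto
  qed
  have iA2: "integrable cone_measure (\<lambda>n. ?Bv n * (?BY n \<bullet> n) * \<rho> n ^ m)"
    using integrable_cone_flux[OF continuous_on_scaleR[OF vc Yc]] by simp
  have iA3: "integrable cone_measure (\<lambda>n. \<bar>?Bv n\<bar> * (\<Sum>b\<in>Basis. \<bar>?BY n \<bullet> b\<bar>) * \<rho> n ^ m)"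
    by (rule integrable_cone_continuous[of "\<lambda>x. \<bar>v x\<bar> * (\<Sum>b\<in>Basis. \<bar>Y x \<bullet> b\<bar>)"])
       (intro continuous_intros vc Yc)
  let ?B = "\<lambda>n. h (\<rho> n) * ?Bv n * \<rho> n ^ m - t * (?Bv n * (?BY n \<bullet> n) * \<rho> n ^ m)
    + (\<bar>t\<bar> * (8 * L / r0)) * (\<bar>?Bv n\<bar> * (\<Sum>b\<in>Basis. \<bar>?BY n \<bullet> b\<bar>) * \<rho> n ^ m)"
  have "A1 - t * A2 + \<bar>t\<bar> * (8 * L / r0) * A3 = (LINT n|cone_measure. ?B n)"
    unfolding A1_def A2_def A3_def using iA1 iA2 iA3 by simp
  also have "\<dots> \<le> (LINT n|cone_measure. b * (?Bv n * \<rho> n ^ m))"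
  proof (rule integral_cone_mono)
    show "integrable cone_measure ?B" using iA1 iA2 iA3 by simp
    show "integrable cone_measure (\<lambda>n. b * (?Bv n * \<rho> n ^ m))" using integrable_cone_continuous[OF vc] by simp
    fix n :: 'a assume n: "norm n = 1"
    have "0 \<le> ?Bv n * \<rho> n ^ m" using v0 \<rho>_pos[of n] by simp
    from mult_left_mono[OF boundary[OF n] this] show "?B n \<le> b * (?Bv n * \<rho> n ^ m)"
      using v0 by (simp add: algebra_simps)
  qed
  also have "\<dots> = b * (LINT n|cone_measure. ?Bv n * \<rho> n ^ m)" by simp
  finally have "(\<mu> - \<eta>) * (LINT x:D|lborel. v x)
      \<le> (LINT x:D|lborel. norm (Z x) powr p) + b * (LINT n|cone_measure. ?Bv n * \<rho> n ^ m)"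
    using main T unfolding R by linarith
  then show ?thesis unfolding v_def .
qed

end

section \<open>Mollification\<close>

text \<open>The standard flat functions \<open>P(1/t) exp(-1/t)\<close>, extended by 0. With the
  polynomial as a parameter the family is closed under differentiation, which turns smoothness into
  an induction.\<close>

definition exp_poly :: "real poly \<Rightarrow> real \<Rightarrow> real" where
  "exp_poly P t = (if 0 < t then poly P (1 / t) * exp (- (1 / t)) else 0)"

lemma poly_exp_tendsto_0: "((\<lambda>s::real. poly P s * exp (- s)) \<longlongrightarrow> 0) at_top"
proof -
  have "((\<lambda>s. \<Sum>i\<le>degree P. coeff P i * (s ^ i / exp s)) \<longlongrightarrow> (\<Sum>i\<le>degree P. coeff P i * 0)) at_top"
    by (intro tendsto_sum tendsto_mult tendsto_const tendsto_power_div_exp_0)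
  moreover have "(\<Sum>i\<le>degree P. coeff P i * (s ^ i / exp s)) = poly P s * exp (- s)" for s
    by (simp add: poly_altdef sum_distrib_right exp_minus divide_inverse mult.assoc)
  ultimately show ?thesis by simp
qed

text \<open>The factor \<open>[:0, 0, 1:]\<close> is the square of \<open>1 / t\<close> contributed
  by the inner derivative. At the origin the exponential beats every polynomial in
  \<open>1 / t\<close>.\<close>

lemma exp_poly_deriv:
  "(exp_poly P has_real_derivative exp_poly ([:0, 0, 1:] * (P - pderiv P)) t) (at t)"
proof -
  consider "t < 0" | "t = 0" | "0 < t" by linarith
  then show ?thesis
  proof cases
    case 1
    have "((\<lambda>_. 0) has_real_derivative 0) (at t)" by simp
    then have "(exp_poly P has_real_derivative 0) (at t)"
      by (rule has_field_derivative_transform_within_open[of _ _ _ "{..<0}"]) (use 1 in \<open>auto simp: exp_poly_def\<close>)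
    then show ?thesis using 1 by (simp add: exp_poly_def)
  next
    case 2
    have r: "((\<lambda>h. exp_poly P h / h) \<longlongrightarrow> 0) (at_right 0)"
    proof -
      have "((\<lambda>h::real. poly ([:0, 1:] * P) (inverse h) * exp (- inverse h)) \<longlongrightarrow> 0) (at_right 0)"
        by (rule filterlim_compose[OF poly_exp_tendsto_0 filterlim_inverse_at_top_right])
      then show ?thesis
      proof (rule Lim_transform_eventually)
        show "\<forall>\<^sub>F h in at_right 0. poly ([:0, 1:] * P) (inverse h) * exp (- inverse h) = exp_poly P h / h"
          using eventually_at_right_less[of 0] by eventually_elim (simp add: exp_poly_def inverse_eq_divide)
      qed
    qed
    have l: "((\<lambda>h. exp_poly P h / h) \<longlongrightarrow> 0) (at_left 0)"
    proof (rule Lim_transform_eventually[OF tendsto_const])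
      show "\<forall>\<^sub>F h in at_left 0. 0 = exp_poly P h / h"
        unfolding eventually_at_filter by (rule always_eventually) (auto simp: exp_poly_def)
    qed
    have "((\<lambda>h. exp_poly P h / h) \<longlongrightarrow> 0) (at 0)" using l r by (rule filterlim_split_at)
    then show ?thesis using 2 by (simp add: has_field_derivative_iff exp_poly_def)
  next
    case 3
    have "((\<lambda>t. poly P (1 / t) * exp (- (1 / t))) has_real_derivative exp_poly ([:0, 0, 1:] * (P - pderiv P)) t) (at t)"
      using 3 by (auto intro!: derivative_eq_intros poly_DERIV simp: exp_poly_def field_simps power2_eq_square)
    then show ?thesis
      by (rule has_field_derivative_transform_within_open[of _ _ _ "{0<..}"]) (use 3 in \<open>auto simp: exp_poly_def\<close>)
  qed
qed

text \<open>The chain rule produces factors \<open>(y - a) \<bullet> v\<close>, hence the closure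
  under multiplication by coordinates. The class contains the partial derivatives of its
  members.\<close>

inductive_set bumps :: "real \<Rightarrow> 'a::euclidean_space \<Rightarrow> ('a \<Rightarrow> real) set" for \<delta> a where
  base: "(\<lambda>y. exp_poly P (\<delta>\<^sup>2 - (y - a) \<bullet> (y - a))) \<in> bumps \<delta> a"
| coord: "f \<in> bumps \<delta> a \<Longrightarrow> (\<lambda>y. (y \<bullet> b) * f y) \<in> bumps \<delta> a"
| scale: "f \<in> bumps \<delta> a \<Longrightarrow> (\<lambda>y. c * f y) \<in> bumps \<delta> a"
| add: "f \<in> bumps \<delta> a \<Longrightarrow> g \<in> bumps \<delta> a \<Longrightarrow> (\<lambda>y. f y + g y) \<in> bumps \<delta> a"

lemma exp_poly_radial_deriv:
  fixes a :: "'a::euclidean_space"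
  shows "((\<lambda>y. exp_poly P (\<delta>\<^sup>2 - (y - a) \<bullet> (y - a))) has_derivative
    (\<lambda>v. exp_poly ([:0, 0, 1:] * (P - pderiv P)) (\<delta>\<^sup>2 - (y - a) \<bullet> (y - a)) * (- 2 * ((y - a) \<bullet> v)))) (at y)"
proof -
  have 1: "((\<lambda>y. \<delta>\<^sup>2 - (y - a) \<bullet> (y - a)) has_derivative (\<lambda>v. - 2 * ((y - a) \<bullet> v))) (at y)"
    by (auto intro!: derivative_eq_intros simp: inner_commute)
  have 2: "(exp_poly P has_derivative (\<lambda>s. exp_poly ([:0, 0, 1:] * (P - pderiv P)) t * s)) (at t)" for t
    using exp_poly_deriv[of P t] by (simp only: has_field_derivative_def)
  from has_derivative_compose[OF 1 2] show ?thesis .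
qed

lemma bumps_deriv:
  "f \<in> bumps \<delta> a \<Longrightarrow> \<exists>f'. (\<forall>y. (f has_derivative f' y) (at y)) \<and> (\<forall>b. (\<lambda>y. f' y b) \<in> bumps \<delta> a)"
proof (induction rule: bumps.induct)
  case (base P)
  let ?g = "\<lambda>y. exp_poly ([:0, 0, 1:] * (P - pderiv P)) (\<delta>\<^sup>2 - (y - a) \<bullet> (y - a))"
  have "(\<lambda>y. ?g y * (- 2 * ((y - a) \<bullet> v))) \<in> bumps \<delta> a" for v
  proof -
    have "(\<lambda>y. (-2) * ((y \<bullet> v) * ?g y) + (2 * (a \<bullet> v)) * ?g y) \<in> bumps \<delta> a"
      by (intro bumps.add bumps.scale bumps.coord bumps.base)
    then show ?thesis by (simp add: inner_diff_left algebra_simps)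
  qed
  then show ?case by (intro exI[of _ "\<lambda>y v. ?g y * (- 2 * ((y - a) \<bullet> v))"] conjI allI exp_poly_radial_deriv)
next
  case (coord f b)
  then obtain f' where f': "\<And>y. (f has_derivative f' y) (at y)" "\<And>b. (\<lambda>y. f' y b) \<in> bumps \<delta> a" by blast
  have "((\<lambda>y. (y \<bullet> b) * f y) has_derivative (\<lambda>v. (v \<bullet> b) * f y + (y \<bullet> b) * f' y v)) (at y)" for y
    by (rule has_derivative_eq_rhs[OF has_derivative_mult[OF has_derivative_inner_left[OF has_derivative_ident] f'(1)]])
       (simp add: fun_eq_iff)
  moreover have "(\<lambda>y. (v \<bullet> b) * f y + (y \<bullet> b) * f' y v) \<in> bumps \<delta> a" for v
    by (intro bumps.add bumps.scale bumps.coord coord f')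
  ultimately show ?case by (intro exI[of _ "\<lambda>y v. (v \<bullet> b) * f y + (y \<bullet> b) * f' y v"]) simp
next
  case (scale f c)
  then obtain f' where f': "\<And>y. (f has_derivative f' y) (at y)" "\<And>b. (\<lambda>y. f' y b) \<in> bumps \<delta> a" by blast
  then show ?case by (intro exI[of _ "\<lambda>y v. c * f' y v"]) (auto intro!: bumps.scale has_derivative_mult_right)
next
  case (add f g)
  then obtain f' g' where f': "\<And>y. (f has_derivative f' y) (at y)" "\<And>b. (\<lambda>y. f' y b) \<in> bumps \<delta> a"
    and g': "\<And>y. (g has_derivative g' y) (at y)" "\<And>b. (\<lambda>y. g' y b) \<in> bumps \<delta> a" by blast
  then show ?case by (intro exI[of _ "\<lambda>y v. f' y v + g' y v"]) (auto intro!: bumps.add has_derivative_add)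
qed

lemma bumps_smooth:
  assumes "f \<in> bumps \<delta> (a::'a::euclidean_space)"
  shows "smooth_on UNIV f"
proof -
  have "Ck_on k UNIV f" if "f \<in> bumps \<delta> a" for k and f :: "'a \<Rightarrow> real" using that
  proof (induction k arbitrary: f)
    case 0
    then obtain f' where "\<And>y. (f has_derivative f' y) (at y)" using bumps_deriv by blast
    then have "continuous_on UNIV f" by (intro continuous_on_if_derivative)
    then show ?case by simp
  next
    case (Suc k)
    then obtain f' where f': "\<And>y. (f has_derivative f' y) (at y)" "\<And>b. (\<lambda>y. f' y b) \<in> bumps \<delta> a"
      using bumps_deriv by blast
    have "frechet_derivative f (at y) = f' y" for y using frechet_derivative_at[OF f'(1)] by simp
    then show ?case using Suc.IH f' by (auto simp: differentiable_on_def differentiable_def)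
  qed
  then show ?thesis using assms by (auto simp: smooth_on_def)
qed

lemma mollifier_exists:
  assumes \<delta>: "0 < \<delta>"
  obtains k :: "'a::euclidean_space \<Rightarrow> real" and k' :: "'a \<Rightarrow> 'a" where
    "\<And>w. (k has_derivative (\<lambda>v. k' w \<bullet> v)) (at w)" "continuous_on UNIV k'"
    "\<And>w. 0 \<le> k w" "\<And>w. \<delta> \<le> norm w \<Longrightarrow> k w = 0" "\<And>w. \<delta> \<le> norm w \<Longrightarrow> k' w = 0"
    "(\<integral>\<^sup>+w. ennreal (k w) \<partial>lborel) = 1"
    "\<And>a. smooth_on UNIV (\<lambda>y. k (a - y))"
proof -
  define g where "g w = exp_poly 1 (\<delta>\<^sup>2 - w \<bullet> w)" for w :: 'a
  have g_cont: "continuous_on UNIV g"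
    using continuous_on_if_derivative[OF exp_poly_radial_deriv[of 1 \<delta> "0::'a"], of UNIV] by (simp add: g_def[abs_def])
  have [measurable]: "g \<in> borel_measurable borel" by (rule borel_measurable_continuous_onI[OF g_cont])
  have g0: "0 \<le> g w" for w by (simp add: g_def exp_poly_def)
  have out: "\<delta>\<^sup>2 - w \<bullet> w \<le> 0" if "\<delta> \<le> norm w" for w :: 'a
    using that \<delta> power_mono[of \<delta> "norm w" 2] by (simp add: power2_norm_eq_inner)
  have g_out: "g w = 0" if "\<delta> \<le> norm w" for w using out[OF that] by (simp add: g_def exp_poly_def)
  have g1: "g w \<le> 1" for w by (simp add: g_def exp_poly_def)
  define N where "N = (\<integral>\<^sup>+w. ennreal (g w) \<partial>lborel)"
  have "N \<le> (\<integral>\<^sup>+w. indicator (ball 0 \<delta>) (w::'a) \<partial>lborel)"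
    unfolding N_def using g_out g1 by (intro nn_integral_mono) (auto simp: indicator_def not_less)
  also have "\<dots> < top" using \<delta> by (simp add: emeasure_ball)
  finally have N_fin: "N < top" .
  \<comment> \<open>On the ball of half the radius the argument of \<open>exp_poly\<close> is at
    least \<open>3 * \<delta>\<^sup>2 / 4\<close>, so the integrand is bounded below there.\<close>
  have N_pos: "0 < N"
  proof -
    have "0 < \<delta>\<^sup>2" using \<delta> by simp
    have "ennreal (exp (- (1 / (3 * \<delta>\<^sup>2 / 4)))) * emeasure lborel (ball (0::'a) (\<delta> / 2))
        = (\<integral>\<^sup>+w. ennreal (exp (- (1 / (3 * \<delta>\<^sup>2 / 4)))) * indicator (ball 0 (\<delta> / 2)) (w::'a) \<partial>lborel)"
      by (subst nn_integral_cmult_indicator) auto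
    also have "\<dots> \<le> N" unfolding N_def
    proof (rule nn_integral_mono)
      fix w :: 'a
      show "ennreal (exp (- (1 / (3 * \<delta>\<^sup>2 / 4)))) * indicator (ball 0 (\<delta> / 2)) w \<le> ennreal (g w)"
      proof (cases "w \<in> ball 0 (\<delta> / 2)")
        case True
        then have "(norm w)\<^sup>2 \<le> (\<delta> / 2)\<^sup>2" by (intro power_mono) auto
        then have le: "3 * \<delta>\<^sup>2 / 4 \<le> \<delta>\<^sup>2 - w \<bullet> w" by (simp add: power2_norm_eq_inner power_divide)
        then have pos: "0 < \<delta>\<^sup>2 - w \<bullet> w" using \<open>0 < \<delta>\<^sup>2\<close> by linarith
        have "1 / (\<delta>\<^sup>2 - w \<bullet> w) \<le> 1 / (3 * \<delta>\<^sup>2 / 4)" by (rule frac_le[OF _ order_refl _ le]) (use \<open>0 < \<delta>\<^sup>2\<close> in auto)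
        then show ?thesis using True pos by (simp add: g_def exp_poly_def)
      qed simp
    qed
    finally have "ennreal (exp (- (1 / (3 * \<delta>\<^sup>2 / 4)))) * emeasure lborel (ball (0::'a) (\<delta> / 2)) \<le> N" .
    moreover have "0 < ennreal (exp (- (1 / (3 * \<delta>\<^sup>2 / 4)))) * emeasure lborel (ball (0::'a) (\<delta> / 2))"
      using \<delta> unit_ball_vol_pos[of "real DIM('a)"] by (simp add: emeasure_ball ennreal_zero_less_mult_iff)
    ultimately show ?thesis by (rule order_less_le_trans[rotated])
  qed
  obtain c where c: "N = ennreal c" "0 < c" using N_pos N_fin by (cases N) auto
  define Q :: "real poly" where "Q = [:0, 0, 1:] * (1 - pderiv 1)"
  define k where "k w = (1 / c) * g w" for w
  define k' where "k' w = (- 2 / c * exp_poly Q (\<delta>\<^sup>2 - w \<bullet> w)) *\<^sub>R w" for w :: 'a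
  have dk: "(k has_derivative (\<lambda>v. k' w \<bullet> v)) (at w)" for w
  proof -
    have "(g has_derivative (\<lambda>v. exp_poly Q (\<delta>\<^sup>2 - w \<bullet> w) * (- 2 * (w \<bullet> v)))) (at w)"
      using exp_poly_radial_deriv[of 1 \<delta> "0::'a" w] by (simp add: g_def[abs_def] Q_def)
    from has_derivative_mult_right[OF this, of "1 / c"]
    show ?thesis unfolding k_def by (rule has_derivative_eq_rhs) (simp add: fun_eq_iff k'_def)
  qed
  have Qc: "continuous_on UNIV (exp_poly Q)" by (rule continuous_on_if_derivative)
       (use exp_poly_deriv[of Q] in \<open>simp only: has_field_derivative_def\<close>)
  show thesis
  proof (rule that[of k k'])
    show "continuous_on UNIV k'" unfolding k'_def by (intro continuous_intros continuous_on_compose2[OF Qc]) auto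
    show "k w = 0" "k' w = 0" if "\<delta> \<le> norm w" for w
      using g_out[OF that] out[OF that] by (simp_all add: k_def k'_def exp_poly_def)
    show "0 \<le> k w" for w using g0 c by (simp add: k_def)
    have "(\<integral>\<^sup>+w. ennreal (k w) \<partial>lborel) = (\<integral>\<^sup>+w. ennreal (1 / c) * ennreal (g w) \<partial>lborel)"
      using c g0 by (simp add: k_def ennreal_mult[symmetric])
    also have "\<dots> = ennreal (1 / c) * N" unfolding N_def by (rule nn_integral_cmult) measurable
    also have "\<dots> = 1" using c by (simp add: ennreal_mult[symmetric])
    finally show "(\<integral>\<^sup>+w. ennreal (k w) \<partial>lborel) = 1" .
    have "(\<lambda>y. (1 / c) * exp_poly 1 (\<delta>\<^sup>2 - (y - a) \<bullet> (y - a))) \<in> bumps \<delta> a" for a :: 'a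
      by (intro bumps.scale bumps.base)
    moreover have "(\<lambda>y. k (a - y)) = (\<lambda>y. (1 / c) * exp_poly 1 (\<delta>\<^sup>2 - (y - a) \<bullet> (y - a)))" for a
    proof
      fix y
      have "(a - y) \<bullet> (a - y) = (y - a) \<bullet> (y - a)" by (simp add: inner_diff_left inner_diff_right inner_commute)
      then show "k (a - y) = (1 / c) * exp_poly 1 (\<delta>\<^sup>2 - (y - a) \<bullet> (y - a))" by (simp only: k_def g_def)
    qed
    ultimately show "smooth_on UNIV (\<lambda>y. k (a - y))" for a
      using bumps_smooth[of "\<lambda>y. k (a - y)" \<delta> a] by simp
  qed (rule dk)
qed

text \<open>Uniform continuity of \<open>k'\<close> makes the first-order remainder of the kernel a
  small multiple of the increment for all arguments at once; integration against \<open>f\<close>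
  then multiplies it only by the integral of \<open>\<bar>f y\<bar>\<close>.\<close>

lemma has_derivative_convolution:
  fixes k :: "'a::euclidean_space \<Rightarrow> real" and k' :: "'a \<Rightarrow> 'a" and f :: "'a \<Rightarrow> real"
  assumes k: "\<And>w. (k has_derivative (\<lambda>v. k' w \<bullet> v)) (at w)" and k'u: "uniformly_continuous_on UNIV k'"
    and f: "integrable M f"
    and int: "\<And>x. integrable M (\<lambda>y. f y * k (x - y))" "\<And>x. integrable M (\<lambda>y. f y *\<^sub>R k' (x - y))"
  shows "((\<lambda>x. LINT y|M. f y * k (x - y)) has_derivative (\<lambda>v. (LINT y|M. f y *\<^sub>R k' (x - y)) \<bullet> v)) (at x)"
    and "continuous_on UNIV (\<lambda>x. LINT y|M. f y *\<^sub>R k' (x - y))"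
proof -
  let ?G = "\<lambda>x. LINT y|M. f y *\<^sub>R k' (x - y)"
  define T where "T = (LINT y|M. \<bar>f y\<bar>)"
  have T0: "0 \<le> T" unfolding T_def by simp
  have bnd: "\<exists>d>0. \<forall>w w'. dist w w' < d \<longrightarrow> norm (k' w - k' w') \<le> e" if "0 < e" for e
    using k'u that unfolding uniformly_continuous_on_def by (metis UNIV_I dist_norm less_imp_le)
  show "((\<lambda>x. LINT y|M. f y * k (x - y)) has_derivative (\<lambda>v. ?G x \<bullet> v)) (at x)" unfolding has_derivative_at_alt
  proof (intro conjI allI impI)
    show "bounded_linear (\<lambda>v. ?G x \<bullet> v)" by (rule bounded_linear_inner_right)
    fix e :: real assume e: "0 < e"
    define e' where "e' = e / (T + 1)"
    have e': "0 < e'" using e T0 by (simp add: e'_def)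
    obtain d where d: "0 < d" "\<And>w w'. dist w w' < d \<Longrightarrow> norm (k' w - k' w') \<le> e'" using bnd[OF e'] by auto
    show "\<exists>d>0. \<forall>y. norm (y - x) < d \<longrightarrow> norm ((LINT ya|M. f ya * k (y - ya)) - (LINT y|M. f y * k (x - y))
        - ?G x \<bullet> (y - x)) \<le> e * norm (y - x)"
    proof (intro exI[of _ d] conjI allI impI d(1))
      fix x' assume x': "norm (x' - x) < d"
      define v where "v = x' - x"
      have taylor: "\<bar>k (w + v) - k w - k' w \<bullet> v\<bar> \<le> e' * norm v" for w
      proof -
        let ?g = "\<lambda>s. k (w + s *\<^sub>R v) - s * (k' w \<bullet> v)"
        have "(?g has_real_derivative (k' (w + s *\<^sub>R v) \<bullet> v - k' w \<bullet> v)) (at s)" for s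
        proof -
          have "((\<lambda>s. w + s *\<^sub>R v) has_derivative (\<lambda>s. s *\<^sub>R v)) (at s)" by (auto intro!: derivative_eq_intros)
          from has_derivative_compose[OF this k]
          have "((\<lambda>s. k (w + s *\<^sub>R v)) has_real_derivative k' (w + s *\<^sub>R v) \<bullet> v) (at s)"
            by (simp add: has_field_derivative_def mult_commute_abs)
          then show ?thesis by (auto intro!: derivative_eq_intros)
        qed
        from MVT2[of 0 1, OF _ this] obtain s where s: "0 < s" "s < 1"
          "?g 1 - ?g 0 = (1 - 0) * (k' (w + s *\<^sub>R v) \<bullet> v - k' w \<bullet> v)" by auto
        then have "k (w + v) - k w - k' w \<bullet> v = (k' (w + s *\<^sub>R v) - k' w) \<bullet> v" by (simp add: inner_diff_left)
        also have "\<bar>\<dots>\<bar> \<le> norm (k' (w + s *\<^sub>R v) - k' w) * norm v" by (rule Cauchy_Schwarz_ineq2)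
        also have "\<dots> \<le> e' * norm v"
        proof (intro mult_right_mono d(2))
          have "s * norm v \<le> 1 * norm v" using s by (intro mult_right_mono) auto
          then show "dist (w + s *\<^sub>R v) w < d" using x' s by (simp add: dist_norm v_def)
        qed simp
        finally show ?thesis .
      qed
      have eq: "(LINT y|M. f y * k (x' - y)) - (LINT y|M. f y * k (x - y)) - ?G x \<bullet> (x' - x)
          = (LINT y|M. f y * (k ((x - y) + v) - k (x - y) - k' (x - y) \<bullet> v))"
      proof -
        have "?G x \<bullet> v = (LINT y|M. (f y *\<^sub>R k' (x - y)) \<bullet> v)" using int(2) by (rule integral_inner_left[symmetric])
        moreover have "integrable M (\<lambda>y. (f y *\<^sub>R k' (x - y)) \<bullet> v)" using int(2) by (intro integrable_inner_left)
        ultimately have "(LINT y|M. f y * k (x' - y)) - (LINT y|M. f y * k (x - y)) - ?G x \<bullet> v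
          = (LINT y|M. f y * k (x' - y) - f y * k (x - y) - (f y *\<^sub>R k' (x - y)) \<bullet> v)"
          using int by simp
        also have "\<dots> = (LINT y|M. f y * (k ((x - y) + v) - k (x - y) - k' (x - y) \<bullet> v))"
          by (intro Bochner_Integration.integral_cong) (simp_all add: v_def algebra_simps)
        finally show ?thesis unfolding v_def .
      qed
      have "\<bar>LINT y|M. f y * (k ((x - y) + v) - k (x - y) - k' (x - y) \<bullet> v)\<bar>
          \<le> (LINT y|M. \<bar>f y * (k ((x - y) + v) - k (x - y) - k' (x - y) \<bullet> v)\<bar>)" by (rule integral_abs_bound)
      also have "\<dots> \<le> (LINT y|M. (e' * norm v) * \<bar>f y\<bar>)"
      proof (rule integral_mono)
        have "integrable M (\<lambda>y. f y * k (x' - y) - f y * k (x - y) - (f y *\<^sub>R k' (x - y)) \<bullet> v)"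
          using int by (intro Bochner_Integration.integrable_diff integrable_inner_left) auto
        then show "integrable M (\<lambda>y. \<bar>f y * (k ((x - y) + v) - k (x - y) - k' (x - y) \<bullet> v)\<bar>)"
          by (intro integrable_abs) (simp add: v_def algebra_simps)
        show "\<bar>f y * (k ((x - y) + v) - k (x - y) - k' (x - y) \<bullet> v)\<bar> \<le> (e' * norm v) * \<bar>f y\<bar>" for y
          using mult_left_mono[OF taylor[of "x - y"], of "\<bar>f y\<bar>"] by (simp add: abs_mult mult_ac)
      qed (use f in auto)
      also have "\<dots> = e' * T * norm v" by (simp add: T_def mult_ac)
      also have "\<dots> \<le> e * norm v"
        using e T0 by (intro mult_right_mono) (auto simp: e'_def field_simps)
      finally show "norm ((LINT y|M. f y * k (x' - y)) - (LINT y|M. f y * k (x - y))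
        - ?G x \<bullet> (x' - x)) \<le> e * norm (x' - x)"
        unfolding eq by (simp add: v_def)
    qed
  qed
  show "continuous_on UNIV (\<lambda>x. LINT y|M. f y *\<^sub>R k' (x - y))" unfolding continuous_on_iff
  proof (intro ballI allI impI)
    fix x :: 'a and e :: real assume e: "0 < e"
    define e' where "e' = e / (T + 1) / 2"
    have e': "0 < e'" using e T0 by (simp add: e'_def)
    obtain d where d: "0 < d" "\<And>w w'. dist w w' < d \<Longrightarrow> norm (k' w - k' w') \<le> e'" using bnd[OF e'] by auto
    show "\<exists>d>0. \<forall>x'\<in>UNIV. dist x' x < d \<longrightarrow> dist (LINT y|M. f y *\<^sub>R k' (x' - y)) (?G x) < e"
    proof (intro exI[of _ d] conjI ballI impI d(1))
      fix x' assume x': "dist x' x < d"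
      have "(LINT y|M. f y *\<^sub>R k' (x' - y)) - ?G x = (LINT y|M. f y *\<^sub>R (k' (x' - y) - k' (x - y)))"
        using int(2) by (simp add: scaleR_diff_right)
      also have "norm \<dots> \<le> (LINT y|M. norm (f y *\<^sub>R (k' (x' - y) - k' (x - y))))" by (rule integral_norm_bound)
      also have "\<dots> \<le> (LINT y|M. e' * \<bar>f y\<bar>)"
      proof (rule integral_mono)
        show "integrable M (\<lambda>y. norm (f y *\<^sub>R (k' (x' - y) - k' (x - y))))"
          using int(2) by (simp add: scaleR_diff_right)
        fix y
        have "norm (k' (x' - y) - k' (x - y)) \<le> e'" using x' by (intro d(2)) (simp add: dist_norm)
        then show "norm (f y *\<^sub>R (k' (x' - y) - k' (x - y))) \<le> e' * \<bar>f y\<bar>"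
          using mult_left_mono[of "norm (k' (x' - y) - k' (x - y))" e' "\<bar>f y\<bar>"] by (simp add: mult.commute)
      qed (use f in auto)
      also have "\<dots> = e' * T" by (simp add: T_def)
      also have "\<dots> < e" using e T0 by (simp add: e'_def field_simps add_nonneg_pos)
      finally show "dist (LINT y|M. f y *\<^sub>R k' (x' - y)) (?G x) < e" by (simp add: dist_norm)
    qed
  qed
qed

section \<open>The closure of the domain, and Borel representatives\<close>

context radial_graph
begin

lemma sgn_scale: "0 < s \<Longrightarrow> sgn (s *\<^sub>R x) = sgn (x::'a)"
  by (simp add: sgn_scaleR)

lemma closure_D: "closure D = {x. norm x \<le> \<rho> (sgn x)}"
proof -
  have "closure D = D \<union> frontier D" by (auto simp: frontier_def closure_def interior_open[OF open_D])
  also have "\<dots> = {x. norm x \<le> \<rho> (sgn x)}"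
  proof (intro set_eqI iffI)
    fix x assume "x \<in> D \<union> frontier D"
    then show "x \<in> {x. norm x \<le> \<rho> (sgn x)}"
    proof
      assume "x \<in> frontier D"
      then obtain n where n: "norm n = 1" "x = graph_map n" by (auto simp: frontier_D graph_map_def)
      then show ?thesis by (simp add: sgn_graph_map norm_graph_map)
    qed (simp add: D_eq)
  next
    fix x assume "x \<in> {x. norm x \<le> \<rho> (sgn x)}"
    then consider "norm x < \<rho> (sgn x)" | "norm x = \<rho> (sgn x)" by fastforce
    then show "x \<in> D \<union> frontier D"
    proof cases
      case 2
      then have "x \<noteq> 0" using \<rho>_pos[of "sgn x"] by auto
      have "x = \<rho> (sgn x) *\<^sub>R sgn x" using 2 norm_scaleR_sgn[of x] by simp
      then have "x \<in> frontier D" unfolding frontier_D using \<open>x \<noteq> 0\<close> by (intro image_eqI[of _ _ "sgn x"]) (auto simp: norm_sgn)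
      then show ?thesis by simp
    qed (simp add: D_eq)
  qed
  finally show ?thesis .
qed

lemma closure_D_bounded: "x \<in> closure D \<Longrightarrow> norm x \<le> r1"
  using \<rho>_bounds(2)[of "sgn x"] by (auto simp: closure_D)

lemma compact_closure_D: "compact (closure D)"
proof -
  have "bounded (closure D)" unfolding bounded_iff using closure_D_bounded by blast
  then show ?thesis by (simp add: compact_eq_bounded_closed)
qed

lemma shrink_closure_D:
  assumes "x \<in> closure D" "0 < s" "s < 1"
  shows "s *\<^sub>R x \<in> D"
proof (cases "x = 0")
  case False
  have "s * norm x < norm x" using assms False by simp
  also have "\<dots> \<le> \<rho> (sgn x)" using assms(1) by (simp add: closure_D)
  finally show ?thesis using assms by (simp add: D_eq sgn_scale)
qed (use zero_in_D in simp)

lemma graph_map_closure: "norm n = 1 \<Longrightarrow> graph_map n \<in> closure D"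
  by (simp add: closure_D sgn_graph_map norm_graph_map)

text \<open>Sobolev functions live on the completed measure restricted to \<open>D\<close>, while
  polar coordinates, translations and Fubini are carried out on \<open>lborel\<close>. A Borel
  function equal almost everywhere links the two.\<close>

lemma lebesgue_on_D_integral:
  fixes f g :: "'a \<Rightarrow> real"
  assumes g: "(\<lambda>x. indicator D x * g x) \<in> borel_measurable borel"
    and ae: "AE x in lebesgue_on D. f x = g x" and f: "f \<in> borel_measurable (lebesgue_on D)"
  shows "integrable (lebesgue_on D) f \<longleftrightarrow> set_integrable lborel D g"
    and "(LINT x|lebesgue_on D. f x) = (LINT x:D|lborel. g x)"
proof -
  have D: "D \<in> sets lebesgue" by (simp add: borel_open[OF open_D] sets_completionI_sets)
  have gm: "(\<lambda>x. indicator D x *\<^sub>R g x) \<in> borel_measurable lborel" using g by simp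
  have gL: "g \<in> borel_measurable (lebesgue_on D)"
    using measurable_completion[OF gm] D by (subst borel_measurable_restrict_space_iff) (auto simp: mult.commute)
  have "integrable (lebesgue_on D) f \<longleftrightarrow> integrable (lebesgue_on D) g" using ae f gL by (intro integrable_cong_AE) auto
  also have "\<dots> \<longleftrightarrow> integrable lebesgue (\<lambda>x. indicator D x *\<^sub>R g x)"
    using D by (subst integrable_restrict_space) auto
  also have "\<dots> \<longleftrightarrow> set_integrable lborel D g"
    unfolding set_integrable_def using gm by (rule integrable_completion)
  finally show "integrable (lebesgue_on D) f \<longleftrightarrow> set_integrable lborel D g" .
  have "(LINT x|lebesgue_on D. f x) = (LINT x|lebesgue_on D. g x)" using ae f gL by (intro integral_cong_AE) auto
  also have "\<dots> = (LINT x|lebesgue. indicator D x *\<^sub>R g x)"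
    using D by (subst integral_restrict_space) auto
  also have "\<dots> = (LINT x:D|lborel. g x)"
    unfolding set_lebesgue_integral_def using gm by (rule integral_completion)
  finally show "(LINT x|lebesgue_on D. f x) = (LINT x:D|lborel. g x)" .
qed

lemma borel_representative:
  fixes G :: "'a \<Rightarrow> 'b::euclidean_space"
  assumes G: "G \<in> borel_measurable (lebesgue_on D)"
  obtains G0 where "G0 \<in> borel_measurable borel" "AE x in lebesgue_on D. G x = G0 x"
proof -
  have D: "D \<in> sets lebesgue" by (simp add: borel_open[OF open_D] sets_completionI_sets)
  have "\<exists>g. g \<in> borel_measurable borel \<and> (AE x in lborel. indicator D x * (G x \<bullet> b) = g x)" for b
  proof -
    have "(\<lambda>x. G x \<bullet> b) \<in> borel_measurable (lebesgue_on D)" using G by measurable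
    then have "(\<lambda>x. indicator D x * (G x \<bullet> b)) \<in> borel_measurable (completion lborel)"
      using D by (subst (asm) borel_measurable_restrict_space_iff) (auto simp: mult.commute)
    from completion_ex_borel_measurable_real[OF this] show ?thesis by auto
  qed
  then obtain g where g: "\<And>b. g b \<in> borel_measurable borel" "\<And>b. AE x in lborel. indicator D x * (G x \<bullet> b) = g b x"
    by metis
  show thesis
  proof (rule that[of "\<lambda>x. \<Sum>b\<in>Basis. g b x *\<^sub>R b"])
    show "(\<lambda>x. \<Sum>b\<in>Basis. g b x *\<^sub>R b) \<in> borel_measurable borel" using g(1) by measurable
    have "AE x in lborel. \<forall>b\<in>Basis. indicator D x * (G x \<bullet> b) = g b x" using g(2) by (intro AE_finite_allI) auto
    then have "AE x in lebesgue. \<forall>b\<in>Basis. indicator D x * (G x \<bullet> b) = g b x" by (rule AE_completion)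
    then have "AE x in lebesgue. x \<in> D \<longrightarrow> G x = (\<Sum>b\<in>Basis. g b x *\<^sub>R b)"
    proof eventually_elim
      case (elim x)
      show ?case
      proof
        assume "x \<in> D"
        then have "(\<Sum>b\<in>Basis. g b x *\<^sub>R b) = (\<Sum>b\<in>Basis. (G x \<bullet> b) *\<^sub>R b)" using elim by (intro sum.cong) auto
        then show "G x = (\<Sum>b\<in>Basis. g b x *\<^sub>R b)" by (simp add: euclidean_representation)
      qed
    qed
    then show "AE x in lebesgue_on D. G x = (\<Sum>b\<in>Basis. g b x *\<^sub>R b)" using D by (subst AE_restrict_space_iff) auto
  qed
qed

end

lemma compact_support_uniform:
  fixes k :: "'a::euclidean_space \<Rightarrow> 'b::real_normed_vector"
  assumes k: "continuous_on UNIV k" and supp: "\<And>w. \<delta> \<le> norm w \<Longrightarrow> k w = 0"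
  shows "uniformly_continuous_on UNIV k" "\<exists>K. \<forall>w. norm (k w) \<le> K"
proof -
  have u: "uniformly_continuous_on (cball 0 (\<delta> + 1)) k"
    by (intro compact_uniformly_continuous continuous_on_subset[OF k]) auto
  show "uniformly_continuous_on UNIV k" unfolding uniformly_continuous_on_def
  proof (intro allI impI)
    fix e :: real assume "0 < e"
    then obtain d where d: "0 < d" "\<And>x x'. x \<in> cball 0 (\<delta> + 1) \<Longrightarrow> x' \<in> cball 0 (\<delta> + 1) \<Longrightarrow> dist x' x < d \<Longrightarrow> dist (k x') (k x) < e"
      using u unfolding uniformly_continuous_on_def by metis
    have "dist (k x') (k x) < e" if "dist x' x < min d 1" for x x'
    proof (cases "norm x \<le> \<delta> + 1 \<and> norm x' \<le> \<delta> + 1")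
      case True
      then show ?thesis using that by (intro d(2)) auto
    next
      case False
      have "norm x \<le> norm x' + dist x' x" "norm x' \<le> norm x + dist x' x"
        by (metis add.commute dist_norm norm_minus_commute norm_triangle_sub)+
      then have "\<delta> \<le> norm x" "\<delta> \<le> norm x'" using False that by auto
      then show ?thesis using \<open>0 < e\<close> by (simp add: supp)
    qed
    then show "\<exists>d>0. \<forall>x\<in>UNIV. \<forall>x'\<in>UNIV. dist x' x < d \<longrightarrow> dist (k x') (k x) < e"
      using d(1) by (intro exI[of _ "min d 1"]) auto
  qed
  obtain K where K: "\<forall>x\<in>cball 0 \<delta>. \<bar>norm (k x)\<bar> \<le> K"
    using compact_abs_bounded[OF compact_cball continuous_on_norm[OF continuous_on_subset[OF k subset_UNIV]]] by blast
  have "norm (k w) \<le> max K 0" for w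
  proof (cases "norm w \<le> \<delta>")
    case True
    then have "\<bar>norm (k w)\<bar> \<le> K" using K by auto
    then show ?thesis by simp
  qed (simp add: supp)
  then show "\<exists>K. \<forall>w. norm (k w) \<le> K" by blast
qed

section \<open>Approximation of Sobolev functions by continuously differentiable ones\<close>

lemma nn_integral_lborel_affine:
  fixes f :: "'a::euclidean_space \<Rightarrow> ennreal"
  assumes [measurable]: "f \<in> borel_measurable borel" and c: "c \<noteq> 0"
  shows "(\<integral>\<^sup>+x. f x \<partial>lborel) = ennreal (\<bar>c\<bar> ^ DIM('a)) * (\<integral>\<^sup>+x. f (t + c *\<^sub>R x) \<partial>lborel)"
  by (subst lborel_affine[OF c, of t]) (simp add: nn_integral_density nn_integral_distr nn_integral_cmult)

context radial_graph
begin

text \<open>Jensen's inequality by duality: Young's inequality for \<open>G y\<close> and the vector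
  dual to the average \<open>A\<close> is integrated against the probability density
  \<open>q\<close>, and its left side becomes \<open>norm A powr p\<close>.\<close>

lemma jensen_kernel:
  fixes q :: "'a \<Rightarrow> real" and G :: "'a \<Rightarrow> 'a"
  assumes p: "1 < p" and [measurable]: "q \<in> borel_measurable borel" "G \<in> borel_measurable borel"
    and q: "\<And>y. 0 \<le> q y" "\<And>y. q y \<le> K" "(LINT y:D|lborel. q y) = 1"
    and G: "set_integrable lborel D (\<lambda>y. norm (G y) powr p)"
  shows "set_integrable lborel D (\<lambda>y. q y *\<^sub>R G y)"
    and "set_integrable lborel D (\<lambda>y. norm (G y) powr p * q y)"
    and "norm (LINT y:D|lborel. q y *\<^sub>R G y) powr p \<le> (LINT y:D|lborel. norm (G y) powr p * q y)"
proof -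
  have K0: "0 \<le> K" using q(1,2) order_trans by blast
  have one: "set_integrable lborel D (\<lambda>_. 1 :: real)" by (rule set_integrable_D_bounded[where M = 1]) auto
  have "set_integrable lborel D (\<lambda>y. K * (1 + norm (G y) powr p))"
    by (intro set_integrable_mult_right set_integral_add one G)
  then show i1: "set_integrable lborel D (\<lambda>y. q y *\<^sub>R G y)" unfolding set_integrable_def
  proof (rule Bochner_Integration.integrable_bound)
    show "AE y in lborel. norm (indicator D y *\<^sub>R q y *\<^sub>R G y) \<le> norm (indicator D y *\<^sub>R (K * (1 + norm (G y) powr p)))"
    proof (intro always_eventually allI)
      fix y
      have "norm (G y) \<le> 1 + norm (G y) powr p"
      proof (cases "norm (G y) \<le> 1")
        case False
        then have "norm (G y) powr 1 \<le> norm (G y) powr p" using p by (intro powr_mono) auto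
        then show ?thesis using False by simp
      qed (simp add: add_increasing2)
      then have "q y * norm (G y) \<le> K * (1 + norm (G y) powr p)" using q K0 by (intro mult_mono) auto
      then show "norm (indicator D y *\<^sub>R q y *\<^sub>R G y) \<le> norm (indicator D y *\<^sub>R (K * (1 + norm (G y) powr p)))"
        using q(1)[of y] K0 by (cases "y \<in> D") (auto simp: abs_mult)
    qed
  qed measurable
  have "set_integrable lborel D (\<lambda>y. K * norm (G y) powr p)" by (intro set_integrable_mult_right G)
  then show i2: "set_integrable lborel D (\<lambda>y. norm (G y) powr p * q y)" unfolding set_integrable_def
  proof (rule Bochner_Integration.integrable_bound)
    show "AE y in lborel. norm (indicator D y *\<^sub>R (norm (G y) powr p * q y)) \<le> norm (indicator D y *\<^sub>R (K * norm (G y) powr p))"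
    proof (intro always_eventually allI)
      fix y
      have "norm (G y) powr p * q y \<le> norm (G y) powr p * K" using q(2)[of y] by (intro mult_left_mono) auto
      then show "norm (indicator D y *\<^sub>R (norm (G y) powr p * q y)) \<le> norm (indicator D y *\<^sub>R (K * norm (G y) powr p))"
        using q(1)[of y] K0 by (cases "y \<in> D") (auto simp: abs_mult mult.commute)
    qed
  qed measurable
  define A where "A = (LINT y:D|lborel. q y *\<^sub>R G y)"
  define V where "V = norm A powr (p - 1) *\<^sub>R sgn A"
  have i3: "set_integrable lborel D q" using q(1,2) by (intro set_integrable_D_bounded[where M = K]) auto
  have AV: "(LINT y:D|lborel. q y * (G y \<bullet> V)) = A \<bullet> V"
    using i1 unfolding A_def set_lebesgue_integral_def set_integrable_def
    by (subst integral_inner_left[symmetric]) (auto simp: mult.assoc)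
  have i4: "set_integrable lborel D (\<lambda>y. q y * (G y \<bullet> V))"
  proof -
    have "integrable lborel (\<lambda>y. (indicator D y *\<^sub>R q y *\<^sub>R G y) \<bullet> V)"
      using i1 unfolding set_integrable_def by (intro integrable_inner_left)
    then show ?thesis unfolding set_integrable_def by (simp add: mult.assoc)
  qed
  have VV: "A \<bullet> V = norm A powr p" "norm V powr (p / (p - 1)) = norm A powr p"
  proof -
    show "A \<bullet> V = norm A powr p"
    proof (cases "A = 0")
      case False
      then have "A \<bullet> sgn A = norm A" by (simp add: sgn_div_norm dot_square_norm power2_eq_square)
      then show ?thesis using False by (simp add: V_def powr_diff)
    qed simp
    show "norm V powr (p / (p - 1)) = norm A powr p"
      using p by (cases "A = 0") (simp_all add: V_def norm_sgn powr_powr)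
  qed
  have "(LINT y:D|lborel. p * (q y * (G y \<bullet> V)) - ((p - 1) * norm A powr p) * q y) \<le> (LINT y:D|lborel. norm (G y) powr p * q y)"
  proof (rule set_integral_mono)
    show "set_integrable lborel D (\<lambda>y. p * (q y * (G y \<bullet> V)) - ((p - 1) * norm A powr p) * q y)"
      by (intro set_integral_diff set_integrable_mult_right i3 i4)
    fix y
    have "q y * (p * (G y \<bullet> V) - (p - 1) * norm A powr p) \<le> q y * norm (G y) powr p"
      using norm_powr_Young[OF p, of "G y" V] q(1)[of y] unfolding VV by (intro mult_left_mono)
    then show "p * (q y * (G y \<bullet> V)) - ((p - 1) * norm A powr p) * q y \<le> norm (G y) powr p * q y"
      by (simp add: algebra_simps)
  qed (rule i2)
  moreover have "(LINT y:D|lborel. p * (q y * (G y \<bullet> V)) - ((p - 1) * norm A powr p) * q y)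
      = p * norm A powr p - (p - 1) * norm A powr p"
    using i3 i4 AV VV q(3) by (simp only: set_integral_diff set_integrable_mult_right set_integral_mult_right)
  ultimately show "norm (LINT y:D|lborel. q y *\<^sub>R G y) powr p \<le> (LINT y:D|lborel. norm (G y) powr p * q y)"
    unfolding A_def by (simp add: algebra_simps)
qed

text \<open>Dilation before convolution: every \<open>s *\<^sub>R x\<close> with \<open>x\<close> in
  the closure keeps a distance greater than \<delta> from the complement of \<open>D\<close>, so the
  kernel centred there is a test function for the weak gradient. Jensen's inequality and the
  substitution by \<open>s\<close> give the factor \<open>s powr p / s ^ DIM('a)\<close>.\<close>

lemma mollify_step:
  fixes z :: "'a \<Rightarrow> real" and G :: "'a \<Rightarrow> 'a"
  assumes p: "1 < p" and z: "continuous_on UNIV z" and G: "G \<in> Lp p (lebesgue_on D)" and wg: "weak_gradient D z G"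
    and s: "0 < s" "s < 1" and \<delta>: "0 < \<delta>" "\<And>x. x \<in> closure D \<Longrightarrow> cball (s *\<^sub>R x) \<delta> \<subseteq> D"
    and near: "\<And>x y. x \<in> closure D \<Longrightarrow> y \<in> D \<Longrightarrow> dist y (s *\<^sub>R x) \<le> \<delta> \<Longrightarrow> \<bar>z y - z x\<bar> \<le> e"
  shows "\<exists>z' Z'. (\<forall>x. (z' has_derivative (\<lambda>v. Z' x \<bullet> v)) (at x)) \<and> continuous_on UNIV Z' \<and> (\<forall>x\<in>closure D. \<bar>z' x - z x\<bar> \<le> e)
    \<and> (LINT x:D|lborel. norm (Z' x) powr p) \<le> s powr p / s ^ DIM('a) * (LINT x|lebesgue_on D. norm (G x) powr p)"
proof -
  obtain k :: "'a \<Rightarrow> real" and k' where k: "\<And>w. (k has_derivative (\<lambda>v. k' w \<bullet> v)) (at w)" "continuous_on UNIV k'"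
    "\<And>w. 0 \<le> k w" "\<And>w. \<delta> \<le> norm w \<Longrightarrow> k w = 0" "\<And>w. \<delta> \<le> norm w \<Longrightarrow> k' w = 0"
    "(\<integral>\<^sup>+w. ennreal (k w) \<partial>lborel) = 1" "\<And>a. smooth_on UNIV (\<lambda>y. k (a - y))" using mollifier_exists[OF \<delta>(1)] by blast
  have kc: "continuous_on UNIV k" by (rule continuous_on_if_derivative[OF k(1)])
  have [measurable]: "k \<in> borel_measurable borel" "k' \<in> borel_measurable borel" "z \<in> borel_measurable borel"
    using kc k(2) z by (auto intro: borel_measurable_continuous_onI)
  obtain K where K: "\<And>w. \<bar>k w\<bar> \<le> K" using compact_support_uniform(2)[OF kc k(4)] by auto
  obtain K' where K': "\<And>w. norm (k' w) \<le> K'" using compact_support_uniform(2)[OF k(2,5)] by auto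
  obtain Mz where Mz: "\<forall>x\<in>cball 0 r1. \<bar>z x\<bar> \<le> Mz"
    using compact_abs_bounded[OF compact_cball continuous_on_subset[OF z subset_UNIV]] by blast
  have Mz': "\<bar>z y\<bar> \<le> Mz" if "y \<in> D" for y using norm_D[OF that] Mz by simp
  have Mz0: "0 \<le> Mz" using Mz'[OF zero_in_D] by simp
  define f where "f y = indicator D y * z y" for y
  have [measurable]: "f \<in> borel_measurable borel" unfolding f_def by measurable
  have fM: "\<bar>f y\<bar> \<le> Mz" for y using Mz' Mz0 by (auto simp: f_def indicator_def)
  have f_out: "f y = 0" if "y \<notin> D" for y using that by (simp add: f_def)
  have intf: "integrable lborel f"
    using set_integrable_D_bounded[of z Mz] Mz' by (simp add: set_integrable_def f_def[abs_def])
  have intk: "integrable lborel (\<lambda>y. f y * k (x - y))" for x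
  proof (rule integrableI_bounded_set[where A = D and B = "Mz * K"])
    show "AE y in lborel. y \<in> D \<longrightarrow> norm (f y * k (x - y)) \<le> Mz * K"
      using fM K Mz0 by (auto simp: abs_mult intro!: mult_mono)
  qed (use D_finite f_out in auto)
  have intk': "integrable lborel (\<lambda>y. f y *\<^sub>R k' (x - y))" for x
  proof (rule integrableI_bounded_set[where A = D and B = "Mz * K'"])
    show "AE y in lborel. y \<in> D \<longrightarrow> norm (f y *\<^sub>R k' (x - y)) \<le> Mz * K'" using fM K' Mz0 by (auto intro!: mult_mono)
  qed (use D_finite f_out in auto)
  define F where "F x = (LINT y|lborel. f y * k (x - y))" for x
  define F' where "F' x = (LINT y|lborel. f y *\<^sub>R k' (x - y))" for x
  have dF: "(F has_derivative (\<lambda>v. F' x \<bullet> v)) (at x)" for x unfolding F_def F'_def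
    by (rule has_derivative_convolution(1)[OF k(1) compact_support_uniform(1)[OF k(2,5)] intf intk intk'])
  have cF: "continuous_on UNIV F'" unfolding F'_def
    by (rule has_derivative_convolution(2)[OF k(1) compact_support_uniform(1)[OF k(2,5)] intf intk intk'])
  have k_one: "(\<integral>\<^sup>+y. ennreal (k (a - y)) \<partial>lborel) = 1" for a
    using nn_integral_lborel_affine[of "\<lambda>w. ennreal (k w)" "-1" a] k(6) by simp
  have k_out: "k (a - y) = 0" if "cball a \<delta> \<subseteq> D" "y \<notin> D" for a y
  proof (rule k(4))
    have "y \<notin> cball a \<delta>" using that by blast
    then show "\<delta> \<le> norm (a - y)" by (simp add: dist_norm)
  qed
  have one: "(LINT y:D|lborel. k (a - y)) = 1" if a: "cball a \<delta> \<subseteq> D" for a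
  proof -
    have "(\<lambda>y. indicator D y *\<^sub>R k (a - y)) = (\<lambda>y. k (a - y))"
    proof
      show "indicator D y *\<^sub>R k (a - y) = k (a - y)" for y using k_out[OF a] by (cases "y \<in> D") auto
    qed
    then have "(LINT y:D|lborel. k (a - y)) = (LINT y|lborel. k (a - y))" by (simp only: set_lebesgue_integral_def)
    also have "\<dots> = enn2real (\<integral>\<^sup>+y. ennreal (k (a - y)) \<partial>lborel)"
      using k(3) by (intro integral_eq_nn_integral) auto
    finally show ?thesis by (simp add: k_one)
  qed
  have Gm: "G \<in> borel_measurable (lebesgue_on D)" and Gi: "integrable (lebesgue_on D) (\<lambda>x. norm (G x) powr p)"
    using G by (auto simp: Lp_def)
  obtain G0 where G0[measurable]: "G0 \<in> borel_measurable borel" and ae: "AE x in lebesgue_on D. G x = G0 x"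
    using borel_representative[OF Gm] by blast
  have G0p: "set_integrable lborel D (\<lambda>x. norm (G0 x) powr p)"
    "(LINT x|lebesgue_on D. norm (G x) powr p) = (LINT x:D|lborel. norm (G0 x) powr p)"
  proof -
    have "AE x in lebesgue_on D. norm (G x) powr p = norm (G0 x) powr p" using ae by eventually_elim simp
    from lebesgue_on_D_integral[OF _ this] show "set_integrable lborel D (\<lambda>x. norm (G0 x) powr p)"
      "(LINT x|lebesgue_on D. norm (G x) powr p) = (LINT x:D|lborel. norm (G0 x) powr p)" using Gi Gm by auto
  qed
  \<comment> \<open>The kernel centred at \<open>a\<close> is supported in \<open>D\<close>. Its
    derivative in the integration variable carries the minus sign that cancels the one in
    \<open>weak_gradient\<close>.\<close>
  have F'_eq: "F' a = (LINT y:D|lborel. k (a - y) *\<^sub>R G0 y)" if a: "cball a \<delta> \<subseteq> D" for a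
  proof (rule euclidean_eqI)
    fix b :: 'a assume b: "b \<in> Basis"
    let ?\<phi> = "\<lambda>y. k (a - y)"
    have "test_function D ?\<phi>" unfolding test_function_def using k(7) a k(4)
      by (intro conjI exI[of _ "cball a \<delta>"]) (auto simp: dist_norm)
    then have w: "(LINT x|lebesgue_on D. z x * frechet_derivative ?\<phi> (at x) b) = - (LINT x|lebesgue_on D. (G x \<bullet> b) * ?\<phi> x)"
      using wg b unfolding weak_gradient_def by blast
    have fd: "frechet_derivative ?\<phi> (at y) b = - (k' (a - y) \<bullet> b)" for y
    proof -
      have "((\<lambda>y. a - y) has_derivative (\<lambda>v. - v)) (at y)" by (auto intro!: derivative_eq_intros)
      from has_derivative_compose[OF this k(1)] have "(?\<phi> has_derivative (\<lambda>v. k' (a - y) \<bullet> - v)) (at y)" .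
      then have "frechet_derivative ?\<phi> (at y) = (\<lambda>v. k' (a - y) \<bullet> - v)" by (rule frechet_derivative_at[symmetric])
      then show ?thesis by simp
    qed
    have i: "set_integrable lborel D (\<lambda>y. k (a - y) *\<^sub>R G0 y)"
      using K k(3) one[OF a] G0p by (intro jensen_kernel(1)[OF p, where K = K]) (auto simp: abs_le_iff)
    have "(LINT x|lebesgue_on D. z x * frechet_derivative ?\<phi> (at x) b) = (LINT x:D|lborel. z x * - (k' (a - x) \<bullet> b))"
      unfolding fd
    proof (rule lebesgue_on_D_integral(2))
      show "(\<lambda>x. z x * - (k' (a - x) \<bullet> b)) \<in> borel_measurable (lebesgue_on D)"
        by (intro measurable_restrict_space1 measurable_completion) measurable
    qed auto
    also have "\<dots> = (LINT x|lborel. - ((f x *\<^sub>R k' (a - x)) \<bullet> b))"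
      unfolding set_lebesgue_integral_def by (intro Bochner_Integration.integral_cong) (auto simp: f_def)
    also have "\<dots> = - (F' a \<bullet> b)"
    proof -
      have "(LINT x|lborel. (f x *\<^sub>R k' (a - x)) \<bullet> b) = F' a \<bullet> b"
        unfolding F'_def by (intro integral_inner_left intk')
      then show ?thesis by (simp del: inner_scaleR_left)
    qed
    finally have l: "(LINT x|lebesgue_on D. z x * frechet_derivative ?\<phi> (at x) b) = - (F' a \<bullet> b)" .
    have "(LINT x|lebesgue_on D. (G x \<bullet> b) * ?\<phi> x) = (LINT x:D|lborel. (G0 x \<bullet> b) * ?\<phi> x)"
    proof (rule lebesgue_on_D_integral(2))
      show "AE x in lebesgue_on D. (G x \<bullet> b) * ?\<phi> x = (G0 x \<bullet> b) * ?\<phi> x" using ae by eventually_elim simp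
      have "?\<phi> \<in> borel_measurable (lebesgue_on D)" by (intro measurable_restrict_space1 measurable_completion) measurable
      then show "(\<lambda>x. (G x \<bullet> b) * ?\<phi> x) \<in> borel_measurable (lebesgue_on D)" using Gm by measurable
    qed measurable
    also have "\<dots> = (LINT x|lborel. (indicator D x *\<^sub>R ?\<phi> x *\<^sub>R G0 x) \<bullet> b)"
      unfolding set_lebesgue_integral_def by (intro Bochner_Integration.integral_cong) auto
    also have "\<dots> = (LINT y:D|lborel. k (a - y) *\<^sub>R G0 y) \<bullet> b"
      using i unfolding set_lebesgue_integral_def set_integrable_def by (intro integral_inner_left)
    finally show "F' a \<bullet> b = (LINT y:D|lborel. k (a - y) *\<^sub>R G0 y) \<bullet> b" using w l by simp
  qed
  define g where "g y = ennreal (indicator D y * norm (G0 y) powr p)" for y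
  have [measurable]: "g \<in> borel_measurable borel" unfolding g_def by measurable
  have jensen: "ennreal (norm (F' a) powr p) \<le> (\<integral>\<^sup>+y. g y * ennreal (k (a - y)) \<partial>lborel)" if a: "cball a \<delta> \<subseteq> D" for a
  proof -
    note j = jensen_kernel[OF p _ G0 k(3) _ one[OF a] G0p(1), where K = K]
    have kb: "(\<lambda>y. k (a - y)) \<in> borel_measurable borel" "\<And>y. k (a - y) \<le> K" using K by (auto simp: abs_le_iff)
    have "norm (F' a) powr p \<le> (LINT y:D|lborel. norm (G0 y) powr p * k (a - y))"
      unfolding F'_eq[OF a] by (rule j(3)[OF kb])
    then have "ennreal (norm (F' a) powr p) \<le> ennreal (LINT y:D|lborel. norm (G0 y) powr p * k (a - y))" by (rule ennreal_leI)
    also have "\<dots> = (\<integral>\<^sup>+y. ennreal (indicator D y *\<^sub>R (norm (G0 y) powr p * k (a - y))) \<partial>lborel)"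
      unfolding set_lebesgue_integral_def using j(2)[OF kb] k(3) unfolding set_integrable_def
      by (intro nn_integral_eq_integral[symmetric]) auto
    also have "\<dots> = (\<integral>\<^sup>+y. g y * ennreal (k (a - y)) \<partial>lborel)"
      using k(3) by (intro nn_integral_cong) (simp add: g_def ennreal_mult[symmetric] mult.assoc)
    finally show ?thesis .
  qed
  define z' where "z' x = F (s *\<^sub>R x)" for x
  define Z' where "Z' x = s *\<^sub>R F' (s *\<^sub>R x)" for x
  have dz: "(z' has_derivative (\<lambda>v. Z' x \<bullet> v)) (at x)" for x
  proof -
    have "((\<lambda>x. s *\<^sub>R x) has_derivative (\<lambda>v. s *\<^sub>R v)) (at x)" by (auto intro!: derivative_eq_intros)
    from has_derivative_compose[OF this dF] show ?thesis by (simp add: z'_def[abs_def] Z'_def)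
  qed
  have cZ: "continuous_on UNIV Z'" unfolding Z'_def by (intro continuous_intros continuous_on_compose2[OF cF]) auto
  have close: "\<bar>z' x - z x\<bar> \<le> e" if x: "x \<in> closure D" for x
  proof -
    have a: "cball (s *\<^sub>R x) \<delta> \<subseteq> D" by (rule \<delta>(2)[OF x])
    have ik: "set_integrable lborel D (\<lambda>y. k (s *\<^sub>R x - y))" by (rule set_integrable_D_bounded[where M = K]) (use K in auto)
    have izk: "set_integrable lborel D (\<lambda>y. z y * k (s *\<^sub>R x - y))"
      using intk[of "s *\<^sub>R x"] by (simp add: set_integrable_def f_def mult.assoc)
    have "z' x = (LINT y:D|lborel. z y * k (s *\<^sub>R x - y))"
      unfolding z'_def F_def set_lebesgue_integral_def f_def by (simp add: mult.assoc)
    moreover have "z x = (LINT y:D|lborel. z x * k (s *\<^sub>R x - y))" using one[OF a] by simp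
    ultimately have "z' x - z x = (LINT y:D|lborel. z y * k (s *\<^sub>R x - y)) - (LINT y:D|lborel. z x * k (s *\<^sub>R x - y))"
      by simp
    also have "\<dots> = (LINT y:D|lborel. z y * k (s *\<^sub>R x - y) - z x * k (s *\<^sub>R x - y))"
      by (rule set_integral_diff(2)[symmetric]) (intro izk ik set_integrable_mult_right)+
    finally have eq: "z' x - z x = (LINT y:D|lborel. z y * k (s *\<^sub>R x - y) - z x * k (s *\<^sub>R x - y))" .
    have iD: "set_integrable lborel D (\<lambda>y. z y * k (s *\<^sub>R x - y) - z x * k (s *\<^sub>R x - y))"
      by (intro set_integral_diff izk ik set_integrable_mult_right)
    have "\<bar>z' x - z x\<bar> \<le> (LINT y:D|lborel. \<bar>z y * k (s *\<^sub>R x - y) - z x * k (s *\<^sub>R x - y)\<bar>)"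
      unfolding eq using set_integral_norm_bound[OF iD] by simp
    also have "\<dots> \<le> (LINT y:D|lborel. e * k (s *\<^sub>R x - y))"
    proof (rule set_integral_mono)
      show "set_integrable lborel D (\<lambda>y. \<bar>z y * k (s *\<^sub>R x - y) - z x * k (s *\<^sub>R x - y)\<bar>)" using iD by (rule set_integrable_abs)
      show "set_integrable lborel D (\<lambda>y. e * k (s *\<^sub>R x - y))" by (intro set_integrable_mult_right ik)
      fix y assume y: "y \<in> D"
      show "\<bar>z y * k (s *\<^sub>R x - y) - z x * k (s *\<^sub>R x - y)\<bar> \<le> e * k (s *\<^sub>R x - y)"
      proof (cases "dist y (s *\<^sub>R x) \<le> \<delta>")
        case True
        have "\<bar>z y - z x\<bar> * k (s *\<^sub>R x - y) \<le> e * k (s *\<^sub>R x - y)"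
          using near[OF x y True] k(3) by (intro mult_right_mono) auto
        then show ?thesis using k(3) by (simp add: left_diff_distrib[symmetric] abs_mult)
      next
        case False
        then have "k (s *\<^sub>R x - y) = 0" by (intro k(4)) (simp add: dist_norm norm_minus_commute)
        then show ?thesis by simp
      qed
    qed
    also have "\<dots> = e" using one[OF a] by simp
    finally show ?thesis .
  qed
  have "(LINT x:D|lborel. norm (Z' x) powr p) \<le> s powr p / s ^ DIM('a) * (LINT x:D|lborel. norm (G0 x) powr p)"
  proof -
    define I where "I = (LINT x:D|lborel. norm (G0 x) powr p)"
    have I0: "0 \<le> I" unfolding I_def set_lebesgue_integral_def by (intro integral_nonneg_AE) auto
    have gI: "(\<integral>\<^sup>+y. g y \<partial>lborel) = ennreal I"
      unfolding g_def I_def set_lebesgue_integral_def using G0p(1) unfolding set_integrable_def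
      by (subst nn_integral_eq_integral[symmetric]) auto
    \<comment> \<open>The dilation of the first argument turns the unit mass of the kernel into the
      reciprocal Jacobian.\<close>
    have inner: "(\<integral>\<^sup>+x. ennreal (k (s *\<^sub>R x - y)) \<partial>lborel) = ennreal (1 / s ^ DIM('a))" for y
    proof -
      have "1 = ennreal (s ^ DIM('a)) * (\<integral>\<^sup>+x. ennreal (k (s *\<^sub>R x - y)) \<partial>lborel)"
        using nn_integral_lborel_affine[of "\<lambda>w. ennreal (k w)" s "- y"] k(6) s by simp
      then have "ennreal (1 / s ^ DIM('a)) * 1 = ennreal (1 / s ^ DIM('a)) * (ennreal (s ^ DIM('a)) * (\<integral>\<^sup>+x. ennreal (k (s *\<^sub>R x - y)) \<partial>lborel))"
        by simp
      then show ?thesis using s by (simp add: mult.assoc[symmetric] ennreal_mult'[symmetric])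
    qed
    have "(\<integral>\<^sup>+x. ennreal (indicator D x *\<^sub>R norm (Z' x) powr p) \<partial>lborel)
        \<le> (\<integral>\<^sup>+x. ennreal (s powr p) * (\<integral>\<^sup>+y. g y * ennreal (k (s *\<^sub>R x - y)) \<partial>lborel) \<partial>lborel)"
    proof (rule nn_integral_mono)
      fix x
      show "ennreal (indicator D x *\<^sub>R norm (Z' x) powr p) \<le> ennreal (s powr p) * (\<integral>\<^sup>+y. g y * ennreal (k (s *\<^sub>R x - y)) \<partial>lborel)"
      proof (cases "x \<in> D")
        case True
        then have a: "cball (s *\<^sub>R x) \<delta> \<subseteq> D" using closure_subset by (intro \<delta>(2)) blast
        have "ennreal (indicator D x *\<^sub>R norm (Z' x) powr p) = ennreal (s powr p) * ennreal (norm (F' (s *\<^sub>R x)) powr p)"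
          using True s by (simp add: Z'_def powr_mult ennreal_mult[symmetric])
        also have "\<dots> \<le> ennreal (s powr p) * (\<integral>\<^sup>+y. g y * ennreal (k (s *\<^sub>R x - y)) \<partial>lborel)"
          by (intro mult_left_mono jensen[OF a]) simp
        finally show ?thesis .
      qed simp
    qed
    also have "\<dots> = ennreal (s powr p) * (\<integral>\<^sup>+x. (\<integral>\<^sup>+y. g y * ennreal (k (s *\<^sub>R x - y)) \<partial>lborel) \<partial>lborel)"
      by (rule nn_integral_cmult) measurable
    also have "(\<integral>\<^sup>+x. (\<integral>\<^sup>+y. g y * ennreal (k (s *\<^sub>R x - y)) \<partial>lborel) \<partial>lborel)
        = (\<integral>\<^sup>+y. (\<integral>\<^sup>+x. g y * ennreal (k (s *\<^sub>R x - y)) \<partial>lborel) \<partial>lborel)"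
      by (rule lborel_pair.Fubini') measurable
    also have "\<dots> = (\<integral>\<^sup>+y. g y * ennreal (1 / s ^ DIM('a)) \<partial>lborel)"
      by (intro nn_integral_cong) (simp add: nn_integral_cmult inner)
    also have "\<dots> = ennreal I * ennreal (1 / s ^ DIM('a))" by (simp add: nn_integral_multc gI)
    finally have le: "(\<integral>\<^sup>+x. ennreal (indicator D x *\<^sub>R norm (Z' x) powr p) \<partial>lborel) \<le> ennreal (s powr p / s ^ DIM('a) * I)"
      using s I0 by (simp add: ennreal_mult[symmetric] mult_ac)
    have "set_integrable lborel D (\<lambda>x. norm (Z' x) powr p)"
      by (rule set_integrable_continuous) (intro continuous_on_powr' continuous_intros cZ, use p in auto)
    then have "(\<integral>\<^sup>+x. ennreal (indicator D x *\<^sub>R norm (Z' x) powr p) \<partial>lborel) = ennreal (LINT x:D|lborel. norm (Z' x) powr p)"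
      unfolding set_integrable_def set_lebesgue_integral_def by (intro nn_integral_eq_integral) auto
    with le have "ennreal (LINT x:D|lborel. norm (Z' x) powr p) \<le> ennreal (s powr p / s ^ DIM('a) * I)" by simp
    then show ?thesis unfolding I_def[symmetric] using I0 s by (subst (asm) ennreal_le_iff) auto
  qed
  then show ?thesis using dz cZ close G0p(2) by (intro exI[of _ z'] exI[of _ Z']) auto
qed

end

text \<open>Convexity of the power with weights \<open>1 / (1 + r)\<close> and
  \<open>r / (1 + r)\<close>. As the coefficient of \<open>x powr p\<close> tends to 1 with
  \<open>r\<close> tending to 0, this does the work of the triangle inequality of L^p in passages to
  the limit.\<close>

lemma powr_add_le:
  fixes x y :: real
  assumes p: "1 < p" and r: "0 < r" and xy: "0 \<le> x" "0 \<le> y"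
  shows "(x + y) powr p \<le> (1 + r) powr (p - 1) * x powr p + (1 + 1 / r) powr (p - 1) * y powr p"
proof -
  consider "x = 0" | "y = 0" | "0 < x" "0 < y" using xy by linarith
  then show ?thesis
  proof cases
    case 1
    have "1 \<le> (1 + 1 / r) powr (p - 1)" using p r by (intro ge_one_powr_ge_zero) auto
    from mult_right_mono[OF this, of "y powr p"] show ?thesis using 1 p by simp
  next
    case 2
    have "1 \<le> (1 + r) powr (p - 1)" using p r by (intro ge_one_powr_ge_zero) auto
    from mult_right_mono[OF this, of "x powr p"] show ?thesis using 2 p by simp
  next
    case 3
    define X where "X = (1 + r) * x"
    define Y where "Y = (1 + 1 / r) * y"
    have XY: "0 < X" "0 < Y" using 3 r by (auto simp: X_def Y_def add_pos_pos)
    have "1 - 1 / (1 + r) = r / (1 + r)" "1 + 1 / r = (1 + r) / r" using r by (auto simp: field_simps)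
    then have e: "(1 / (1 + r)) * X = x" "(1 - 1 / (1 + r)) * Y = y" using r by (auto simp: X_def Y_def)
    have "((1 - (1 - 1 / (1 + r))) *\<^sub>R X + (1 - 1 / (1 + r)) *\<^sub>R Y) powr p
        \<le> (1 - (1 - 1 / (1 + r))) * X powr p + (1 - 1 / (1 + r)) * Y powr p"
      using p r XY by (intro convex_onD[OF powr_convex]) auto
    then have "(x + y) powr p \<le> (1 / (1 + r)) * X powr p + (1 - 1 / (1 + r)) * Y powr p" using e by simp
    also have "(1 / (1 + r)) * X powr p = (1 + r) powr (p - 1) * x powr p"
      using r 3 by (simp add: X_def powr_mult powr_diff)
    also have "(1 - 1 / (1 + r)) * Y powr p = (1 + 1 / r) powr (p - 1) * y powr p"
    proof -
      have "1 - 1 / (1 + r) = 1 / (1 + 1 / r)" using r by (simp add: field_simps)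
      moreover have "0 < 1 + 1 / r" using r by (simp add: add_pos_pos)
      ultimately show ?thesis using 3 by (simp add: Y_def powr_mult powr_diff)
    qed
    finally show ?thesis .
  qed
qed

lemma Lp_diff:
  fixes f g :: "'a \<Rightarrow> 'b::euclidean_space"
  assumes p: "1 < p" and f: "f \<in> Lp p M" and g: "g \<in> Lp p M"
  shows "integrable M (\<lambda>x. norm (f x - g x) powr p)"
    and "0 < r \<Longrightarrow> (LINT x|M. norm (f x) powr p)
      \<le> (1 + r) powr (p - 1) * (LINT x|M. norm (g x) powr p) + (1 + 1 / r) powr (p - 1) * (LINT x|M. norm (f x - g x) powr p)"
proof -
  have [measurable]: "f \<in> borel_measurable M" "g \<in> borel_measurable M"
    and i: "integrable M (\<lambda>x. norm (f x) powr p)" "integrable M (\<lambda>x. norm (g x) powr p)"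
    using f g by (auto simp: Lp_def)
  have "integrable M (\<lambda>x. 2 powr (p - 1) * norm (f x) powr p + 2 powr (p - 1) * norm (g x) powr p)" using i by auto
  then show i3: "integrable M (\<lambda>x. norm (f x - g x) powr p)"
  proof (rule Bochner_Integration.integrable_bound)
    show "AE x in M. norm (norm (f x - g x) powr p) \<le> norm (2 powr (p - 1) * norm (f x) powr p + 2 powr (p - 1) * norm (g x) powr p)"
    proof (intro always_eventually allI)
      fix x
      have "norm (f x - g x) powr p \<le> (norm (f x) + norm (g x)) powr p"
        using p by (intro powr_mono2 norm_triangle_ineq4) auto
      also have "\<dots> \<le> 2 powr (p - 1) * norm (f x) powr p + 2 powr (p - 1) * norm (g x) powr p"
        using powr_add_le[OF p, of 1 "norm (f x)" "norm (g x)"] by simp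
      finally show "norm (norm (f x - g x) powr p) \<le> norm (2 powr (p - 1) * norm (f x) powr p + 2 powr (p - 1) * norm (g x) powr p)"
        by simp
    qed
  qed measurable
  assume r: "0 < r"
  have "(LINT x|M. norm (f x) powr p) \<le> (LINT x|M. (1 + r) powr (p - 1) * norm (g x) powr p + (1 + 1 / r) powr (p - 1) * norm (f x - g x) powr p)"
  proof (rule integral_mono)
    fix x
    have "norm (f x) powr p \<le> (norm (g x) + norm (f x - g x)) powr p"
      using p norm_triangle_sub[of "f x" "g x"] by (intro powr_mono2) auto
    also have "\<dots> \<le> (1 + r) powr (p - 1) * norm (g x) powr p + (1 + 1 / r) powr (p - 1) * norm (f x - g x) powr p"
      by (rule powr_add_le[OF p r]) auto
    finally show "norm (f x) powr p \<le> (1 + r) powr (p - 1) * norm (g x) powr p + (1 + 1 / r) powr (p - 1) * norm (f x - g x) powr p" .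
  qed (use i i3 in auto)
  then show "(LINT x|M. norm (f x) powr p)
      \<le> (1 + r) powr (p - 1) * (LINT x|M. norm (g x) powr p) + (1 + 1 / r) powr (p - 1) * (LINT x|M. norm (f x - g x) powr p)"
    using i i3 by simp
qed

context radial_graph
begin

text \<open>The dilation is taken so close to 1 that its effect on the energy and the displacement
  of the closure are both small; the kernel radius then comes from compactness of the dilated
  closure inside \<open>D\<close>.\<close>

lemma mollification:
  fixes z :: "'a \<Rightarrow> real" and G :: "'a \<Rightarrow> 'a"
  assumes p: "1 < p" and z: "continuous_on UNIV z" and G: "G \<in> Lp p (lebesgue_on D)" and wg: "weak_gradient D z G"
    and e: "0 < e"
  shows "\<exists>z' Z'. (\<forall>x. (z' has_derivative (\<lambda>v. Z' x \<bullet> v)) (at x)) \<and> continuous_on UNIV Z' \<and> (\<forall>x\<in>closure D. \<bar>z' x - z x\<bar> \<le> e)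
    \<and> (LINT x:D|lborel. norm (Z' x) powr p) \<le> (1 + e) * (LINT x|lebesgue_on D. norm (G x) powr p)"
proof -
  let ?E = "LINT x|lebesgue_on D. norm (G x) powr p"
  have "uniformly_continuous_on (closure D) z"
    by (intro compact_uniformly_continuous continuous_on_subset[OF z] compact_closure_D) auto
  then obtain d where d: "0 < d" "\<And>x y. x \<in> closure D \<Longrightarrow> y \<in> closure D \<Longrightarrow> dist y x < d \<Longrightarrow> dist (z y) (z x) < e"
    using e unfolding uniformly_continuous_on_def by metis
  have "((\<lambda>s. s powr p / s ^ DIM('a)) \<longlongrightarrow> 1 powr p / 1 ^ DIM('a)) (at_left (1::real))" by (intro tendsto_intros) auto
  then have "\<forall>\<^sub>F s in at_left (1::real). s powr p / s ^ DIM('a) < 1 + e" using e by (intro order_tendstoD(2)) auto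
  moreover have "((\<lambda>s. (1 - s) * r1) \<longlongrightarrow> (1 - 1) * r1) (at_left (1::real))" by (intro tendsto_intros)
  then have "\<forall>\<^sub>F s in at_left (1::real). (1 - s) * r1 < d / 2" using d(1) by (intro order_tendstoD(2)) auto
  moreover have "\<forall>\<^sub>F s in at_left (1::real). s \<in> {0<..<1}" by (rule eventually_at_left_real) simp
  ultimately have "\<forall>\<^sub>F s in at_left (1::real). s powr p / s ^ DIM('a) < 1 + e \<and> (1 - s) * r1 < d / 2 \<and> s \<in> {0<..<1}"
    by eventually_elim simp
  then obtain s :: real where s: "s powr p / s ^ DIM('a) < 1 + e" "(1 - s) * r1 < d / 2" "0 < s" "s < 1"
    using eventually_happens'[OF trivial_limit_at_left_real] by auto
  have "compact ((\<lambda>x. s *\<^sub>R x) ` closure D)" by (intro compact_continuous_image continuous_intros compact_closure_D)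
  moreover have "(\<lambda>x. s *\<^sub>R x) ` closure D \<subseteq> D" using shrink_closure_D s by auto
  ultimately obtain \<delta>0 where \<delta>0: "0 < \<delta>0" "(\<Union>x\<in>(\<lambda>x. s *\<^sub>R x) ` closure D. ball x \<delta>0) \<subseteq> D"
    using compact_subset_open_imp_ball_epsilon_subset[OF _ open_D] by metis
  define \<delta> where "\<delta> = min (\<delta>0 / 2) (d / 2)"
  have \<delta>: "0 < \<delta>" using \<delta>0 d by (simp add: \<delta>_def)
  have sub: "cball (s *\<^sub>R x) \<delta> \<subseteq> D" if "x \<in> closure D" for x
  proof -
    have "cball (s *\<^sub>R x) \<delta> \<subseteq> ball (s *\<^sub>R x) \<delta>0" using \<delta>0(1) by (auto simp: \<delta>_def)
    then show ?thesis using \<delta>0(2) that by blast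
  qed
  have near: "\<bar>z y - z x\<bar> \<le> e" if x: "x \<in> closure D" and y: "y \<in> D" and yx: "dist y (s *\<^sub>R x) \<le> \<delta>" for x y
  proof -
    have "s *\<^sub>R x - x = (s - 1) *\<^sub>R x" by (simp add: algebra_simps)
    then have "dist (s *\<^sub>R x) x = (1 - s) * norm x" using s by (simp add: dist_norm)
    also have "\<dots> \<le> (1 - s) * r1" using closure_D_bounded[OF x] s by (intro mult_left_mono) auto
    also have "\<dots> < d / 2" by (rule s)
    finally have "dist y x < d" using dist_triangle[of y x "s *\<^sub>R x"] yx by (simp add: \<delta>_def)
    then have "dist (z y) (z x) < e" using x y closure_subset[of D] by (intro d(2)) auto
    then show ?thesis by (simp add: dist_real_def)
  qed
  have G0: "0 \<le> ?E" by (intro integral_nonneg_AE) auto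
  obtain z' Z' where z': "\<forall>x. (z' has_derivative (\<lambda>v. Z' x \<bullet> v)) (at x)" "continuous_on UNIV Z'" "\<forall>x\<in>closure D. \<bar>z' x - z x\<bar> \<le> e"
    "(LINT x:D|lborel. norm (Z' x) powr p) \<le> s powr p / s ^ DIM('a) * ?E"
    using mollify_step[OF p z G wg s(3,4) \<delta> sub near] by blast
  note z'(4)
  also have "s powr p / s ^ DIM('a) * ?E \<le> (1 + e) * ?E"
    using s(1) G0 by (intro mult_right_mono) auto
  finally show ?thesis using z' by blast
qed

lemma surface_integral_ge:
  fixes f :: "'a \<Rightarrow> real"
  assumes f: "continuous_on UNIV f" "\<And>x. 0 \<le> f x" and int: "integrable (surface_measure D) f"
  shows "\<kappa> * (LINT n|cone_measure. f (graph_map n) * \<rho> n ^ m) \<le> (LINT x|surface_measure D. f x)"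
proof -
  have [measurable]: "f \<in> borel_measurable borel" by (rule borel_measurable_continuous_onI[OF f(1)])
  have i: "integrable cone_measure (\<lambda>n. f (graph_map n) * \<rho> n ^ m)" by (rule integrable_cone_continuous[OF f(1)])
  have "ennreal (\<kappa> * (LINT n|cone_measure. f (graph_map n) * \<rho> n ^ m))
      = ennreal (LINT n|cone_measure. \<kappa> * (f (graph_map n) * \<rho> n ^ m))" by simp
  also have "\<dots> = (\<integral>\<^sup>+n. ennreal (\<kappa> * (f (graph_map n) * \<rho> n ^ m)) \<partial>cone_measure)"
    using i \<kappa>_pos f(2) less_imp_le[OF \<rho>_pos] by (intro nn_integral_eq_integral[symmetric]) auto
  also have "\<dots> = (\<integral>\<^sup>+n. ennreal (\<kappa> * \<rho> n ^ m) * ennreal (f (graph_map n)) \<partial>cone_measure)"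
    using \<kappa>_pos f(2) less_imp_le[OF \<rho>_pos] by (intro nn_integral_cong) (simp add: ennreal_mult[symmetric] mult_ac)
  also have "\<dots> \<le> (\<integral>\<^sup>+x. ennreal (f x) \<partial>surface_measure D)" by (rule nn_integral_surface_ge) measurable
  also have "\<dots> = ennreal (LINT x|surface_measure D. f x)"
    using int f(2) by (intro nn_integral_eq_integral) auto
  finally show ?thesis using f(2) by (subst (asm) ennreal_le_iff) (auto intro: integral_nonneg_AE)
qed

lemma surface_integral_le:
  fixes f :: "'a \<Rightarrow> real"
  assumes f: "continuous_on UNIV f" "\<And>x. 0 \<le> f x"
  shows "integrable (surface_measure D) f"
    and "(LINT x|surface_measure D. f x) \<le> \<kappa> * (LINT n|cone_measure. f (graph_map n) * sqrt ((\<rho> n)\<^sup>2 + L\<^sup>2) ^ m)"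
proof -
  let ?S = "\<integral>\<^sup>+x. ennreal (f x) \<partial>surface_measure D"
  let ?w = "\<lambda>n. sqrt ((\<rho> n)\<^sup>2 + L\<^sup>2) ^ m"
  have [measurable]: "f \<in> borel_measurable borel" by (rule borel_measurable_continuous_onI[OF f(1)])
  have fs: "f \<in> borel_measurable (surface_measure D)" unfolding surface_measure_def by (intro measurable_restrict_space1) simp
  obtain M where M: "\<forall>x\<in>cball 0 r1. \<bar>f x\<bar> \<le> M"
    using compact_abs_bounded[OF compact_cball continuous_on_subset[OF f(1) subset_UNIV]] by blast
  have i: "integrable cone_measure (\<lambda>n. f (graph_map n) * ?w n)"
  proof (rule integrable_cone_bounded[where M = "M * sqrt (r1\<^sup>2 + L\<^sup>2) ^ m"])
    fix n :: 'a assume n: "norm n = 1"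
    have "graph_map n \<in> cball 0 r1" using norm_graph_map[OF n] \<rho>_bounds(2)[of n] by simp
    then have 1: "f (graph_map n) \<le> M" using M by (auto simp: abs_le_iff)
    have "(\<rho> n)\<^sup>2 \<le> r1\<^sup>2" using \<rho>_bounds(2)[of n] less_imp_le[OF \<rho>_pos] by (intro power_mono)
    then have "f (graph_map n) * ?w n \<le> M * sqrt (r1\<^sup>2 + L\<^sup>2) ^ m"
      using 1 f(2)[of "graph_map n"] by (intro mult_mono power_mono real_sqrt_le_mono) auto
    then show "\<bar>f (graph_map n) * ?w n\<bar> \<le> M * sqrt (r1\<^sup>2 + L\<^sup>2) ^ m"
      using f(2)[of "graph_map n"] by (simp add: abs_mult power_abs)
  qed measurable
  have le: "?S \<le> ennreal (\<kappa> * (LINT n|cone_measure. f (graph_map n) * ?w n))"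
  proof -
    have "?S
        \<le> (\<integral>\<^sup>+n. ennreal (\<kappa> * ?w n) * ennreal (f (graph_map n)) \<partial>cone_measure)"
      by (rule nn_integral_surface_le) measurable
    also have "\<dots> = (\<integral>\<^sup>+n. ennreal (\<kappa> * (f (graph_map n) * ?w n)) \<partial>cone_measure)"
      using \<kappa>_pos f(2) by (intro nn_integral_cong) (simp add: ennreal_mult[symmetric] mult_ac)
    also have "\<dots> = ennreal (LINT n|cone_measure. \<kappa> * (f (graph_map n) * ?w n))"
      using i \<kappa>_pos f(2) by (intro nn_integral_eq_integral) auto
    finally show ?thesis by simp
  qed
  show int: "integrable (surface_measure D) f"
  proof (rule integrableI_bounded[OF fs])
    have "(\<integral>\<^sup>+x. ennreal (norm (f x)) \<partial>surface_measure D) = ?S" using f(2) by simp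
    also have "\<dots> < \<infinity>" using order_le_less_trans[OF le ennreal_less_top] by (simp add: infinity_ennreal_def)
    finally show "(\<integral>\<^sup>+x. ennreal (norm (f x)) \<partial>surface_measure D) < \<infinity>" .
  qed
  have "ennreal (LINT x|surface_measure D. f x) = ?S"
    using int f(2) by (intro nn_integral_eq_integral[symmetric]) auto
  with le have "ennreal (LINT x|surface_measure D. f x) \<le> ennreal (\<kappa> * (LINT n|cone_measure. f (graph_map n) * ?w n))" by simp
  then show "(LINT x|surface_measure D. f x) \<le> \<kappa> * (LINT n|cone_measure. f (graph_map n) * ?w n)"
    using \<kappa>_pos f(2) by (subst (asm) ennreal_le_iff) (auto intro!: mult_nonneg_nonneg integral_nonneg_AE)
qed

lemma D_lebesgue: "D \<in> sets lebesgue" by (simp add: borel_open[OF open_D] sets_completionI_sets)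

lemma lebesgue_on_D_continuous:
  fixes f :: "'a \<Rightarrow> real"
  assumes f: "continuous_on UNIV f"
  shows "integrable (lebesgue_on D) f" "(LINT x|lebesgue_on D. f x) = (LINT x:D|lborel. f x)"
proof -
  have [measurable]: "f \<in> borel_measurable borel" by (rule borel_measurable_continuous_onI[OF f])
  have m: "f \<in> borel_measurable (lebesgue_on D)" by (intro measurable_restrict_space1 measurable_completion) measurable
  show "integrable (lebesgue_on D) f" "(LINT x|lebesgue_on D. f x) = (LINT x:D|lborel. f x)"
    using lebesgue_on_D_integral[of f f] m set_integrable_continuous[OF f] by auto
qed

end

section \<open>Bounds for the first eigenvalue from below and above\<close>

context profile
begin

text \<open>The requirements on a correction \<open>t *\<^sub>R Y x\<close> of the radial field:
  \<eta> is the loss in the interior, and \<open>b\<close> bounds the boundary values with the error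
  of the approximate divergence theorem included. As boundary integrals are taken over
  \<open>cone_measure\<close>, \<open>b\<close> corresponds to \<kappa> times a Robin
  parameter.\<close>

definition calibration :: "('a \<Rightarrow> 'a) \<Rightarrow> ('a \<Rightarrow> real) \<Rightarrow> real \<Rightarrow> real \<Rightarrow> real \<Rightarrow> bool" where
  "calibration Y \<delta> t \<eta> b \<longleftrightarrow> has_divergence Y \<delta> \<and> 0 \<le> b \<and>
    (\<forall>x\<in>D. (p - 1) * norm (- h (norm x) *\<^sub>R sgn x + t *\<^sub>R Y x) powr q \<le> (p - 1) * h (norm x) powr q - t * \<delta> x + \<eta>) \<and>
    (\<forall>n. norm n = 1 \<longrightarrow>
      h (\<rho> n) - t * (Y (graph_map n) \<bullet> n) + \<bar>t\<bar> * (8 * L / r0) * (\<Sum>b\<in>Basis. \<bar>Y (graph_map n) \<bullet> b\<bar>) \<le> b)"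

lemma abs_powr_cont: "continuous_on S z \<Longrightarrow> continuous_on S (\<lambda>x. \<bar>z x :: real\<bar> powr p)"
  using p by (intro continuous_on_powr' continuous_intros) auto

text \<open>Uniform convergence on the closure carries the volume and the boundary integral to the
  limit, while the energies of the approximations exceed that of \<open>G\<close> at most by a
  factor tending to 1.\<close>

lemma sobolev_lower_bound:
  fixes z :: "'a \<Rightarrow> real" and G Y :: "'a \<Rightarrow> 'a"
  assumes z: "continuous_on UNIV z" and G: "G \<in> Lp p (lebesgue_on D)" and wg: "weak_gradient D z G"
    and cal: "calibration Y \<delta> t \<eta> b"
  shows "(\<mu> - \<eta>) * (LINT x:D|lborel. \<bar>z x\<bar> powr p)
    \<le> (LINT x|lebesgue_on D. norm (G x) powr p) + b * (LINT n|cone_measure. \<bar>z (graph_map n)\<bar> powr p * \<rho> n ^ m)"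
proof -
  let ?E = "LINT x|lebesgue_on D. norm (G x) powr p"
  let ?B = "\<lambda>z. LINT n|cone_measure. \<bar>z (graph_map n)\<bar> powr p * \<rho> n ^ m"
  define e where "e k = 1 / real (Suc k)" for k
  have e: "0 < e k" "e k \<le> 1" for k by (auto simp: e_def)
  have e0: "e \<longlonglongrightarrow> 0" unfolding e_def using LIMSEQ_inverse_real_of_nat by (simp add: inverse_eq_divide)
  obtain z' Z' where z': "\<And>k x. (z' k has_derivative (\<lambda>v. Z' k x \<bullet> v)) (at x)" "\<And>k. continuous_on UNIV (Z' k)"
    "\<And>k x. x \<in> closure D \<Longrightarrow> \<bar>z' k x - z x\<bar> \<le> e k"
    "\<And>k. (LINT x:D|lborel. norm (Z' k x) powr p) \<le> (1 + e k) * ?E" using mollification[OF p z G wg e(1)] by metis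
  have cz': "continuous_on UNIV (z' k)" for k by (rule continuous_on_if_derivative[OF z'(1)])
  have ptw: "(\<lambda>k. \<bar>z' k x\<bar> powr p) \<longlonglongrightarrow> \<bar>z x\<bar> powr p" if x: "x \<in> closure D" for x
  proof -
    have "(\<lambda>k. z' k x - z x) \<longlonglongrightarrow> 0" by (rule Lim_null_comparison[OF _ e0]) (use z'(3)[OF x] in simp)
    then have "(\<lambda>k. z' k x) \<longlonglongrightarrow> z x" by (simp add: LIM_zero_iff)
    then show ?thesis using p by (intro tendsto_powr2 tendsto_rabs tendsto_const) auto
  qed
  obtain M where M: "\<forall>x\<in>cball 0 r1. \<bar>z x\<bar> \<le> M"
    using compact_abs_bounded[OF compact_cball continuous_on_subset[OF z subset_UNIV]] by blast
  have bnd: "\<bar>z' k x\<bar> powr p \<le> (M + 1) powr p" if x: "x \<in> closure D" for x k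
  proof -
    have "\<bar>z x\<bar> \<le> M" using closure_D_bounded[OF x] M by simp
    then have "\<bar>z' k x\<bar> \<le> M + 1" using z'(3)[OF x, of k] e(2)[of k] by linarith
    then show ?thesis using p by (intro powr_mono2) auto
  qed
  have [measurable]: "z \<in> borel_measurable borel" "z' k \<in> borel_measurable borel" for k
    using z cz' by (auto intro: borel_measurable_continuous_onI)
  have l1: "(\<lambda>k. LINT x:D|lborel. \<bar>z' k x\<bar> powr p) \<longlonglongrightarrow> (LINT x:D|lborel. \<bar>z x\<bar> powr p)"
    unfolding set_lebesgue_integral_def
  proof (rule integral_dominated_convergence[where w = "\<lambda>x. indicator D x * (M + 1) powr p"])
    show "integrable lborel (\<lambda>x. indicator D x * (M + 1) powr p)"
      using set_integrable_D_bounded[of "\<lambda>_. (M + 1) powr p" "(M + 1) powr p"] by (simp add: set_integrable_def)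
    show "AE x in lborel. (\<lambda>k. indicator D x *\<^sub>R \<bar>z' k x\<bar> powr p) \<longlonglongrightarrow> indicator D x *\<^sub>R \<bar>z x\<bar> powr p"
    proof (intro always_eventually allI)
      fix x
      show "(\<lambda>k. indicator D x *\<^sub>R \<bar>z' k x\<bar> powr p) \<longlonglongrightarrow> indicator D x *\<^sub>R \<bar>z x\<bar> powr p"
        using ptw[of x] closure_subset[of D] by (cases "x \<in> D") auto
    qed
    show "AE x in lborel. norm (indicator D x *\<^sub>R \<bar>z' k x\<bar> powr p) \<le> indicator D x * (M + 1) powr p" for k
    proof (intro always_eventually allI)
      fix x
      show "norm (indicator D x *\<^sub>R \<bar>z' k x\<bar> powr p) \<le> indicator D x * (M + 1) powr p"
        using bnd[of x k] closure_subset[of D] by (cases "x \<in> D") auto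
    qed
  qed measurable
  have l2: "(\<lambda>k. LINT n|cone_measure. \<bar>z' k (graph_map n)\<bar> powr p * \<rho> n ^ m) \<longlonglongrightarrow> ?B z"
  proof (rule integral_dominated_convergence[where w = "\<lambda>n. (M + 1) powr p * \<rho> n ^ m"])
    show "integrable cone_measure (\<lambda>n. (M + 1) powr p * \<rho> n ^ m)"
      by (rule integrable_cone_continuous[of "\<lambda>_. (M + 1) powr p"]) simp
    show "AE n in cone_measure. (\<lambda>k. \<bar>z' k (graph_map n)\<bar> powr p * \<rho> n ^ m) \<longlonglongrightarrow> \<bar>z (graph_map n)\<bar> powr p * \<rho> n ^ m"
      using AE_cone_measure by eventually_elim (intro tendsto_mult tendsto_const ptw graph_map_closure, simp)
    show "AE n in cone_measure. norm (\<bar>z' k (graph_map n)\<bar> powr p * \<rho> n ^ m) \<le> (M + 1) powr p * \<rho> n ^ m" for k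
      using AE_cone_measure
    proof eventually_elim
      case (elim n)
      have "\<bar>z' k (graph_map n)\<bar> powr p * \<rho> n ^ m \<le> (M + 1) powr p * \<rho> n ^ m"
        using elim \<rho>_pos[of n] by (intro mult_right_mono bnd graph_map_closure) auto
      then show ?case using \<rho>_pos[of n] by (simp add: abs_mult)
    qed
  qed measurable
  have "(\<mu> - \<eta>) * (LINT x:D|lborel. \<bar>z' k x\<bar> powr p)
      \<le> (1 + e k) * ?E + b * ?B (z' k)" for k
  proof -
    have "(\<mu> - \<eta>) * (LINT x:D|lborel. \<bar>z' k x\<bar> powr p)
        \<le> (LINT x:D|lborel. norm (Z' k x) powr p) + b * ?B (z' k)"
      using cal unfolding calibration_def by (intro C1_lower_bound[OF z'(1,2)]) auto
    then show ?thesis using z'(4)[of k] by linarith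
  qed
  moreover have "(\<lambda>k. (1 + e k) * ?E + b * ?B (z' k))
      \<longlonglongrightarrow> (1 + 0) * ?E + b * ?B z"
    by (intro tendsto_add tendsto_mult tendsto_const e0 l2)
  moreover have "(\<lambda>k. (\<mu> - \<eta>) * (LINT x:D|lborel. \<bar>z' k x\<bar> powr p)) \<longlonglongrightarrow> (\<mu> - \<eta>) * (LINT x:D|lborel. \<bar>z x\<bar> powr p)"
    by (intro tendsto_mult tendsto_const l1)
  ultimately have "(\<mu> - \<eta>) * (LINT x:D|lborel. \<bar>z x\<bar> powr p)
      \<le> (1 + 0) * ?E + b * ?B z"
    by (intro LIMSEQ_le) auto
  then show ?thesis by simp
qed

lemma continuous_trace_lower_bound:
  fixes \<phi> :: "'a \<Rightarrow> real" and \<Phi> :: "'a \<Rightarrow> 'a"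
  assumes \<phi>: "sobolev p D \<phi> \<Phi>" "continuous_on (closure D) \<phi>" "\<phi> \<in> Lp p (surface_measure D)"
    and cal: "calibration Y \<delta> t \<eta> (\<kappa> * b)"
  shows "(\<mu> - \<eta>) * (LINT x|lebesgue_on D. \<bar>\<phi> x\<bar> powr p)
    \<le> (LINT x|lebesgue_on D. norm (\<Phi> x) powr p) + b * (LINT x|surface_measure D. \<bar>\<phi> x\<bar> powr p)"
proof -
  have "0 \<le> \<kappa> * b" using cal by (simp add: calibration_def)
  then have b: "0 \<le> b" using \<kappa>_pos by (simp add: zero_le_mult_iff)
  \<comment> \<open>\<phi> is continuous on the closure only. A Tietze extension leaves all
    integrals unchanged, since they see just \<open>D\<close> and its frontier.\<close>
  have "closedin (top_of_set UNIV) (closure D)" by simp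
  then obtain z where z: "continuous_on UNIV z" "\<And>x. x \<in> closure D \<Longrightarrow> z x = \<phi> x"
    using Tietze_unbounded[OF \<phi>(2)] by blast
  let ?B = "LINT n|cone_measure. \<bar>z (graph_map n)\<bar> powr p * \<rho> n ^ m"
  have zD: "z x = \<phi> x" if "x \<in> D" for x using z(2) that closure_subset by blast
  have zF: "z x = \<phi> x" if "x \<in> frontier D" for x using z(2) that by (auto simp: frontier_def)
  have spD: "space (lebesgue_on D) = D" by (simp add: space_restrict_space)
  have wg: "weak_gradient D z \<Phi>"
  proof -
    have "(LINT x|lebesgue_on D. z x * F x) = (LINT x|lebesgue_on D. \<phi> x * F x)" for F :: "'a \<Rightarrow> real"
      by (intro Bochner_Integration.integral_cong refl) (simp add: zD)
    then show ?thesis using \<phi>(1) unfolding sobolev_def weak_gradient_def by simp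
  qed
  have G: "\<Phi> \<in> Lp p (lebesgue_on D)" using \<phi>(1) by (simp add: sobolev_def)
  have zp: "continuous_on UNIV (\<lambda>x. \<bar>z x\<bar> powr p)" by (rule abs_powr_cont[OF z(1)])
  have "(LINT x|lebesgue_on D. \<bar>\<phi> x\<bar> powr p) = (LINT x|lebesgue_on D. \<bar>z x\<bar> powr p)"
    by (intro Bochner_Integration.integral_cong refl) (simp add: zD)
  also have "\<dots> = (LINT x:D|lborel. \<bar>z x\<bar> powr p)" by (rule lebesgue_on_D_continuous[OF zp])
  finally have e1: "(LINT x|lebesgue_on D. \<bar>\<phi> x\<bar> powr p) = (LINT x:D|lborel. \<bar>z x\<bar> powr p)" .
  have e2: "(LINT x|surface_measure D. \<bar>\<phi> x\<bar> powr p) = (LINT x|surface_measure D. \<bar>z x\<bar> powr p)"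
    by (intro Bochner_Integration.integral_cong refl) (simp add: zF space_surface_measure)
  have "integrable (surface_measure D) (\<lambda>x. \<bar>z x\<bar> powr p) \<longleftrightarrow> integrable (surface_measure D) (\<lambda>x. norm (\<phi> x) powr p)"
    by (intro Bochner_Integration.integrable_cong refl) (simp add: zF space_surface_measure)
  then have "integrable (surface_measure D) (\<lambda>x. \<bar>z x\<bar> powr p)" using \<phi>(3) by (simp add: Lp_def)
  then have "\<kappa> * ?B \<le> (LINT x|surface_measure D. \<bar>z x\<bar> powr p)" by (intro surface_integral_ge zp) auto
  then have "b * (\<kappa> * ?B) \<le> b * (LINT x|surface_measure D. \<bar>z x\<bar> powr p)" using b by (intro mult_left_mono)
  moreover have "(\<mu> - \<eta>) * (LINT x:D|lborel. \<bar>z x\<bar> powr p)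
    \<le> (LINT x|lebesgue_on D. norm (\<Phi> x) powr p) + \<kappa> * b * ?B"
    by (rule sobolev_lower_bound[OF z(1) G wg cal])
  ultimately show ?thesis unfolding e1 e2 by (simp add: mult_ac)
qed

text \<open>The functions with continuous boundary values approximate \<open>z\<close>,
  \<open>G\<close> and \<open>g\<close> simultaneously. The limit in \<open>k\<close> is taken for
  fixed \<open>r\<close>, and \<open>r\<close> tends to 0 afterwards. Nonnegativity of
  \<open>\<mu> - \<eta>\<close> allows the upper estimate of the norm of \<open>z\<close> to be
  multiplied by it.\<close>

lemma trace_lower_bound:
  fixes z g :: "'a \<Rightarrow> real" and G :: "'a \<Rightarrow> 'a"
  assumes z: "sobolev p D z G" "has_trace p D z G g"
    and cal: "calibration Y \<delta> t \<eta> (\<kappa> * b)" and \<mu>\<eta>: "0 \<le> \<mu> - \<eta>"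
  shows "(\<mu> - \<eta>) * (LINT x|lebesgue_on D. \<bar>z x\<bar> powr p)
    \<le> (LINT x|lebesgue_on D. norm (G x) powr p) + b * (LINT x|surface_measure D. \<bar>g x\<bar> powr p)"
proof -
  have "0 \<le> \<kappa> * b" using cal by (simp add: calibration_def)
  then have b: "0 \<le> b" using \<kappa>_pos by (simp add: zero_le_mult_iff)
  obtain \<phi> \<Phi> where ap: "\<And>k. sobolev p D (\<phi> k) (\<Phi> k)" "\<And>k. continuous_on (closure D) (\<phi> k)"
    "\<And>k. \<phi> k \<in> Lp p (surface_measure D)"
    and lim: "Lp_tendsto p (lebesgue_on D) \<phi> z" "Lp_tendsto p (lebesgue_on D) \<Phi> G" "Lp_tendsto p (surface_measure D) \<phi> g"
    and g: "g \<in> Lp p (surface_measure D)" using z(2) unfolding has_trace_def by blast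
  have zG: "z \<in> Lp p (lebesgue_on D)" "G \<in> Lp p (lebesgue_on D)" using z(1) by (auto simp: sobolev_def)
  have \<phi>\<Phi>: "\<phi> k \<in> Lp p (lebesgue_on D)" "\<Phi> k \<in> Lp p (lebesgue_on D)" for k using ap(1)[of k] by (auto simp: sobolev_def)
  let ?N = "LINT x|lebesgue_on D. \<bar>z x\<bar> powr p" and ?E1 = "LINT x|lebesgue_on D. norm (G x) powr p"
    and ?E2 = "LINT x|surface_measure D. \<bar>g x\<bar> powr p"
  define c1 where "c1 k = (LINT x|lebesgue_on D. norm (\<phi> k x - z x) powr p)" for k
  define c2 where "c2 k = (LINT x|lebesgue_on D. norm (\<Phi> k x - G x) powr p)" for k
  define c3 where "c3 k = (LINT x|surface_measure D. norm (\<phi> k x - g x) powr p)" for k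
  have c0: "c1 \<longlonglongrightarrow> 0" "c2 \<longlonglongrightarrow> 0" "c3 \<longlonglongrightarrow> 0"
    using lim by (auto simp: Lp_tendsto_def c1_def[abs_def] c2_def[abs_def] c3_def[abs_def])
  have main: "(\<mu> - \<eta>) * ?N \<le> (1 + r) powr (p - 1) * ((1 + r) powr (p - 1) * (?E1 + b * ?E2))" if r: "0 < r" for r
  proof -
    define A where "A = (1 + r) powr (p - 1)"
    define B where "B = (1 + 1 / r) powr (p - 1)"
    have A0: "0 \<le> A" by (simp add: A_def)
    have "(\<mu> - \<eta>) * ?N \<le> A * (A * (?E1 + b * ?E2) + B * (c2 k + b * c3 k)) + (\<mu> - \<eta>) * B * c1 k" for k
    proof -
      have "?N \<le> A * (LINT x|lebesgue_on D. \<bar>\<phi> k x\<bar> powr p) + B * c1 k"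
        using Lp_diff(2)[OF p zG(1) \<phi>\<Phi>(1)[of k] r] by (simp add: A_def B_def c1_def abs_minus_commute)
      then have 1: "(\<mu> - \<eta>) * ?N \<le> A * ((\<mu> - \<eta>) * (LINT x|lebesgue_on D. \<bar>\<phi> k x\<bar> powr p)) + (\<mu> - \<eta>) * B * c1 k"
        using mult_left_mono[OF _ \<mu>\<eta>] by (fastforce simp: algebra_simps)
      have 2: "(\<mu> - \<eta>) * (LINT x|lebesgue_on D. \<bar>\<phi> k x\<bar> powr p)
          \<le> (LINT x|lebesgue_on D. norm (\<Phi> k x) powr p) + b * (LINT x|surface_measure D. \<bar>\<phi> k x\<bar> powr p)"
        by (rule continuous_trace_lower_bound[OF ap cal])
      have 3: "(LINT x|lebesgue_on D. norm (\<Phi> k x) powr p) \<le> A * ?E1 + B * c2 k"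
        using Lp_diff(2)[OF p \<phi>\<Phi>(2)[of k] zG(2) r] by (simp add: A_def B_def c2_def)
      have "(LINT x|surface_measure D. \<bar>\<phi> k x\<bar> powr p) \<le> A * ?E2 + B * c3 k"
        using Lp_diff(2)[OF p ap(3)[of k] g r] by (simp add: A_def B_def c3_def)
      then have 4: "b * (LINT x|surface_measure D. \<bar>\<phi> k x\<bar> powr p) \<le> b * (A * ?E2 + B * c3 k)" using b by (rule mult_left_mono)
      have "(\<mu> - \<eta>) * (LINT x|lebesgue_on D. \<bar>\<phi> k x\<bar> powr p) \<le> A * (?E1 + b * ?E2) + B * (c2 k + b * c3 k)"
        using 2 3 4 by (simp add: algebra_simps)
      from mult_left_mono[OF this A0] 1 show ?thesis by linarith
    qed
    moreover have "(\<lambda>k. A * (A * (?E1 + b * ?E2) + B * (c2 k + b * c3 k)) + (\<mu> - \<eta>) * B * c1 k)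
        \<longlonglongrightarrow> A * (A * (?E1 + b * ?E2) + B * (0 + b * 0)) + (\<mu> - \<eta>) * B * 0"
      by (intro tendsto_add tendsto_mult tendsto_const c0)
    ultimately have "(\<mu> - \<eta>) * ?N \<le> A * (A * (?E1 + b * ?E2) + B * (0 + b * 0)) + (\<mu> - \<eta>) * B * 0"
      by (intro LIMSEQ_le_const) auto
    then show ?thesis by (simp add: A_def)
  qed
  have "(\<mu> - \<eta>) * ?N \<le> (1 + 0) powr (p - 1) * ((1 + 0) powr (p - 1) * (?E1 + b * ?E2))"
  proof (rule tendsto_lowerbound[where F = "at_right 0"])
    show "((\<lambda>r. (1 + r) powr (p - 1) * ((1 + r) powr (p - 1) * (?E1 + b * ?E2))) \<longlongrightarrow>
        (1 + 0) powr (p - 1) * ((1 + 0) powr (p - 1) * (?E1 + b * ?E2))) (at_right 0)"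
      by (intro tendsto_intros) auto
    show "\<forall>\<^sub>F r in at_right 0. (\<mu> - \<eta>) * ?N \<le> (1 + r) powr (p - 1) * ((1 + r) powr (p - 1) * (?E1 + b * ?E2))"
      using eventually_at_right_less[of 0] by (rule eventually_mono) (rule main)
  qed simp
  then show ?thesis by simp
qed

lemma u_powr_cont: "continuous_on S (\<lambda>x. u x powr p)"
  using abs_powr_cont[OF u_cont] u_pos by (simp add: abs_of_pos)

text \<open>For a test function \<phi> the product of \<open>u\<close> and \<phi> vanishes on the
  frontier. Both the boundary term and the error term of the translation estimate are then zero, and
  integration by parts is exact.\<close>

lemma u_sobolev: "sobolev p D u u'"
  unfolding sobolev_def
proof (intro conjI)
  have [measurable]: "u \<in> borel_measurable borel" "u' \<in> borel_measurable borel"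
    using u_cont u'_cont by (auto intro: borel_measurable_continuous_onI)
  have m: "u \<in> borel_measurable (lebesgue_on D)" "u' \<in> borel_measurable (lebesgue_on D)"
    by (intro measurable_restrict_space1 measurable_completion; measurable)+
  show "u \<in> Lp p (lebesgue_on D)"
    using m(1) lebesgue_on_D_continuous(1)[OF u_powr_cont] u_pos by (simp add: Lp_def abs_of_pos)
  have "continuous_on UNIV (\<lambda>x. norm (u' x) powr p)"
    using p by (intro continuous_on_powr' continuous_intros u'_cont) auto
  then show "u' \<in> Lp p (lebesgue_on D)" using m(2) lebesgue_on_D_continuous(1) by (simp add: Lp_def)
  show "weak_gradient D u u'" unfolding weak_gradient_def
  proof (intro allI impI ballI)
    fix \<phi> :: "'a \<Rightarrow> real" and b :: 'a
    assume \<phi>: "test_function D \<phi>" and b: "b \<in> Basis"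
    have "Ck_on (Suc 0) UNIV \<phi>" using \<phi> by (auto simp: test_function_def smooth_on_def)
    then have d: "\<phi> differentiable (at x)" and dc: "continuous_on UNIV (\<lambda>x. frechet_derivative \<phi> (at x) b)" for x
      using b by (auto simp: differentiable_on_def)
    have \<phi>': "(\<phi> has_derivative frechet_derivative \<phi> (at x)) (at x)" for x using d frechet_derivative_works by blast
    have \<phi>c: "continuous_on UNIV \<phi>" by (rule continuous_on_if_derivative[OF \<phi>'])
    have c1: "continuous_on UNIV (\<lambda>x. u x * frechet_derivative \<phi> (at x) b)" by (intro continuous_intros dc u_cont)
    have c2: "continuous_on UNIV (\<lambda>x. (u' x \<bullet> b) * \<phi> x)" by (intro continuous_intros u'_cont \<phi>c)
    have zero: "u (graph_map n) * \<phi> (graph_map n) = 0" if "norm n = 1" for n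
    proof -
      have "graph_map n \<in> frontier D" using that by (auto simp: frontier_D graph_map_def)
      then have "graph_map n \<notin> D" using open_D by (simp add: frontier_def interior_open)
      then show ?thesis using \<phi> by (auto simp: test_function_def)
    qed
    have "\<bar>(LINT x:D|lborel. u x * frechet_derivative \<phi> (at x) b + (u' x \<bullet> b) * \<phi> x)
        - (LINT n|cone_measure. u (graph_map n) * \<phi> (graph_map n) * (b \<bullet> n) * \<rho> n ^ m)\<bar>
      \<le> 8 * L / r0 * (LINT n|cone_measure. \<bar>u (graph_map n) * \<phi> (graph_map n)\<bar> * \<rho> n ^ m)"
      by (rule translation_divergence[of "\<lambda>x. u x * \<phi> x" "\<lambda>x v. u x * frechet_derivative \<phi> (at x) v + (u' x \<bullet> v) * \<phi> x"])
         (use b in \<open>auto intro!: has_derivative_mult u_deriv \<phi>' continuous_on_add c1 c2\<close>)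
    moreover have "(LINT n|cone_measure. u (graph_map n) * \<phi> (graph_map n) * (b \<bullet> n) * \<rho> n ^ m) = 0"
      by (intro integral_eq_zero_AE eventually_mono[OF AE_cone_measure]) (use zero in auto)
    moreover have "(LINT n|cone_measure. \<bar>u (graph_map n) * \<phi> (graph_map n)\<bar> * \<rho> n ^ m) = 0"
      by (intro integral_eq_zero_AE eventually_mono[OF AE_cone_measure]) (use zero in auto)
    ultimately have "(LINT x:D|lborel. u x * frechet_derivative \<phi> (at x) b + (u' x \<bullet> b) * \<phi> x) = 0" by simp
    then show "(LINT x|lebesgue_on D. u x * frechet_derivative \<phi> (at x) b) = - (LINT x|lebesgue_on D. (u' x \<bullet> b) * \<phi> x)"
      using set_integral_add(2)[OF set_integrable_continuous[OF c1] set_integrable_continuous[OF c2]]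
      by (simp add: lebesgue_on_D_continuous[OF c1] lebesgue_on_D_continuous[OF c2])
  qed
qed

lemma u_trace: "has_trace p D u u' u"
proof -
  have [measurable]: "u \<in> borel_measurable borel" using u_cont by (auto intro: borel_measurable_continuous_onI)
  have "u \<in> borel_measurable (surface_measure D)" unfolding surface_measure_def by (intro measurable_restrict_space1) simp
  then have "u \<in> Lp p (surface_measure D)"
    using surface_integral_le(1)[OF u_powr_cont] u_pos by (simp add: Lp_def abs_of_pos)
  then show ?thesis unfolding has_trace_def using u_sobolev u_cont
    by (intro conjI exI[of _ "\<lambda>_. u"] exI[of _ "\<lambda>_. u'"]) (auto simp: Lp_tendsto_def)
qed

lemma Lp_norm_pos:
  assumes z: "z \<in> Lp p (lebesgue_on D)" and nz: "\<not> (AE x in lebesgue_on D. z x = 0)"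
  shows "0 < (LINT x|lebesgue_on D. \<bar>z x :: real\<bar> powr p)"
proof (rule ccontr)
  have i: "integrable (lebesgue_on D) (\<lambda>x. \<bar>z x\<bar> powr p)" using z by (simp add: Lp_def)
  assume "\<not> ?thesis"
  moreover have "0 \<le> (LINT x|lebesgue_on D. \<bar>z x\<bar> powr p)" by (intro integral_nonneg_AE) auto
  ultimately have "(LINT x|lebesgue_on D. \<bar>z x\<bar> powr p) = 0" by linarith
  then have "AE x in lebesgue_on D. \<bar>z x\<bar> powr p = 0" using i by (subst (asm) integral_nonneg_eq_0_iff_AE) auto
  then show False using nz by auto
qed

lemma u_not_zero: "\<not> (AE x in lebesgue_on D. u x = 0)"
proof
  assume "AE x in lebesgue_on D. u x = 0"
  then have "AE x in lebesgue_on D. False" using u_pos by (auto elim!: eventually_mono simp: less_imp_neq[symmetric])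
  then have "emeasure (lebesgue_on D) (space (lebesgue_on D)) = 0" by (subst (asm) AE_iff_measurable[OF sets.top]) auto
  then have "emeasure lborel D = 0" using D_lebesgue by (simp add: space_restrict_space emeasure_restrict_space)
  moreover obtain e where e: "0 < e" "ball 0 e \<subseteq> D" using open_D zero_in_D openE by blast
  then have "emeasure lborel (ball (0::'a) e) \<le> emeasure lborel D" by (intro emeasure_mono) auto
  moreover have "0 < emeasure lborel (ball (0::'a) e)"
    using e(1) unit_ball_vol_pos[of "real DIM('a)"] by (simp add: emeasure_ball)
  ultimately show False by simp
qed

lemma rayleigh_quotients_bdd_below: "0 < \<beta> \<Longrightarrow> bdd_below
     {((LINT x|lebesgue_on D. norm (G x) powr p) + \<beta> * (LINT x|surface_measure D. \<bar>g x\<bar> powr p))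
        / (LINT x|lebesgue_on D. \<bar>z x\<bar> powr p) | z G g.
      sobolev p D z G \<and> has_trace p D z G g \<and> \<not> (AE x in lebesgue_on D. z x = 0)}"
  by (intro bdd_belowI[of _ 0])
     (auto intro!: divide_nonneg_nonneg add_nonneg_nonneg mult_nonneg_nonneg integral_nonneg_AE)

text \<open>The radial profile as test function: its energy is \<mu> times its norm minus the
  weighted boundary integral of \<open>h\<close>, so only the mismatch between the Robin term and
  \<open>h (\<rho> n)\<close> remains. The majorant \<open>F\<close> is a parameter so that its part
  of mean zero can be integrated exactly.\<close>

lemma robin_upper:
  assumes \<beta>: "0 < \<beta>" and F: "integrable cone_measure F"
    "\<And>n. norm n = 1 \<Longrightarrow> (\<kappa> * \<beta> * sqrt ((\<rho> n)\<^sup>2 + L\<^sup>2) ^ m - h (\<rho> n) * \<rho> n ^ m) * u (graph_map n) powr p \<le> F n"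
  shows "robin_lambda1 p \<beta> D \<le> \<mu> + (LINT n|cone_measure. F n) / (LINT x:D|lborel. u x powr p)"
proof -
  let ?U = "\<lambda>n. u (graph_map n) powr p"
  let ?w = "\<lambda>n. sqrt ((\<rho> n)\<^sup>2 + L\<^sup>2) ^ m"
  let ?N = "LINT x:D|lborel. u x powr p"
  have [measurable]: "u \<in> borel_measurable borel" "u' \<in> borel_measurable borel" "h \<in> borel_measurable borel"
    using u_cont u'_cont h_cont by (auto intro: borel_measurable_continuous_onI)
  have N: "(LINT x|lebesgue_on D. \<bar>u x\<bar> powr p) = ?N"
    using lebesgue_on_D_continuous(2)[OF u_powr_cont] u_pos by (simp add: abs_of_pos)
  have Npos: "0 < ?N" using Lp_norm_pos[OF _ u_not_zero] u_sobolev unfolding N by (simp add: sobolev_def)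
  have uV: "((\<lambda>x. u x powr p) has_derivative (\<lambda>y. ((p * u x powr (p - 1)) *\<^sub>R u' x) \<bullet> y)) (at x)" for x
  proof -
    have "((\<lambda>r. r powr p) has_real_derivative p * u x powr (p - 1)) (at (u x))"
      by (rule has_real_derivative_powr[OF u_pos])
    from has_derivative_compose[OF u_deriv this[unfolded has_field_derivative_def]]
    show ?thesis by simp
  qed
  have Vc: "continuous_on UNIV (\<lambda>x. (p * u x powr (p - 1)) *\<^sub>R u' x)"
    using u_pos by (intro continuous_intros u'_cont continuous_on_powr' u_cont) (auto simp: less_imp_le less_imp_neq[symmetric])
  have hn: "continuous_on UNIV (\<lambda>x::'a. h (norm x))" by (intro continuous_on_compose2[OF h_cont] continuous_intros) auto
  have c1: "continuous_on UNIV (\<lambda>x. h (norm x) powr q * u x powr p)"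
    using q h_nonneg hn by (intro continuous_intros continuous_on_powr' u_powr_cont) auto
  have c2: "continuous_on UNIV (\<lambda>x. norm (u' x) powr p)"
    using p by (intro continuous_on_powr' continuous_intros u'_cont) auto
  have norm_u': "norm (u' x) powr p = h (norm x) powr q * u x powr p" if x: "x \<in> D" for x
  proof (cases "x = 0")
    case True
    then show ?thesis using u'_eq[of 0] r1_pos p q by (simp add: h_0)
  next
    case False
    have "(q - 1) * p = q" using p by (simp add: q_def field_simps)
    then show ?thesis using u'_eq[OF norm_D[OF x]] False h_nonneg u_pos[of x]
      by (simp add: norm_sgn powr_mult powr_powr abs_mult)
  qed
  have E1: "(LINT x|lebesgue_on D. norm (u' x) powr p) = (LINT x:D|lborel. h (norm x) powr q * u x powr p)"
    unfolding lebesgue_on_D_continuous(2)[OF c2] by (intro set_lebesgue_integral_cong) (auto simp: norm_u')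
  \<comment> \<open>Inserting \<open>u'\<close> turns the first term into
    \<open>- p * h powr q * u powr p\<close>, which combines with the factor \<open>p - 1\<close> to
    a single negative multiple of the energy density.\<close>
  have "(LINT x:D|lborel. h (norm x) * (((p * u x powr (p - 1)) *\<^sub>R u' x) \<bullet> sgn x) + u x powr p * (\<mu> + (p - 1) * h (norm x) powr q))
    = (LINT x:D|lborel. \<mu> * (u x powr p) - h (norm x) powr q * u x powr p)"
  proof (intro set_lebesgue_integral_cong)
    show "\<forall>x. x \<in> D \<longrightarrow> h (norm x) * (((p * u x powr (p - 1)) *\<^sub>R u' x) \<bullet> sgn x) + u x powr p * (\<mu> + (p - 1) * h (norm x) powr q)
        = \<mu> * (u x powr p) - h (norm x) powr q * u x powr p"
    proof (intro allI impI)
      fix x assume x: "x \<in> D"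
      show "h (norm x) * (((p * u x powr (p - 1)) *\<^sub>R u' x) \<bullet> sgn x) + u x powr p * (\<mu> + (p - 1) * h (norm x) powr q)
        = \<mu> * (u x powr p) - h (norm x) powr q * u x powr p"
      proof (cases "x = 0 \<or> h (norm x) = 0")
        case True
        then show ?thesis using q by (auto simp: h_0)
      next
        case False
        have s: "sgn x \<bullet> sgn x = 1" using False by (simp add: dot_square_norm norm_sgn)
        have "h (norm x) powr q = h (norm x) * h (norm x) powr (q - 1)"
          using False h_nonneg[of "norm x"] by (simp add: powr_diff)
        moreover have "u x powr p = u x powr (p - 1) * u x" using u_pos[of x] by (simp add: powr_diff)
        ultimately show ?thesis using s u'_eq[OF norm_D[OF x]] by (simp add: algebra_simps)
      qed
    qed
  qed simp
  also have "\<dots> = \<mu> * ?N - (LINT x:D|lborel. h (norm x) powr q * u x powr p)"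
    using set_integrable_continuous[OF u_powr_cont] set_integrable_continuous[OF c1] by (subst set_integral_diff) auto
  finally have rad: "(LINT x:D|lborel. h (norm x) powr q * u x powr p)
      = \<mu> * ?N - (LINT n|cone_measure. h (\<rho> n) * ?U n * \<rho> n ^ m)"
    using radial_part[OF uV Vc] by simp
  have i1: "integrable cone_measure (\<lambda>n. h (\<rho> n) * ?U n * \<rho> n ^ m)"
  proof -
    have "integrable cone_measure (\<lambda>n. (h (norm (graph_map n)) * ?U n) * \<rho> n ^ m)"
      by (intro integrable_cone_continuous continuous_on_mult hn u_powr_cont)
    moreover have "AE n in cone_measure. (h (norm (graph_map n)) * ?U n) * \<rho> n ^ m = h (\<rho> n) * ?U n * \<rho> n ^ m"
      using AE_cone_measure by eventually_elim (simp add: norm_graph_map)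
    ultimately show ?thesis by (subst (asm) integrable_cong_AE) auto
  qed
  have i2: "integrable cone_measure (\<lambda>n. ?U n * ?w n)"
  proof -
    obtain M where M: "\<forall>x\<in>cball 0 r1. \<bar>u x powr p\<bar> \<le> M"
      using compact_abs_bounded[OF compact_cball u_powr_cont] by blast
    show ?thesis
    proof (rule integrable_cone_bounded[where M = "M * sqrt (r1\<^sup>2 + L\<^sup>2) ^ m"])
      fix n :: 'a assume n: "norm n = 1"
      have "graph_map n \<in> cball 0 r1" using norm_graph_map[OF n] \<rho>_bounds(2)[of n] by simp
      then have 1: "?U n \<le> M" using M by (auto simp: abs_le_iff)
      have "(\<rho> n)\<^sup>2 \<le> r1\<^sup>2" using \<rho>_bounds(2)[of n] less_imp_le[OF \<rho>_pos] by (intro power_mono)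
      then have "?U n * ?w n \<le> M * sqrt (r1\<^sup>2 + L\<^sup>2) ^ m"
        using 1 by (intro mult_mono power_mono real_sqrt_le_mono) (auto intro: order_trans[OF _ 1])
      then show "\<bar>?U n * ?w n\<bar> \<le> M * sqrt (r1\<^sup>2 + L\<^sup>2) ^ m" by (simp add: abs_mult power_abs)
    qed measurable
  qed
  have "robin_lambda1 p \<beta> D \<le> ((LINT x|lebesgue_on D. norm (u' x) powr p) + \<beta> * (LINT x|surface_measure D. \<bar>u x\<bar> powr p))
        / (LINT x|lebesgue_on D. \<bar>u x\<bar> powr p)"
    unfolding robin_lambda1_def using u_sobolev u_trace u_not_zero
    by (intro cInf_lower rayleigh_quotients_bdd_below[OF \<beta>]) auto
  also have "\<dots> \<le> (\<mu> * ?N + (LINT n|cone_measure. F n)) / ?N"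
  proof -
    have "(LINT x|surface_measure D. \<bar>u x\<bar> powr p) \<le> \<kappa> * (LINT n|cone_measure. ?U n * ?w n)"
      using surface_integral_le(2)[OF u_powr_cont] u_pos by (simp add: abs_of_pos)
    from mult_left_mono[OF this, of \<beta>]
    have "\<beta> * (LINT x|surface_measure D. \<bar>u x\<bar> powr p) \<le> (LINT n|cone_measure. \<kappa> * \<beta> * (?U n * ?w n))"
      using \<beta> by (simp add: mult_ac)
    moreover have "(LINT n|cone_measure. \<kappa> * \<beta> * (?U n * ?w n) - h (\<rho> n) * ?U n * \<rho> n ^ m) \<le> (LINT n|cone_measure. F n)"
      by (rule integral_cone_mono[OF Bochner_Integration.integrable_diff F(1)]) (use i1 i2 F(2) in \<open>auto simp: algebra_simps\<close>)
    moreover have "(LINT n|cone_measure. \<kappa> * \<beta> * (?U n * ?w n) - h (\<rho> n) * ?U n * \<rho> n ^ m)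
        = (LINT n|cone_measure. \<kappa> * \<beta> * (?U n * ?w n))
          - (LINT n|cone_measure. h (\<rho> n) * ?U n * \<rho> n ^ m)"
      by (rule Bochner_Integration.integral_diff) (use i1 i2 in auto)
    ultimately show ?thesis unfolding N E1 rad using Npos by (intro divide_right_mono) auto
  qed
  also have "\<dots> = \<mu> + (LINT n|cone_measure. F n) / ?N"
    using Npos by (simp add: add_divide_distrib)
  finally show ?thesis .
qed

text \<open>The calibration bounds the quotient for the larger Robin parameter \<open>b\<close>; as
  \<open>b \<ge> \<beta>\<close>, that quotient is at most \<open>b / \<beta>\<close> times the one
  for \<beta>.\<close>

lemma robin_lower:
  assumes \<beta>: "0 < \<beta>" "\<beta> \<le> b" and cal: "calibration Y \<delta> t \<eta> (\<kappa> * b)" and \<mu>\<eta>: "0 \<le> \<mu> - \<eta>"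
  shows "(\<mu> - \<eta>) * (\<beta> / b) \<le> robin_lambda1 p \<beta> D"
  unfolding robin_lambda1_def
proof (rule cInf_greatest)
  show "{((LINT x|lebesgue_on D. norm (G x) powr p) + \<beta> * (LINT x|surface_measure D. \<bar>g x\<bar> powr p))
        / (LINT x|lebesgue_on D. \<bar>z x\<bar> powr p) | z G g.
      sobolev p D z G \<and> has_trace p D z G g \<and> \<not> (AE x in lebesgue_on D. z x = 0)} \<noteq> {}"
    using u_sobolev u_trace u_not_zero by blast
  fix y assume "y \<in> {((LINT x|lebesgue_on D. norm (G x) powr p) + \<beta> * (LINT x|surface_measure D. \<bar>g x\<bar> powr p))
        / (LINT x|lebesgue_on D. \<bar>z x\<bar> powr p) | z G g.
      sobolev p D z G \<and> has_trace p D z G g \<and> \<not> (AE x in lebesgue_on D. z x = 0)}"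
  then obtain z G g where y: "y = ((LINT x|lebesgue_on D. norm (G x) powr p) + \<beta> * (LINT x|surface_measure D. \<bar>g x\<bar> powr p))
        / (LINT x|lebesgue_on D. \<bar>z x\<bar> powr p)"
    and z: "sobolev p D z G" "has_trace p D z G g" "\<not> (AE x in lebesgue_on D. z x = 0)" by blast
  let ?N = "LINT x|lebesgue_on D. \<bar>z x\<bar> powr p" and ?E1 = "LINT x|lebesgue_on D. norm (G x) powr p"
    and ?E2 = "LINT x|surface_measure D. \<bar>g x\<bar> powr p"
  have N: "0 < ?N" using Lp_norm_pos[OF _ z(3)] z(1) by (simp add: sobolev_def)
  have "0 \<le> ?E1" by (intro integral_nonneg_AE) auto
  then have "?E1 \<le> b / \<beta> * ?E1" using \<beta> mult_right_mono[of 1 "b / \<beta>" ?E1] by simp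
  then have "?E1 + b * ?E2 \<le> b / \<beta> * (?E1 + \<beta> * ?E2)" using \<beta> by (simp add: algebra_simps)
  with trace_lower_bound[OF z(1,2) cal \<mu>\<eta>] have "(\<mu> - \<eta>) * ?N \<le> b / \<beta> * (?E1 + \<beta> * ?E2)" by linarith
  then have "(\<mu> - \<eta>) * (\<beta> / b) * ?N \<le> ?E1 + \<beta> * ?E2" using \<beta> by (simp add: field_simps)
  then show "(\<mu> - \<eta>) * (\<beta> / b) \<le> y" using N by (simp add: y field_simps)
qed

end

section \<open>Perturbations of a ball are radial graphs\<close>

text \<open>The image is open by invariance of domain, and its frontier is the image of the sphere.
  It is a radial graph because the distance of a frontier point from the origin is a Lipschitz
  function of its direction, with a constant of order \<open>s\<close>; in particular each ray meets
  the frontier only once.\<close>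

lemma near_identity_radial_graph:
  fixes f w :: "'a::euclidean_space \<Rightarrow> 'a"
  assumes R: "0 < R" and s: "0 \<le> s" "4 * (4 + 2 * R) * s \<le> R" and r1: "R + s \<le> r1"
    and f: "\<And>x. x \<in> cball 0 R \<Longrightarrow> f x = x + w x"
    and bd: "\<And>x. x \<in> cball 0 R \<Longrightarrow> norm (w x) \<le> s"
    and lip: "\<And>x y. x \<in> cball 0 R \<Longrightarrow> y \<in> cball 0 R \<Longrightarrow> norm (w x - w y) \<le> s * norm (x - y)"
  shows "\<exists>\<rho>. radial_graph (f ` ball 0 R) \<rho> (R / 2) r1 (8 * (4 + 2 * R) * s) (DIM('a) - 1) (hausdorff_ratio TYPE('a))
    \<and> (\<forall>n. norm n = 1 \<longrightarrow> (\<exists>x\<in>sphere 0 R. \<rho> n *\<^sub>R n = x + w x))"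
proof -
  have "0 \<le> R * s" using R s by simp
  then have sR: "16 * s \<le> R" "R * (8 * s) \<le> R * 1" using s by (auto simp: algebra_simps)
  then have s1: "8 * s \<le> 1" using R by (simp add: mult_le_cancel_left_pos)
  have wc: "continuous_on (cball 0 R) w"
    by (rule lipschitz_on_continuous_on[OF lipschitz_onI]) (use lip s in \<open>auto simp: dist_norm\<close>)
  have fc: "continuous_on (cball 0 R) f"
    using continuous_on_add[OF continuous_on_id wc] by (rule continuous_on_eq) (simp add: f)
  have expand: "norm (x - y) \<le> 2 * norm (f x - f y)" if "x \<in> cball 0 R" "y \<in> cball 0 R" for x y
  proof -
    have e: "x - y = (f x - f y) - (w x - w y)" using that by (simp add: f)
    have "norm (x - y) \<le> norm (f x - f y) + norm (w x - w y)" by (subst e) (rule norm_triangle_ineq4)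
    also have "norm (w x - w y) \<le> s * norm (x - y)" by (rule lip[OF that])
    also have "s * norm (x - y) \<le> 1 / 2 * norm (x - y)" using s1 by (intro mult_right_mono) auto
    finally show ?thesis by simp
  qed
  have inj: "inj_on f (cball 0 R)" by (rule inj_onI) (use expand in fastforce)
  define D where "D = f ` ball 0 R"
  have oD: "open D" unfolding D_def
    by (rule invariance_of_domain[OF continuous_on_subset[OF fc] _ inj_on_subset[OF inj]]) auto
  have comp: "compact (f ` cball 0 R)" by (rule compact_continuous_image[OF fc compact_cball])
  have bD: "bounded D" unfolding D_def by (rule bounded_subset[OF compact_imp_bounded[OF comp]]) (use ball_subset_cball in blast)
  have "closure D = f ` cball 0 R"
  proof
    show "closure D \<subseteq> f ` cball 0 R" unfolding D_def
      by (rule closure_minimal[OF _ compact_imp_closed[OF comp]]) (use ball_subset_cball in blast)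
    have "f ` closure (ball 0 R) \<subseteq> closure (f ` ball 0 R)"
      by (rule continuous_image_closure_subset[OF continuous_on_subset[OF fc]]) (use R in \<open>auto simp: closure_ball\<close>)
    then show "f ` cball 0 R \<subseteq> closure D" using R by (simp add: D_def)
  qed
  then have fD: "frontier D = f ` sphere 0 R"
  proof -
    have "f ` cball 0 R - f ` ball 0 R = f ` (cball 0 R - ball 0 R)"
      by (rule inj_on_image_set_diff[OF inj, symmetric]) auto
    moreover have "cball 0 R - ball 0 R = sphere (0::'a) R" by auto
    ultimately show ?thesis using oD \<open>closure D = f ` cball 0 R\<close> by (simp add: frontier_def interior_open D_def)
  qed
  \<comment> \<open>By Brouwer \<open>- w\<close> has a fixed point, which is a preimage of the
    origin. It is interior because its norm is at most \<open>s\<close>, which is less than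
    \<open>R\<close>.\<close>
  have zD: "0 \<in> D"
  proof -
    have "(\<lambda>x. - w x) ` cball 0 R \<subseteq> cball 0 R"
    proof
      fix y assume "y \<in> (\<lambda>x. - w x) ` cball 0 R"
      then show "y \<in> cball 0 R" using bd sR s by force
    qed
    then obtain x where x: "x \<in> cball 0 R" "- w x = x" using brouwer_ball[OF R continuous_on_minus[OF wc]] by blast
    then have "norm x \<le> s" using bd[OF x(1)] by (metis norm_minus_cancel)
    then have "x \<in> ball 0 R" using sR s R by simp
    moreover have "f x = 0" using f[OF x(1)] x(2) by (metis add.right_inverse minus_minus)
    ultimately show ?thesis by (force simp: D_def)
  qed
  have bound: "R / 2 \<le> norm (f x)" "norm (f x) \<le> R + s" if x: "x \<in> sphere 0 R" for x
  proof -
    have "x \<in> cball 0 R" using x by simp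
    from bd[OF this] f[OF this] have "norm (w x) \<le> s" "f x = x + w x" by auto
    then show "R / 2 \<le> norm (f x)" "norm (f x) \<le> R + s"
      using norm_triangle_ineq[of x "w x"] norm_diff_ineq[of x "w x"] x sR s by auto
  qed
  \<comment> \<open>The squared norm of \<open>f x\<close> is \<open>R\<^sup>2\<close> plus terms
    whose Lipschitz constant in \<open>x\<close> is of order \<open>s\<close>, and
    \<open>x - y\<close> is controlled by the difference of the directions plus the difference
    \<Delta> of the norms. For small \<open>s\<close> the contribution of \<Delta> is
    absorbed.\<close>
  have direction: "\<bar>norm (f x) - norm (f y)\<bar> \<le> 8 * (4 + 2 * R) * s * norm (sgn (f x) - sgn (f y))"
    if xy: "x \<in> sphere 0 R" "y \<in> sphere 0 R" for x y
  proof -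
    have c: "x \<in> cball 0 R" "y \<in> cball 0 R" and nm: "norm x = R" "norm y = R" using xy by auto
    define \<Delta> where "\<Delta> = norm (f x) - norm (f y)"
    define k where "k = (4 + 2 * R) * s / R"
    have k: "0 \<le> k" "4 * k \<le> 1" using s R by (auto simp: k_def field_simps)
    have sq: "(norm (f x))\<^sup>2 = R\<^sup>2 + 2 * (x \<bullet> w x) + (norm (w x))\<^sup>2" if "x \<in> cball 0 R" "norm x = R" for x
    proof -
      have "f x = x + w x" "x \<bullet> x = R\<^sup>2" using f that by (auto simp: dot_square_norm)
      then show ?thesis by (simp add: power2_norm_eq_inner inner_add_left inner_add_right inner_commute)
    qed
    have "x \<bullet> w x - y \<bullet> w y = (x - y) \<bullet> w x + y \<bullet> (w x - w y)" by (simp add: inner_diff_left inner_diff_right)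
    then have "\<bar>x \<bullet> w x - y \<bullet> w y\<bar> \<le> \<bar>(x - y) \<bullet> w x\<bar> + \<bar>y \<bullet> (w x - w y)\<bar>" by simp
    moreover have "\<bar>(x - y) \<bullet> w x\<bar> \<le> norm (x - y) * s"
      by (rule order_trans[OF Cauchy_Schwarz_ineq2]) (intro mult_left_mono bd c, simp)
    moreover have "\<bar>y \<bullet> (w x - w y)\<bar> \<le> R * (s * norm (x - y))"
      by (rule order_trans[OF Cauchy_Schwarz_ineq2]) (use nm R lip[OF c] in \<open>auto intro: mult_left_mono\<close>)
    ultimately have a1: "\<bar>x \<bullet> w x - y \<bullet> w y\<bar> \<le> (1 + R) * s * norm (x - y)" by (simp add: algebra_simps)
    have "(norm (w x))\<^sup>2 - (norm (w y))\<^sup>2 = (norm (w x) - norm (w y)) * (norm (w x) + norm (w y))"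
      by (simp add: power2_eq_square algebra_simps)
    then have "\<bar>(norm (w x))\<^sup>2 - (norm (w y))\<^sup>2\<bar> = \<bar>norm (w x) - norm (w y)\<bar> * (norm (w x) + norm (w y))"
      by (simp add: abs_mult)
    moreover have "\<dots> \<le> (s * norm (x - y)) * 2"
      by (rule mult_mono) (use order_trans[OF norm_triangle_ineq3 lip[OF c]] bd[OF c(1)] bd[OF c(2)] s s1 in auto)
    ultimately have a2: "\<bar>(norm (w x))\<^sup>2 - (norm (w y))\<^sup>2\<bar> \<le> 2 * s * norm (x - y)" by simp
    have "\<Delta> * (norm (f x) + norm (f y)) = 2 * (x \<bullet> w x - y \<bullet> w y) + ((norm (w x))\<^sup>2 - (norm (w y))\<^sup>2)"
      using sq[OF c(1) nm(1)] sq[OF c(2) nm(2)] by (simp add: \<Delta>_def power2_eq_square algebra_simps)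
    then have "\<bar>\<Delta>\<bar> * \<bar>norm (f x) + norm (f y)\<bar> \<le> (4 + 2 * R) * s * norm (x - y)"
      unfolding abs_mult[symmetric] using a1 a2 by (simp add: algebra_simps abs_le_iff)
    moreover have "\<bar>\<Delta>\<bar> * R \<le> \<bar>\<Delta>\<bar> * \<bar>norm (f x) + norm (f y)\<bar>"
      using bound(1)[OF xy(1)] bound(1)[OF xy(2)] by (intro mult_left_mono) auto
    ultimately have d1: "\<bar>\<Delta>\<bar> \<le> k * norm (x - y)" using R by (simp add: k_def field_simps)
    have "f x = norm (f x) *\<^sub>R sgn (f x)" "f y = norm (f y) *\<^sub>R sgn (f y)" by (simp_all only: norm_scaleR_sgn)
    then have "f x - f y = norm (f x) *\<^sub>R (sgn (f x) - sgn (f y)) + \<Delta> *\<^sub>R sgn (f y)" by (simp add: \<Delta>_def algebra_simps)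
    then have "norm (f x - f y) \<le> norm (f x) * norm (sgn (f x) - sgn (f y)) + \<bar>\<Delta>\<bar> * norm (sgn (f y))"
      using norm_triangle_ineq[of "norm (f x) *\<^sub>R (sgn (f x) - sgn (f y))" "\<Delta> *\<^sub>R sgn (f y)"] by simp
    also have "\<dots> \<le> 2 * R * norm (sgn (f x) - sgn (f y)) + \<bar>\<Delta>\<bar> * 1"
      using bound(2)[OF xy(1)] sR s by (intro add_mono mult_mono) (auto simp: norm_sgn)
    finally have "norm (x - y) \<le> 2 * (2 * R * norm (sgn (f x) - sgn (f y)) + \<bar>\<Delta>\<bar>)" using expand[OF c] by simp
    from mult_left_mono[OF this k(1)] d1 have "\<bar>\<Delta>\<bar> \<le> 4 * k * R * norm (sgn (f x) - sgn (f y)) + 2 * k * \<bar>\<Delta>\<bar>"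
      by (simp add: algebra_simps)
    moreover have "2 * k * \<bar>\<Delta>\<bar> \<le> 1 / 2 * \<bar>\<Delta>\<bar>" using k by (intro mult_right_mono) auto
    ultimately have "\<bar>\<Delta>\<bar> \<le> 8 * (k * R) * norm (sgn (f x) - sgn (f y))" by simp
    then show ?thesis using R by (simp add: k_def \<Delta>_def mult_ac)
  qed
  have "\<exists>d>0. d *\<^sub>R n \<in> frontier D \<and> (\<forall>e. 0 \<le> e \<and> e < d \<longrightarrow> e *\<^sub>R n \<in> D)" if "norm n = 1" for n :: 'a
  proof -
    have "n \<noteq> 0" using that by auto
    from ray_to_frontier[OF bD _ this, of 0] zD oD show ?thesis by (metis add_0 interior_open)
  qed
  then obtain \<rho> where \<rho>: "\<And>n. norm n = 1 \<Longrightarrow> 0 < \<rho> n" "\<And>n. norm n = 1 \<Longrightarrow> \<rho> n *\<^sub>R n \<in> frontier D"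
    "\<And>n e. norm n = 1 \<Longrightarrow> 0 \<le> e \<Longrightarrow> e < \<rho> n \<Longrightarrow> e *\<^sub>R n \<in> D" by metis
  have foot: "\<exists>x\<in>sphere 0 R. f x = \<rho> n *\<^sub>R n \<and> sgn (f x) = n \<and> norm (f x) = \<rho> n" if n: "norm n = 1" for n
  proof -
    obtain x where x: "x \<in> sphere 0 R" "f x = \<rho> n *\<^sub>R n" using \<rho>(2)[OF n] unfolding fD by (metis imageE)
    then show ?thesis using \<rho>(1)[OF n] n by (intro bexI[OF _ x(1)]) (simp add: sgn_scaleR sgn_div_norm)
  qed
  have uniq: "\<rho> (sgn y) = norm y" if "y \<in> frontier D" for y
  proof -
    obtain x where x: "x \<in> sphere 0 R" "y = f x" using \<open>y \<in> frontier D\<close> unfolding fD by blast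
    then have "y \<noteq> 0" using bound(1)[OF x(1)] R by auto
    then have "norm (sgn y) = 1" by (simp add: norm_sgn)
    from foot[OF this] obtain x' where x': "x' \<in> sphere 0 R" "sgn (f x') = sgn y" "norm (f x') = \<rho> (sgn y)" by blast
    then show ?thesis using direction[OF x(1) x'(1)] x(2) by simp
  qed
  have lipR: "\<bar>\<rho> n - \<rho> n'\<bar> \<le> 8 * (4 + 2 * R) * s * dist n n'" if n: "norm n = 1" "norm n' = 1" for n n'
  proof -
    from foot[OF n(1)] obtain x where x: "x \<in> sphere 0 R" "sgn (f x) = n" "norm (f x) = \<rho> n" by blast
    from foot[OF n(2)] obtain y where y: "y \<in> sphere 0 R" "sgn (f y) = n'" "norm (f y) = \<rho> n'" by blast
    show ?thesis using direction[OF x(1) y(1)] x y by (simp add: dist_norm)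
  qed
  \<comment> \<open>The extension to the whole space goes through \<open>sgn\<close>; the value
    \<open>R\<close> is assigned at the origin, where \<open>sgn\<close> gives no direction.\<close>
  define \<rho>' where "\<rho>' x = (if x \<in> {0} then R else \<rho> (sgn x))" for x
  have \<rho>'1: "\<rho>' n = \<rho> n" if "norm n = 1" for n using that by (auto simp: \<rho>'_def sgn_div_norm)
  have rangeR: "R / 2 \<le> \<rho> n" "\<rho> n \<le> R + s" if n: "norm n = 1" for n using foot[OF n] bound by metis+
  show ?thesis
  proof (intro exI[of _ \<rho>'] conjI allI impI)
    show "radial_graph (f ` ball 0 R) \<rho>' (R / 2) r1 (8 * (4 + 2 * R) * s) (DIM('a) - 1) (hausdorff_ratio TYPE('a))"
      unfolding D_def[symmetric]
    proof (unfold_locales)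
      show "D = {x. norm x < \<rho>' (sgn x)}"
      proof (intro set_eqI iffI; simp)
        fix x assume x: "x \<in> D"
        show "norm x < \<rho>' (sgn x)"
        proof (cases "x = 0")
          case False
          then have nm: "norm (sgn x) = 1" by (simp add: norm_sgn)
          then have "sgn x \<noteq> 0" by auto
          from ray_to_frontier[OF bD _ this, of x] x oD obtain d where d: "0 < d" "x + d *\<^sub>R sgn x \<in> frontier D"
            by (metis interior_open)
          have "x + d *\<^sub>R sgn x = (norm x + d) *\<^sub>R sgn x" by (simp add: sgn_div_norm algebra_simps False)
          then have "sgn (x + d *\<^sub>R sgn x) = sgn x" "norm (x + d *\<^sub>R sgn x) = norm x + d"
            using d(1) nm by (simp_all add: sgn_scaleR add_nonneg_pos sgn_div_norm[of "sgn x"])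
          with uniq[OF d(2)] have "\<rho> (sgn x) = norm x + d" by simp
          then show ?thesis using d(1) \<rho>'1[OF nm] by simp
        qed (use R in \<open>simp add: \<rho>'_def\<close>)
      next
        fix x assume x: "norm x < \<rho>' (sgn x)"
        show "x \<in> D"
        proof (cases "x = 0")
          case False
          then have nm: "norm (sgn x) = 1" by (simp add: norm_sgn)
          then have "norm x *\<^sub>R sgn x \<in> D" using x \<rho>'1[OF nm] by (intro \<rho>(3)) auto
          then show ?thesis using False by (simp add: sgn_div_norm)
        qed (use zD in simp)
      qed
      show "frontier D = (\<lambda>n. \<rho>' n *\<^sub>R n) ` sphere 0 1"
      proof (intro set_eqI iffI)
        fix y assume y: "y \<in> frontier D"
        have "y \<noteq> 0" using y zD oD by (auto simp: frontier_def interior_open)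
        then have nm: "norm (sgn y) = 1" by (simp add: norm_sgn)
        then have "y = \<rho>' (sgn y) *\<^sub>R sgn y" using uniq[OF y] \<rho>'1[OF nm] by (simp add: norm_scaleR_sgn)
        then show "y \<in> (\<lambda>n. \<rho>' n *\<^sub>R n) ` sphere 0 1" using nm by (intro image_eqI) auto
      qed (use \<rho>(2) \<rho>'1 in auto)
      show "\<rho>' \<in> borel_measurable borel" unfolding \<rho>'_def[abs_def]
      proof (rule borel_measurable_continuous_on_if)
        have "continuous_on (sphere 0 1) \<rho>"
          by (rule lipschitz_on_continuous_on[OF lipschitz_onI[where L = "8 * (4 + 2 * R) * s"]]) (use lipR R s in \<open>auto simp: dist_real_def\<close>)
        then show "continuous_on (- {0}) (\<lambda>x. \<rho> (sgn x))"
          by (rule continuous_on_compose2) (auto simp: norm_sgn split: if_splits intro!: continuous_on_sgn continuous_on_id)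
      qed auto
      show "R / 2 \<le> \<rho>' x" "\<rho>' x \<le> r1" for x using rangeR[of "sgn x"] R r1 s by (auto simp: \<rho>'_def norm_sgn)
      show "\<bar>\<rho>' n - \<rho>' n'\<bar> \<le> 8 * (4 + 2 * R) * s * dist n n'" if "norm n = 1" "norm n' = 1" for n n'
        using lipR[OF that] \<rho>'1 that by simp
    qed (use oD R s in auto)
    fix n :: 'a assume n: "norm n = 1"
    from foot[OF n] obtain x where "x \<in> sphere 0 R" "f x = \<rho> n *\<^sub>R n" by blast
    then show "\<exists>x\<in>sphere 0 R. \<rho>' n *\<^sub>R n = x + w x" using \<rho>'1[OF n] f by (intro bexI) auto
  qed
qed

lemma smooth_on_closed_ball_Lipschitz:
  fixes v :: "'a::euclidean_space \<Rightarrow> 'a"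
  assumes "smooth_on_closed (cball 0 R) v"
  obtains A where "0 < A" "\<And>x. x \<in> cball 0 R \<Longrightarrow> norm (v x) \<le> A"
    "\<And>x y. x \<in> cball 0 R \<Longrightarrow> y \<in> cball 0 R \<Longrightarrow> norm (v x - v y) \<le> A * norm (x - y)"
proof -
  obtain U g where U: "cball 0 R \<subseteq> U" "open U" "\<And>k. Ck_on k U g" and g: "\<And>x. x \<in> cball 0 R \<Longrightarrow> g x = v x"
    using assms unfolding smooth_on_closed_def smooth_on_def by blast
  have "Ck_on (Suc 0) U g" by (rule U)
  then have d: "g differentiable_on U" and c: "\<And>b. b \<in> Basis \<Longrightarrow> continuous_on U (\<lambda>x. frechet_derivative g (at x) b)" by auto
  have g': "(g has_derivative frechet_derivative g (at x)) (at x)" if "x \<in> cball 0 R" for x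
    using d U(1,2) that by (simp add: differentiable_on_eq_differentiable_at frechet_derivative_works[symmetric] subset_iff)
  have "continuous_on (cball 0 R) (\<lambda>x. \<Sum>b\<in>Basis. norm (frechet_derivative g (at x) b))"
    using c U(1) by (intro continuous_intros) (auto intro: continuous_on_subset)
  from compact_abs_bounded[OF compact_cball this]
  obtain M where M: "\<And>x. x \<in> cball 0 R \<Longrightarrow> \<bar>\<Sum>b\<in>Basis. norm (frechet_derivative g (at x) b)\<bar> \<le> M" by blast
  have "continuous_on (cball 0 R) (\<lambda>x. norm (g x))"
    by (intro continuous_on_norm continuous_on_subset[OF differentiable_imp_continuous_on[OF d] U(1)])
  from compact_abs_bounded[OF compact_cball this]
  obtain M' where M': "\<And>x. x \<in> cball 0 R \<Longrightarrow> norm (g x) \<le> M'" by (metis abs_norm_cancel)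
  have on: "onorm (frechet_derivative g (at x)) \<le> M" if x: "x \<in> cball 0 R" for x
  proof (rule onorm_le)
    fix y
    have lin: "linear (frechet_derivative g (at x))" using g'[OF x] has_derivative_linear by blast
    have "frechet_derivative g (at x) y = frechet_derivative g (at x) (\<Sum>b\<in>Basis. (y \<bullet> b) *\<^sub>R b)" by (simp add: euclidean_representation)
    also have "\<dots> = (\<Sum>b\<in>Basis. (y \<bullet> b) *\<^sub>R frechet_derivative g (at x) b)"
      using lin by (simp add: linear_sum linear_scale)
    finally have eq: "frechet_derivative g (at x) y = (\<Sum>b\<in>Basis. (y \<bullet> b) *\<^sub>R frechet_derivative g (at x) b)" .
    have "norm (frechet_derivative g (at x) y) \<le> (\<Sum>b\<in>Basis. norm ((y \<bullet> b) *\<^sub>R frechet_derivative g (at x) b))"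
      unfolding eq by (rule norm_sum)
    also have "\<dots> \<le> (\<Sum>b\<in>Basis. norm y * norm (frechet_derivative g (at x) b))"
      by (intro sum_mono) (auto intro!: mult_right_mono Basis_le_norm)
    also have "\<dots> = (\<Sum>b\<in>Basis. norm (frechet_derivative g (at x) b)) * norm y" by (simp add: sum_distrib_left mult.commute)
    also have "\<dots> \<le> M * norm y" using M[OF x] by (intro mult_right_mono) auto
    finally show "norm (frechet_derivative g (at x) y) \<le> M * norm y" .
  qed
  show thesis
  proof (rule that[of "max 1 (max M M')"])
    fix x y :: 'a assume xy: "x \<in> cball 0 R" "y \<in> cball 0 R"
    have "norm (g x - g y) \<le> M * norm (x - y)"
      by (rule differentiable_bound[OF convex_cball has_derivative_at_withinI[OF g'] on xy])
    also have "\<dots> \<le> max 1 (max M M') * norm (x - y)" by (intro mult_right_mono) auto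
    finally show "norm (v x - v y) \<le> max 1 (max M M') * norm (x - y)" using g xy by simp
  next
    fix x :: 'a assume "x \<in> cball 0 R"
    then show "norm (v x) \<le> max 1 (max M M')" using M' g by fastforce
  qed simp
qed

text \<open>The frontier point in direction \<open>n\<close> is \<open>x + w x\<close> for some
  \<open>x\<close> on the sphere, with direction \<open>z\<close> at distance O(t) from
  \<open>n\<close>. The inner product with \<open>z\<close> instead of \<open>n\<close> makes the
  deviation of the directions enter the radius only quadratically.\<close>

lemma perturbation_radial_graph:
  fixes v :: "'a::euclidean_space \<Rightarrow> 'a"
  assumes R: "0 < R" "R < r1" and v: "smooth_on_closed (closure (ball 0 R)) v" and T: "perturbation_family (ball 0 R) v T"
  obtains C where "0 \<le> C" "\<And>\<epsilon>. 0 < \<epsilon> \<Longrightarrow> \<forall>\<^sub>F t in nhds 0. \<exists>\<rho>.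
    radial_graph (T t ` ball 0 R) \<rho> (R / 2) r1 (C * \<bar>t\<bar>) (DIM('a) - 1) (hausdorff_ratio TYPE('a))
    \<and> (\<forall>n. norm n = 1 \<longrightarrow> \<bar>\<rho> n - R - t * (v (R *\<^sub>R n) \<bullet> n)\<bar> \<le> \<epsilon> * \<bar>t\<bar>)"
proof -
  have cl: "closure (ball 0 R) = cball (0::'a) R" using R by simp
  obtain A0 where A0: "0 < A0" "\<And>x. x \<in> cball 0 R \<Longrightarrow> norm (v x) \<le> A0"
    "\<And>x y. x \<in> cball 0 R \<Longrightarrow> y \<in> cball 0 R \<Longrightarrow> norm (v x - v y) \<le> A0 * norm (x - y)"
    using smooth_on_closed_ball_Lipschitz v unfolding cl by blast
  define A where "A = A0 + 1"
  have A: "0 < A" using A0 by (simp add: A_def)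
  show thesis
  proof (rule that[of "8 * (4 + 2 * R) * A"])
    show "0 \<le> 8 * (4 + 2 * R) * A" using R A by simp
    fix \<epsilon> :: real assume \<epsilon>: "0 < \<epsilon>"
    define e where "e = min 1 (\<epsilon> / 2)"
    have e: "0 < e" "e \<le> 1" "e \<le> \<epsilon> / 2" using \<epsilon> by (auto simp: e_def)
    \<comment> \<open>Coefficients of the two errors of second order in t: the squared deviation of
      directions, and the variation of the normal velocity between \<open>x\<close> and
      \<open>R *\<^sub>R n\<close>.\<close>
    define B where "B = 4 * A\<^sup>2 / R + 2 * A * A * (R + 1) / R"
    have B: "0 \<le> B" using A R by (simp add: B_def)
    have "((\<lambda>t. 4 * (4 + 2 * R) * (A * \<bar>t\<bar>)) \<longlongrightarrow> 4 * (4 + 2 * R) * (A * \<bar>0\<bar>)) (nhds 0)"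
      by (intro tendsto_intros filterlim_ident)
    then have ev1: "\<forall>\<^sub>F t in nhds 0. 4 * (4 + 2 * R) * (A * \<bar>t\<bar>) < R" using R by (intro order_tendstoD(2)) auto
    have "((\<lambda>t. B * \<bar>t\<bar>) \<longlongrightarrow> B * \<bar>0\<bar>) (nhds (0::real))" by (intro tendsto_intros filterlim_ident)
    then have ev2: "\<forall>\<^sub>F t in nhds 0. B * \<bar>t\<bar> < \<epsilon> / 2" using \<epsilon> by (intro order_tendstoD(2)) auto
    have "((\<lambda>t. R + A * \<bar>t\<bar>) \<longlongrightarrow> R + A * \<bar>0\<bar>) (nhds (0::real))" by (intro tendsto_intros filterlim_ident)
    then have ev4: "\<forall>\<^sub>F t in nhds 0. R + A * \<bar>t\<bar> < r1" using R by (intro order_tendstoD(2)) auto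
    have ev3: "\<forall>\<^sub>F t in nhds 0. \<exists>r'.
        C1_derivative_on (cball 0 R) (\<lambda>x. T t x - (x + t *\<^sub>R v x)) r' \<and>
        (\<forall>x\<in>cball 0 R. norm (T t x - (x + t *\<^sub>R v x)) \<le> e * \<bar>t\<bar> \<and> norm (r' x) \<le> e * \<bar>t\<bar>)"
      using T e(1) unfolding perturbation_family_def cl by blast
    show "\<forall>\<^sub>F t in nhds 0. \<exists>\<rho>.
      radial_graph (T t ` ball 0 R) \<rho> (R / 2) r1 (8 * (4 + 2 * R) * A * \<bar>t\<bar>) (DIM('a) - 1) (hausdorff_ratio TYPE('a))
      \<and> (\<forall>n. norm n = 1 \<longrightarrow> \<bar>\<rho> n - R - t * (v (R *\<^sub>R n) \<bullet> n)\<bar> \<le> \<epsilon> * \<bar>t\<bar>)"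
      using ev1 ev2 ev3 ev4
    proof eventually_elim
      case (elim t)
      define r where "r x = T t x - (x + t *\<^sub>R v x)" for x
      define w where "w x = t *\<^sub>R v x + r x" for x
      define s where "s = A * \<bar>t\<bar>"
      obtain r' where r': "\<And>x. x \<in> cball 0 R \<Longrightarrow> (r has_derivative blinfun_apply (r' x)) (at x within cball 0 R)"
        and rb: "\<And>x. x \<in> cball 0 R \<Longrightarrow> norm (r x) \<le> e * \<bar>t\<bar>" "\<And>x. x \<in> cball 0 R \<Longrightarrow> norm (r' x) \<le> e * \<bar>t\<bar>"
        using elim(3) unfolding C1_derivative_on_def r_def[abs_def] by blast
      have et: "e * \<bar>t\<bar> \<le> 1 * \<bar>t\<bar>" using e by (intro mult_right_mono) auto
      have rl: "norm (r x - r y) \<le> \<bar>t\<bar> * norm (x - y)" if "x \<in> cball 0 R" "y \<in> cball 0 R" for x y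
        by (rule differentiable_bound[OF convex_cball r' _ that]) (use rb(2) et in \<open>auto simp: norm_blinfun.rep_eq intro: order_trans\<close>)
      have wb: "norm (w x) \<le> s" if x: "x \<in> cball 0 R" for x
      proof -
        have "norm (w x) \<le> norm (t *\<^sub>R v x) + norm (r x)" unfolding w_def by (rule norm_triangle_ineq)
        also have "\<dots> \<le> \<bar>t\<bar> * A0 + 1 * \<bar>t\<bar>" using A0(2)[OF x] rb(1)[OF x] et by (auto intro!: add_mono mult_left_mono)
        finally show ?thesis by (simp add: s_def A_def algebra_simps)
      qed
      have wl: "norm (w x - w y) \<le> s * norm (x - y)" if xy: "x \<in> cball 0 R" "y \<in> cball 0 R" for x y
      proof -
        have "w x - w y = t *\<^sub>R (v x - v y) + (r x - r y)" by (simp add: w_def algebra_simps)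
        then have "norm (w x - w y) \<le> \<bar>t\<bar> * norm (v x - v y) + norm (r x - r y)"
          using norm_triangle_ineq[of "t *\<^sub>R (v x - v y)" "r x - r y"] by simp
        also have "\<dots> \<le> \<bar>t\<bar> * (A0 * norm (x - y)) + \<bar>t\<bar> * norm (x - y)"
          by (intro add_mono mult_left_mono A0(3) rl xy) simp
        finally show ?thesis by (simp add: s_def A_def algebra_simps)
      qed
      have s0: "0 \<le> s" using A by (simp add: s_def)
      have Tt: "T t x = x + w x" for x by (simp add: w_def r_def)
      have "\<exists>\<rho>. radial_graph (T t ` ball 0 R) \<rho> (R / 2) r1 (8 * (4 + 2 * R) * s) (DIM('a) - 1) (hausdorff_ratio TYPE('a))
        \<and> (\<forall>n. norm n = 1 \<longrightarrow> (\<exists>x\<in>sphere 0 R. \<rho> n *\<^sub>R n = x + w x))"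
        by (rule near_identity_radial_graph[OF R(1) s0 _ _ Tt wb wl]) (use elim(1,4) in \<open>auto simp: s_def\<close>)
      then obtain \<rho> where \<rho>: "radial_graph (T t ` ball 0 R) \<rho> (R / 2) r1 (8 * (4 + 2 * R) * s) (DIM('a) - 1) (hausdorff_ratio TYPE('a))"
        and foot: "\<And>n. norm n = 1 \<Longrightarrow> \<exists>x\<in>sphere 0 R. \<rho> n *\<^sub>R n = x + w x" by blast
      have "\<bar>\<rho> n - R - t * (v (R *\<^sub>R n) \<bullet> n)\<bar> \<le> \<epsilon> * \<bar>t\<bar>" if n: "norm n = 1" for n
      proof -
        obtain x where x: "norm x = R" "\<rho> n *\<^sub>R n = x + w x" using foot[OF n] by auto
        have xc: "x \<in> cball 0 R" "R *\<^sub>R n \<in> cball 0 R" using x R n by auto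
        define z where "z = x /\<^sub>R R"
        have z: "norm z = 1" "x = R *\<^sub>R z" using x R by (auto simp: z_def)
        have \<rho>R: "R / 2 \<le> \<rho> n" "\<rho> n \<le> 2 * R"
        proof -
          show "R / 2 \<le> \<rho> n" using radial_graph.\<rho>_bounds(1)[OF \<rho>] by auto
          have "0 \<le> R * s" using R s0 by simp
          then have "s \<le> R" using elim(1) s0 unfolding s_def[symmetric] by (simp add: algebra_simps)
          moreover have "norm (\<rho> n *\<^sub>R n) \<le> R + s"
            unfolding x(2) using norm_triangle_ineq[of x "w x"] wb[OF xc(1)] x(1) by simp
          ultimately show "\<rho> n \<le> 2 * R" using n by simp
        qed
        define \<delta> where "\<delta> = norm (n - z)"
        have "n \<bullet> n = 1" "z \<bullet> z = 1" using n z by (auto simp: dot_square_norm)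
        then have \<delta>2: "n \<bullet> z = 1 - \<delta>\<^sup>2 / 2"
          by (simp add: \<delta>_def power2_norm_eq_inner inner_diff_left inner_diff_right inner_commute diff_divide_distrib)
        have \<delta>: "\<delta> \<le> 2 * s / R"
        proof -
          have "\<bar>\<rho> n - R\<bar> = \<bar>norm (\<rho> n *\<^sub>R n) - norm x\<bar>" using n x(1) \<rho>R R by simp
          also have "\<dots> \<le> norm (\<rho> n *\<^sub>R n - x)" by (rule norm_triangle_ineq3)
          also have "\<dots> = norm (w x)" using x by simp
          finally have 1: "\<bar>R - \<rho> n\<bar> \<le> norm (w x)" by simp
          have "R *\<^sub>R (n - z) = (R - \<rho> n) *\<^sub>R n + w x" using x(2) z by (simp add: algebra_simps)
          then have "R * \<delta> = norm ((R - \<rho> n) *\<^sub>R n + w x)" using R unfolding \<delta>_def by (metis abs_of_pos norm_scaleR)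
          also have "\<dots> \<le> \<bar>R - \<rho> n\<bar> + norm (w x)" using norm_triangle_ineq[of "(R - \<rho> n) *\<^sub>R n" "w x"] n by simp
          also have "\<dots> \<le> 2 * s" using 1 wb[OF xc(1)] by simp
          finally show ?thesis using R by (simp add: field_simps)
        qed
        have \<delta>0: "0 \<le> \<delta>" by (simp add: \<delta>_def)
        have "\<rho> n * (n \<bullet> z) = (x + w x) \<bullet> z" unfolding x(2)[symmetric] by simp
        also have "\<dots> = R + t * (v x \<bullet> z) + r x \<bullet> z" using z(2) \<open>z \<bullet> z = 1\<close> by (simp add: w_def inner_add_left algebra_simps)
        finally have eq: "\<rho> n - R - t * (v (R *\<^sub>R n) \<bullet> n) = \<rho> n * (\<delta>\<^sup>2 / 2) + r x \<bullet> z + t * (v x \<bullet> z - v (R *\<^sub>R n) \<bullet> n)"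
          unfolding \<delta>2 by (simp add: algebra_simps)
        have "\<delta>\<^sup>2 \<le> (2 * s / R)\<^sup>2" using \<delta> \<delta>0 by (intro power_mono)
        then have "\<rho> n * (\<delta>\<^sup>2 / 2) \<le> 2 * R * ((2 * s / R)\<^sup>2 / 2)" using \<rho>R R by (intro mult_mono) auto
        also have "\<dots> = \<bar>t\<bar> * (4 * A\<^sup>2 / R * \<bar>t\<bar>)" using R by (simp add: s_def power2_eq_square field_simps)
        finally have t1: "\<bar>\<rho> n * (\<delta>\<^sup>2 / 2)\<bar> \<le> \<bar>t\<bar> * (4 * A\<^sup>2 / R * \<bar>t\<bar>)" using \<rho>R R by simp
        have t2: "\<bar>r x \<bullet> z\<bar> \<le> e * \<bar>t\<bar>" using Cauchy_Schwarz_ineq2[of "r x" z] rb(1)[OF xc(1)] z(1) by simp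
        have "v x \<bullet> z - v (R *\<^sub>R n) \<bullet> n = (v x - v (R *\<^sub>R n)) \<bullet> z + v (R *\<^sub>R n) \<bullet> (z - n)"
          by (simp add: inner_diff_left inner_diff_right)
        then have "\<bar>v x \<bullet> z - v (R *\<^sub>R n) \<bullet> n\<bar> \<le> norm (v x - v (R *\<^sub>R n)) * norm z + norm (v (R *\<^sub>R n)) * norm (z - n)"
          using Cauchy_Schwarz_ineq2[of "v x - v (R *\<^sub>R n)" z] Cauchy_Schwarz_ineq2[of "v (R *\<^sub>R n)" "z - n"] by linarith
        also have "\<dots> \<le> (A0 * norm (x - R *\<^sub>R n)) * 1 + A0 * \<delta>"
          using z(1) A0(1) A0(2)[OF xc(2)] by (intro add_mono mult_mono A0(3) xc) (auto simp: \<delta>_def norm_minus_commute)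
        also have "norm (x - R *\<^sub>R n) = R * \<delta>"
          unfolding z(2) \<delta>_def using R by (subst norm_minus_commute) (simp flip: scaleR_diff_right)
        also have "A0 * (R * \<delta>) * 1 + A0 * \<delta> = A0 * (R + 1) * \<delta>" by (simp add: algebra_simps)
        also have "\<dots> \<le> A * (R + 1) * (2 * s / R)" using \<delta> \<delta>0 A0(1) R by (intro mult_mono) (auto simp: A_def)
        also have "\<dots> = 2 * A * A * (R + 1) / R * \<bar>t\<bar>" by (simp add: s_def)
        finally have "\<bar>t\<bar> * \<bar>v x \<bullet> z - v (R *\<^sub>R n) \<bullet> n\<bar> \<le> \<bar>t\<bar> * (2 * A * A * (R + 1) / R * \<bar>t\<bar>)" by (rule mult_left_mono) simp
        then have t3: "\<bar>t * (v x \<bullet> z - v (R *\<^sub>R n) \<bullet> n)\<bar> \<le> \<bar>t\<bar> * (2 * A * A * (R + 1) / R * \<bar>t\<bar>)" by (simp add: abs_mult)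
        have "\<bar>\<rho> n - R - t * (v (R *\<^sub>R n) \<bullet> n)\<bar> \<le> \<bar>t\<bar> * (4 * A\<^sup>2 / R * \<bar>t\<bar>) + e * \<bar>t\<bar> + \<bar>t\<bar> * (2 * A * A * (R + 1) / R * \<bar>t\<bar>)"
          unfolding eq using t1 t2 t3 by linarith
        also have "\<dots> = \<bar>t\<bar> * (B * \<bar>t\<bar>) + e * \<bar>t\<bar>" by (simp add: B_def algebra_simps)
        also have "\<dots> \<le> \<bar>t\<bar> * (\<epsilon> / 2) + \<epsilon> / 2 * \<bar>t\<bar>"
          using elim(2) e(3) by (intro add_mono mult_left_mono mult_right_mono) auto
        finally show ?thesis by (simp add: algebra_simps)
      qed
      with \<rho> show ?case by (auto simp: s_def mult_ac intro!: exI[of _ \<rho>])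
    qed
  qed
qed

section \<open>Radial functions and the family of profiles\<close>

lemma continuous_on_radial_field:
  fixes \<phi> :: "real \<Rightarrow> real"
  assumes \<phi>: "continuous_on UNIV \<phi>" "\<phi> 0 = 0"
  shows "continuous_on UNIV (\<lambda>x::'a::real_normed_vector. \<phi> (norm x) *\<^sub>R sgn x)"
  unfolding continuous_on_eq_continuous_within
proof
  have c: "continuous_on UNIV (\<lambda>x::'a. \<phi> (norm x))" by (intro continuous_on_compose2[OF \<phi>(1)] continuous_intros) auto
  fix x :: 'a
  have cx: "((\<lambda>x::'a. \<phi> (norm x)) \<longlongrightarrow> \<phi> (norm x)) (at x)"
    using c by (simp add: continuous_on_eq_continuous_within continuous_within)
  show "continuous (at x within UNIV) (\<lambda>x::'a. \<phi> (norm x) *\<^sub>R sgn x)"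
  proof (cases "x = 0")
    case True
    have "((\<lambda>x::'a. \<bar>\<phi> (norm x)\<bar>) \<longlongrightarrow> 0) (at 0)" using tendsto_rabs[OF cx] True \<phi>(2) by simp
    then have "((\<lambda>x::'a. \<phi> (norm x) *\<^sub>R sgn x) \<longlongrightarrow> 0) (at 0)"
    proof (rule Lim_null_comparison[rotated])
      show "\<forall>\<^sub>F x in at 0. norm (\<phi> (norm x) *\<^sub>R sgn (x::'a)) \<le> \<bar>\<phi> (norm x)\<bar>"
        by (rule always_eventually) (simp add: norm_sgn)
    qed
    then show ?thesis using True by (simp add: continuous_within)
  next
    case False
    then show ?thesis using cx unfolding continuous_within by (intro tendsto_scaleR tendsto_sgn tendsto_ident_at) auto
  qed
qed

text \<open>The condition \<open>E' 0 = 0\<close> removes the conical singularity of the norm at the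
  origin.\<close>

lemma radial_has_derivative:
  fixes x :: "'a::real_inner"
  assumes E: "\<And>r. 0 \<le> r \<Longrightarrow> (E has_real_derivative E' r) (at r)" and E0: "E' 0 = 0"
  shows "((\<lambda>x. E (norm x)) has_derivative (\<lambda>v. (E' (norm x) *\<^sub>R sgn x) \<bullet> v)) (at x)"
proof (cases "x = 0")
  case True
  have "(E has_derivative (\<lambda>_. 0)) (at 0)" using E[of 0] E0 unfolding has_field_derivative_def lambda_zero by simp
  then have "\<And>e. 0 < e \<Longrightarrow> \<exists>d>0. \<forall>y. \<bar>y\<bar> < d \<longrightarrow> \<bar>E y - E 0\<bar> \<le> e * \<bar>y\<bar>" by (simp add: has_derivative_at_alt)
  then have "\<And>e. 0 < e \<Longrightarrow> \<exists>d>0. \<forall>y::'a. norm y < d \<longrightarrow> \<bar>E (norm y) - E 0\<bar> \<le> e * norm y" by (metis abs_norm_cancel)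
  then show ?thesis using True by (simp add: has_derivative_at_alt)
next
  case False
  have "(norm has_derivative (\<lambda>v. v \<bullet> sgn x)) (at x)" using GDERIV_norm[OF False] by (simp add: gderiv_def)
  from has_derivative_compose[OF this E[of "norm x", unfolded has_field_derivative_def]]
  show ?thesis by (simp add: inner_commute)
qed

text \<open>Normalised to be \<open>1\<close> on the sphere of radius \<open>R\<close>; the lower limit \<open>- 1\<close> makes \<open>0\<close> an interior point.\<close>

definition radial_potential :: "(real \<Rightarrow> real) \<Rightarrow> real \<Rightarrow> real \<Rightarrow> 'a::real_normed_vector \<Rightarrow> real" where
  "radial_potential h q R x = exp (integral {-1..R} (\<lambda>r. h r powr (q - 1)) - integral {-1..norm x} (\<lambda>r. h r powr (q - 1)))"

locale radial_profile =
  fixes h :: "real \<Rightarrow> real" and q R :: real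
  assumes q1: "1 < q" and R0: "0 \<le> R" and hc: "continuous_on UNIV h" and h0: "h 0 = 0" and hn: "\<And>r. 0 \<le> h r"
begin

lemma slope_cont: "continuous_on S (\<lambda>r. h r powr (q - 1))"
  using hn q1 by (intro continuous_on_powr' continuous_on_subset[OF hc] continuous_intros) auto

lemma integral_slope: "0 \<le> r \<Longrightarrow> ((\<lambda>r. integral {-1..r} (\<lambda>r. h r powr (q - 1))) has_real_derivative h r powr (q - 1)) (at r)"
  using integral_has_real_derivative[OF slope_cont, of r "-1" "r + 1"] at_within_Icc_at[of "-1" r "r + 1"] by simp

lemma potential_pos: "0 < radial_potential h q R x"
  by (simp add: radial_potential_def)

lemma potential_deriv:
  fixes x :: "'a::real_inner"
  shows "(radial_potential h q R has_derivative (\<lambda>v. (- (h (norm x) powr (q - 1) * radial_potential h q R x) *\<^sub>R sgn x) \<bullet> v)) (at x)"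
proof -
  have 1: "((\<lambda>r. exp (integral {-1..R} (\<lambda>r. h r powr (q - 1)) - integral {-1..r} (\<lambda>r. h r powr (q - 1)))) has_real_derivative
      - (h r powr (q - 1) * exp (integral {-1..R} (\<lambda>r. h r powr (q - 1)) - integral {-1..r} (\<lambda>r. h r powr (q - 1))))) (at r)"
    if "0 \<le> r" for r by (auto intro!: derivative_eq_intros integral_slope[OF that])
  show ?thesis unfolding radial_potential_def[abs_def] by (rule radial_has_derivative[OF 1]) (simp_all add: h0)
qed

lemma potential_gradient_cont:
  "continuous_on UNIV (\<lambda>x::'a::real_inner. - (h (norm x) powr (q - 1) * radial_potential h q R x) *\<^sub>R sgn x)"
proof -
  have "continuous_on UNIV (radial_potential h q R :: 'a \<Rightarrow> real)"
    by (rule continuous_on_if_derivative[OF potential_deriv])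
  then have "continuous_on UNIV (\<lambda>x::'a. - (radial_potential h q R x *\<^sub>R (h (norm x) powr (q - 1) *\<^sub>R sgn x)))"
    by (intro continuous_intros continuous_on_radial_field slope_cont) (simp_all add: h0)
  then show ?thesis by (simp add: mult.commute)
qed

text \<open>The logarithm of the profile vanishes at radius \<open>R\<close> and has slope at most
  \<open>M powr (q - 1)\<close>. The profile is therefore close to 1 near the sphere, where it acts
  as a weight in both estimates.\<close>

lemma potential_bound:
  assumes M: "\<And>r. h r \<le> M"
  shows "\<bar>ln (radial_potential h q R x)\<bar> \<le> M powr (q - 1) * \<bar>norm x - R\<bar>"
proof -
  have "norm (integral {-1..norm x} (\<lambda>r. h r powr (q - 1)) - integral {-1..R} (\<lambda>r. h r powr (q - 1)))
      \<le> M powr (q - 1) * norm (norm x - R)"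
  proof (rule field_differentiable_bound[of "{0..}"])
    show "((\<lambda>r. integral {-1..r} (\<lambda>r. h r powr (q - 1))) has_real_derivative h z powr (q - 1)) (at z within {0..})"
      if "z \<in> {0..}" for z using that by (intro has_field_derivative_at_within[OF integral_slope]) simp
    show "norm (h z powr (q - 1)) \<le> M powr (q - 1)" for z using M hn q1 by (auto intro!: powr_mono2)
  qed (use R0 in auto)
  then show ?thesis by (simp add: radial_potential_def abs_minus_commute)
qed

end

lemma profileI:
  fixes D :: "'a::euclidean_space set"
  assumes rg: "radial_graph D \<rho> r0 r1 L m \<kappa>" and p: "1 < p" and R: "0 \<le> R"
    and h: "continuous_on UNIV h" "h 0 = 0" "\<And>r. 0 \<le> h r"
    and hd: "\<And>r. 0 < r \<Longrightarrow> r < r1 \<Longrightarrow>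
      (h has_real_derivative \<mu> - real m * h r / r + (p - 1) * h r powr (p / (p - 1))) (at r)"
  shows "profile D \<rho> r0 r1 L m \<kappa> p (p / (p - 1)) \<mu> h (radial_potential h (p / (p - 1)) R)
    (\<lambda>x. - (h (norm x) powr (p / (p - 1) - 1) * radial_potential h (p / (p - 1)) R x) *\<^sub>R sgn x)"
proof -
  interpret radial_graph D \<rho> r0 r1 L m \<kappa> by (rule rg)
  interpret radial_profile h "p / (p - 1)" R using p R h by unfold_locales (auto simp: field_simps)
  show ?thesis by unfold_locales (use p h hd potential_pos potential_deriv potential_gradient_cont in auto)
qed

context riccati
begin

text \<open>The profiles for all eigenvalues are rescalings of the single function \<open>H\<close>
  by powers of \<mu>, so their dependence on \<mu> is differentiable by the chain rule. The
  constants \<open>hr\<close> and \<open>ml\<close> are the partial derivatives in \<open>r\<close>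
  and \<mu> at the point where the Robin condition holds; they are positive since \<open>H\<close>
  and its slope are.\<close>

lemma family:
  assumes b: "0 < b" and R: "0 < R"
  obtains \<mu>0 hr ml r1 M \<delta>0 and h :: "real \<Rightarrow> real \<Rightarrow> real"
  where "0 < \<mu>0" "0 < hr" "0 < ml" "R < r1" "0 < \<delta>0"
    "\<And>\<mu>. continuous_on UNIV (h \<mu>)" "\<And>\<mu>. h \<mu> 0 = 0" "\<And>\<mu> r. 0 \<le> h \<mu> r"
    "\<And>\<mu> r. \<bar>\<mu> - \<mu>0\<bar> < \<delta>0 \<Longrightarrow> h \<mu> r \<le> M"
    "\<And>\<mu> r. \<bar>\<mu> - \<mu>0\<bar> < \<delta>0 \<Longrightarrow> 0 < r \<Longrightarrow> r < r1 \<Longrightarrow>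
      (h \<mu> has_real_derivative \<mu> - (real n - 1) * h \<mu> r / r + (p - 1) * h \<mu> r powr (p / (p - 1))) (at r)"
    "\<And>e. 0 < e \<Longrightarrow> \<exists>d>0. \<forall>\<mu> r. \<bar>\<mu> - \<mu>0\<bar> < d \<and> \<bar>r - R\<bar> < d \<longrightarrow>
      \<bar>h \<mu> r - b - hr * (r - R) - ml * (\<mu> - \<mu>0)\<bar> \<le> e * (\<bar>\<mu> - \<mu>0\<bar> + \<bar>r - R\<bar>)"
proof -
  define q where "q = p / (p - 1)"
  define e1 where "e1 = (p - 1) / p"
  define e2 where "e2 = 1 / p"
  have e: "0 < e1" "0 < e2" "e1 + e2 = 1" "e1 * q = 1" using p by (auto simp: q_def e1_def e2_def field_simps)
  obtain s0 where s0: "0 < s0" "bdd (s0 * R)" "s0 powr (p - 1) * H (s0 * R) = b" using shooting[OF b R] by blast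
  obtain \<delta> where \<delta>: "0 < \<delta>" "bdd (s0 * R + \<delta>)" using bdd_open[OF s0(2)] by blast
  define rM where "rM = s0 * R + \<delta>"
  have rM: "0 < rM" "bdd rM" "s0 * R < rM" using \<delta> s0 R by (auto simp: rM_def add_pos_pos)
  define \<mu>0 where "\<mu>0 = s0 powr p"
  have \<mu>0: "0 < \<mu>0" "\<mu>0 powr e2 = s0" "\<mu>0 powr e1 = s0 powr (p - 1)"
    using s0 p by (auto simp: \<mu>0_def e1_def e2_def powr_powr)
  \<comment> \<open>Clamping to \<open>{0..rM}\<close> gives a bounded continuous function on the
    whole line that agrees with \<open>H\<close> near \<open>s0 * R\<close>.\<close>
  define c where "c r = max 0 (min r rM)" for r
  define K where "K r = H (c r)" for r
  have c: "0 \<le> c r" "c r \<le> rM" for r using rM by (auto simp: c_def)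
  have Kc: "continuous_on UNIV K"
    unfolding K_def using c by (intro continuous_on_compose2[OF H_cont[OF rM(2)]]) (auto simp: c_def intro!: continuous_intros)
  have K0: "K r = 0" if "r \<le> 0" for r using that rM H_0 by (auto simp: K_def c_def)
  have Kn: "0 \<le> K r" for r unfolding K_def by (rule H_nonneg[OF bdd_mono[OF rM(2) c]])
  have KM: "K r \<le> H rM" for r unfolding K_def by (rule H_mono[OF rM(2) c])
  have Kd: "(K has_real_derivative rhs (K r) - (real n - 1) * K r / r) (at r)" if r: "0 < r" "r < rM" for r
  proof -
    have "K r = H r" using r by (simp add: K_def c_def)
    then have "(H has_real_derivative rhs (K r) - (real n - 1) * K r / r) (at r)" using H_deriv[OF rM(2) r] by simp
    then show ?thesis
      by (rule has_field_derivative_transform_within_open[of _ _ _ "{0<..<rM}"]) (use r in \<open>auto simp: K_def c_def\<close>)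
  qed
  define h where "h \<mu> r = \<mu> powr e1 * K (\<mu> powr e2 * r)" for \<mu> r
  have slope: "\<mu> * (rhs (K (\<mu> powr e2 * r)) - (real n - 1) * K (\<mu> powr e2 * r) / (\<mu> powr e2 * r))
      = \<mu> - (real n - 1) * h \<mu> r / r + (p - 1) * h \<mu> r powr q" if \<mu>: "0 < \<mu>" and r: "0 < r" for \<mu> r
  proof -
    have "h \<mu> r powr q = \<mu> * K (\<mu> powr e2 * r) powr q" using Kn \<mu> e(4) by (simp add: h_def powr_mult powr_powr)
    moreover have "\<mu> * ((real n - 1) * K (\<mu> powr e2 * r) / (\<mu> powr e2 * r)) = (real n - 1) * h \<mu> r / r"
    proof -
      have "\<mu> = \<mu> powr e1 * \<mu> powr e2" using \<mu> e(3) by (simp add: powr_add[symmetric])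
      then have "\<mu> * ((real n - 1) * K (\<mu> powr e2 * r) / (\<mu> powr e2 * r))
          = (\<mu> powr e1 * \<mu> powr e2) * ((real n - 1) * K (\<mu> powr e2 * r) / (\<mu> powr e2 * r))" by simp
      then show ?thesis using \<mu> r by (simp add: h_def)
    qed
    ultimately show ?thesis by (simp add: rhs_def q_def algebra_simps)
  qed
  have hd: "(h \<mu> has_real_derivative \<mu> - (real n - 1) * h \<mu> r / r + (p - 1) * h \<mu> r powr q) (at r)"
    if \<mu>: "0 < \<mu>" and r: "0 < r" "\<mu> powr e2 * r < rM" for \<mu> r
  proof -
    let ?X = "rhs (K (\<mu> powr e2 * r)) - (real n - 1) * K (\<mu> powr e2 * r) / (\<mu> powr e2 * r)"
    have "(K has_real_derivative ?X) (at (\<mu> powr e2 * r))" using \<mu> r by (intro Kd) auto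
    then have "(h \<mu> has_real_derivative \<mu> powr e1 * (?X * \<mu> powr e2)) (at r)"
      unfolding h_def[abs_def] by (auto intro!: derivative_eq_intros DERIV_chain2[of K])
    moreover have "\<mu> powr e1 * (?X * \<mu> powr e2) = \<mu> * ?X" using \<mu> e(3) powr_add[of \<mu> e1 e2] by (simp add: mult_ac)
    ultimately show ?thesis using slope[OF \<mu> r(1)] by simp
  qed
  define hr where "hr = \<mu>0 - (real n - 1) * b / R + (p - 1) * b powr q"
  define X where "X = rhs (K (s0 * R)) - (real n - 1) * K (s0 * R) / (s0 * R)"
  have Kb: "K (s0 * R) = H (s0 * R)" using s0 R rM by (simp add: K_def c_def)
  have hb: "h \<mu>0 R = b" using s0(3) \<mu>0 Kb by (simp add: h_def)
  have hrX: "hr = \<mu>0 * X" using slope[OF \<mu>0(1) R] unfolding hb \<mu>0(2) by (simp add: hr_def X_def)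
  have X: "0 < X" unfolding X_def Kb using s0 R rM by (intro H_deriv_pos[OF rM(2)]) auto
  then have hr: "0 < hr" using \<mu>0 by (simp add: hrX)
  define ml where "ml = e1 * b / \<mu>0 + X * e2 * R"
  have ml: "0 < ml" using e b \<mu>0 X R by (simp add: ml_def add_pos_pos)
  \<comment> \<open>Uses half of the room beyond \<open>s0 * R\<close>; the other half is left for
    the variation of \<mu>.\<close>
  define r1 where "r1 = R + \<delta> / (2 * s0)"
  have r1: "R < r1" "s0 * r1 < rM" using \<delta> s0 by (auto simp: r1_def rM_def field_simps)
  have "((\<lambda>\<mu>. \<mu> powr e2 * r1) \<longlongrightarrow> \<mu>0 powr e2 * r1) (nhds \<mu>0)" using \<mu>0 by (intro tendsto_intros filterlim_ident) auto
  then have "\<forall>\<^sub>F \<mu> in nhds \<mu>0. \<mu> powr e2 * r1 < rM" using r1 \<mu>0 by (intro order_tendstoD(2)) auto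
  then obtain d1 where d1: "0 < d1" "\<And>\<mu>. \<bar>\<mu> - \<mu>0\<bar> < d1 \<Longrightarrow> \<mu> powr e2 * r1 < rM"
    by (auto simp: eventually_nhds_metric dist_real_def)
  \<comment> \<open>Keeps \<mu> positive and below \<open>\<mu>0 + 1\<close>, which gives the bound
    \<open>M\<close>, and keeps the rescaled radii where the equation for \<open>K\<close>
    holds.\<close>
  define \<delta>0 where "\<delta>0 = min d1 (min 1 \<mu>0)"
  have F: "((\<lambda>y. h (fst y) (snd y)) has_derivative (\<lambda>y. ml * fst y + hr * snd y)) (at (\<mu>0, R))"
  proof -
    have 1: "((\<lambda>y::real \<times> real. fst y powr a) has_derivative (\<lambda>y. a * \<mu>0 powr (a - 1) * fst y)) (at (\<mu>0, R))" for a
      using has_derivative_compose[OF has_derivative_fst[OF has_derivative_ident], of "\<lambda>x. x powr a" _ "(\<mu>0, R)"]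
        has_real_derivative_powr[OF \<mu>0(1), of a] by (simp add: has_field_derivative_def)
    have 2: "((\<lambda>y. fst y powr e2 * snd y) has_derivative (\<lambda>y. s0 * snd y + e2 * \<mu>0 powr (e2 - 1) * fst y * R)) (at (\<mu>0, R))"
      using has_derivative_mult[OF 1[of e2] has_derivative_snd[OF has_derivative_ident]] \<mu>0 by simp
    have "(K has_real_derivative X) (at (s0 * R))" unfolding X_def using s0 R rM by (intro Kd) auto
    then have "(K has_derivative (*) X) (at (fst (\<mu>0, R) powr e2 * snd (\<mu>0, R)))"
      using \<mu>0 by (simp add: has_field_derivative_def)
    from has_derivative_mult[OF 1[of e1] has_derivative_compose[OF 2 this]]
    have "((\<lambda>y. h (fst y) (snd y)) has_derivative
        (\<lambda>y. \<mu>0 powr e1 * (X * (s0 * snd y + e2 * \<mu>0 powr (e2 - 1) * fst y * R)) + e1 * \<mu>0 powr (e1 - 1) * fst y * K (s0 * R))) (at (\<mu>0, R))"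
      unfolding h_def using \<mu>0 by simp
    moreover have "\<mu>0 powr e1 * (X * (s0 * c + e2 * \<mu>0 powr (e2 - 1) * a * R)) + e1 * \<mu>0 powr (e1 - 1) * a * K (s0 * R) = ml * a + hr * c" for a c
    proof -
      have E1: "\<mu>0 powr e1 * s0 = \<mu>0" using powr_add[of \<mu>0 e1 e2] e(3) \<mu>0 by simp
      have E2: "\<mu>0 powr e1 * \<mu>0 powr (e2 - 1) = 1" using powr_add[of \<mu>0 e1 "e2 - 1"] e(3) \<mu>0 by (simp add: algebra_simps)
      have E3: "\<mu>0 powr (e1 - 1) * K (s0 * R) = b / \<mu>0"
        unfolding hb[unfolded h_def \<mu>0(2), symmetric] powr_diff using \<mu>0(1) by simp
      have "\<mu>0 powr e1 * (X * (s0 * c + e2 * \<mu>0 powr (e2 - 1) * a * R)) + e1 * \<mu>0 powr (e1 - 1) * a * K (s0 * R)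
          = (\<mu>0 powr e1 * s0) * X * c + (\<mu>0 powr e1 * \<mu>0 powr (e2 - 1)) * X * e2 * R * a + e1 * (\<mu>0 powr (e1 - 1) * K (s0 * R)) * a"
        by (simp add: algebra_simps)
      then show ?thesis unfolding E1 E2 E3 by (simp add: ml_def hrX algebra_simps)
    qed
    ultimately show ?thesis by simp
  qed
  show thesis
  proof (rule that[of \<mu>0 hr ml r1 \<delta>0 h "(\<mu>0 + 1) powr e1 * H rM"])
    show "0 < \<delta>0" using d1 \<mu>0 by (simp add: \<delta>0_def)
    show "continuous_on UNIV (h \<mu>)" for \<mu>
      unfolding h_def by (intro continuous_intros continuous_on_compose2[OF Kc]) auto
    show "h \<mu> 0 = 0" "0 \<le> h \<mu> r" for \<mu> r using K0 Kn by (auto simp: h_def)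
    fix \<mu> assume "\<bar>\<mu> - \<mu>0\<bar> < \<delta>0"
    then have \<mu>: "\<bar>\<mu> - \<mu>0\<bar> < d1" "0 < \<mu>" "\<mu> \<le> \<mu>0 + 1" by (auto simp: \<delta>0_def)
    show "h \<mu> r \<le> (\<mu>0 + 1) powr e1 * H rM" for r unfolding h_def using \<mu> e Kn KM by (intro mult_mono powr_mono2) auto
    fix r assume r: "0 < r" "r < r1"
    have "\<mu> powr e2 * r \<le> \<mu> powr e2 * r1" using r by (intro mult_left_mono) auto
    then show "(h \<mu> has_real_derivative \<mu> - (real n - 1) * h \<mu> r / r + (p - 1) * h \<mu> r powr (p / (p - 1))) (at r)"
      using hd[OF \<mu>(2) r(1)] d1(2)[OF \<mu>(1)] unfolding q_def by simp
  next
    fix e :: real assume "0 < e"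
    then obtain d where d: "0 < d" "\<And>y. norm (y - (\<mu>0, R)) < d \<Longrightarrow>
        norm (h (fst y) (snd y) - h (fst (\<mu>0, R)) (snd (\<mu>0, R)) - (ml * fst (y - (\<mu>0, R)) + hr * snd (y - (\<mu>0, R)))) \<le> e * norm (y - (\<mu>0, R))"
      using F unfolding has_derivative_at_alt by blast
    show "\<exists>d>0. \<forall>\<mu> r. \<bar>\<mu> - \<mu>0\<bar> < d \<and> \<bar>r - R\<bar> < d \<longrightarrow>
      \<bar>h \<mu> r - b - hr * (r - R) - ml * (\<mu> - \<mu>0)\<bar> \<le> e * (\<bar>\<mu> - \<mu>0\<bar> + \<bar>r - R\<bar>)"
    proof (intro exI[of _ "d / 2"] conjI allI impI)
      fix \<mu> r assume a: "\<bar>\<mu> - \<mu>0\<bar> < d / 2 \<and> \<bar>r - R\<bar> < d / 2"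
      have n: "norm ((\<mu>, r) - (\<mu>0, R)) \<le> \<bar>\<mu> - \<mu>0\<bar> + \<bar>r - R\<bar>" using norm_Pair_le[of "\<mu> - \<mu>0" "r - R"] by simp
      then have "norm ((\<mu>, r) - (\<mu>0, R)) < d" using a by linarith
      from d(2)[OF this] have "\<bar>h \<mu> r - b - hr * (r - R) - ml * (\<mu> - \<mu>0)\<bar> \<le> e * norm ((\<mu>, r) - (\<mu>0, R))"
        by (simp add: hb algebra_simps)
      also have "\<dots> \<le> e * (\<bar>\<mu> - \<mu>0\<bar> + \<bar>r - R\<bar>)" using n \<open>0 < e\<close> by (intro mult_left_mono) auto
      finally show "\<bar>h \<mu> r - b - hr * (r - R) - ml * (\<mu> - \<mu>0)\<bar> \<le> e * (\<bar>\<mu> - \<mu>0\<bar> + \<bar>r - R\<bar>)" .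
    qed (use d in simp)
  qed (use \<mu>0 hr ml r1 in auto)
qed

end

section \<open>The derivative of the eigenvalue\<close>

lemma ball_radial_graph:
  assumes "0 < R"
  shows "radial_graph (ball (0::'a::euclidean_space) R) (\<lambda>_. R) R R 0 (DIM('a) - 1) (hausdorff_ratio TYPE('a))"
proof (unfold_locales)
  have "x \<in> (\<lambda>n::'a. R *\<^sub>R n) ` sphere 0 1" if "norm x = R" for x
    using that assms by (intro image_eqI[where x = "x /\<^sub>R R"]) auto
  then show "frontier (ball 0 R) = (\<lambda>n::'a. R *\<^sub>R n) ` sphere 0 1" using assms by auto
qed (use assms in auto)

text \<open>On a ball the Lipschitz constant of the graph is 0, so the lower and the upper bound for
  surface integrals of nonnegative functions coincide. Positive and negative parts are treated
  separately.\<close>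

lemma surface_integral_ball:
  fixes f :: "'a::euclidean_space \<Rightarrow> real"
  assumes R: "0 < R" and f: "continuous_on UNIV f"
  shows "(LINT x|surface_measure (ball 0 R). f x)
    = hausdorff_ratio TYPE('a) * R ^ (DIM('a) - 1) * (LINT n|cone_measure. f (R *\<^sub>R n))"
proof -
  interpret radial_graph "ball (0::'a) R" "\<lambda>_. R" R R 0 "DIM('a) - 1" "hausdorff_ratio TYPE('a)"
    by (rule ball_radial_graph[OF R])
  have gm: "graph_map = (\<lambda>n. R *\<^sub>R n)" by (rule ext) (simp add: graph_map_def)
  have nn: "integrable (surface_measure (ball 0 R)) g \<and> (LINT x|surface_measure (ball 0 R). g x) = \<kappa> * R ^ m * (LINT n|cone_measure. g (R *\<^sub>R n))"
    if "continuous_on UNIV g" "\<And>x. 0 \<le> g x" and \<kappa>m: "\<kappa> = hausdorff_ratio TYPE('a)" "m = DIM('a) - 1" for g :: "'a \<Rightarrow> real" and \<kappa> m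
    using surface_integral_le[OF that(1,2)] surface_integral_ge[OF that(1,2)] R unfolding gm \<kappa>m by (simp add: mult_ac)
  have c: "continuous_on UNIV (\<lambda>x. max (f x) 0)" "continuous_on UNIV (\<lambda>x. max (- f x) 0)"
    using f by (auto intro!: continuous_intros)
  have i: "integrable cone_measure (\<lambda>n. g (R *\<^sub>R n))" if g: "continuous_on UNIV g" for g :: "'a \<Rightarrow> real"
  proof -
    have "integrable cone_measure (\<lambda>n. g (graph_map n) * R ^ (DIM('a) - 1) / R ^ (DIM('a) - 1))"
      using integrable_cone_continuous[OF g] by (rule Bochner_Integration.integrable_divide)
    then show ?thesis using R by (simp add: gm)
  qed
  have e: "f x = max (f x) 0 - max (- f x) 0" for x by simp
  have "(LINT x|surface_measure (ball 0 R). f x) = (LINT x|surface_measure (ball 0 R). max (f x) 0 - max (- f x) 0)"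
    by (rule Bochner_Integration.integral_cong[OF refl e])
  also have "\<dots> = (LINT x|surface_measure (ball 0 R). max (f x) 0) - (LINT x|surface_measure (ball 0 R). max (- f x) 0)"
    using nn[OF c(1) _ refl refl] nn[OF c(2) _ refl refl] by (intro Bochner_Integration.integral_diff) auto
  also have "\<dots> = hausdorff_ratio TYPE('a) * R ^ (DIM('a) - 1) * (LINT n|cone_measure. max (f (R *\<^sub>R n)) 0 - max (- f (R *\<^sub>R n)) 0)"
    using nn[OF c(1) _ refl refl] nn[OF c(2) _ refl refl] i[OF c(1)] i[OF c(2)]
    by (subst Bochner_Integration.integral_diff) (auto simp: algebra_simps)
  also have "(LINT n|cone_measure. max (f (R *\<^sub>R n)) 0 - max (- f (R *\<^sub>R n)) 0) = (LINT n|cone_measure. f (R *\<^sub>R n))"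
    by (rule Bochner_Integration.integral_cong[OF refl e[symmetric]])
  finally show ?thesis .
qed

text \<open>Data of the one-parameter problem: \<open>w\<close> extends the normal velocity from the
  sphere, \<open>h_expand\<close> is the joint linearisation of \<open>h\<close> in eigenvalue and
  radius, and \<open>graph\<close> contains the geometry of the moved domains. The value
  \<open>b\<close> includes \<kappa> because boundary integrals are taken over
  \<open>cone_measure\<close>.\<close>

locale robin_family =
  fixes p \<beta> R b hr ml \<mu>0 M r1 \<delta>0 C A :: real and h :: "real \<Rightarrow> real \<Rightarrow> real" and w :: "'a::euclidean_space \<Rightarrow> real"
    and T :: "real \<Rightarrow> 'a \<Rightarrow> 'a" and m :: nat and \<kappa> q :: real
  assumes p: "1 < p" and \<beta>: "0 < \<beta>" and R: "0 < R" and m_def: "m = DIM('a) - 1" and \<kappa>_def: "\<kappa> = hausdorff_ratio TYPE('a)"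
    and b_def: "b = \<kappa> * \<beta>" and q_def: "q = p / (p - 1)"
    and pos: "0 < \<mu>0" "0 < hr" "0 < ml" "R < r1" "0 < \<delta>0" "0 \<le> C" "0 \<le> A"
    and h_cont: "\<And>\<mu>. continuous_on UNIV (h \<mu>)" and h_0: "\<And>\<mu>. h \<mu> 0 = 0" and h_nonneg: "\<And>\<mu> r. 0 \<le> h \<mu> r"
    and h_le: "\<And>\<mu> r. \<bar>\<mu> - \<mu>0\<bar> < \<delta>0 \<Longrightarrow> h \<mu> r \<le> M"
    and h_deriv: "\<And>\<mu> r. \<bar>\<mu> - \<mu>0\<bar> < \<delta>0 \<Longrightarrow> 0 < r \<Longrightarrow> r < r1 \<Longrightarrow>
      (h \<mu> has_real_derivative \<mu> - real m * h \<mu> r / r + (p - 1) * h \<mu> r powr q) (at r)"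
    and h_expand: "\<And>e. 0 < e \<Longrightarrow> \<exists>d>0. \<forall>\<mu> r. \<bar>\<mu> - \<mu>0\<bar> < d \<and> \<bar>r - R\<bar> < d \<longrightarrow>
      \<bar>h \<mu> r - b - hr * (r - R) - ml * (\<mu> - \<mu>0)\<bar> \<le> e * (\<bar>\<mu> - \<mu>0\<bar> + \<bar>r - R\<bar>)"
    and w: "continuous_on UNIV w" "\<And>n. norm n = 1 \<Longrightarrow> \<bar>w (R *\<^sub>R n)\<bar> \<le> A"
    and graph: "\<And>e. 0 < e \<Longrightarrow> \<forall>\<^sub>F t in nhds 0. \<exists>\<rho>. radial_graph (T t ` ball 0 R) \<rho> (R / 2) r1 (C * \<bar>t\<bar>) m \<kappa>
      \<and> (\<forall>n. norm n = 1 \<longrightarrow> \<bar>\<rho> n - R - t * w (R *\<^sub>R n)\<bar> \<le> e * \<bar>t\<bar>)"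
begin

sublocale ball: radial_graph "ball (0::'a) R" "\<lambda>_. R" R R 0 m \<kappa>
  unfolding m_def \<kappa>_def by (rule ball_radial_graph[OF R])

definition S :: real where "S = measure (cone_measure :: 'a measure) UNIV"

definition slope :: real where "slope = - (hr * (LINT n|cone_measure. w (R *\<^sub>R n)) / (ml * S))"

text \<open>First-order coefficient in t of \<open>h (\<mu> t) (\<rho> n) - b\<close>;
  \<open>slope\<close> is the value for which its mean over the sphere vanishes.\<close>

definition g :: "'a \<Rightarrow> real" where "g n = hr * w (R *\<^sub>R n) + ml * slope"

definition \<mu> :: "real \<Rightarrow> real" where "\<mu> t = \<mu>0 + slope * t"

definition k :: real where "k = M powr (q - 1)"

definition good :: "real \<Rightarrow> real \<Rightarrow> ('a \<Rightarrow> real) \<Rightarrow> bool" where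
  "good e t \<rho> \<longleftrightarrow> radial_graph (T t ` ball 0 R) \<rho> (R / 2) r1 (C * \<bar>t\<bar>) m \<kappa> \<and> \<bar>\<mu> t - \<mu>0\<bar> < \<delta>0 \<and>
    (\<forall>n. norm n = 1 \<longrightarrow> \<bar>\<rho> n - R\<bar> \<le> (A + 1) * \<bar>t\<bar> \<and> \<bar>h (\<mu> t) (\<rho> n) - b - t * g n\<bar> \<le> e * \<bar>t\<bar>)"

lemma q: "1 < q" "(p - 1) * q = p" using p by (auto simp: q_def field_simps)

lemmas \<kappa>_pos = ball.\<kappa>_pos

lemma b_pos: "0 < b" using \<kappa>_pos \<beta> by (simp add: b_def)

lemma S_pos: "0 < S"
proof -
  have "0 < real DIM('a) * unit_ball_vol (real DIM('a))" by (intro mult_pos_pos unit_ball_vol_pos) auto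
  then show ?thesis using emeasure_cone_measure_UNIV[where 'a='a] by (simp add: S_def measure_def)
qed

lemma cone_const: "integrable (cone_measure :: 'a measure) (\<lambda>_. c :: real)" "(LINT n|(cone_measure :: 'a measure). c) = S * c" for c
proof -
  interpret finite_measure "cone_measure :: 'a measure" by (rule finite_measure_cone_measure)
  show "integrable (cone_measure :: 'a measure) (\<lambda>_. c)" "(LINT n|(cone_measure :: 'a measure). c) = S * c"
    by (auto simp: S_def)
qed

lemma w_meas [measurable]: "w \<in> borel_measurable borel" by (rule borel_measurable_continuous_onI[OF w(1)])

lemma g_bound: "norm n = 1 \<Longrightarrow> \<bar>g n\<bar> \<le> hr * A + ml * \<bar>slope\<bar>"
proof -
  assume n: "norm n = 1"
  have "\<bar>g n\<bar> \<le> hr * \<bar>w (R *\<^sub>R n)\<bar> + ml * \<bar>slope\<bar>"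
    unfolding g_def using abs_triangle_ineq[of "hr * w (R *\<^sub>R n)" "ml * slope"] pos by (simp add: abs_mult)
  moreover have "hr * \<bar>w (R *\<^sub>R n)\<bar> \<le> hr * A" using w(2)[OF n] pos by (intro mult_left_mono) auto
  ultimately show ?thesis by linarith
qed

lemma g_integral: "integrable cone_measure g" "(LINT n|cone_measure. g n) = 0"
proof -
  have i: "integrable cone_measure (\<lambda>n. w (R *\<^sub>R n))" using w(2) by (intro ball.integrable_cone_bounded) measurable
  show "integrable cone_measure g" "(LINT n|cone_measure. g n) = 0"
    unfolding g_def[abs_def] using i cone_const S_pos pos by (auto simp: slope_def S_def[symmetric])
qed

lemma small_linear: "0 < c \<Longrightarrow> \<forall>\<^sub>F t in nhds 0. a * \<bar>t :: real\<bar> < c"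
proof -
  have "((\<lambda>t::real. a * \<bar>t\<bar>) \<longlongrightarrow> a * \<bar>0\<bar>) (nhds 0)" by (intro tendsto_intros filterlim_ident)
  then show "0 < c \<Longrightarrow> ?thesis" by (intro order_tendstoD(2)) auto
qed

lemma eventually_good:
  assumes e: "0 < e"
  shows "\<forall>\<^sub>F t in nhds 0. \<exists>\<rho>. good e t \<rho>"
proof -
  \<comment> \<open>\<open>e1\<close> limits the error of the radius and \<open>e2\<close> that of
    the linearisation, each contributing \<open>e / 2\<close>. The bound 1 in \<open>e1\<close> is
    where the constant \<open>A + 1\<close> comes from.\<close>
  define e1 where "e1 = min 1 (e / (2 * hr))"
  define e2 where "e2 = e / (2 * (\<bar>slope\<bar> + (A + 1)))"
  have e1: "0 < e1" "e1 \<le> 1" "hr * e1 \<le> e / 2" using e pos by (auto simp: e1_def min_def field_simps)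
  have s1: "0 < \<bar>slope\<bar> + (A + 1)" using pos by simp
  have e2: "0 < e2" "e2 * (\<bar>slope\<bar> + (A + 1)) = e / 2"
  proof -
    have "e / (2 * X) * X = e / 2" if "0 < X" for X using that by simp
    then show "0 < e2" "e2 * (\<bar>slope\<bar> + (A + 1)) = e / 2" using s1 e unfolding e2_def by (blast intro: divide_pos_pos mult_pos_pos zero_less_numeral)+
  qed
  obtain d where d: "0 < d" "\<And>\<mu> r. \<bar>\<mu> - \<mu>0\<bar> < d \<Longrightarrow> \<bar>r - R\<bar> < d \<Longrightarrow>
      \<bar>h \<mu> r - b - hr * (r - R) - ml * (\<mu> - \<mu>0)\<bar> \<le> e2 * (\<bar>\<mu> - \<mu>0\<bar> + \<bar>r - R\<bar>)"
    using h_expand[OF e2(1)] by metis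
  show ?thesis using graph[OF e1(1)] small_linear[OF d(1), of "\<bar>slope\<bar>"] small_linear[OF d(1), of "A + 1"]
      small_linear[OF pos(5), of "\<bar>slope\<bar>"]
  proof eventually_elim
    case (elim t)
    obtain \<rho> where \<rho>: "radial_graph (T t ` ball 0 R) \<rho> (R / 2) r1 (C * \<bar>t\<bar>) m \<kappa>"
      "\<And>n. norm n = 1 \<Longrightarrow> \<bar>\<rho> n - R - t * w (R *\<^sub>R n)\<bar> \<le> e1 * \<bar>t\<bar>" using elim(1) by blast
    have \<mu>d: "\<bar>\<mu> t - \<mu>0\<bar> = \<bar>slope\<bar> * \<bar>t\<bar>" "\<mu> t - \<mu>0 = slope * t" by (auto simp: \<mu>_def abs_mult)
    have "\<bar>\<rho> n - R\<bar> \<le> (A + 1) * \<bar>t\<bar> \<and> \<bar>h (\<mu> t) (\<rho> n) - b - t * g n\<bar> \<le> e * \<bar>t\<bar>" if n: "norm n = 1" for n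
    proof
      have "\<bar>t * w (R *\<^sub>R n)\<bar> \<le> \<bar>t\<bar> * A" using w(2)[OF n] by (simp add: abs_mult mult_left_mono)
      moreover have "e1 * \<bar>t\<bar> \<le> 1 * \<bar>t\<bar>" using e1 by (intro mult_right_mono) auto
      ultimately show 1: "\<bar>\<rho> n - R\<bar> \<le> (A + 1) * \<bar>t\<bar>" using \<rho>(2)[OF n] by (simp add: algebra_simps)
      have "\<bar>h (\<mu> t) (\<rho> n) - b - hr * (\<rho> n - R) - ml * (slope * t)\<bar> \<le> e2 * (\<bar>\<mu> t - \<mu>0\<bar> + \<bar>\<rho> n - R\<bar>)"
        using d(2)[of "\<mu> t" "\<rho> n"] elim(2,3) 1 \<mu>d by simp
      also have "\<dots> \<le> e2 * (\<bar>slope\<bar> * \<bar>t\<bar> + (A + 1) * \<bar>t\<bar>)" using 1 e2 \<mu>d by (intro mult_left_mono) auto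
      also have "\<dots> = e2 * (\<bar>slope\<bar> + (A + 1)) * \<bar>t\<bar>" by (simp add: algebra_simps)
      finally have 2: "\<bar>h (\<mu> t) (\<rho> n) - b - hr * (\<rho> n - R) - ml * (slope * t)\<bar> \<le> e / 2 * \<bar>t\<bar>" unfolding e2(2) .
      have "\<bar>hr * (\<rho> n - R - t * w (R *\<^sub>R n))\<bar> \<le> hr * (e1 * \<bar>t\<bar>)" using \<rho>(2)[OF n] pos by (simp add: abs_mult)
      moreover have "hr * (e1 * \<bar>t\<bar>) \<le> e / 2 * \<bar>t\<bar>"
        using mult_right_mono[OF e1(3), of "\<bar>t\<bar>"] by (simp only: mult.assoc abs_ge_zero)
      moreover have "h (\<mu> t) (\<rho> n) - b - t * g n
          = (h (\<mu> t) (\<rho> n) - b - hr * (\<rho> n - R) - ml * (slope * t)) + hr * (\<rho> n - R - t * w (R *\<^sub>R n))"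
        by (simp add: g_def algebra_simps)
      ultimately show "\<bar>h (\<mu> t) (\<rho> n) - b - t * g n\<bar> \<le> e * \<bar>t\<bar>" using 2 by linarith
    qed
    then show ?case using \<rho>(1) elim(4) \<mu>d by (auto simp: good_def)
  qed
qed

lemma good_profile:
  assumes "good e t \<rho>"
  shows "profile (T t ` ball 0 R) \<rho> (R / 2) r1 (C * \<bar>t\<bar>) m \<kappa> p q (\<mu> t) (h (\<mu> t)) (radial_potential (h (\<mu> t)) q R)
    (\<lambda>x. - (h (\<mu> t) (norm x) powr (q - 1) * radial_potential (h (\<mu> t)) q R x) *\<^sub>R sgn x)"
  unfolding q_def using assms p R h_cont h_0 h_nonneg h_deriv[unfolded q_def] unfolding good_def
  by (intro profileI) auto

lemma potential_powr:
  assumes "good e t \<rho>" "\<bar>norm x - R\<bar> \<le> d"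
  shows "radial_potential (h (\<mu> t)) q R x powr s \<in> {exp (- (\<bar>s\<bar> * k * d))..exp (\<bar>s\<bar> * k * d)}"
proof -
  interpret rp: radial_profile "h (\<mu> t)" q R using q R h_cont h_0 h_nonneg by unfold_locales auto
  let ?u = "radial_potential (h (\<mu> t)) q R x"
  have "\<bar>ln ?u\<bar> \<le> k * \<bar>norm x - R\<bar>"
    unfolding k_def by (rule rp.potential_bound[OF h_le]) (use assms in \<open>simp add: good_def\<close>)
  also have "\<dots> \<le> k * d" using assms(2) by (intro mult_left_mono) (auto simp: k_def)
  finally have "\<bar>s * ln ?u\<bar> \<le> \<bar>s\<bar> * (k * d)" unfolding abs_mult by (rule mult_left_mono) simp
  moreover have "?u powr s = exp (s * ln ?u)" using rp.potential_pos[of x] by (simp add: powr_def)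
  ultimately show ?thesis by (auto simp: abs_le_iff mult_ac)
qed

lemma upper_estimate:
  assumes e: "0 < e"
  shows "\<forall>\<^sub>F t in nhds 0. robin_lambda1 p \<beta> (T t ` ball 0 R) \<le> \<mu> t + e * \<bar>t\<bar>"
proof -
  let ?k = "\<lambda>t. p * k * ((A + 1) * \<bar>t\<bar>)"
  define G where "G = hr * A + ml * \<bar>slope\<bar>"
  have G: "0 \<le> G" "\<And>n. norm n = 1 \<Longrightarrow> \<bar>g n\<bar> \<le> G" using g_bound pos by (auto simp: G_def)
  \<comment> \<open>A lower bound for the norm of the profile that is uniform in t, since every
    moved domain contains the ball of half the radius.\<close>
  define N0 where "N0 = exp (- (p * k * R)) * measure lborel (ball (0::'a) (R / 2))"
  have N0: "0 < N0" unfolding N0_def using R by (intro mult_pos_pos content_ball_pos) auto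
  define Q where "Q = 2 * (R ^ m + 1) + G"
  have Q: "0 < Q" using R G by (simp add: Q_def add_pos_nonneg)
  define e' where "e' = min 1 (e * N0 / (S * Q))"
  have e': "0 < e'" "e' \<le> 1" "S * (e' * Q) \<le> e * N0" using e N0 S_pos Q by (auto simp: e'_def min_def field_simps)
  \<comment> \<open>The factor by which the upper surface density exceeds the lower one has
    derivative 0 at \<open>t = 0\<close>, because the Lipschitz constant enters squared.\<close>
  have z: "((\<lambda>t. b * (1 + (2 * C * t / R)\<^sup>2) ^ m) has_real_derivative 0) (at 0)"
    using R by (auto intro!: derivative_eq_intros)
  have "\<forall>\<^sub>F t in nhds 0. \<bar>b * (1 + (2 * C * t / R)\<^sup>2) ^ m - b\<bar> \<le> e' * \<bar>t\<bar>"
    using z e'(1) unfolding has_field_derivative_def has_derivative_at_alt eventually_nhds_metric dist_real_def by fastforce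
  moreover have "((\<lambda>t. exp (?k t) * (R + (A + 1) * \<bar>t\<bar>) ^ m) \<longlongrightarrow> exp (p * k * ((A + 1) * \<bar>0\<bar>)) * (R + (A + 1) * \<bar>0\<bar>) ^ m) (nhds 0)"
    by (intro tendsto_intros filterlim_ident)
  then have "\<forall>\<^sub>F t in nhds 0. exp (?k t) * (R + (A + 1) * \<bar>t\<bar>) ^ m < R ^ m + e'"
    by (rule order_tendstoD(2)) (use e' in simp)
  moreover have "((\<lambda>t. exp (- (?k t)) * (R - (A + 1) * \<bar>t\<bar>) ^ m) \<longlongrightarrow> exp (- (p * k * ((A + 1) * \<bar>0\<bar>))) * (R - (A + 1) * \<bar>0\<bar>) ^ m) (nhds 0)"
    by (intro tendsto_intros filterlim_ident)
  then have "\<forall>\<^sub>F t in nhds 0. R ^ m - e' < exp (- (?k t)) * (R - (A + 1) * \<bar>t\<bar>) ^ m"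
    by (rule order_tendstoD(1)) (use e' in simp)
  ultimately show ?thesis
    using eventually_good[OF e'(1)] small_linear[OF R, of "A + 1"]
  proof eventually_elim
    case (elim t)
    obtain \<rho> where \<rho>: "good e' t \<rho>" using elim(4) by blast
    interpret profile "T t ` ball 0 R" \<rho> "R / 2" r1 "C * \<bar>t\<bar>" m \<kappa> p q "\<mu> t" "h (\<mu> t)" "radial_potential (h (\<mu> t)) q R"
      "\<lambda>x. - (h (\<mu> t) (norm x) powr (q - 1) * radial_potential (h (\<mu> t)) q R x) *\<^sub>R sgn x"
      by (rule good_profile[OF \<rho>])
    let ?u = "radial_potential (h (\<mu> t)) q R :: 'a \<Rightarrow> real"
    let ?D = "T t ` ball 0 R"
    \<comment> \<open>The boundary weight \<open>\<rho> n ^ m * ?u (graph_map n) powr p\<close> is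
      replaced by its limit \<open>R ^ m\<close>, so that the term with \<open>g\<close> integrates
      to 0. The remaining terms are of size \<open>e' * \<bar>t\<bar>\<close>.\<close>
    define F where "F n = 2 * e' * \<bar>t\<bar> * (R ^ m + 1) + \<bar>t\<bar> * G * e' - t * R ^ m * g n" for n
    have F: "(\<kappa> * \<beta> * sqrt ((\<rho> n)\<^sup>2 + (C * \<bar>t\<bar>)\<^sup>2) ^ m - h (\<mu> t) (\<rho> n) * \<rho> n ^ m) * ?u (graph_map n) powr p \<le> F n"
      if n: "norm n = 1" for n
    proof -
      have g1: "\<bar>\<rho> n - R\<bar> \<le> (A + 1) * \<bar>t\<bar>" "\<bar>h (\<mu> t) (\<rho> n) - b - t * g n\<bar> \<le> e' * \<bar>t\<bar>"
        using \<rho> n unfolding good_def by auto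
      have r0: "R / 2 \<le> \<rho> n" by (rule \<rho>_bounds)
      define P where "P = \<rho> n ^ m * ?u (graph_map n) powr p"
      have up: "?u (graph_map n) powr p \<in> {exp (- (?k t))..exp (?k t)}"
        using potential_powr[OF \<rho>, of "graph_map n" "(A + 1) * \<bar>t\<bar>" p] g1(1) p by (simp add: norm_graph_map[OF n])
      have P: "\<bar>P - R ^ m\<bar> \<le> e'"
      proof -
        have "P \<le> (R + (A + 1) * \<bar>t\<bar>) ^ m * exp (?k t)"
          unfolding P_def using up g1(1) r0 R by (intro mult_mono power_mono) auto
        moreover have "(R - (A + 1) * \<bar>t\<bar>) ^ m * exp (- (?k t)) \<le> P"
          unfolding P_def using up g1(1) r0 R elim(5) by (intro mult_mono power_mono) auto
        ultimately show ?thesis using elim(2,3) by (simp add: abs_le_iff mult.commute)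
      qed
      have P0: "0 \<le> P" "P \<le> R ^ m + 1" using P e' r0 R by (auto simp: P_def abs_le_iff)
      have sq: "sqrt ((\<rho> n)\<^sup>2 + (C * \<bar>t\<bar>)\<^sup>2) ^ m \<le> (1 + (2 * C * t / R)\<^sup>2) ^ m * \<rho> n ^ m"
      proof -
        have "C\<^sup>2 * t\<^sup>2 * R\<^sup>2 \<le> C\<^sup>2 * t\<^sup>2 * (2 * \<rho> n)\<^sup>2" using r0 R by (intro mult_left_mono power_mono) auto
        then have "(\<rho> n)\<^sup>2 + (C * \<bar>t\<bar>)\<^sup>2 \<le> (1 + (2 * C * t / R)\<^sup>2) * (\<rho> n)\<^sup>2"
          using R by (simp add: power_mult_distrib power_divide field_simps)
        also have "\<dots> \<le> (1 + (2 * C * t / R)\<^sup>2)\<^sup>2 * (\<rho> n)\<^sup>2"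
          by (intro mult_right_mono) (auto simp: self_le_power)
        finally have "sqrt ((\<rho> n)\<^sup>2 + (C * \<bar>t\<bar>)\<^sup>2) \<le> (1 + (2 * C * t / R)\<^sup>2) * \<rho> n"
          using r0 R by (intro real_le_lsqrt) (auto simp: power_mult_distrib)
        from power_mono[OF this, of m] show ?thesis by (simp add: power_mult_distrib)
      qed
      have "(\<kappa> * \<beta> * sqrt ((\<rho> n)\<^sup>2 + (C * \<bar>t\<bar>)\<^sup>2) ^ m - h (\<mu> t) (\<rho> n) * \<rho> n ^ m) * ?u (graph_map n) powr p
          \<le> (\<kappa> * \<beta> * ((1 + (2 * C * t / R)\<^sup>2) ^ m * \<rho> n ^ m) - h (\<mu> t) (\<rho> n) * \<rho> n ^ m) * ?u (graph_map n) powr p"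
        using sq b_pos unfolding b_def[symmetric] by (intro mult_right_mono diff_right_mono mult_left_mono) auto
      also have "\<dots> = (b * (1 + (2 * C * t / R)\<^sup>2) ^ m - h (\<mu> t) (\<rho> n)) * P" by (simp add: P_def b_def algebra_simps)
      also have "\<dots> \<le> (2 * e' * \<bar>t\<bar> - t * g n) * P"
        using elim(1) g1(2) P0(1) by (intro mult_right_mono) auto
      also have "\<dots> = 2 * e' * \<bar>t\<bar> * P + (- (t * g n)) * (P - R ^ m) - t * R ^ m * g n" by (simp add: algebra_simps)
      also have "\<dots> \<le> 2 * e' * \<bar>t\<bar> * (R ^ m + 1) + \<bar>t\<bar> * G * e' - t * R ^ m * g n"
      proof -
        have "(- (t * g n)) * (P - R ^ m) \<le> \<bar>t\<bar> * \<bar>g n\<bar> * \<bar>P - R ^ m\<bar>"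
          using abs_ge_self[of "(- (t * g n)) * (P - R ^ m)"] by (simp add: abs_mult)
        also have "\<dots> \<le> \<bar>t\<bar> * G * e'" using G(2)[OF n] P G(1) by (intro mult_mono) auto
        finally show ?thesis using P0 e' by (intro diff_right_mono add_mono mult_left_mono) auto
      qed
      finally show ?thesis by (simp add: F_def)
    qed
    have Fi: "integrable cone_measure F" "(LINT n|cone_measure. F n) = S * (\<bar>t\<bar> * e' * Q)"
      unfolding F_def[abs_def] using g_integral cone_const by (auto simp: Q_def S_def[symmetric] algebra_simps)
    have N: "N0 \<le> (LINT x:?D|lborel. ?u x powr p)"
    proof -
      have sub: "ball 0 (R / 2) \<subseteq> ?D"
      proof
        fix x :: 'a assume "x \<in> ball 0 (R / 2)"
        then show "x \<in> ?D" using \<rho>_bounds(1)[of "sgn x"] unfolding D_eq by simp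
      qed
      have "N0 = (LINT x:ball (0::'a) (R / 2)|lborel. exp (- (p * k * R)))"
        by (simp add: N0_def set_lebesgue_integral_def mult.commute)
      also have "\<dots> \<le> (LINT x:ball (0::'a) (R / 2)|lborel. ?u x powr p)"
      proof (rule set_integral_mono)
        show "set_integrable lborel (ball (0::'a) (R / 2)) (\<lambda>x. exp (- (p * k * R)))" unfolding set_integrable_def
          by (intro integrable_scaleR_left integrable_real_indicator) (use emeasure_lborel_ball_finite in auto)
        show "set_integrable lborel (ball (0::'a) (R / 2)) (\<lambda>x. ?u x powr p)"
          by (rule set_integrable_subset[OF set_integrable_continuous[OF u_powr_cont] _ sub]) simp
        fix x :: 'a assume "x \<in> ball 0 (R / 2)"
        then show "exp (- (p * k * R)) \<le> ?u x powr p" using potential_powr[OF \<rho>, of x R p] p R by simp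
      qed
      also have "\<dots> \<le> (LINT x:?D|lborel. ?u x powr p)"
        unfolding set_lebesgue_integral_def
      proof (rule integral_mono)
        show "integrable lborel (\<lambda>x. indicator (ball (0::'a) (R / 2)) x *\<^sub>R ?u x powr p)"
          using set_integrable_subset[OF set_integrable_continuous[OF u_powr_cont] _ sub] by (simp add: set_integrable_def)
        show "integrable lborel (\<lambda>x. indicator ?D x *\<^sub>R ?u x powr p)"
          using set_integrable_continuous[OF u_powr_cont] by (simp add: set_integrable_def)
      qed (use sub in \<open>auto split: split_indicator\<close>)
      finally show ?thesis .
    qed
    have "robin_lambda1 p \<beta> ?D \<le> \<mu> t + (LINT n|cone_measure. F n) / (LINT x:?D|lborel. ?u x powr p)"
      by (rule robin_upper[OF \<beta> Fi(1) F])
    also have "(LINT n|cone_measure. F n) / (LINT x:?D|lborel. ?u x powr p) \<le> S * (\<bar>t\<bar> * e' * Q) / N0"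
      unfolding Fi(2) using N N0 S_pos e' Q by (intro divide_left_mono mult_pos_pos mult_nonneg_nonneg) auto
    also have "\<dots> \<le> e * \<bar>t\<bar>"
      using mult_right_mono[OF e'(3), of "\<bar>t\<bar>"] N0 by (simp add: field_simps)
    finally show ?case by simp
  qed
qed

text \<open>The tangential estimate on the ball itself, with \<open>v\<close> constantly 1 and
  Lipschitz constant 0, hence without error.\<close>

lemma flux_zero:
  fixes W :: "'a \<Rightarrow> 'a"
  assumes W: "has_divergence W (\<lambda>x. 0)"
  shows "integrable cone_measure (\<lambda>n. W (R *\<^sub>R n) \<bullet> n)" "(LINT n|cone_measure. W (R *\<^sub>R n) \<bullet> n) = 0"
proof -
  have gm: "ball.graph_map = (\<lambda>n. R *\<^sub>R n)" by (rule ext) (simp add: ball.graph_map_def)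
  obtain W' where "\<And>x. (W has_derivative W' x) (at x)" using W unfolding has_divergence_def C1_field_def by metis
  then have "continuous_on UNIV W" by (rule continuous_on_if_derivative)
  from ball.integrable_cone_flux[OF this] show "integrable cone_measure (\<lambda>n. W (R *\<^sub>R n) \<bullet> n)" using R by (simp add: gm)
  have "\<bar>(LINT x:ball 0 R|lborel. 0 \<bullet> W x + 1 * 0) - (LINT n|cone_measure. 1 * (W (ball.graph_map n) \<bullet> n) * R ^ m)\<bar>
      \<le> 8 * 0 / R * (LINT n|cone_measure. \<bar>1\<bar> * (\<Sum>b\<in>Basis. \<bar>W (ball.graph_map n) \<bullet> b\<bar>) * R ^ m)"
    by (rule ball.tangential_divergence) (use W in auto)
  then show "(LINT n|cone_measure. W (R *\<^sub>R n) \<bullet> n) = 0" using R by (simp add: gm set_lebesgue_integral_def)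
qed

text \<open>The flux of \<open>W\<close> and the mean of \<open>g\<close> both vanish, so the
  additive constant left open by \<open>flux_density\<close> is itself bounded by the approximation
  error.\<close>

lemma approximating_field:
  assumes e: "0 < e"
  shows "\<exists>W. has_divergence W (\<lambda>x. 0) \<and> (\<forall>n. norm n = 1 \<longrightarrow> \<bar>W (R *\<^sub>R n) \<bullet> n - g n\<bar> \<le> e)"
proof -
  have "continuous_on (sphere 0 R) (\<lambda>x. R * (hr * w x + ml * slope))"
    by (intro continuous_intros continuous_on_subset[OF w(1)]) auto
  then have "flux_density R (\<lambda>x. R * (hr * w x + ml * slope))" by (rule flux_density_continuous[OF R])
  moreover have "0 < e * R / 2" using e R by simp
  ultimately obtain W c where W: "has_divergence W (\<lambda>x. 0)"
    and a: "\<forall>x\<in>sphere 0 R. \<bar>W x \<bullet> x - R * (hr * w x + ml * slope) - c\<bar> \<le> e * R / 2"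
    unfolding flux_density_def by blast
  have b: "\<bar>R * (W (R *\<^sub>R n) \<bullet> n) - R * g n - c\<bar> \<le> e * R / 2" if "norm n = 1" for n
    using a[rule_format, of "R *\<^sub>R n"] that R by (simp add: g_def)
  define f where "f n = R * (W (R *\<^sub>R n) \<bullet> n) - R * g n - c" for n
  have f: "integrable cone_measure f" "(LINT n|cone_measure. f n) = - (S * c)"
    unfolding f_def[abs_def] using flux_zero[OF W] g_integral cone_const by (auto simp: S_def[symmetric])
  have fb: "f n \<le> e * R / 2 \<and> - (e * R / 2) \<le> f n" if "norm n = 1" for n using b[OF that] unfolding f_def by linarith
  have "- (S * c) \<le> (LINT n|(cone_measure :: 'a measure). e * R / 2)"
    unfolding f(2)[symmetric] using fb by (intro ball.integral_cone_mono f cone_const) auto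
  moreover have "(LINT n|(cone_measure :: 'a measure). - (e * R / 2)) \<le> - (S * c)"
    unfolding f(2)[symmetric] using fb by (intro ball.integral_cone_mono f cone_const) auto
  ultimately have "S * \<bar>c\<bar> \<le> S * (e * R / 2)" unfolding cone_const(2) by (auto simp: abs_if)
  then have c: "\<bar>c\<bar> \<le> e * R / 2" using S_pos by simp
  have "\<bar>W (R *\<^sub>R n) \<bullet> n - g n\<bar> \<le> e" if "norm n = 1" for n
  proof -
    have "\<bar>R * (W (R *\<^sub>R n) \<bullet> n - g n)\<bar> \<le> e * R" using b[OF that] c unfolding right_diff_distrib by linarith
    then show ?thesis using R by (simp add: abs_mult mult.commute)
  qed
  with W show ?thesis by blast
qed

lemma lower_estimate:
  assumes e: "0 < e"
  shows "\<forall>\<^sub>F t in nhds 0. \<mu> t - e * \<bar>t\<bar> \<le> robin_lambda1 p \<beta> (T t ` ball 0 R)"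
proof -
  let ?k = "\<lambda>t. p * k * ((A + 1) * \<bar>t\<bar>)"
  \<comment> \<open>Total loss per unit of \<open>e' * \<bar>t\<bar>\<close>: 1 from the interior,
    and at most \<open>5 * (\<mu>0 + \<delta>0) / b\<close> from the enlarged Robin
    parameter.\<close>
  define Y where "Y = 1 + 5 * (\<mu>0 + \<delta>0) / b"
  have Y: "1 \<le> Y" using pos b_pos by (simp add: Y_def)
  define e' where "e' = min 1 (e / Y)"
  have e': "0 < e'" "e' \<le> 1" "e' * Y \<le> e" using e Y by (auto simp: e'_def min_def field_simps)
  obtain W where W: "has_divergence W (\<lambda>x. 0)" and Wg: "\<And>n. norm n = 1 \<Longrightarrow> \<bar>W (R *\<^sub>R n) \<bullet> n - g n\<bar> \<le> e'"
    using approximating_field[OF e'(1)] by blast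
  obtain W' where "\<And>x. (W has_derivative W' x) (at x)" using W unfolding has_divergence_def C1_field_def by metis
  then have Wc: "continuous_on X W" for X by (rule continuous_on_if_derivative)
  have "continuous_on (cball 0 r1) (\<lambda>x. \<Sum>b\<in>Basis. \<bar>W x \<bullet> b\<bar>)" by (intro continuous_intros Wc)
  from compact_abs_bounded[OF compact_cball this]
  obtain K where "\<forall>x\<in>cball 0 r1. \<bar>\<Sum>b\<in>Basis. \<bar>W x \<bullet> b\<bar>\<bar> \<le> K" by blast
  then have K: "(\<Sum>b\<in>Basis. \<bar>W x \<bullet> b\<bar>) \<le> K" if "x \<in> cball 0 r1" for x using that abs_le_D1 by blast
  have KW: "norm (W x) \<le> K" if "x \<in> cball 0 r1" for x using norm_le_l1[of "W x"] K[OF that] by linarith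
  have K0: "0 \<le> K" using KW[of 0] pos R by (auto intro: order_trans[OF norm_ge_zero])
  have "uniformly_continuous_on (cball 0 r1) W" by (intro compact_uniformly_continuous Wc) auto
  then obtain \<delta>W where \<delta>W: "0 < \<delta>W" "\<And>x y. x \<in> cball 0 r1 \<Longrightarrow> y \<in> cball 0 r1 \<Longrightarrow> dist y x < \<delta>W \<Longrightarrow> dist (W y) (W x) < e'"
    unfolding uniformly_continuous_on_def using e'(1) by metis
  \<comment> \<open>Bounds the norm of the weighted field on the moved domains, uniformly in
    t.\<close>
  define K3 where "K3 = exp (p * k * r1) * K"
  have K3: "0 \<le> K3" using K0 by (simp add: K3_def)
  define e2 where "e2 = e' / ((p - 1) * (K3 + 1))"
  have e2: "0 < e2" "(p - 1) * e2 * K3 \<le> e'"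
  proof -
    show "0 < e2" using e' p K3 by (simp add: e2_def)
    then have "(p - 1) * e2 * K3 \<le> (p - 1) * e2 * (K3 + 1)" using p by (intro mult_left_mono) auto
    also have "\<dots> = ((p - 1) * (K3 + 1)) * e2" by simp
    also have "\<dots> = e'"
    proof -
      have "X * (e' / X) = e'" if "X \<noteq> 0" for X using that by simp
      then show ?thesis unfolding e2_def using p K3 by (metis add_nonneg_pos diff_gt_0_iff_gt less_irrefl mult_pos_pos zero_less_one)
    qed
    finally show "(p - 1) * e2 * K3 \<le> e'" .
  qed
  obtain \<delta>E where \<delta>E: "0 < \<delta>E" "\<And>a w :: 'a. norm a \<le> M \<Longrightarrow> norm w \<le> \<delta>E \<Longrightarrow>
      norm (a + w) powr q \<le> norm a powr q + q * ((norm a powr (q - 1) *\<^sub>R sgn a) \<bullet> w) + e2 * norm w"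
    using norm_powr_expansion[OF q(1) e2(1)] by blast
  have "((\<lambda>t. exp (?k t)) \<longlongrightarrow> exp (p * k * ((A + 1) * \<bar>0\<bar>))) (nhds 0)" by (intro tendsto_intros filterlim_ident)
  moreover have "0 < e' / (K + 1)" using e' K0 by simp
  ultimately have ev1: "\<forall>\<^sub>F t in nhds 0. exp (?k t) < 1 + e' / (K + 1)" by (intro order_tendstoD(2)) auto
  have "((\<lambda>t. exp (- (?k t))) \<longlongrightarrow> exp (- (p * k * ((A + 1) * \<bar>0\<bar>)))) (nhds 0)" by (intro tendsto_intros filterlim_ident)
  then have ev2: "\<forall>\<^sub>F t in nhds 0. 1 - e' / (K + 1) < exp (- (?k t))"
    using \<open>0 < e' / (K + 1)\<close> by (intro order_tendstoD(1)) auto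
  have ev3: "\<forall>\<^sub>F t in nhds 0. (\<bar>slope\<bar> + 1) * \<bar>t\<bar> < \<mu>0" by (rule small_linear[OF pos(1)])
  show ?thesis
    using eventually_good[OF e'(1)] ev1 ev2 ev3 small_linear[OF \<delta>W(1), of "A + 1"] small_linear[OF \<delta>E(1), of K3]
      small_linear[OF e'(1), of "16 * C / R * 2 * K"]
  proof eventually_elim
    case (elim t)
    obtain \<rho> where \<rho>: "good e' t \<rho>" using elim(1) by blast
    interpret profile "T t ` ball 0 R" \<rho> "R / 2" r1 "C * \<bar>t\<bar>" m \<kappa> p q "\<mu> t" "h (\<mu> t)" "radial_potential (h (\<mu> t)) q R"
      "\<lambda>x. - (h (\<mu> t) (norm x) powr (q - 1) * radial_potential (h (\<mu> t)) q R x) *\<^sub>R sgn x"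
      by (rule good_profile[OF \<rho>])
    let ?u = "radial_potential (h (\<mu> t)) q R :: 'a \<Rightarrow> real"
    let ?D = "T t ` ball 0 R"
    have \<mu>t: "\<bar>\<mu> t - \<mu>0\<bar> < \<delta>0" using \<rho> by (simp add: good_def)
    define \<eta> where "\<eta> = e' * \<bar>t\<bar>"
    \<comment> \<open>The five units are spent on the boundary: one for the expansion of
      \<open>h\<close>, three for replacing the weighted flux at \<open>graph_map n\<close> by
      \<open>g n\<close>, and one for the error of the approximate divergence theorem.\<close>
    define b' where "b' = \<beta> + 5 * e' * \<bar>t\<bar> / \<kappa>"
    have b': "\<kappa> * b' = b + 5 * e' * \<bar>t\<bar>" "\<beta> \<le> b'" using \<kappa>_pos e' by (auto simp: b'_def b_def field_simps)
    have "calibration (\<lambda>x. ?u x powr - p *\<^sub>R W x) (\<lambda>x. - p * ?u x powr (- p - 1) * ((- (h (\<mu> t) (norm x) powr (q - 1) * ?u x) *\<^sub>R sgn x) \<bullet> W x)) t \<eta> (\<kappa> * b')"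
      unfolding calibration_def
    proof (intro conjI ballI allI impI)
      show "has_divergence (\<lambda>x. ?u x powr - p *\<^sub>R W x) (\<lambda>x. - p * ?u x powr (- p - 1) * ((- (h (\<mu> t) (norm x) powr (q - 1) * ?u x) *\<^sub>R sgn x) \<bullet> W x))"
        by (rule has_divergence_weighted[OF W])
      show "0 \<le> \<kappa> * b'" unfolding b'(1) using b_pos e' by simp
    next
      fix x assume x: "x \<in> ?D"
      then have xr: "norm x < r1" by (rule norm_D)
      define a where "a = - h (\<mu> t) (norm x) *\<^sub>R sgn x"
      define y where "y = (t * ?u x powr - p) *\<^sub>R W x"
      have hx: "0 \<le> h (\<mu> t) (norm x)" "h (\<mu> t) (norm x) \<le> M" using h_nonneg h_le[OF \<mu>t] by auto
      have na: "norm a = h (\<mu> t) (norm x)" using hx h_0 by (cases "x = 0") (auto simp: a_def norm_sgn)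
      have "\<bar>norm x - R\<bar> \<le> r1" using xr R pos(4) norm_ge_zero[of x] by linarith
      from potential_powr[OF \<rho> this, of "- p"] have "?u x powr - p \<le> exp (p * k * r1)" using p by simp
      then have "?u x powr - p * norm (W x) \<le> exp (p * k * r1) * K" using KW[of x] xr by (intro mult_mono) auto
      from mult_left_mono[OF this, of "\<bar>t\<bar>"] have ny: "norm y \<le> K3 * \<bar>t\<bar>" by (simp add: y_def K3_def abs_mult mult_ac)
      \<comment> \<open>Where \<open>h\<close> vanishes, \<open>sgn a\<close> is 0 instead of
        \<open>- sgn x\<close>, but its factor \<open>norm a powr (q - 1)\<close> is 0 as
        well.\<close>
      have ay: "(norm a powr (q - 1) *\<^sub>R sgn a) \<bullet> y = - (t * (h (\<mu> t) (norm x) powr (q - 1) * ?u x powr - p * (sgn x \<bullet> W x)))"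
      proof (cases "h (\<mu> t) (norm x) = 0")
        case False
        then have "sgn a = - sgn x" using hx by (simp add: a_def sgn_scaleR sgn_minus sgn_div_norm[of "sgn x"] norm_sgn)
        then show ?thesis by (simp add: na y_def)
      qed (simp add: na)
      have "(p - 1) * norm (a + y) powr q \<le> (p - 1) * (norm a powr q + q * ((norm a powr (q - 1) *\<^sub>R sgn a) \<bullet> y) + e2 * norm y)"
        using p ny elim(6) hx na by (intro mult_left_mono \<delta>E) auto
      also have "\<dots> = (p - 1) * h (\<mu> t) (norm x) powr q + (p - 1) * q * ((norm a powr (q - 1) *\<^sub>R sgn a) \<bullet> y) + (p - 1) * e2 * norm y"
        by (simp add: na algebra_simps)
      also have "\<dots> \<le> (p - 1) * h (\<mu> t) (norm x) powr q - t * (p * h (\<mu> t) (norm x) powr (q - 1) * ?u x powr - p * (sgn x \<bullet> W x)) + \<eta>"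
      proof -
        have "(p - 1) * e2 * norm y \<le> (p - 1) * e2 * (K3 * \<bar>t\<bar>)" using ny p e2 by (intro mult_left_mono) auto
        also have "\<dots> \<le> \<eta>" using mult_right_mono[OF e2(2), of "\<bar>t\<bar>"] by (simp add: \<eta>_def mult_ac)
        finally show ?thesis unfolding q_p ay by (simp add: mult_ac)
      qed
      finally have "(p - 1) * norm (a + y) powr q
        \<le> (p - 1) * h (\<mu> t) (norm x) powr q - t * (p * h (\<mu> t) (norm x) powr (q - 1) * ?u x powr - p * (sgn x \<bullet> W x)) + \<eta>" .
      \<comment> \<open>The divergence of the weighted field is exactly the coefficient of t
        subtracted above, so only the remainder \<eta> is left.\<close>
      moreover have "- p * ?u x powr (- p - 1) * ((- (h (\<mu> t) (norm x) powr (q - 1) * ?u x) *\<^sub>R sgn x) \<bullet> W x)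
          = p * h (\<mu> t) (norm x) powr (q - 1) * ?u x powr - p * (sgn x \<bullet> W x)" (is "?l = ?r")
      proof -
        have "?l = p * h (\<mu> t) (norm x) powr (q - 1) * (?u x powr (- p - 1) * ?u x) * (sgn x \<bullet> W x)" by simp
        also have "?u x powr (- p - 1) * ?u x = ?u x powr - p" using u_pos[of x] by (simp add: powr_diff)
        finally show ?thesis .
      qed
      ultimately show "(p - 1) * norm (- h (\<mu> t) (norm x) *\<^sub>R sgn x + t *\<^sub>R ?u x powr - p *\<^sub>R W x) powr q
        \<le> (p - 1) * h (\<mu> t) (norm x) powr q
          - t * (- p * ?u x powr (- p - 1) * ((- (h (\<mu> t) (norm x) powr (q - 1) * ?u x) *\<^sub>R sgn x) \<bullet> W x)) + \<eta>"
        unfolding a_def y_def by (simp only: scaleR_scaleR)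
    next
      fix n :: 'a assume n: "norm n = 1"
      let ?x = "graph_map n"
      have g1: "\<bar>\<rho> n - R\<bar> \<le> (A + 1) * \<bar>t\<bar>" "\<bar>h (\<mu> t) (\<rho> n) - b - t * g n\<bar> \<le> e' * \<bar>t\<bar>"
        using \<rho> n unfolding good_def by auto
      have xc: "?x \<in> cball 0 r1" "R *\<^sub>R n \<in> cball 0 r1" using n \<rho>_bounds(2)[of n] R pos by (auto simp: norm_graph_map)
      define U where "U = ?u ?x powr - p"
      have "U \<in> {exp (- (?k t))..exp (?k t)}"
        using potential_powr[OF \<rho>, of ?x "(A + 1) * \<bar>t\<bar>" "- p"] g1(1) p by (simp add: norm_graph_map[OF n] U_def)
      then have up: "\<bar>U - 1\<bar> \<le> e' / (K + 1)" using elim(2,3) by (auto simp: abs_le_iff)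
      have "e' / (K + 1) \<le> 1" using e' K0 by (simp add: field_simps)
      then have U2: "0 \<le> U" "U \<le> 2" using up by (auto simp: U_def abs_le_iff)
      have n1: "\<bar>W ?x \<bullet> n\<bar> \<le> K" using Cauchy_Schwarz_ineq2[of "W ?x" n] KW[OF xc(1)] n by simp
      have "\<bar>U - 1\<bar> * \<bar>W ?x \<bullet> n\<bar> \<le> e' / (K + 1) * K" using up n1 by (intro mult_mono) auto
      also have "\<dots> \<le> e'" using e' K0 by (simp add: field_simps)
      finally have t1: "\<bar>(U - 1) * (W ?x \<bullet> n)\<bar> \<le> e'" by (simp add: abs_mult)
      have "?x - R *\<^sub>R n = (\<rho> n - R) *\<^sub>R n" by (simp add: graph_map_def algebra_simps)
      then have "dist ?x (R *\<^sub>R n) = \<bar>\<rho> n - R\<bar>" using n by (simp add: dist_norm)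
      then have "dist ?x (R *\<^sub>R n) < \<delta>W" using g1(1) elim(5) by linarith
      then have "dist (W ?x) (W (R *\<^sub>R n)) < e'" by (intro \<delta>W(2) xc)
      then have t2: "\<bar>(W ?x - W (R *\<^sub>R n)) \<bullet> n\<bar> \<le> e'"
        using Cauchy_Schwarz_ineq2[of "W ?x - W (R *\<^sub>R n)" n] n by (simp add: dist_norm)
      \<comment> \<open>Change of the weight, displacement of the boundary point, and approximation
        of \<open>g\<close> by the flux of \<open>W\<close>: at most \<open>e'\<close> each.\<close>
      have "U * (W ?x \<bullet> n) - g n = (U - 1) * (W ?x \<bullet> n) + (W ?x - W (R *\<^sub>R n)) \<bullet> n + (W (R *\<^sub>R n) \<bullet> n - g n)"
        by (simp add: algebra_simps inner_diff_left)
      then have "\<bar>U * (W ?x \<bullet> n) - g n\<bar> \<le> 3 * e'" using t1 t2 Wg[OF n] by linarith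
      from mult_left_mono[OF this, of "\<bar>t\<bar>"] have "\<bar>t * (U * (W ?x \<bullet> n) - g n)\<bar> \<le> 3 * e' * \<bar>t\<bar>"
        by (simp add: abs_mult mult_ac)
      then have A1: "t * g n - t * (U * (W ?x \<bullet> n)) \<le> 3 * e' * \<bar>t\<bar>" by (simp add: algebra_simps abs_le_iff)
      \<comment> \<open>The error of the approximate divergence theorem is proportional to
        \<open>C * \<bar>t\<bar>\<close> and meets the factor t of the correction, so it is of
        second order.\<close>
      have "\<bar>t\<bar> * (8 * (C * \<bar>t\<bar>) / (R / 2)) * U * (\<Sum>b\<in>Basis. \<bar>W ?x \<bullet> b\<bar>) \<le> \<bar>t\<bar> * (8 * (C * \<bar>t\<bar>) / (R / 2)) * 2 * K"
        using U2 K[OF xc(1)] pos R by (intro mult_mono mult_nonneg_nonneg sum_nonneg) auto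
      also have "\<dots> = \<bar>t\<bar> * (16 * C / R * 2 * K * \<bar>t\<bar>)" by simp
      also have "\<dots> \<le> \<bar>t\<bar> * e'" using elim(7) by (intro mult_left_mono) auto
      finally have A2: "\<bar>t\<bar> * (8 * (C * \<bar>t\<bar>) / (R / 2)) * U * (\<Sum>b\<in>Basis. \<bar>W ?x \<bullet> b\<bar>) \<le> e' * \<bar>t\<bar>" by (simp add: mult.commute)
      have "h (\<mu> t) (\<rho> n) - t * U * (W ?x \<bullet> n) \<le> b + 4 * e' * \<bar>t\<bar>" using g1(2) A1 by (simp add: abs_le_iff mult.assoc)
      moreover have "(\<Sum>b\<in>Basis. \<bar>(U *\<^sub>R W ?x) \<bullet> b\<bar>) = U * (\<Sum>b\<in>Basis. \<bar>W ?x \<bullet> b\<bar>)"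
        using U2(1) by (simp add: abs_mult sum_distrib_left)
      ultimately show "h (\<mu> t) (\<rho> n) - t * ((?u ?x powr - p *\<^sub>R W ?x) \<bullet> n)
        + \<bar>t\<bar> * (8 * (C * \<bar>t\<bar>) / (R / 2)) * (\<Sum>b\<in>Basis. \<bar>(?u ?x powr - p *\<^sub>R W ?x) \<bullet> b\<bar>) \<le> \<kappa> * b'"
        unfolding b'(1) U_def[symmetric] using A2 by (simp add: mult.assoc)
    qed
    moreover have \<mu>\<eta>: "0 \<le> \<mu> t - \<eta>"
    proof -
      have "- (\<bar>slope\<bar> * \<bar>t\<bar>) \<le> slope * t" by (simp add: abs_mult[symmetric] abs_ge_minus_self minus_le_iff)
      moreover have "e' * \<bar>t\<bar> \<le> 1 * \<bar>t\<bar>" using e' by (intro mult_right_mono) auto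
      ultimately show ?thesis using elim(4) by (simp add: \<mu>_def \<eta>_def algebra_simps)
    qed
    ultimately have low: "(\<mu> t - \<eta>) * (\<beta> / b') \<le> robin_lambda1 p \<beta> ?D" by (intro robin_lower[OF \<beta> b'(2)])
    have "1 - 5 * e' * \<bar>t\<bar> / b \<le> \<beta> / b'"
    proof -
      define z where "z = 5 * e' * \<bar>t\<bar> / b"
      have z: "0 \<le> z" "b' = \<beta> * (1 + z)" using e' b_pos \<kappa>_pos \<beta> by (auto simp: z_def b'_def b_def field_simps)
      have "(1 - z) * (1 + z) \<le> 1" by (simp add: algebra_simps)
      then have "1 - z \<le> 1 / (1 + z)" using z(1) by (simp add: pos_le_divide_eq)
      then show ?thesis using z \<beta> by (simp add: z_def)
    qed
    from mult_left_mono[OF this \<mu>\<eta>] low have "(\<mu> t - \<eta>) * (1 - 5 * e' * \<bar>t\<bar> / b) \<le> robin_lambda1 p \<beta> ?D" by linarith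
    moreover have "\<mu> t - e * \<bar>t\<bar> \<le> (\<mu> t - \<eta>) * (1 - 5 * e' * \<bar>t\<bar> / b)"
    proof -
      have "0 \<le> \<eta>" using e' by (simp add: \<eta>_def)
      then have "\<mu> t - \<eta> \<le> \<mu>0 + \<delta>0" using \<mu>t by linarith
      then have "(\<mu> t - \<eta>) * (5 * e' * \<bar>t\<bar> / b) \<le> (\<mu>0 + \<delta>0) * (5 * e' * \<bar>t\<bar> / b)" using e' b_pos by (intro mult_right_mono) auto
      moreover have "\<eta> + (\<mu>0 + \<delta>0) * (5 * e' * \<bar>t\<bar> / b) = (e' * Y) * \<bar>t\<bar>" by (simp add: Y_def \<eta>_def field_simps)
      moreover have "(e' * Y) * \<bar>t\<bar> \<le> e * \<bar>t\<bar>" using e'(3) by (rule mult_right_mono) simp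
      ultimately show ?thesis by (simp add: right_diff_distrib)
    qed
    ultimately show ?case by linarith
  qed
qed

lemma has_derivative_robin: "((\<lambda>t. robin_lambda1 p \<beta> (T t ` ball 0 R)) has_real_derivative slope) (at 0)"
proof -
  let ?F = "\<lambda>t. robin_lambda1 p \<beta> (T t ` ball 0 R)"
  have two: "\<forall>\<^sub>F t in nhds 0. \<bar>?F t - \<mu> t\<bar> \<le> e * \<bar>t\<bar>" if "0 < e" for e
    using upper_estimate[OF that] lower_estimate[OF that] by eventually_elim (simp add: abs_le_iff)
  \<comment> \<open>A property that holds near 0 holds at 0 itself; at \<open>t = 0\<close> the
    two-sided estimate identifies the eigenvalue of the ball.\<close>
  have F0: "?F 0 = \<mu>0" using eventually_nhds_x_imp_x[OF two[of 1]] by (simp add: \<mu>_def)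
  have "\<exists>d>0. \<forall>y. norm (y - 0) < d \<longrightarrow> norm (?F y - ?F 0 - slope * (y - 0)) \<le> e * norm (y - 0)" if e: "0 < e" for e
    using two[OF e] unfolding eventually_nhds_metric F0 \<mu>_def dist_real_def by (simp add: algebra_simps)
  then show ?thesis
    unfolding has_field_derivative_def has_derivative_at_alt by (intro conjI bounded_linear_mult_right allI impI)
qed

end

text \<open>Implicit differentiation of the Robin condition
  \<open>h \<mu> r = \<kappa> * \<beta>\<close>: the eigenvalue changes at the rate
  \<open>- hr / ml\<close> times the mean normal velocity. The constant \<open>c\<close> divides
  \<open>hr / ml\<close> by the area \<open>S * (\<kappa> * R ^ m)\<close> of the sphere, which
  turns the mean into the flux.\<close>

lemma robin_derivative:
  fixes v :: "'a::euclidean_space \<Rightarrow> 'a"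
  assumes p: "1 < p" and \<beta>: "0 < \<beta>" and R: "0 < R"
    and v: "smooth_on_closed (closure (ball 0 R)) v" and T: "perturbation_family (ball 0 R) v T"
  obtains c where "0 < c" "((\<lambda>t. robin_lambda1 p \<beta> (T t ` ball 0 R)) has_real_derivative - (c * ball_flux R v)) (at 0)"
proof -
  define \<kappa> where "\<kappa> = hausdorff_ratio TYPE('a)"
  define m where "m = DIM('a) - 1"
  have \<kappa>: "0 < \<kappa>" unfolding \<kappa>_def by (rule hausdorff_ratio)
  have m: "real DIM('a) - 1 = real m" by (simp add: m_def of_nat_diff DIM_positive Suc_leI)
  have b: "0 < \<kappa> * \<beta>" using \<kappa> \<beta> by simp
  interpret riccati p "DIM('a)" by unfold_locales (use p in auto)
  obtain \<mu>0 hr ml r1 M \<delta>0 and h :: "real \<Rightarrow> real \<Rightarrow> real" where fam: "0 < \<mu>0" "0 < hr" "0 < ml" "R < r1" "0 < \<delta>0"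
    "\<And>\<mu>. continuous_on UNIV (h \<mu>)" "\<And>\<mu>. h \<mu> 0 = 0" "\<And>\<mu> r. 0 \<le> h \<mu> r"
    "\<And>\<mu> r. \<bar>\<mu> - \<mu>0\<bar> < \<delta>0 \<Longrightarrow> h \<mu> r \<le> M"
    "\<And>\<mu> r. \<bar>\<mu> - \<mu>0\<bar> < \<delta>0 \<Longrightarrow> 0 < r \<Longrightarrow> r < r1 \<Longrightarrow>
      (h \<mu> has_real_derivative \<mu> - (real DIM('a) - 1) * h \<mu> r / r + (p - 1) * h \<mu> r powr (p / (p - 1))) (at r)"
    "\<And>e. 0 < e \<Longrightarrow> \<exists>d>0. \<forall>\<mu> r. \<bar>\<mu> - \<mu>0\<bar> < d \<and> \<bar>r - R\<bar> < d \<longrightarrow>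
      \<bar>h \<mu> r - \<kappa> * \<beta> - hr * (r - R) - ml * (\<mu> - \<mu>0)\<bar> \<le> e * (\<bar>\<mu> - \<mu>0\<bar> + \<bar>r - R\<bar>)"
    by (rule family[OF b R]) (rule that)
  have cl: "closure (ball 0 R) = cball (0::'a) R" using R by simp
  obtain U f where U: "cball 0 R \<subseteq> U" "Ck_on 0 U f" and f: "\<And>x. x \<in> cball 0 R \<Longrightarrow> f x = v x"
    using v unfolding cl smooth_on_closed_def smooth_on_def by blast
  have "continuous_on (sphere 0 R) (\<lambda>x. f x \<bullet> (x /\<^sub>R R))"
    using continuous_on_subset[OF U(2)[unfolded Ck_on.simps] order_trans[OF sphere_cball U(1)]] by (intro continuous_intros)
  moreover have "closedin (top_of_set UNIV) (sphere (0::'a) R)" by simp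
  \<comment> \<open>Only the values on the sphere matter for the flux; the Tietze extension provides
    the continuity on the whole space that the locale asks for.\<close>
  ultimately obtain w where w: "continuous_on UNIV w" "\<And>x. x \<in> sphere 0 R \<Longrightarrow> w x = f x \<bullet> (x /\<^sub>R R)"
    using Tietze_unbounded by blast
  have wv: "w x = v x \<bullet> (x /\<^sub>R R)" if "norm x = R" for x using w(2) f that by simp
  obtain A where A: "\<And>x. x \<in> cball 0 R \<Longrightarrow> \<bar>w x\<bar> \<le> A"
    using compact_abs_bounded[OF compact_cball continuous_on_subset[OF w(1) subset_UNIV]] by blast
  obtain C where C: "0 \<le> C" "\<And>e. 0 < e \<Longrightarrow> \<forall>\<^sub>F t in nhds 0. \<exists>\<rho>.
    radial_graph (T t ` ball 0 R) \<rho> (R / 2) r1 (C * \<bar>t\<bar>) (DIM('a) - 1) (hausdorff_ratio TYPE('a))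
    \<and> (\<forall>n. norm n = 1 \<longrightarrow> \<bar>\<rho> n - R - t * (v (R *\<^sub>R n) \<bullet> n)\<bar> \<le> e * \<bar>t\<bar>)"
    using perturbation_radial_graph[OF R fam(4) v T] by blast
  interpret robin_family p \<beta> R "\<kappa> * \<beta>" hr ml \<mu>0 M r1 \<delta>0 C A h w T m \<kappa> "p / (p - 1)"
  proof (unfold_locales)
    show "0 \<le> A" using A[of 0] R by auto
    show "\<bar>w (R *\<^sub>R n)\<bar> \<le> A" if "norm n = 1" for n using A[of "R *\<^sub>R n"] that R by simp
    show "\<forall>\<^sub>F t in nhds 0. \<exists>\<rho>. radial_graph (T t ` ball 0 R) \<rho> (R / 2) r1 (C * \<bar>t\<bar>) m \<kappa>
      \<and> (\<forall>n. norm n = 1 \<longrightarrow> \<bar>\<rho> n - R - t * w (R *\<^sub>R n)\<bar> \<le> e * \<bar>t\<bar>)" if "0 < e" for e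
    proof -
      have "w (R *\<^sub>R n) = v (R *\<^sub>R n) \<bullet> n" if "norm n = 1" for n using wv[of "R *\<^sub>R n"] that R by simp
      then show ?thesis using C(2)[OF that] unfolding m_def \<kappa>_def by simp
    qed
    show "continuous_on UNIV (h \<mu>)" "h \<mu> 0 = 0" "0 \<le> h \<mu> r" for \<mu> r by (rule fam)+
    show "h \<mu> r \<le> M" if "\<bar>\<mu> - \<mu>0\<bar> < \<delta>0" for \<mu> r by (rule fam(9)[OF that])
    show "(h \<mu> has_real_derivative \<mu> - real m * h \<mu> r / r + (p - 1) * h \<mu> r powr (p / (p - 1))) (at r)"
      if "\<bar>\<mu> - \<mu>0\<bar> < \<delta>0" "0 < r" "r < r1" for \<mu> r using fam(10)[OF that] unfolding m .
    show "\<exists>d>0. \<forall>\<mu> r. \<bar>\<mu> - \<mu>0\<bar> < d \<and> \<bar>r - R\<bar> < d \<longrightarrow>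
      \<bar>h \<mu> r - \<kappa> * \<beta> - hr * (r - R) - ml * (\<mu> - \<mu>0)\<bar> \<le> e * (\<bar>\<mu> - \<mu>0\<bar> + \<bar>r - R\<bar>)" if "0 < e" for e
      by (rule fam(11)[OF that])
    show "continuous_on UNIV w" by (rule w)
  qed (fact p \<beta> R m_def \<kappa>_def fam C refl)+
  have flux: "ball_flux R v = \<kappa> * R ^ m * (LINT n|cone_measure. w (R *\<^sub>R n))"
  proof -
    have "ball_flux R v = (LINT x|surface_measure (ball 0 R). w x)" unfolding ball_flux_def using R
      by (intro Bochner_Integration.integral_cong refl) (simp add: wv ball.space_surface_measure)
    then show ?thesis using surface_integral_ball[OF R w(1)] by (simp add: \<kappa>_def m_def)
  qed
  show thesis
  proof (rule that[of "hr / (ml * S * (\<kappa> * R ^ m))"])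
    show "0 < hr / (ml * S * (\<kappa> * R ^ m))" using fam S_pos \<kappa> R by simp
    have "slope = - (hr / (ml * S * (\<kappa> * R ^ m)) * ball_flux R v)" unfolding flux slope_def using R \<kappa> by simp
    with has_derivative_robin show "((\<lambda>t. robin_lambda1 p \<beta> (T t ` ball 0 R)) has_real_derivative
        - (hr / (ml * S * (\<kappa> * R ^ m)) * ball_flux R v)) (at 0)" by simp
  qed
qed

theorem theorem1p3:
  fixes p \<beta> R :: real
  assumes "1 < p" and "\<beta> > 0" and "R > 0"
  shows "(\<beta> \<ge> ((real CARD('n) - 1) / (R * (p - 1))) powr (p - 1) \<longrightarrow>
            (\<forall>(v :: real ^ 'n \<Rightarrow> real ^ 'n) T.
               smooth_on_closed (closure (ball 0 R)) v \<and> perturbation_family (ball 0 R) v T \<longrightarrow>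
               (ball_flux R v > 0 \<longrightarrow>
                  (\<exists>d. ((\<lambda>t. robin_lambda1 p \<beta> (T t ` ball 0 R)) has_real_derivative d) (at 0) \<and> d < 0)) \<and>
               (ball_flux R v < 0 \<longrightarrow>
                  (\<exists>d. ((\<lambda>t. robin_lambda1 p \<beta> (T t ` ball 0 R)) has_real_derivative d) (at 0) \<and> d > 0))))
       \<and> (R \<ge> 1 \<and> \<beta> \<ge> 1 \<and> p \<ge> real CARD('n) \<longrightarrow>
            (\<forall>(v :: real ^ 'n \<Rightarrow> real ^ 'n) T.
               smooth_on_closed (closure (ball 0 R)) v \<and> perturbation_family (ball 0 R) v T \<longrightarrow>
               (ball_flux R v > 0 \<longrightarrow>
                  (\<exists>d. ((\<lambda>t. robin_lambda1 p \<beta> (T t ` ball 0 R)) has_real_derivative d) (at 0) \<and> d \<le> 0)) \<and>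
               (ball_flux R v < 0 \<longrightarrow>
                  (\<exists>d. ((\<lambda>t. robin_lambda1 p \<beta> (T t ` ball 0 R)) has_real_derivative d) (at 0) \<and> d \<ge> 0))))"
proof -
  let ?F = "\<lambda>T t. robin_lambda1 p \<beta> (T t ` ball 0 R)"
  have main: "(ball_flux R v > 0 \<longrightarrow>
        (\<exists>d. (?F T has_real_derivative d) (at 0) \<and> d < 0)) \<and>
     (ball_flux R v < 0 \<longrightarrow>
        (\<exists>d. (?F T has_real_derivative d) (at 0) \<and> d > 0))"
    if vT: "smooth_on_closed (closure (ball 0 R)) v" "perturbation_family (ball 0 R) v T"
    for v :: "real ^ 'n \<Rightarrow> real ^ 'n" and T
  proof -
    obtain c where c: "0 < c" "(?F T has_real_derivative - (c * ball_flux R v)) (at 0)"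
      using robin_derivative[OF assms vT] by blast
    show ?thesis
      using c by (auto intro!: exI[of _ "- (c * ball_flux R v)"] simp: mult_pos_neg)
  qed
  then show ?thesis by (meson less_imp_le)
qed

end
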